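(* Let $d\geq 3$, $W=\mathbb{R}^{d+1}$ and $D=\binom{d+1}{2}$. Let $G=(V,E)$ be a finite graph (parallel edges allowed, no loops) with a bipartition $\{B,R\}$ of $V$. Then, for almost all bar-configurations $\mathbf{q}$ and almost all rod-configurations $\mathbf{r}$, the body-rod-bar matroid $\mathcal{BR}(G,\mathbf{q},\mathbf{r})$ equals the count matroid $\mathcal{M}_f(G,\{B,R\})$. Namely, $I\subseteq E$ is independent in $\mathcal{BR}(G,\mathbf{q},\mathbf{r})$ if and only if $|F|\leq D|V(F)|-D-|R(F)|$ for every nonempty $F\subseteq I$.
   Context: For $F\subseteq E$, $V(F)$ is the set of vertices incident to some edge of $F$, and $R(F)=R\cap V(F)$. The count matroid $\mathcal{M}_f(G,\{B,R\})$ is the matroid on $E$ in which $I$ is independent iff $|F|\le f(F):=D(|V(F)|-1)-|R(F)|$ for all nonempty $F\subseteq I$. Exterior algebra: $\bigwedge^k W$ is identified with $\mathbb{R}^{\binom{d+1}{k}}$ via the standard basis $e_{i_1}\wedge\dots\wedge e_{i_k}$; note $\bigwedge^2W\cong\bigwedge^{d-1}W\cong\mathbb{R}^D$. $Gr(k,W)\subseteq\mathbb{P}(\bigwedge^kW)$ is the set of $k$-dimensional subspaces of $W$ via the Plücker embedding ($X$ with basis $v_1,\dots,v_k$ maps to $[v_1\wedge\dots\wedge v_k]$). For $\mathbf{p}\in\bigwedge^2W$ and $\mathbf{s}\in\bigwedge^{d-1}W$ define the pairing $\mathbf{p}\cdot\mathbf{s}\in\mathbb{R}$ by $\mathbf{p}\wedge\mathbf{s}=(\mathbf{p}\cdot\mathbf{s})\,e_1\wedge\dots\wedge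 e_{d+1}$; for decomposable elements, $\mathbf{p}\cdot\mathbf{s}=0$ iff the corresponding subspaces have a nonzero intersection. A body-rod-bar framework $(G,\mathbf{q},\mathbf{r})$ consists of a rod-configuration $\mathbf{r}:R\to Gr(d-1,W)$, $v\mapsto[\mathbf{r}_v]$, with all rods distinct ($\mathbf{r}(u)\neq\mathbf{r}(v)$ for $u\ne v$), and a bar-configuration $\mathbf{q}:E\to Gr(2,W)$, $e\mapsto[\mathbf{q}_e]$, satisfying the incidence condition $\mathbf{q}_e\cdot\mathbf{r}_v=0$ whenever $e$ is incident to $v\in R$. The body-rod-bar matroid $\mathcal{BR}(G,\mathbf{q},\mathbf{r})$ is the linear matroid on $E$ in which each edge $e=uv$ (with an arbitrary orientation) is represented by the vector in $(\mathbb{R}^D)^V$ whose $u$-block is $\mathbf{q}_e$, whose $v$-block is $-\mathbf{q}_e$, and whose other blocks are $0$; equivalently its rank is the maximum number of linearly independent equations among $\mathbf{q}_e\cdot(\mathbf{m}(u)-\mathbf{m}(v))=0$ ($e=uv\in E$) in the unknown $\mathbf{m}:V\to\bigwedge^{d-1}W$. *)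

theory Defs
  imports "HOL-Analysis.Analysis"
begin

section \<open>Exterior algebra of \<open>W = real ^ 'n\<close>\<close>

text \<open>
  An element of the exterior algebra is given by its coordinates in the standard basis: the
  coordinate at \<open>K = {i\<^sub>1 < \<dots> < i\<^sub>k}\<close> belongs to \<open>e\<^bsub>i\<^sub>1\<^esub> \<and> \<dots> \<and> e\<^bsub>i\<^sub>k\<^esub>\<close>. All degrees live in this one
  type; the \<open>k\<close>-th exterior power is the subspace of vectors supported on the sets of size \<open>k\<close>.
\<close>

type_synonym 'n ext = "(real, 'n set) vec"

text \<open>The sign in \<open>e\<^sub>I \<and> e\<^sub>J = \<plusminus> e\<^bsub>I \<union> J\<^esub>\<close> for disjoint \<open>I\<close>, \<open>J\<close>.\<close>

definition wedge_sign :: "'n::{finite,linorder} set \<Rightarrow> 'n set \<Rightarrow> real" where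
  "wedge_sign I J = (- 1) ^ card {(i, j). i \<in> I \<and> j \<in> J \<and> j < i}"

definition wedge :: "'n::{finite,linorder} ext \<Rightarrow> 'n ext \<Rightarrow> 'n ext" where
  "wedge x y = (\<chi> K. \<Sum>I\<in>Pow K. wedge_sign I (K - I) * (x $ I) * (y $ (K - I)))"

definition ext_of_vec :: "(real, 'n::{finite,linorder}) vec \<Rightarrow> 'n ext" where
  "ext_of_vec v = (\<Sum>i\<in>UNIV. (v $ i) *\<^sub>R axis {i} 1)"

definition wedge_list :: "(real, 'n::{finite,linorder}) vec list \<Rightarrow> 'n ext" where
  "wedge_list vs = foldr (\<lambda>v x. wedge (ext_of_vec v) x) vs (axis {} 1)"

text \<open>The coordinate at \<open>UNIV\<close> is the coefficient of \<open>e\<^sub>1 \<and> \<dots> \<and> e\<^bsub>d+1\<^esub>\<close>.\<close>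

definition pairing :: "'n::{finite,linorder} ext \<Rightarrow> 'n ext \<Rightarrow> real" where
  "pairing p s = wedge p s $ UNIV"

text \<open>
  The Grassmannian, given by all homogeneous coordinate vectors of its points, that is, as the
  punctured cone over the Pluecker-embedded \<open>Gr(k, W)\<close>. The projective point represented by \<open>x\<close> is
  the line \<open>span {x}\<close>.
\<close>

definition Gr_cone :: "nat \<Rightarrow> 'n::{finite,linorder} ext set" where
  "Gr_cone k = {wedge_list vs | vs. length vs = k \<and> distinct vs \<and> independent (set vs)}"


section \<open>Almost all points of an \<open>m\<close>-dimensional set\<close>

text \<open>
  \<open>hausdorff_null m A\<close> says that the \<open>m\<close>-dimensional Hausdorff measure of \<open>A\<close> is zero. The usual
  bound on the diameters of the covering sets is implied for \<open>m > 0\<close>, as every single diameter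
  satisfies \<open>diameter (C i) ^ m < \<epsilon>\<close>. For \<open>m = 0\<close> only the empty set is null (counting measure).
  On an \<open>m\<close>-dimensional smooth submanifold the null sets are those of its volume measure.
\<close>

definition hausdorff_null :: "nat \<Rightarrow> 'a::metric_space set \<Rightarrow> bool" where
  "hausdorff_null m A \<longleftrightarrow>
     (\<forall>\<epsilon>>0. \<exists>C :: nat \<Rightarrow> 'a set.
        A \<subseteq> (\<Union>i. C i) \<and> (\<forall>i. bounded (C i)) \<and>
        summable (\<lambda>i. if C i = {} then 0 else diameter (C i) ^ m) \<and>
        (\<Sum>i. if C i = {} then 0 else diameter (C i) ^ m) < \<epsilon>)"

definition almost_all :: "nat \<Rightarrow> 'a::metric_space set \<Rightarrow> ('a \<Rightarrow> bool) \<Rightarrow> bool" where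
  "almost_all m X P \<longleftrightarrow> hausdorff_null m {x \<in> X. \<not> P x}"


section \<open>Body-rod-bar frameworks\<close>

text \<open>
  A multigraph is given by its edge set and the map \<open>ends\<close> sending an edge to its two endvertices.
\<close>

definition vertices_of :: "('e \<Rightarrow> 'v set) \<Rightarrow> 'e set \<Rightarrow> 'v set" where
  "vertices_of ends F = (\<Union>e\<in>F. ends e)"

text \<open>
  Configurations on \<open>R\<close> and on \<open>E\<close> are vectors over the whole index type that vanish outside \<open>R\<close>
  and \<open>E\<close>, so that they are points of a Euclidean space.
\<close>

definition rod_configs ::
  "nat \<Rightarrow> 'v::finite set \<Rightarrow> ('n::{finite,linorder} ext, 'v) vec set" where
  "rod_configs d R =
     {r. (\<forall>v\<in>R. r $ v \<in> Gr_cone (d - 1)) \<and> (\<forall>v. v \<notin> R \<longrightarrow> r $ v = 0) \<and>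
         (\<forall>u\<in>R. \<forall>v\<in>R. u \<noteq> v \<longrightarrow> span {r $ u} \<noteq> span {r $ v})}"

definition bar_configs ::
  "'e::finite set \<Rightarrow> ('e \<Rightarrow> 'v set) \<Rightarrow> 'v set \<Rightarrow> ('n::{finite,linorder} ext, 'v::finite) vec \<Rightarrow>
   ('n ext, 'e) vec set" where
  "bar_configs E ends R r =
     {q. (\<forall>e\<in>E. q $ e \<in> Gr_cone 2 \<and> (\<forall>v \<in> ends e \<inter> R. pairing (q $ e) (r $ v) = 0)) \<and>
         (\<forall>e. e \<notin> E \<longrightarrow> q $ e = 0)}"

text \<open>
  The dimensions of these two spaces. \<open>Gr(d - 1, W)\<close> and \<open>Gr(2, W)\<close> have dimension \<open>2 (d - 1)\<close>, so the
  cones over them have dimension \<open>2 d - 1\<close>. Each rod at an endvertex of \<open>e\<close> imposes one equation on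
  the bar \<open>e\<close> and lowers the dimension by one. This also holds for two rods, as they are
  distinct: for distinct \<open>(d - 1)\<close>-dimensional \<open>X\<close>, \<open>Y\<close>, the set of planes in \<open>W\<close> that meet both \<open>X\<close>
  and \<open>Y\<close> nontrivially has dimension \<open>2 (d - 1) - 2\<close>.
\<close>

definition rod_dim :: "nat \<Rightarrow> 'v set \<Rightarrow> nat" where
  "rod_dim d R = card R * (2 * d - 1)"

definition bar_dim :: "nat \<Rightarrow> 'e set \<Rightarrow> ('e \<Rightarrow> 'v set) \<Rightarrow> 'v set \<Rightarrow> nat" where
  "bar_dim d E ends R = (\<Sum>e\<in>E. 2 * d - 1 - card (ends e \<inter> R))"


section \<open>The two matroids, given by their independent sets\<close>

definition linear_matroid :: "'e set \<Rightarrow> ('e \<Rightarrow> 'a::real_vector) \<Rightarrow> 'e set set" where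
  "linear_matroid E a = {I. I \<subseteq> E \<and> inj_on a I \<and> independent (a ` I)}"

definition brb_row ::
  "('e \<Rightarrow> 'v) \<Rightarrow> ('e \<Rightarrow> 'v) \<Rightarrow> ('n::{finite,linorder} ext, 'e::finite) vec \<Rightarrow> 'e \<Rightarrow>
   ('n ext, 'v::finite) vec" where
  "brb_row tail head q e = (\<chi> w. if w = tail e then q $ e else if w = head e then - (q $ e) else 0)"

definition brb_matroid ::
  "'e set \<Rightarrow> ('e \<Rightarrow> 'v::finite) \<Rightarrow> ('e \<Rightarrow> 'v) \<Rightarrow> ('n::{finite,linorder} ext, 'e::finite) vec \<Rightarrow>
   'e set set" where
  "brb_matroid E tail head q = linear_matroid E (brb_row tail head q)"

definition count_matroid ::
  "nat \<Rightarrow> 'e set \<Rightarrow> ('e \<Rightarrow> 'v set) \<Rightarrow> 'v set \<Rightarrow> 'e set set" where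
  "count_matroid D E ends R =
     {I. I \<subseteq> E \<and>
         (\<forall>F. F \<subseteq> I \<and> F \<noteq> {} \<longrightarrow>
            int (card F) \<le> int D * (int (card (vertices_of ends F)) - 1)
                              - int (card (R \<inter> vertices_of ends F)))}"

end

theory Submission
  imports Defs
begin

text \<open>
  The hypotheses on the rods enter only through the spaces of motions in which the edges \<open>F\<close> are the
  bodies and two edges at a common rod may move relative to each other by a multiple of that rod. For
  rods that can be moved freely inside the space of bivectors, the dimension of this space is
  generically at most a maximum of counts over the partitions of \<open>F\<close> (induction on the number of
  incidences, by removing or contracting one incidence), and these counts are controlled by the
  count condition. Given such rods, every count-independent edge set has a choice of bars with
  linearly independent rows, by Rado's theorem applied to the spans of the admissible rows.

  Both configuration spaces are covered by finitely many polynomial charts with the right number of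
  parameters. In each chart the exceptional parameters are zeros of a nonzero polynomial, hence
  negligible, and locally Lipschitz maps send them to Hausdorff-null sets.
\<close>

text \<open>The Hodge map turns the pairing into the inner product: a rod becomes a decomposable
  bivector and a bar through it a bivector orthogonal to it. The obstacle is that the admissible
  bars form a nonlinear cone. Duality removes it: this cone spans the whole orthogonal complement of
  the rods at the edge, and Rado's theorem sees only spans. A vector \<open>m\<close> orthogonal to
  all admissible rows then satisfies just that \<open>m u - m v\<close> lies in the span of the rods
  at \<open>u\<close> and \<open>v\<close>. Inserting one body for each edge splits this into
  conditions at single vertices, which are the motions of the overview. In the count,
  \<open>D\<close> is the dimension of the constant motions, and the rods contribute because a
  multiple of each rod may be added at its own vertex.

  A rod can be moved only by itself and only off a proper subspace. Hence the dimension bound is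
  reached in its hardest case by finding one good parameter, which semicontinuity spreads to almost
  all. A chain of two blocks provides a rod that can be moved while the motions of all other blocks
  stay the same; \<open>D \<ge> 6\<close>, that is \<open>d \<ge> 3\<close>, forces such a
  chain.\<close>

section \<open>Zero sets of polynomials have measure zero\<close>

text \<open>The degree bound is uniform in the direction \<open>x\<close>. It becomes the bound on
  the number of rescaled copies that can overlap in one point.\<close>

lemma real_polynomial_function_on_ray:
  fixes p :: "'a::real_normed_vector \<Rightarrow> real"
  assumes "real_polynomial_function p"
  shows "\<exists>K. \<forall>x. \<exists>q::real poly. degree q \<le> K \<and> (\<forall>t. p (a + t *\<^sub>R x) = poly q t)"
  using assms
proof (induction rule: real_polynomial_function.induct)
  case (linear f)
  interpret bounded_linear f by fact
  show ?case
    by (rule exI[of _ 1], intro allI, rule_tac x="[:f a, f x:]" in exI) (simp add: add scaleR)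
next
  case (const c)
  show ?case by (rule exI[of _ 0], intro allI, rule_tac x="[:c:]" in exI) simp
next
  case (add f g)
  then obtain K L where K: "\<And>x. \<exists>q::real poly. degree q \<le> K \<and> (\<forall>t. f (a + t *\<^sub>R x) = poly q t)"
    and L: "\<And>x. \<exists>q::real poly. degree q \<le> L \<and> (\<forall>t. g (a + t *\<^sub>R x) = poly q t)" by metis
  show ?case
  proof (intro exI[of _ "max K L"] allI)
    fix x
    obtain q r where "degree q \<le> K" "\<forall>t. f (a + t *\<^sub>R x) = poly q t"
      "degree r \<le> L" "\<forall>t. g (a + t *\<^sub>R x) = poly r t" using K L by meson
    then show "\<exists>q. degree q \<le> max K L \<and> (\<forall>t. f (a + t *\<^sub>R x) + g (a + t *\<^sub>R x) = poly q t)"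
      by (intro exI[of _ "q + r"]) (auto intro!: degree_add_le)
  qed
next
  case (mult f g)
  then obtain K L where K: "\<And>x. \<exists>q::real poly. degree q \<le> K \<and> (\<forall>t. f (a + t *\<^sub>R x) = poly q t)"
    and L: "\<And>x. \<exists>q::real poly. degree q \<le> L \<and> (\<forall>t. g (a + t *\<^sub>R x) = poly q t)" by metis
  show ?case
  proof (intro exI[of _ "K + L"] allI)
    fix x
    obtain q r where "degree q \<le> K" "\<forall>t. f (a + t *\<^sub>R x) = poly q t"
      "degree r \<le> L" "\<forall>t. g (a + t *\<^sub>R x) = poly r t" using K L by meson
    moreover from this have "degree (q * r) \<le> K + L"
      using degree_mult_le[of q r] by linarith
    ultimately show "\<exists>q. degree q \<le> K + L \<and> (\<forall>t. f (a + t *\<^sub>R x) * g (a + t *\<^sub>R x) = poly q t)"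
      by (intro exI[of _ "q * r"]) auto
  qed
qed

text \<open>A ray from a point where \<open>p\<close> does not vanish meets the zero set \<open>Z\<close> in boundedly many points.
  Infinitely many rescaled copies of a bounded part of \<open>Z\<close> thus overlap boundedly often inside
  a ball, so they have measure zero.\<close>

lemma negligible_zeros_real_polynomial_function:
  fixes p :: "'a::euclidean_space \<Rightarrow> real"
  assumes p: "real_polynomial_function p" and a: "p a \<noteq> 0"
  shows "negligible {x. p x = 0}"
proof -
  obtain K where K: "\<And>x. \<exists>q::real poly. degree q \<le> K \<and> (\<forall>t. p (a + t *\<^sub>R x) = poly q t)"
    using real_polynomial_function_on_ray[OF p, of a] by blast
  define Z where "Z = {x. p (a + x) = 0}"
  have contp: "continuous_on UNIV (\<lambda>x. p (a + x))"
  proof -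
    have "continuous_on UNIV p"
      using p by (simp add: real_polynomial_function_eq continuous_on_polymonial_function)
    then show ?thesis
      by (rule continuous_on_compose2) (auto intro: continuous_intros)
  qed
  have cZ: "closed Z"
    unfolding Z_def by (rule closed_Collect_eq[OF contp]) (rule continuous_on_const)
  have "negligible (Z \<inter> cball 0 r)" for r
  proof -
    define S where "S = Z \<inter> cball 0 r"
    have S: "S \<in> lmeasurable" unfolding S_def
      by (intro lmeasurable_compact closed_Int_compact cZ compact_cball)
    \<comment> \<open>Infinitely many distinct scales in \<open>[1, 2]\<close>: at least 1 keeps the
      shrunken copies inside the ball, at most 2 keeps their volume above a fixed fraction of that
      of \<open>S\<close>.\<close>
    define t :: "nat \<Rightarrow> real" where "t j = 1 + 1 / Suc j" for j
    have t: "t j \<ge> 1" "t j \<le> 2" for j by (auto simp: t_def)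
    have inj: "inj t" by (auto simp: inj_def t_def)
    define T where "T j = (\<lambda>x. (1 / t j) *\<^sub>R x + 0) ` S" for j
    have T: "x \<in> T j \<longleftrightarrow> t j *\<^sub>R x \<in> S" for x j
    proof -
      have "t j \<noteq> 0" using t(1)[of j] by linarith
      then show ?thesis
        unfolding T_def by (auto intro!: image_eqI[of _ _ "t j *\<^sub>R x"])
    qed
    have Tm: "T j \<in> sets lebesgue" for j
    proof -
      have "T j = (*\<^sub>R) (t j) -` S \<inter> space lebesgue" using T by auto
      then show ?thesis
        using measurable_sets[OF lebesgue_measurable_scaling[of "t j"] fmeasurableD[OF S]] by simp
    qed
    have ball: "T j \<subseteq> cball 0 r" for j
    proof
      fix x assume "x \<in> T j"
      then have "norm (t j *\<^sub>R x) \<le> r" by (simp add: T S_def)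
      moreover have "norm x \<le> norm (t j *\<^sub>R x)"
        using t(1)[of j] mult_right_mono[of 1 "t j" "norm x"] by simp
      ultimately show "x \<in> cball 0 r" by simp
    qed
    have eT: "emeasure lebesgue (T j) \<ge> ennreal ((1/2) ^ DIM('a)) * emeasure lebesgue S" for j
    proof -
      have "emeasure lebesgue (T j) = \<bar>1 / t j\<bar> ^ DIM('a) * emeasure lebesgue S"
        unfolding T_def by (rule emeasure_lebesgue_affine)
      moreover have "ennreal ((1/2) ^ DIM('a)) \<le> ennreal (\<bar>1 / t j\<bar> ^ DIM('a))"
        using t[of j] by (intro ennreal_leI power_mono) (auto simp: field_simps)
      ultimately show ?thesis by (simp add: mult_right_mono)
    qed
    \<comment> \<open>\<open>x \<in> T j\<close> implies that \<open>t j\<close> is a root of the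
      polynomial on the ray through \<open>x\<close>. This polynomial is nonzero because its value
      at 0 is \<open>p a\<close>.\<close>
    have mult: "card {j. j < N \<and> x \<in> T j} \<le> K" for N x
    proof -
      obtain q :: "real poly" where q: "degree q \<le> K" "\<And>s. p (a + s *\<^sub>R x) = poly q s"
        using K by meson
      have q0: "q \<noteq> 0" using q(2)[of 0] a by auto
      have "t ` {j. j < N \<and> x \<in> T j} \<subseteq> {s. poly q s = 0}"
        using q(2) by (auto simp: T S_def Z_def)
      then have "card (t ` {j. j < N \<and> x \<in> T j}) \<le> card {s. poly q s = 0}"
        by (intro card_mono poly_roots_finite q0)
      also have "\<dots> \<le> K" using card_poly_roots_bound[OF q0] q(1) by linarith
      finally show ?thesis by (simp add: card_image inj inj_on_subset[OF inj])
    qed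
    \<comment> \<open>Integrates the overlap bound over the ball. The right-hand side does not
      depend on \<open>N\<close>, which forces the volume of \<open>S\<close> to be zero.\<close>
    have main: "of_nat N * (ennreal ((1/2) ^ DIM('a)) * emeasure lebesgue S) \<le> of_nat K * emeasure lebesgue (cball 0 r :: 'a set)" for N
    proof -
      have "of_nat N * (ennreal ((1/2) ^ DIM('a)) * emeasure lebesgue S) \<le> (\<Sum>j<N. emeasure lebesgue (T j))"
        using sum_bounded_below[of "{..<N}" "ennreal ((1/2) ^ DIM('a)) * emeasure lebesgue S" "\<lambda>j. emeasure lebesgue (T j)"] eT
        by simp
      also have "\<dots> = (\<Sum>j<N. \<integral>\<^sup>+x. indicator (T j) x \<partial>lebesgue)"
        by (simp add: Tm)
      also have "\<dots> = (\<integral>\<^sup>+x. (\<Sum>j<N. indicator (T j) x) \<partial>lebesgue)"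
        by (intro nn_integral_sum[symmetric]) (use Tm in auto)
      also have "\<dots> \<le> (\<integral>\<^sup>+x. of_nat K * indicator (cball 0 r :: 'a set) x \<partial>lebesgue)"
      proof (rule nn_integral_mono)
        fix x
        show "(\<Sum>j<N. indicator (T j) x) \<le> (of_nat K * indicator (cball 0 r) x :: ennreal)"
        proof (cases "x \<in> cball 0 r")
          case True
          have "(\<Sum>j<N. indicator (T j) x) = (\<Sum>j\<in>{j. j < N \<and> x \<in> T j}. 1 :: ennreal)"
            by (rule sum.mono_neutral_cong_right) (auto simp: indicator_def)
          also have "\<dots> = of_nat (card {j. j < N \<and> x \<in> T j})" by simp
          also have "\<dots> \<le> of_nat K" using mult by (simp only: of_nat_le_iff)
          finally show ?thesis using True by simp
        next
          case False
          then have "x \<notin> T j" for j using ball by blast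
          then show ?thesis by simp
        qed
      qed
      also have "\<dots> = of_nat K * emeasure lebesgue (cball 0 r :: 'a set)"
        by (subst nn_integral_cmult_indicator) auto
      finally show ?thesis .
    qed
    define \<mu> where "\<mu> = measure lebesgue S"
    have eS: "emeasure lebesgue S = ennreal \<mu>"
      unfolding \<mu>_def by (rule emeasure_eq_measure2[OF S])
    define \<nu> where "\<nu> = measure lebesgue (cball 0 r :: 'a set)"
    have eB: "emeasure lebesgue (cball 0 r :: 'a set) = ennreal \<nu>"
      unfolding \<nu>_def by (rule emeasure_eq_measure2[OF lmeasurable_cball])
    have nonneg: "0 \<le> \<mu>" "0 \<le> \<nu>" by (simp_all add: \<mu>_def \<nu>_def)
    have le: "real N * ((1/2) ^ DIM('a) * \<mu>) \<le> real K * \<nu>" for N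
    proof -
      have "ennreal (real N * ((1/2) ^ DIM('a) * \<mu>)) \<le> ennreal (real K * \<nu>)"
        using main[of N] unfolding eS eB
        by (simp add: ennreal_mult ennreal_of_nat_eq_real_of_nat nonneg)
      then show ?thesis by (subst (asm) ennreal_le_iff) (auto simp: nonneg)
    qed
    have "\<mu> = 0"
    proof (rule ccontr)
      assume "\<mu> \<noteq> 0"
      then have "\<mu> > 0" using nonneg by simp
      then obtain N :: nat where "real N * ((1/2) ^ DIM('a) * \<mu>) > real K * \<nu>"
        using reals_Archimedean3[of "(1/2) ^ DIM('a) * \<mu>"] by auto
      then show False using le[of N] by simp
    qed
    then show ?thesis using S unfolding \<mu>_def S_def[symmetric]
      by (simp add: negligible_iff_measure)
  qed
  then have "negligible (\<Union>r::nat. Z \<inter> cball 0 (real r))"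
    by (intro negligible_countable_Union) auto
  moreover have "(\<Union>r::nat. Z \<inter> cball 0 (real r)) = Z"
    using real_arch_simple by auto
  ultimately have "negligible ((+) a ` Z)" by (simp add: negligible_translation)
  moreover have "(+) a ` Z = {x. p x = 0}"
  proof (intro equalityI subsetI)
    fix x assume "x \<in> {x. p x = 0}"
    then have "x - a \<in> Z" by (simp add: Z_def)
    then show "x \<in> (+) a ` Z" by (intro image_eqI[of _ _ "x - a"]) auto
  qed (auto simp: Z_def)
  ultimately show ?thesis by simp
qed

section \<open>Polynomial maps are Lipschitz on balls\<close>

text \<open>Both bounds go through the induction together, since the Lipschitz constant of a product
  involves the suprema of its factors.\<close>

lemma real_polynomial_function_bounded_lipschitz:
  fixes p :: "'a::real_normed_vector \<Rightarrow> real"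
  assumes "real_polynomial_function p"
  shows "\<exists>M L. \<forall>x. norm x \<le> r \<longrightarrow> \<bar>p x\<bar> \<le> M \<and> (\<forall>y. norm y \<le> r \<longrightarrow> \<bar>p x - p y\<bar> \<le> L * norm (x - y))"
  using assms
proof (induction rule: real_polynomial_function.induct)
  case (linear f)
  interpret bounded_linear f by fact
  obtain K where K: "\<And>x. norm (f x) \<le> norm x * K" "K > 0" using pos_bounded by blast
  have "\<bar>f x\<bar> \<le> r * K" if "norm x \<le> r" for x
    using order.trans[OF K(1)[of x] mult_right_mono[OF that, of K]] K(2) by simp
  moreover have "\<bar>f x - f y\<bar> \<le> K * norm (x - y)" for x y
    using K(1)[of "x - y"] by (simp add: diff mult.commute)
  ultimately show ?case by (intro exI[of _ "r * K"] exI[of _ K]) auto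
next
  case (const c)
  show ?case by (intro exI[of _ "\<bar>c\<bar>"] exI[of _ 0]) auto
next
  case (add f g)
  obtain M L where "\<forall>x. norm x \<le> r \<longrightarrow> \<bar>f x\<bar> \<le> M \<and> (\<forall>y. norm y \<le> r \<longrightarrow> \<bar>f x - f y\<bar> \<le> L * norm (x - y))"
    using add.IH(1) by blast
  then have f: "\<And>x. norm x \<le> r \<Longrightarrow> \<bar>f x\<bar> \<le> M"
      "\<And>x y. norm x \<le> r \<Longrightarrow> norm y \<le> r \<Longrightarrow> \<bar>f x - f y\<bar> \<le> L * norm (x - y)" by blast+
  obtain M' L' where "\<forall>x. norm x \<le> r \<longrightarrow> \<bar>g x\<bar> \<le> M' \<and> (\<forall>y. norm y \<le> r \<longrightarrow> \<bar>g x - g y\<bar> \<le> L' * norm (x - y))"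
    using add.IH(2) by blast
  then have g: "\<And>x. norm x \<le> r \<Longrightarrow> \<bar>g x\<bar> \<le> M'"
      "\<And>x y. norm x \<le> r \<Longrightarrow> norm y \<le> r \<Longrightarrow> \<bar>g x - g y\<bar> \<le> L' * norm (x - y)" by blast+
  have "\<bar>f x + g x\<bar> \<le> M + M'" if "norm x \<le> r" for x
    using f(1)[OF that] g(1)[OF that] by linarith
  moreover have "\<bar>(f x + g x) - (f y + g y)\<bar> \<le> (L + L') * norm (x - y)" if "norm x \<le> r" "norm y \<le> r" for x y
    using f(2)[OF that] g(2)[OF that] by (simp add: distrib_right)
  ultimately show ?case by (intro exI[of _ "M + M'"] exI[of _ "L + L'"]) auto
next
  case (mult f g)
  obtain M L where "\<forall>x. norm x \<le> r \<longrightarrow> \<bar>f x\<bar> \<le> M \<and> (\<forall>y. norm y \<le> r \<longrightarrow> \<bar>f x - f y\<bar> \<le> L * norm (x - y))"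
    using mult.IH(1) by blast
  then have f: "\<And>x. norm x \<le> r \<Longrightarrow> \<bar>f x\<bar> \<le> M"
      "\<And>x y. norm x \<le> r \<Longrightarrow> norm y \<le> r \<Longrightarrow> \<bar>f x - f y\<bar> \<le> L * norm (x - y)" by blast+
  obtain M' L' where "\<forall>x. norm x \<le> r \<longrightarrow> \<bar>g x\<bar> \<le> M' \<and> (\<forall>y. norm y \<le> r \<longrightarrow> \<bar>g x - g y\<bar> \<le> L' * norm (x - y))"
    using mult.IH(2) by blast
  then have g: "\<And>x. norm x \<le> r \<Longrightarrow> \<bar>g x\<bar> \<le> M'"
      "\<And>x y. norm x \<le> r \<Longrightarrow> norm y \<le> r \<Longrightarrow> \<bar>g x - g y\<bar> \<le> L' * norm (x - y)" by blast+
  have "\<bar>f x * g x\<bar> \<le> M * M'" if "norm x \<le> r" for x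
    unfolding abs_mult using f(1)[OF that] g(1)[OF that] by (intro mult_mono) auto
  moreover have "\<bar>f x * g x - f y * g y\<bar> \<le> (M * L' + L * M') * norm (x - y)" if "norm x \<le> r" "norm y \<le> r" for x y
  proof -
    have "f x * g x - f y * g y = f x * (g x - g y) + (f x - f y) * g y" by (simp add: algebra_simps)
    then have "\<bar>f x * g x - f y * g y\<bar> \<le> \<bar>f x\<bar> * \<bar>g x - g y\<bar> + \<bar>f x - f y\<bar> * \<bar>g y\<bar>"
      by (metis abs_mult abs_triangle_ineq)
    also have "\<dots> \<le> M * (L' * norm (x - y)) + (L * norm (x - y)) * M'"
      using f(1)[OF that(1)] g(1)[OF that(2)] f(2)[OF that] g(2)[OF that]
      by (intro add_mono mult_mono) auto
    finally show ?thesis by (simp add: algebra_simps)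
  qed
  ultimately show ?case by (intro exI[of _ "M * M'"] exI[of _ "M * L' + L * M'"]) auto
qed

lemma polynomial_function_lipschitz:
  fixes p :: "'a::real_normed_vector \<Rightarrow> 'b::euclidean_space"
  assumes "polynomial_function p"
  obtains L where "L \<ge> 0" "\<And>x y. norm x \<le> r \<Longrightarrow> norm y \<le> r \<Longrightarrow> norm (p x - p y) \<le> L * norm (x - y)"
proof -
  have "\<exists>L. \<forall>x y. norm x \<le> r \<longrightarrow> norm y \<le> r \<longrightarrow> \<bar>p x \<bullet> b - p y \<bullet> b\<bar> \<le> L * norm (x - y)" if "b \<in> Basis" for b
    using real_polynomial_function_bounded_lipschitz[of "\<lambda>x. p x \<bullet> b" r] assms that
    unfolding polynomial_function_iff_Basis_inner by blast
  then have "\<exists>L. \<forall>b\<in>Basis. \<forall>x y. norm x \<le> r \<longrightarrow> norm y \<le> r \<longrightarrow> \<bar>p x \<bullet> b - p y \<bullet> b\<bar> \<le> L b * norm (x - y)"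
    by (intro bchoice) blast
  then obtain L where L: "\<And>b x y. b \<in> Basis \<Longrightarrow> norm x \<le> r \<Longrightarrow> norm y \<le> r \<Longrightarrow>
      \<bar>p x \<bullet> b - p y \<bullet> b\<bar> \<le> L b * norm (x - y)"
    by blast
  have "norm (p x - p y) \<le> (\<Sum>b\<in>Basis. \<bar>L b\<bar>) * norm (x - y)" if "norm x \<le> r" "norm y \<le> r" for x y
  proof -
    have "norm (p x - p y) \<le> (\<Sum>b\<in>Basis. \<bar>(p x - p y) \<bullet> b\<bar>)" by (rule norm_le_l1)
    also have "\<dots> \<le> (\<Sum>b\<in>Basis. \<bar>L b\<bar> * norm (x - y))"
    proof (rule sum_mono)
      fix b :: 'b assume "b \<in> Basis"
      then have "\<bar>(p x - p y) \<bullet> b\<bar> \<le> L b * norm (x - y)"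
        using L that by (simp add: inner_diff_left)
      also have "\<dots> \<le> \<bar>L b\<bar> * norm (x - y)" by (intro mult_right_mono) auto
      finally show "\<bar>(p x - p y) \<bullet> b\<bar> \<le> \<bar>L b\<bar> * norm (x - y)" .
    qed
    finally show ?thesis by (simp add: sum_distrib_right)
  qed
  then show ?thesis by (intro that[of "\<Sum>b\<in>Basis. \<bar>L b\<bar>"]) (auto intro: sum_nonneg)
qed

section \<open>Hausdorff-null sets\<close>

lemma hausdorff_null_subset:
  assumes "hausdorff_null m B" "A \<subseteq> B"
  shows "hausdorff_null m A"
  unfolding hausdorff_null_def
proof (intro allI impI)
  fix \<epsilon> :: real assume "\<epsilon> > 0"
  then obtain C where "B \<subseteq> (\<Union>i::nat. C i)" "\<forall>i. bounded (C i)"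
    "summable (\<lambda>i. if C i = {} then 0 else diameter (C i) ^ m)"
    "(\<Sum>i. if C i = {} then 0 else diameter (C i) ^ m) < \<epsilon>"
    using assms(1) unfolding hausdorff_null_def by blast
  then show "\<exists>C. A \<subseteq> (\<Union>i::nat. C i) \<and> (\<forall>i. bounded (C i)) \<and>
    summable (\<lambda>i. if C i = {} then 0 else diameter (C i) ^ m) \<and>
    (\<Sum>i. if C i = {} then 0 else diameter (C i) ^ m) < \<epsilon>"
    using assms(2) by blast
qed

text \<open>Empty members of a cover must contribute nothing even for \<open>m = 0\<close>, where
  \<open>diameter {} ^ 0\<close> would be 1.\<close>

definition diam_pow :: "nat \<Rightarrow> 'a::metric_space set \<Rightarrow> real" where
  "diam_pow m C = (if C = {} then 0 else diameter C ^ m)"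

lemma diam_pow_nonneg: "bounded C \<Longrightarrow> 0 \<le> diam_pow m C"
  by (simp add: diam_pow_def diameter_ge_0)

text \<open>In \<open>ennreal\<close> every series has a sum, so covers can be estimated freely; a
  finite value gives back summability over the reals.\<close>

lemma hausdorff_nullI:
  fixes A :: "'a::metric_space set"
  assumes "\<And>\<epsilon>. \<epsilon> > 0 \<Longrightarrow> \<exists>C :: nat \<Rightarrow> 'a set. A \<subseteq> (\<Union>i. C i) \<and> (\<forall>i. bounded (C i)) \<and>
      (\<Sum>i. ennreal (diam_pow m (C i))) < ennreal \<epsilon>"
  shows "hausdorff_null m A"
  unfolding hausdorff_null_def
proof (intro allI impI)
  fix \<epsilon> :: real assume \<epsilon>: "\<epsilon> > 0"
  then obtain C :: "nat \<Rightarrow> 'a set" where C: "A \<subseteq> (\<Union>i. C i)" "\<And>i. bounded (C i)"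
      "(\<Sum>i. ennreal (diam_pow m (C i))) < ennreal \<epsilon>" using assms by blast
  have nn: "0 \<le> diam_pow m (C i)" for i using C(2) by (rule diam_pow_nonneg)
  have s: "summable (\<lambda>i. diam_pow m (C i))"
    by (rule summable_suminf_not_top) (use nn C(3) in auto)
  have "ennreal (\<Sum>i. diam_pow m (C i)) < ennreal \<epsilon>"
    using C(3) by (simp add: suminf_ennreal2[OF nn s])
  then have "(\<Sum>i. diam_pow m (C i)) < \<epsilon>"
    by (simp add: ennreal_less_iff suminf_nonneg[OF s nn])
  then show "\<exists>C. A \<subseteq> (\<Union>i::nat. C i) \<and> (\<forall>i. bounded (C i)) \<and>
    summable (\<lambda>i. if C i = {} then 0 else diameter (C i) ^ m) \<and>
    (\<Sum>i. if C i = {} then 0 else diameter (C i) ^ m) < \<epsilon>"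
    using C(1,2) s unfolding diam_pow_def by blast
qed

lemma hausdorff_nullD:
  fixes A :: "'a::metric_space set"
  assumes "hausdorff_null m A" "\<epsilon> > 0"
  obtains C :: "nat \<Rightarrow> 'a set" where "A \<subseteq> (\<Union>i. C i)" "\<And>i. bounded (C i)"
    "(\<Sum>i. ennreal (diam_pow m (C i))) < ennreal \<epsilon>"
proof -
  obtain C :: "nat \<Rightarrow> 'a set" where C: "A \<subseteq> (\<Union>i. C i)" "\<And>i. bounded (C i)"
    "summable (\<lambda>i. diam_pow m (C i))" "(\<Sum>i. diam_pow m (C i)) < \<epsilon>"
    using assms unfolding hausdorff_null_def diam_pow_def by blast
  have nn: "0 \<le> diam_pow m (C i)" for i using C(2) by (rule diam_pow_nonneg)
  have "(\<Sum>i. ennreal (diam_pow m (C i))) < ennreal \<epsilon>"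
    using C(4) assms(2) by (simp add: suminf_ennreal2[OF nn C(3)] ennreal_less_iff suminf_nonneg[OF C(3) nn])
  then show ?thesis using that C by blast
qed

lemma hausdorff_null_UN_nat:
  fixes A :: "nat \<Rightarrow> 'a::metric_space set"
  assumes "\<And>k. hausdorff_null m (A k)"
  shows "hausdorff_null m (\<Union>k. A k)"
proof (rule hausdorff_nullI)
  fix \<epsilon> :: real assume \<epsilon>: "\<epsilon> > 0"
  \<comment> \<open>The allowances add up to \<open>\<epsilon> / 2\<close> only, because comparing
    infinite sums turns the strict bounds into a weak one.\<close>
  have "\<exists>C :: nat \<Rightarrow> 'a set. A k \<subseteq> (\<Union>i. C i) \<and> (\<forall>i. bounded (C i)) \<and>
    (\<Sum>i. ennreal (diam_pow m (C i))) < ennreal (\<epsilon> / 2 * (1/2) ^ Suc k)" for k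
    using hausdorff_nullD[OF assms, of "\<epsilon> / 2 * (1/2) ^ Suc k" k] \<epsilon> by (metis half_gt_zero mult_pos_pos zero_less_power zero_less_divide_1_iff zero_less_numeral)
  then obtain C :: "nat \<Rightarrow> nat \<Rightarrow> 'a set" where
    C: "\<And>k. A k \<subseteq> (\<Union>i. C k i)" "\<And>k i. bounded (C k i)"
       "\<And>k. (\<Sum>i. ennreal (diam_pow m (C k i))) < ennreal (\<epsilon> / 2 * (1/2) ^ Suc k)"
    by metis
  define C' where "C' j = (case prod_decode j of (k, i) \<Rightarrow> C k i)" for j
  have "(\<Sum>j. ennreal (diam_pow m (C' j))) = (\<Sum>j. (\<lambda>(k, i). ennreal (diam_pow m (C k i))) (prod_decode j))"
    by (simp add: C'_def case_prod_unfold)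
  also have "\<dots> = (\<Sum>k. \<Sum>i. ennreal (diam_pow m (C k i)))"
    by (rule suminf_ennreal_2dimen) simp
  also have "\<dots> \<le> (\<Sum>k. ennreal (\<epsilon> / 2 * (1/2) ^ Suc k))"
    by (intro suminf_le summableI less_imp_le C(3))
  also have "\<dots> = ennreal (\<Sum>k. \<epsilon> / 2 * (1/2) ^ Suc k)"
    using \<epsilon> by (intro suminf_ennreal2) (auto intro!: summable_mult summable_geometric)
  also have "(\<Sum>k. \<epsilon> / 2 * (1/2) ^ Suc k) = \<epsilon> / 2"
    using sums_mult[OF power_half_series, of "\<epsilon>/2"] by (simp add: sums_iff)
  also have "ennreal (\<epsilon> / 2) < ennreal \<epsilon>" using \<epsilon> by (simp add: ennreal_less_iff)
  finally have "(\<Sum>j. ennreal (diam_pow m (C' j))) < ennreal \<epsilon>" .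
  moreover have "(\<Union>k. A k) \<subseteq> (\<Union>j. C' j)"
  proof
    fix x assume "x \<in> (\<Union>k. A k)"
    then obtain k i where "x \<in> C k i" using C(1) by blast
    then have "x \<in> C' (prod_encode (k, i))" by (simp add: C'_def)
    then show "x \<in> (\<Union>j. C' j)" by blast
  qed
  moreover have "bounded (C' j)" for j using C(2) by (simp add: C'_def case_prod_unfold)
  ultimately show "\<exists>C :: nat \<Rightarrow> 'a set. (\<Union>k. A k) \<subseteq> (\<Union>i. C i) \<and> (\<forall>i. bounded (C i)) \<and>
      (\<Sum>i. ennreal (diam_pow m (C i))) < ennreal \<epsilon>" by blast
qed

lemma hausdorff_null_empty: "hausdorff_null m {}"
  by (rule hausdorff_nullI, rule exI[of _ "\<lambda>_. {}"]) (simp add: diam_pow_def)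

lemma hausdorff_null_UN_finite:
  assumes "finite I" "\<And>i. i \<in> I \<Longrightarrow> hausdorff_null m (A i)"
  shows "hausdorff_null m (\<Union>i\<in>I. A i)"
proof (cases "I = {}")
  case True
  then show ?thesis by (simp add: hausdorff_null_empty)
next
  case False
  have "(\<Union>i\<in>I. A i) = (\<Union>k::nat. A (from_nat_into I k))"
    using range_from_nat_into[OF False countable_finite[OF assms(1)]] by (metis image_image)
  moreover have "hausdorff_null m (A (from_nat_into I k))" for k
    by (intro assms(2) from_nat_into False)
  ultimately show ?thesis by (simp add: hausdorff_null_UN_nat)
qed

section \<open>Null images of cylinders under polynomial maps\<close>

lemma prod_if_card:
  fixes a b :: real
  shows "(\<Prod>i\<in>(UNIV::'i::finite set). if i \<in> J then a else b) = a ^ card J * b ^ (CARD('i) - card J)"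
proof -
  have "(\<Prod>i\<in>UNIV. if i \<in> J then a else b) = (\<Prod>i\<in>J. a) * (\<Prod>i\<in>-J. b)"
    by (subst prod.If_cases) (auto simp: Compl_eq_Diff_UNIV)
  then show ?thesis by (simp add: card_Diff_subset Compl_eq_Diff_UNIV)
qed

lemma emeasure_lborel_cbox_cart:
  fixes l u :: "real^'i"
  assumes "\<And>i. l $ i \<le> u $ i"
  shows "emeasure lborel (cbox l u) = ennreal (\<Prod>i\<in>UNIV. u $ i - l $ i)"
proof -
  have "cbox l u \<noteq> {}" using assms by (simp add: interval_ne_empty_cart)
  then show ?thesis
    by (simp add: content_cbox_cart[symmetric] emeasure_eq_measure2)
qed

text \<open>A null set \<open>Z\<close> that is a cylinder over the coordinates in \<open>J\<close> is covered by dyadic cubes of small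
  total volume. Averaging over the remaining coordinates \<open>y\<close> gives a slice where the cubes
  that meet it have small total \<open>card J\<close>-dimensional volume.\<close>

lemma hausdorff_null_image_cube:
  fixes Z :: "(real^'i) set" and \<phi> :: "real^'i \<Rightarrow> 'b::euclidean_space"
  assumes neg: "negligible Z"
    and cyl: "\<And>s s'. s \<in> Z \<Longrightarrow> (\<And>i. i \<in> J \<Longrightarrow> s' $ i = s $ i) \<Longrightarrow> s' \<in> Z"
    and \<phi>J: "\<And>s s'. (\<And>i. i \<in> J \<Longrightarrow> s' $ i = s $ i) \<Longrightarrow> \<phi> s' = \<phi> s"
    and \<phi>: "polynomial_function \<phi>" and r: "r > 0"
  shows "hausdorff_null (card J) (\<phi> ` (Z \<inter> cbox (\<chi> i. - r) (\<chi> i. r)))"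
proof (rule hausdorff_nullI)
  fix \<epsilon> :: real assume \<epsilon>: "\<epsilon> > 0"
  define m where "m = card J"
  define n where "n = CARD('i)"
  have mn: "m \<le> n" unfolding m_def n_def by (rule card_mono) auto
  define Q where "Q = cbox (\<chi> i. - r) (\<chi> i. r) \<inter> (UNIV :: (real^'i) set)"
  have Q: "x \<in> Q \<longleftrightarrow> (\<forall>i. - r \<le> x $ i \<and> x $ i \<le> r)" for x by (auto simp: Q_def mem_box_cart)
  have normQ: "norm x \<le> real n * r" if "x \<in> Q" for x
  proof -
    have "norm x \<le> (\<Sum>i\<in>UNIV. \<bar>x $ i\<bar>)" by (rule norm_le_l1_cart)
    also have "\<dots> \<le> (\<Sum>i\<in>(UNIV::'i set). r)" using that by (intro sum_mono) (auto simp: Q abs_le_iff minus_le_iff)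
    finally show ?thesis by (simp add: n_def)
  qed
  obtain L where L: "L \<ge> 0" "\<And>x y. norm x \<le> real n * r \<Longrightarrow> norm y \<le> real n * r \<Longrightarrow> norm (\<phi> x - \<phi> y) \<le> L * norm (x - y)"
    using polynomial_function_lipschitz[OF \<phi>] by blast
  \<comment> \<open>The image of a cube of side \<open>s\<close> has diameter at most
    \<open>L * n * s\<close>, the Euclidean norm being bounded by the sum of the coordinates. Adding
    1 makes \<open>A\<close> positive even for \<open>L = 0\<close>.\<close>
  define A where "A = L * n + 1"
  have A: "A > 0" using L(1) by (simp add: A_def add_nonneg_pos)
  define \<eta> where "\<eta> = \<epsilon> / A ^ m"
  have \<eta>: "\<eta> > 0" using \<epsilon> A by (simp add: \<eta>_def)
  \<comment> \<open>The integral of the slice sums over \<open>Q\<close> will be at most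
    \<open>(2 * r) ^ m * e\<close>, whereas slice sums of at least \<open>\<eta>\<close> everywhere
    would give \<open>\<eta> * (2 * r) ^ n\<close>. The factor 2 in the denominator makes these two
    values strictly ordered.\<close>
  define e where "e = \<eta> * (2 * r) ^ n / (2 * (2 * r) ^ m)"
  have e: "e > 0" using \<eta> r by (simp add: e_def)
  have er: "(2 * r) ^ m * e < \<eta> * (2 * r) ^ n"
    using \<eta> r by (simp add: e_def field_simps)
  have negZQ: "negligible (Z \<inter> Q)" using neg by (rule negligible_subset) auto
  have mZQ: "Z \<inter> Q \<in> lmeasurable" "measure lebesgue (Z \<inter> Q) = 0"
    using negZQ by (auto simp: negligible_iff_measure)
  have "Z \<inter> Q \<subseteq> cbox (\<chi> i. - r) (\<chi> i. r)" by (auto simp: Q_def)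
  \<comment> \<open>The boxes arise by repeated halving of a cube, so each has equal sides; a single
    side length then controls both diameter and volume.\<close>
  from measurable_outer_intervals_bounded[OF mZQ(1) this e]
  obtain \<D> where D: "countable \<D>"
        "\<And>K. K \<in> \<D> \<Longrightarrow> K \<subseteq> cbox (\<chi> i. - r) (\<chi> i. r) \<and> K \<noteq> {} \<and> (\<exists>c d. K = cbox c d)"
        "pairwise (\<lambda>A B. interior A \<inter> interior B = {}) \<D>"
        "\<And>u v. cbox u v \<in> \<D> \<Longrightarrow> \<exists>k. \<forall>i\<in>Basis. v \<bullet> i - u \<bullet> i = ((\<chi> i. r) \<bullet> i - (\<chi> i. - r) \<bullet> i) / 2 ^ k"
        "Z \<inter> Q \<subseteq> \<Union>\<D>" "\<Union>\<D> \<in> lmeasurable" "measure lebesgue (\<Union>\<D>) \<le> measure lebesgue (Z \<inter> Q) + e"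
    by (metis (no_types, lifting))
  have "\<exists>c d s. K = cbox c d \<and> s > 0 \<and> (\<forall>i. d $ i - c $ i = s)" if K: "K \<in> \<D>" for K
  proof -
    obtain c d where cd: "K = cbox c d" using D(2)[OF K] by blast
    obtain k :: nat where k: "\<forall>i\<in>Basis. d \<bullet> i - c \<bullet> i = ((\<chi> i. r) \<bullet> i - (\<chi> i. - r) \<bullet> i) / 2 ^ k"
      using D(4)[of c d] K cd by auto
    have "d $ i - c $ i = 2 * r / 2 ^ k" for i
      using k[rule_format, of "axis i 1"] by (auto simp: inner_axis axis_in_Basis_iff)
    then show ?thesis using cd r by (intro exI[of _ c] exI[of _ d] exI[of _ "2 * r / 2 ^ k"]) auto
  qed
  then obtain c d s where cds: "\<And>K. K \<in> \<D> \<Longrightarrow> K = cbox (c K) (d K)" "\<And>K. K \<in> \<D> \<Longrightarrow> s K > 0"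
     "\<And>K i. K \<in> \<D> \<Longrightarrow> d K $ i - c K $ i = s K" by metis
  \<comment> \<open>The cover may be finite, so it is enumerated by a set \<open>T\<close> of
    naturals; indices outside \<open>T\<close> contribute zero.\<close>
  define T where "T = to_nat_on \<D> ` \<D>"
  define \<kappa> where "\<kappa> = from_nat_into \<D>"
  have \<kappa>: "\<kappa> j \<in> \<D>" if "j \<in> T" for j using that D(1) by (auto simp: T_def \<kappa>_def)
  have \<kappa>inj: "j = k" if "j \<in> T" "k \<in> T" "\<kappa> j = \<kappa> k" for j k
    using that D(1) by (auto simp: T_def \<kappa>_def)
  have \<kappa>surj: "\<exists>j\<in>T. \<kappa> j = K" if "K \<in> \<D>" for K
    using that D(1) by (auto simp: T_def \<kappa>_def)
  define sd where "sd j = s (\<kappa> j)" for j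
  have sd: "sd j > 0" if "j \<in> T" for j using cds(2)[OF \<kappa>[OF that]] by (simp add: sd_def)
  have box_em: "emeasure lborel (interior (\<kappa> j)) = ennreal (sd j ^ n)" if j: "j \<in> T" for j
  proof -
    have K: "\<kappa> j \<in> \<D>" by (rule \<kappa>[OF j])
    have le: "c (\<kappa> j) $ i \<le> d (\<kappa> j) $ i" for i
      using cds(3)[OF K, of i] cds(2)[OF K] by linarith
    have "emeasure lborel (box (c (\<kappa> j)) (d (\<kappa> j))) = emeasure lborel (cbox (c (\<kappa> j)) (d (\<kappa> j)))"
      by (simp add: emeasure_lborel_box_eq emeasure_lborel_cbox_eq)
    also have "\<dots> = ennreal (\<Prod>i\<in>UNIV. d (\<kappa> j) $ i - c (\<kappa> j) $ i)"
      by (rule emeasure_lborel_cbox_cart[OF le])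
    also have "\<dots> = ennreal (sd j ^ n)" using cds(3)[OF K] by (simp add: sd_def n_def)
    finally show ?thesis using cds(1)[OF K] by (metis interior_cbox)
  qed
  \<comment> \<open>Only the interiors of the boxes are disjoint, but they carry the full
    volumes.\<close>
  have vol: "(\<Sum>j. if j \<in> T then ennreal (sd j ^ n) else 0) \<le> ennreal e"
  proof -
    define I where "I j = (if j \<in> T then interior (\<kappa> j) else {})" for j
    have "(\<Sum>j. if j \<in> T then ennreal (sd j ^ n) else 0) = (\<Sum>j. emeasure lebesgue (I j))"
      by (intro suminf_cong) (simp add: I_def box_em)
    also have "\<dots> = emeasure lebesgue (\<Union>j. I j)"
    proof (rule suminf_emeasure)
      show "range I \<subseteq> sets lebesgue" by (auto simp: I_def)
      show "disjoint_family I"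
        unfolding disjoint_family_on_def
      proof (intro ballI impI)
        fix j k :: nat assume "j \<noteq> k"
        then show "I j \<inter> I k = {}"
          using D(3) \<kappa>[of j] \<kappa>[of k] \<kappa>inj[of j k] unfolding I_def pairwise_def by auto
      qed
    qed
    also have "\<dots> \<le> emeasure lebesgue (\<Union>\<D>)"
    proof (rule emeasure_mono)
      show "(\<Union>j. I j) \<subseteq> \<Union>\<D>"
        using \<kappa> interior_subset unfolding I_def by (fastforce split: if_splits)
      show "\<Union>\<D> \<in> sets lebesgue" using D(6) by (rule fmeasurableD)
    qed
    also have "\<dots> = ennreal (measure lebesgue (\<Union>\<D>))" by (rule emeasure_eq_measure2[OF D(6)])
    also have "\<dots> \<le> ennreal e" using D(7) mZQ(2) by (intro ennreal_leI) simp
    finally show ?thesis .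
  qed
  \<comment> \<open>The \<open>j\<close>-th box stretched to full width in the directions of
    \<open>J\<close>. A point \<open>y\<close> of \<open>Q\<close> lies in it iff the slice through
    \<open>y\<close> in these directions meets the box. With the weight \<open>sd j ^ m\<close>, its
    volume becomes that of the box times the constant \<open>(2 * r) ^ m\<close>.\<close>
  define E where "E j = cbox (\<chi> i. if i \<in> J then - r else c (\<kappa> j) $ i) (\<chi> i. if i \<in> J then r else d (\<kappa> j) $ i)" for j
  have E: "y \<in> E j \<longleftrightarrow> (\<forall>i\<in>J. -r \<le> y $ i \<and> y $ i \<le> r) \<and> (\<forall>i\<in>-J. c (\<kappa> j) $ i \<le> y $ i \<and> y $ i \<le> d (\<kappa> j) $ i)" for y j
    unfolding E_def mem_box_cart by (auto split: if_splits)
  have E_em: "emeasure lborel (E j) = ennreal ((2 * r) ^ m * sd j ^ (n - m))" if j: "j \<in> T" for j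
  proof -
    have K: "\<kappa> j \<in> \<D>" by (rule \<kappa>[OF j])
    have le: "c (\<kappa> j) $ i \<le> d (\<kappa> j) $ i" for i
      using cds(3)[OF K, of i] cds(2)[OF K] by linarith
    have "emeasure lborel (E j) = ennreal (\<Prod>i\<in>UNIV. (\<chi> i. if i \<in> J then r else d (\<kappa> j) $ i) $ i - (\<chi> i. if i \<in> J then - r else c (\<kappa> j) $ i) $ i)"
      unfolding E_def using le r by (intro emeasure_lborel_cbox_cart) auto
    also have "(\<Prod>i\<in>UNIV. (\<chi> i. if i \<in> J then r else d (\<kappa> j) $ i) $ i - (\<chi> i. if i \<in> J then - r else c (\<kappa> j) $ i) $ i)
        = (\<Prod>i\<in>UNIV. if i \<in> J then 2 * r else sd j)"
      by (intro prod.cong) (auto simp: cds(3)[OF K] sd_def)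
    also have "\<dots> = (2 * r) ^ m * sd j ^ (n - m)" unfolding m_def n_def by (rule prod_if_card)
    finally show ?thesis .
  qed
  define F where "F y = (\<Sum>j. (if j \<in> T then ennreal (sd j ^ m) else 0) * indicator (E j) y)" for y :: "real^'i"
  have intF: "(\<integral>\<^sup>+y. F y \<partial>lborel) \<le> ennreal ((2 * r) ^ m * e)"
  proof -
    have "(\<integral>\<^sup>+y. F y \<partial>lborel) = (\<Sum>j. \<integral>\<^sup>+y. (if j \<in> T then ennreal (sd j ^ m) else 0) * indicator (E j) y \<partial>lborel)"
      unfolding F_def by (rule nn_integral_suminf) (auto simp: E_def)
    also have "\<dots> = (\<Sum>j. (if j \<in> T then ennreal (sd j ^ m) else 0) * emeasure lborel (E j))"
      by (intro suminf_cong nn_integral_cmult_indicator) (auto simp: E_def)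
    also have "\<dots> = (\<Sum>j. ennreal ((2 * r) ^ m) * (if j \<in> T then ennreal (sd j ^ n) else 0))"
    proof (intro suminf_cong)
      fix j
      show "(if j \<in> T then ennreal (sd j ^ m) else 0) * emeasure lborel (E j) = ennreal ((2 * r) ^ m) * (if j \<in> T then ennreal (sd j ^ n) else 0)"
      proof (cases "j \<in> T")
        case True
        have "sd j ^ m * ((2 * r) ^ m * sd j ^ (n - m)) = (2 * r) ^ m * (sd j ^ m * sd j ^ (n - m))" by simp
        also have "sd j ^ m * sd j ^ (n - m) = sd j ^ n" using mn by (simp flip: power_add)
        finally show ?thesis using True E_em[OF True] sd[OF True] r by (simp flip: ennreal_mult)
      qed simp
    qed
    also have "\<dots> = ennreal ((2 * r) ^ m) * (\<Sum>j. if j \<in> T then ennreal (sd j ^ n) else 0)" by simp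
    also have "\<dots> \<le> ennreal ((2 * r) ^ m) * ennreal e" by (intro mult_left_mono vol) simp
    also have "\<dots> = ennreal ((2 * r) ^ m * e)" using r e by (simp flip: ennreal_mult)
    finally show ?thesis .
  qed
  have "\<exists>y\<in>Q. F y < ennreal \<eta>"
  proof (rule ccontr)
    assume "\<not> (\<exists>y\<in>Q. F y < ennreal \<eta>)"
    then have ge: "F y \<ge> ennreal \<eta>" if "y \<in> Q" for y using that by (auto simp: not_less)
    have emQ: "emeasure lborel Q = ennreal ((2 * r) ^ n)"
      unfolding Q_def Int_UNIV_right using r
      by (subst emeasure_lborel_cbox_cart) (auto simp: n_def)
    have "ennreal (\<eta> * (2 * r) ^ n) = ennreal \<eta> * emeasure lborel Q"
      using \<eta> r by (simp add: emQ ennreal_mult)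
    also have "\<dots> = (\<integral>\<^sup>+y. ennreal \<eta> * indicator Q y \<partial>lborel)"
      by (rule nn_integral_cmult_indicator[symmetric]) (simp add: Q_def)
    also have "\<dots> \<le> (\<integral>\<^sup>+y. F y \<partial>lborel)"
      by (rule nn_integral_mono) (use ge in \<open>auto simp: indicator_def\<close>)
    also have "\<dots> \<le> ennreal ((2 * r) ^ m * e)" by (rule intF)
    finally show False using er \<eta> r e by (simp add: ennreal_le_iff)
  qed
  then obtain y where y: "y \<in> Q" "F y < ennreal \<eta>" by blast
  define C where "C j = (if j \<in> T \<and> y \<in> E j then \<phi> ` \<kappa> j else {})" for j
  have KQ: "\<kappa> j \<subseteq> Q" if "j \<in> T" for j using D(2)[OF \<kappa>[OF that]] by (auto simp: Q_def)
  have dist\<phi>: "norm (\<phi> x - \<phi> x') \<le> A * sd j" if "j \<in> T" "x \<in> \<kappa> j" "x' \<in> \<kappa> j" for j x x'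
  proof -
    have K: "\<kappa> j \<in> \<D>" using \<kappa> that by blast
    have inK: "x \<in> cbox (c (\<kappa> j)) (d (\<kappa> j))" "x' \<in> cbox (c (\<kappa> j)) (d (\<kappa> j))"
      using that(2,3) cds(1)[OF K] by blast+
    have "norm (x - x') \<le> (\<Sum>i\<in>UNIV. \<bar>(x - x') $ i\<bar>)" by (rule norm_le_l1_cart)
    also have "\<dots> \<le> (\<Sum>i\<in>(UNIV::'i set). sd j)"
    proof (rule sum_mono)
      fix i
      have "c (\<kappa> j) $ i \<le> x $ i" "x $ i \<le> d (\<kappa> j) $ i" "c (\<kappa> j) $ i \<le> x' $ i" "x' $ i \<le> d (\<kappa> j) $ i"
        using inK by (auto simp: mem_box_cart)
      then show "\<bar>(x - x') $ i\<bar> \<le> sd j" using cds(3)[OF K, of i] by (simp add: sd_def)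
    qed
    also have "\<dots> = n * sd j" by (simp add: n_def)
    finally have "norm (x - x') \<le> n * sd j" .
    moreover have "norm (\<phi> x - \<phi> x') \<le> L * norm (x - x')"
      using KQ[OF that(1)] that normQ by (intro L(2)) auto
    ultimately have "norm (\<phi> x - \<phi> x') \<le> L * (n * sd j)"
      using L(1) by (meson mult_left_mono order_trans)
    also have "\<dots> \<le> A * sd j" using sd[OF that(1)] by (simp add: A_def algebra_simps)
    finally show ?thesis .
  qed
  have bnd: "bounded (C j)" for j
  proof (cases "j \<in> T \<and> y \<in> E j")
    case True
    have K: "\<kappa> j \<in> \<D>" "\<kappa> j \<noteq> {}" using \<kappa> True D(2) by auto
    then obtain x where x: "x \<in> \<kappa> j" by blast
    show ?thesis unfolding bounded_def C_def using True dist\<phi>[OF _ x]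
      by (auto simp: dist_norm intro!: exI[of _ "\<phi> x"] exI[of _ "A * sd j"])
  next
    case False
    then show ?thesis by (simp only: C_def if_False bounded_empty)
  qed
  have dpT: "diam_pow m (C j) \<le> A ^ m * (sd j ^ m)" if "j \<in> T" for j
  proof (cases "C j = {}")
    case True
    then show ?thesis using A sd[OF that] by (simp add: diam_pow_def)
  next
    case False
    have "diameter (C j) \<le> A * sd j"
      using False dist\<phi>[OF that] by (intro diameter_le) (auto simp: C_def split: if_splits)
    then have "diameter (C j) ^ m \<le> (A * sd j) ^ m"
      by (intro power_mono diameter_ge_0 bnd)
    then show ?thesis using False by (simp add: diam_pow_def power_mult_distrib)
  qed
  have dp: "ennreal (diam_pow m (C j)) \<le> ennreal (A ^ m) * ((if j \<in> T then ennreal (sd j ^ m) else 0) * indicator (E j) y)" for j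
  proof (cases "j \<in> T \<and> y \<in> E j")
    case True
    then have "diam_pow m (C j) \<le> A ^ m * (sd j ^ m)" using dpT by blast
    then have "ennreal (diam_pow m (C j)) \<le> ennreal (A ^ m * (sd j ^ m))" by (rule ennreal_leI)
    then show ?thesis using True A sd[of j] by (simp add: ennreal_mult)
  next
    case False
    then have "C j = {}" by (simp only: C_def if_False)
    then show ?thesis by (simp add: diam_pow_def)
  qed
  have "(\<Sum>j. ennreal (diam_pow m (C j))) \<le> (\<Sum>j. ennreal (A ^ m) * ((if j \<in> T then ennreal (sd j ^ m) else 0) * indicator (E j) y))"
    by (intro suminf_le summableI dp)
  also have "\<dots> = ennreal (A ^ m) * F y" by (simp only: ennreal_suminf_cmult F_def)
  also have "\<dots> < ennreal (A ^ m) * ennreal \<eta>"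
    using y(2) A by (intro ennreal_mult_strict_left_mono) auto
  also have "\<dots> = ennreal \<epsilon>" using A \<eta> by (simp add: \<eta>_def flip: ennreal_mult)
  finally have small: "(\<Sum>j. ennreal (diam_pow m (C j))) < ennreal \<epsilon>" .
  have "\<phi> ` (Z \<inter> Q) \<subseteq> (\<Union>j. C j)"
  proof
    fix w assume "w \<in> \<phi> ` (Z \<inter> Q)"
    then obtain z where z: "z \<in> Z" "z \<in> Q" "w = \<phi> z" by blast
    \<comment> \<open>Moves \<open>z\<close> into the slice through \<open>y\<close> while keeping
      the coordinates in \<open>J\<close>, hence also membership in \<open>Z\<close> and the value
      of \<open>\<phi>\<close>.\<close>
    define z' where "z' = (\<chi> i. if i \<in> J then z $ i else y $ i)"
    have "z' \<in> Z" by (rule cyl[OF z(1)]) (simp add: z'_def)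
    moreover have z'Q: "z' \<in> Q" using z(2) y(1) by (auto simp: Q z'_def)
    ultimately obtain K where K: "K \<in> \<D>" "z' \<in> K" using D(5) by blast
    obtain j where j: "j \<in> T" "\<kappa> j = K" using \<kappa>surj[OF K(1)] by blast
    have "z' \<in> cbox (c K) (d K)" using K cds(1) by blast
    then have "y \<in> E j" using y(1) unfolding E by (auto simp: Q j(2) mem_box_cart z'_def split: if_splits)
    moreover have "w = \<phi> z'" unfolding z(3) by (rule \<phi>J) (simp add: z'_def)
    ultimately have "w \<in> C j" using j K(2) by (auto simp: C_def)
    then show "w \<in> (\<Union>j. C j)" by blast
  qed
  then show "\<exists>C :: nat \<Rightarrow> 'b set. \<phi> ` (Z \<inter> cbox (\<chi> i. - r) (\<chi> i. r)) \<subseteq> (\<Union>i. C i) \<and> (\<forall>i. bounded (C i)) \<and>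
      (\<Sum>i. ennreal (diam_pow (card J) (C i))) < ennreal \<epsilon>"
    using bnd small unfolding Q_def m_def by (intro exI[of _ C]) auto
qed

lemma hausdorff_null_image:
  fixes Z :: "(real^'i) set" and \<phi> :: "real^'i \<Rightarrow> 'b::euclidean_space"
  assumes "negligible Z"
    and "\<And>s s'. s \<in> Z \<Longrightarrow> (\<And>i. i \<in> J \<Longrightarrow> s' $ i = s $ i) \<Longrightarrow> s' \<in> Z"
    and "\<And>s s'. (\<And>i. i \<in> J \<Longrightarrow> s' $ i = s $ i) \<Longrightarrow> \<phi> s' = \<phi> s"
    and "polynomial_function \<phi>"
  shows "hausdorff_null (card J) (\<phi> ` Z)"
proof -
  define Q where "Q k = (cbox (\<chi> i. - real (Suc k)) (\<chi> i. real (Suc k)) :: (real^'i) set)" for k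
  have sub: "\<phi> ` Z \<subseteq> (\<Union>k. \<phi> ` (Z \<inter> Q k))"
  proof
    fix w assume "w \<in> \<phi> ` Z"
    then obtain z where z: "z \<in> Z" "w = \<phi> z" by blast
    obtain k :: nat where k: "norm z \<le> real k" using real_arch_simple by blast
    have "\<bar>z $ i\<bar> \<le> real (Suc k)" for i using component_le_norm_cart[of z i] k by simp
    then have "z \<in> Q k" by (auto simp: Q_def mem_box_cart abs_le_iff) (smt (verit))
    then show "w \<in> (\<Union>k. \<phi> ` (Z \<inter> Q k))" using z by blast
  qed
  have cube: "hausdorff_null (card J) (\<phi> ` (Z \<inter> Q k))" for k
    unfolding Q_def
  proof (rule hausdorff_null_image_cube)
    show "s' \<in> Z" if "s \<in> Z" "\<And>i. i \<in> J \<Longrightarrow> s' $ i = s $ i" for s s'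
      by (rule assms(2)[OF that])
    show "\<phi> s' = \<phi> s" if "\<And>i. i \<in> J \<Longrightarrow> s' $ i = s $ i" for s s'
      by (rule assms(3)) (rule that)
  qed (rule assms(1), rule assms(4), simp)
  show ?thesis by (rule hausdorff_null_subset[OF hausdorff_null_UN_nat[of _ "\<lambda>k. \<phi> ` (Z \<inter> Q k)", OF cube] sub])
qed

text \<open>\<open>J\<close> is enlarged to a set \<open>J'\<close> of exactly \<open>m\<close>
  coordinates, for which \<open>m \<le> CARD('i)\<close> leaves room. The map ignores a new
  coordinate \<open>j\<close>, so its range is already the image of the hyperplane where
  \<open>j\<close> vanishes, a null cylinder over \<open>J'\<close>.\<close>

lemma hausdorff_null_image_few_coordinates:
  fixes \<phi> :: "real^'i \<Rightarrow> 'b::euclidean_space"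
  assumes J: "card J < m" "m \<le> CARD('i)"
    and "\<And>s s'. (\<And>i. i \<in> J \<Longrightarrow> s' $ i = s $ i) \<Longrightarrow> \<phi> s' = \<phi> s"
    and "polynomial_function \<phi>"
  shows "hausdorff_null m (range \<phi>)"
proof -
  have "\<exists>J'. J \<subseteq> J' \<and> J' \<subseteq> UNIV \<and> card J' = m"
    by (rule exists_subset_between) (use J in auto)
  then obtain J' where J': "J \<subseteq> J'" "card J' = m" by blast
  have "\<not> J' \<subseteq> J" using card_mono[of J J'] J(1) J'(2) by auto
  then obtain j where j: "j \<in> J'" "j \<notin> J" by blast
  define Z where "Z = {s :: real^'i. s $ j = 0}"
  have "\<phi> s \<in> \<phi> ` Z" for s
  proof (rule image_eqI)
    show "\<phi> s = \<phi> (\<chi> i. if i = j then 0 else s $ i)" using j by (intro assms(3)) auto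
    show "(\<chi> i. if i = j then 0 else s $ i) \<in> Z" by (simp add: Z_def)
  qed
  then have "range \<phi> \<subseteq> \<phi> ` Z" by blast
  moreover have "hausdorff_null (card J') (\<phi> ` Z)"
  proof (rule hausdorff_null_image)
    show "negligible Z" unfolding Z_def by (rule negligible_standard_hyperplane_cart)
    show "s' \<in> Z" if "s \<in> Z" "\<And>i. i \<in> J' \<Longrightarrow> s' $ i = s $ i" for s s'
      using that j(1) by (simp add: Z_def)
    show "\<phi> s' = \<phi> s" if "\<And>i. i \<in> J' \<Longrightarrow> s' $ i = s $ i" for s s'
      using that J'(1) by (intro assms(3)) auto
  qed (rule assms(4))
  ultimately show ?thesis using J'(2) hausdorff_null_subset[of m "\<phi> ` Z" "range \<phi>"] by simp
qed

section \<open>Generic linear independence in polynomial families\<close>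

text \<open>Gaussian elimination with polynomial entries. A coordinate in which \<open>v k\<close>
  does not vanish at \<open>s0\<close> serves as pivot, and the other vectors are cleared by
  cross-multiplication; \<open>p\<close> is the product of the pivots.\<close>

lemma polynomial_family_independent_open:
  fixes v :: "'m \<Rightarrow> 'p::real_normed_vector \<Rightarrow> 'c::euclidean_space"
  assumes "finite S" "\<And>m. m \<in> S \<Longrightarrow> polynomial_function (v m)"
    and "\<And>a. (\<Sum>m\<in>S. a m *\<^sub>R v m s0) = 0 \<Longrightarrow> \<forall>m\<in>S. a m = (0::real)"
  shows "\<exists>p. real_polynomial_function p \<and> p s0 \<noteq> 0 \<and>
    (\<forall>s a. p s \<noteq> 0 \<longrightarrow> (\<Sum>m\<in>S. a m *\<^sub>R v m s) = 0 \<longrightarrow> (\<forall>m\<in>S. a m = 0))"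
  using assms
proof (induction S arbitrary: v rule: finite_induct)
  case empty
  show ?case by (rule exI[of _ "\<lambda>_. 1"]) auto
next
  case (insert k S)
  have sums: "(\<Sum>m\<in>insert k S. a m *\<^sub>R v m s) = a k *\<^sub>R v k s + (\<Sum>m\<in>S. a m *\<^sub>R v m s)" for a s
    using insert.hyps by simp
  have "v k s0 \<noteq> 0"
  proof
    assume "v k s0 = 0"
    then have "(\<Sum>m\<in>insert k S. (if m = k then 1 else 0) *\<^sub>R v m s0) = 0"
      by (intro sum.neutral) auto
    then show False using insert.prems(2)[of "\<lambda>m. if m = k then 1 else 0"] by auto
  qed
  then obtain b where b: "b \<in> Basis" "v k s0 \<bullet> b \<noteq> 0"
    by (metis euclidean_all_zero_iff)
  define q where "q s = v k s \<bullet> b" for s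
  \<comment> \<open>Elimination without division: \<open>w m s\<close> is orthogonal to
    \<open>b\<close> and remains polynomial in \<open>s\<close>.\<close>
  define w where "w m s = q s *\<^sub>R v m s - (v m s \<bullet> b) *\<^sub>R v k s" for m s
  have pv: "polynomial_function (v m)" if "m \<in> insert k S" for m using insert.prems(1) that by blast
  have pb: "real_polynomial_function (\<lambda>s. v m s \<bullet> b)" if "m \<in> insert k S" for m
    using pv[OF that] b(1) unfolding polynomial_function_iff_Basis_inner by blast
  have pq: "real_polynomial_function q" unfolding q_def by (rule pb) simp
  have pw: "polynomial_function (w m)" if "m \<in> S" for m
    unfolding w_def using pv pb pq that
    by (intro polynomial_function_diff polynomial_function_mult) (auto simp: real_polynomial_function_eq[symmetric])
  have sumw: "(\<Sum>m\<in>S. a m *\<^sub>R w m s) = (\<Sum>m\<in>S. (a m * q s) *\<^sub>R v m s) - (\<Sum>m\<in>S. a m * (v m s \<bullet> b)) *\<^sub>R v k s" for a s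
    by (simp add: w_def algebra_simps sum_subtractf scaleR_sum_left)
  have ind: "\<forall>m\<in>S. a m = 0" if "(\<Sum>m\<in>S. a m *\<^sub>R w m s0) = 0" for a
  proof -
    \<comment> \<open>A relation among the \<open>w m\<close> at \<open>s0\<close> lifts to one
      among the \<open>v m\<close>; the coefficient of the pivot vector collects what was
      subtracted.\<close>
    define a' where "a' m = (if m = k then - (\<Sum>m\<in>S. a m * (v m s0 \<bullet> b)) else a m * q s0)" for m
    have "(\<Sum>m\<in>insert k S. a' m *\<^sub>R v m s0) = a' k *\<^sub>R v k s0 + (\<Sum>m\<in>S. a' m *\<^sub>R v m s0)"
      by (rule sums)
    also have "(\<Sum>m\<in>S. a' m *\<^sub>R v m s0) = (\<Sum>m\<in>S. (a m * q s0) *\<^sub>R v m s0)"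
      using insert.hyps by (intro sum.cong) (auto simp: a'_def)
    finally have "(\<Sum>m\<in>insert k S. a' m *\<^sub>R v m s0) = 0"
      using that by (simp add: sumw a'_def)
    then have z: "\<forall>m\<in>insert k S. a' m = 0" by (rule insert.prems(2))
    show ?thesis
    proof
      fix m assume m: "m \<in> S"
      then have "a' m = 0" "m \<noteq> k" using z insert.hyps by auto
      then show "a m = 0" using b(2) by (simp add: a'_def q_def)
    qed
  qed
  obtain p where p: "real_polynomial_function p" "p s0 \<noteq> 0"
    "\<And>s a. p s \<noteq> 0 \<Longrightarrow> (\<Sum>m\<in>S. a m *\<^sub>R w m s) = 0 \<Longrightarrow> \<forall>m\<in>S. a m = 0"
    using insert.IH[of w, OF pw ind] by blast
  show ?case
  proof (intro exI[of _ "\<lambda>s. q s * p s"] conjI allI impI)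
    show "real_polynomial_function (\<lambda>s. q s * p s)" using pq p(1) by blast
    show "q s0 * p s0 \<noteq> 0" using b(2) p(2) by (simp add: q_def)
    fix s a assume nz: "q s * p s \<noteq> 0" and 0: "(\<Sum>m\<in>insert k S. a m *\<^sub>R v m s) = 0"
    have e: "(\<Sum>m\<in>S. a m *\<^sub>R v m s) = - (a k *\<^sub>R v k s)"
      using 0 unfolding sums by (simp add: eq_neg_iff_add_eq_0 add.commute)
    have "(\<Sum>m\<in>S. a m * (v m s \<bullet> b)) = (\<Sum>m\<in>S. a m *\<^sub>R v m s) \<bullet> b"
      by (simp add: inner_sum_left)
    also have "\<dots> = - (a k * q s)" by (simp add: e q_def)
    finally have e2: "(\<Sum>m\<in>S. a m * (v m s \<bullet> b)) = - (a k * q s)" .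
    have "(\<Sum>m\<in>S. (a m * q s) *\<^sub>R v m s) = q s *\<^sub>R (\<Sum>m\<in>S. a m *\<^sub>R v m s)"
      by (simp add: scaleR_sum_right mult.commute)
    then have "(\<Sum>m\<in>S. a m *\<^sub>R w m s) = 0" unfolding sumw e2 by (simp add: e)
    then have S0: "\<forall>m\<in>S. a m = 0" using nz by (intro p(3)) auto
    then have "(\<Sum>m\<in>S. a m *\<^sub>R v m s) = 0" by simp
    then have "a k *\<^sub>R v k s = 0" using e by simp
    then have "a k = 0" using nz by (auto simp: q_def)
    then show "\<forall>m\<in>insert k S. a m = 0" using S0 by simp
  qed
qed

text \<open>Negligible sets are closed under finite unions and are never the whole space. So
  finitely many generic conditions hold together and have a common witness.\<close>

definition generically :: "('p::euclidean_space \<Rightarrow> bool) \<Rightarrow> bool" where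
  "generically P \<longleftrightarrow> negligible {s. \<not> P s}"

lemma generically_mono: "generically P \<Longrightarrow> (\<And>s. P s \<Longrightarrow> Q s) \<Longrightarrow> generically Q"
  unfolding generically_def by (erule negligible_subset) auto

lemma generically_conj: "generically P \<Longrightarrow> generically Q \<Longrightarrow> generically (\<lambda>s. P s \<and> Q s)"
proof -
  assume "generically P" "generically Q"
  moreover have "{s. \<not> (P s \<and> Q s)} = {s. \<not> P s} \<union> {s. \<not> Q s}" by auto
  ultimately show ?thesis unfolding generically_def by (simp add: negligible_Un)
qed

lemma generically_ball_finite:
  assumes "finite A" "\<And>x. x \<in> A \<Longrightarrow> generically (P x)"
  shows "generically (\<lambda>s. \<forall>x\<in>A. P x s)"
proof -
  have "{s. \<not> (\<forall>x\<in>A. P x s)} = (\<Union>x\<in>A. {s. \<not> P x s})" by auto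
  moreover have "negligible (\<Union>x\<in>A. {s. \<not> P x s})"
    using assms unfolding generically_def by (intro negligible_Union) auto
  ultimately show ?thesis unfolding generically_def by metis
qed

lemma generically_True: "(\<And>s. P s) \<Longrightarrow> generically P"
  by (simp add: generically_def)

lemma generically_ex:
  assumes "generically P"
  obtains s where "P s"
proof (rule ccontr)
  assume "\<not> thesis"
  then have "{s. \<not> P s} = UNIV" using that by blast
  then show False using assms non_negligible_UNIV unfolding generically_def by metis
qed

lemma generically_independent_family:
  fixes v :: "'m \<Rightarrow> 'p::euclidean_space \<Rightarrow> 'c::euclidean_space"
  assumes "finite S" "\<And>m. m \<in> S \<Longrightarrow> polynomial_function (v m)"
    and "\<And>a. (\<Sum>m\<in>S. a m *\<^sub>R v m s0) = 0 \<Longrightarrow> \<forall>m\<in>S. a m = (0::real)"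
  shows "generically (\<lambda>s. \<forall>a. (\<Sum>m\<in>S. a m *\<^sub>R v m s) = 0 \<longrightarrow> (\<forall>m\<in>S. a m = 0))"
proof -
  obtain p where p: "real_polynomial_function p" "p s0 \<noteq> 0"
    "\<forall>s a. p s \<noteq> 0 \<longrightarrow> (\<Sum>m\<in>S. a m *\<^sub>R v m s) = 0 \<longrightarrow> (\<forall>m\<in>S. a m = 0)"
    using polynomial_family_independent_open[where v=v and ?s0.0=s0, OF assms] by blast
  have "generically (\<lambda>s. p s \<noteq> 0)"
    unfolding generically_def using negligible_zeros_real_polynomial_function[OF p(1,2)] by simp
  then show ?thesis by (rule generically_mono) (use p(3) in blast)
qed

section \<open>Partition counts\<close>

text \<open>The expected dimension of the motions in which blocks with equal label under
  \<open>p\<close> move as one body: \<open>D\<close> for each class, less \<open>D\<close> (at a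
  rod \<open>D - 1\<close>) for each further class at a vertex. The natural subtraction makes
  vertices without incidences contribute zero.\<close>

definition block_count :: "nat \<Rightarrow> 'v::finite set \<Rightarrow> 'b set \<Rightarrow> ('b \<Rightarrow> 'v set) \<Rightarrow> ('b \<Rightarrow> 'b) \<Rightarrow> int" where
  "block_count D R N Inc p = int D * int (card (p ` N)) -
     (\<Sum>v\<in>UNIV. (int D - of_bool (v \<in> R)) * int (card (p ` {b \<in> N. v \<in> Inc b}) - 1))"

lemma block_count_const:
  assumes "p ` N = {l}"
  shows "block_count D R N Inc p = int D"
proof -
  have "card (p ` {b \<in> N. v \<in> Inc b}) \<le> 1" for v
    using card_mono[of "{l}" "p ` {b \<in> N. v \<in> Inc b}"] assms by auto
  then have "card (p ` {b \<in> N. v \<in> Inc b}) - 1 = 0" for v by simp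
  then show ?thesis using assms by (simp add: block_count_def)
qed

lemma sum_fiber_card:
  assumes "finite A" "A \<subseteq> N" "finite N"
  shows "(\<Sum>l\<in>p ` N. int (card {b \<in> A. p b = l} - 1)) = int (card A) - int (card (p ` A))"
proof -
  have "(\<Sum>l\<in>p ` N. int (card {b \<in> A. p b = l} - 1)) = (\<Sum>l\<in>p ` A. int (card {b \<in> A. p b = l} - 1))"
  proof (rule sum.mono_neutral_right)
    show "\<forall>l\<in>p ` N - p ` A. int (card {b \<in> A. p b = l} - 1) = 0"
    proof
      fix l assume "l \<in> p ` N - p ` A"
      then have e: "{b \<in> A. p b = l} = {}" by (auto simp: image_iff)
      show "int (card {b \<in> A. p b = l} - 1) = 0" unfolding e by simp
    qed
  qed (use assms in auto)
  also have "\<dots> = (\<Sum>l\<in>p ` A. int (card {b \<in> A. p b = l}) - 1)"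
  proof (rule sum.cong)
    fix l assume "l \<in> p ` A"
    then have "{b \<in> A. p b = l} \<noteq> {}" by auto
    then have "card {b \<in> A. p b = l} \<ge> 1" using assms(1) by (simp add: Suc_le_eq card_gt_0_iff)
    then show "int (card {b \<in> A. p b = l} - 1) = int (card {b \<in> A. p b = l}) - 1" by simp
  qed simp
  also have "\<dots> = (\<Sum>l\<in>p ` A. int (card {b \<in> A. p b = l})) - int (card (p ` A))"
    by (simp add: sum_subtractf)
  also have "(\<Sum>l\<in>p ` A. int (card {b \<in> A. p b = l})) = int (card A)"
    using sum.image_gen[OF assms(1), of "\<lambda>_. 1::int" p] by simp
  finally show ?thesis .
qed

text \<open>At a vertex met by \<open>k\<close> blocks, \<open>k - 1\<close> is the number of
  classes minus one plus, over all classes, the number of its blocks there minus one. So passing to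
  the finest partition changes the count class by class.\<close>

lemma block_count_split:
  assumes "finite N"
  shows "block_count D R N Inc id =
    block_count D R N Inc p + (\<Sum>l\<in>p ` N. block_count D R {b \<in> N. p b = l} Inc id - int D)"
proof -
  define A where "A v = {b \<in> N. v \<in> Inc b}" for v
  define w where "w v = int D - of_bool (v \<in> R)" for v
  have fA: "finite (A v)" "A v \<subseteq> N" for v using assms by (auto simp: A_def)
  have Al: "{b \<in> {b \<in> N. p b = l}. v \<in> Inc b} = {b \<in> A v. p b = l}" for v l by (auto simp: A_def)
  have fib: "int (card (A v) - 1) = int (card (p ` A v) - 1) + (\<Sum>l\<in>p ` N. int (card {b \<in> A v. p b = l} - 1))" for v
  proof (cases "A v = {}")
    case False
    then have "card (A v) \<ge> 1" "card (p ` A v) \<ge> 1" using fA(1) by (simp_all add: Suc_le_eq card_gt_0_iff)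
    then show ?thesis using sum_fiber_card[OF fA(1)[of v] fA(2)[of v] assms, of p] by linarith
  qed simp
  have cN: "int (card N) = (\<Sum>l\<in>p ` N. int (card {b \<in> N. p b = l}))"
    using sum.image_gen[OF assms, of "\<lambda>_. 1::int" p] by simp
  have "(\<Sum>l\<in>p ` N. block_count D R {b \<in> N. p b = l} Inc id - int D) =
    int D * int (card N) - (\<Sum>l\<in>p ` N. \<Sum>v\<in>UNIV. w v * int (card {b \<in> A v. p b = l} - 1)) - int D * int (card (p ` N))"
    unfolding block_count_def Al by (simp add: sum_subtractf w_def sum_distrib_left cN)
  also have "(\<Sum>l\<in>p ` N. \<Sum>v\<in>UNIV. w v * int (card {b \<in> A v. p b = l} - 1)) =
     (\<Sum>v\<in>UNIV. w v * (\<Sum>l\<in>p ` N. int (card {b \<in> A v. p b = l} - 1)))"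
    by (subst sum.swap) (simp add: sum_distrib_left)
  also have "\<dots> = (\<Sum>v\<in>UNIV. w v * int (card (A v) - 1)) - (\<Sum>v\<in>UNIV. w v * int (card (p ` A v) - 1))"
  proof -
    have "(\<Sum>v\<in>UNIV. w v * int (card (A v) - 1)) = (\<Sum>v\<in>UNIV. w v * int (card (p ` A v) - 1) + w v * (\<Sum>l\<in>p ` N. int (card {b \<in> A v. p b = l} - 1)))"
      by (rule sum.cong[OF refl]) (simp only: fib distrib_left)
    then show ?thesis by (simp add: sum.distrib)
  qed
  finally show ?thesis
    unfolding block_count_def by (simp add: A_def w_def)
qed

text \<open>If \<open>p\<close> has several classes, each class is a proper subfamily and counts at
  least \<open>D\<close>, singletons exactly \<open>D\<close>. Splitting all classes into single
  blocks therefore cannot lower the count, and only the coarsest and the finest partition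
  matter.\<close>

lemma block_count_le_max:
  assumes N: "finite N" "N \<noteq> {}"
    and X: "\<And>X. X \<subset> N \<Longrightarrow> card X \<ge> 2 \<Longrightarrow> block_count D R X Inc id \<ge> int D"
  shows "block_count D R N Inc p \<le> max (int D) (block_count D R N Inc id)"
proof (cases "\<exists>l. p ` N = {l}")
  case True
  then obtain l where "p ` N = {l}" by blast
  then have "block_count D R N Inc p = int D" by (rule block_count_const)
  then show ?thesis by simp
next
  case False
  have "block_count D R {b \<in> N. p b = l} Inc id \<ge> int D" if l: "l \<in> p ` N" for l
  proof -
    have ne: "{b \<in> N. p b = l} \<noteq> {}" using l by auto
    have sub: "{b \<in> N. p b = l} \<subset> N"
    proof -
      have "{b \<in> N. p b = l} \<noteq> N"
      proof
        assume "{b \<in> N. p b = l} = N"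
        then have "p ` N = {l}" using l by auto
        then show False using False by blast
      qed
      then show ?thesis by auto
    qed
    show ?thesis
    proof (cases "card {b \<in> N. p b = l} \<ge> 2")
      case True
      then show ?thesis using X[OF sub] by blast
    next
      case False
      then have "card {b \<in> N. p b = l} = 1"
        using ne N(1) card_gt_0_iff[of "{b \<in> N. p b = l}"] by simp
      then obtain x where "{b \<in> N. p b = l} = {x}" by (auto simp: card_1_singleton_iff)
      then show ?thesis using block_count_const[of id "{b \<in> N. p b = l}" x D R Inc] by simp
    qed
  qed
  then have "(\<Sum>l\<in>p ` N. block_count D R {b \<in> N. p b = l} Inc id - int D) \<ge> 0"
    by (intro sum_nonneg) simp
  then show ?thesis using block_count_split[OF N(1), of D R Inc p] by linarith
qed

section \<open>Discharging on the incidence graph of blocks and rods\<close>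

lemma sum_card_incidences:
  fixes Inc :: "'b \<Rightarrow> 'v::finite set"
  assumes "finite N"
  shows "(\<Sum>b\<in>N. card (Inc b)) = (\<Sum>v\<in>UNIV. card {b \<in> N. v \<in> Inc b})"
proof -
  have "(\<Sum>b\<in>N. card (Inc b)) = (\<Sum>b\<in>N. \<Sum>v\<in>UNIV. of_bool (v \<in> Inc b))"
    by (simp add: sum_of_bool_eq)
  also have "\<dots> = (\<Sum>v\<in>UNIV. \<Sum>b\<in>N. of_bool (v \<in> Inc b))" by (rule sum.swap)
  also have "\<dots> = (\<Sum>v\<in>UNIV. card {b \<in> N. v \<in> Inc b})"
    using assms by (intro sum.cong) (simp_all add: sum_of_bool_eq Int_def)
  finally show ?thesis .
qed

text \<open>If two blocks that each carry only two rods never share a rod of degree two, then discharging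
  shows that the incidence graph has too many independent cycles for its count.\<close>

lemma exists_chain_rod:
  fixes Inc :: "'b \<Rightarrow> 'v::finite set"
  assumes N: "finite N" and D: "D \<ge> 6"
    and rods: "\<And>b v. b \<in> N \<Longrightarrow> v \<in> Inc b \<Longrightarrow> v \<in> R"
    and t2: "\<And>b v. b \<in> N \<Longrightarrow> v \<in> Inc b \<Longrightarrow> card {x \<in> N. v \<in> Inc x} \<ge> 2"
    and b2: "\<And>b. b \<in> N \<Longrightarrow> card (Inc b) \<ge> 2"
    and cnt: "block_count D R N Inc id \<ge> 2"
  obtains b b' u v w where "b \<in> N" "b' \<in> N" "b \<noteq> b'" "Inc b = {u, v}" "Inc b' = {v, w}" "u \<noteq> v" "w \<noteq> v"
    "{x \<in> N. v \<in> Inc x} = {b, b'}"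
proof (rule ccontr)
  assume no: "\<not> thesis"
  note found = that
  \<comment> \<open>\<open>t\<close> is the degree of a rod in the incidence graph; \<open>a\<close>
    and \<open>c\<close> count its blocks with exactly two and with at least three rods. The sums
    below compare small blocks with the excess of large blocks and of rods of high degree.\<close>
  define t where "t v = card {b \<in> N. v \<in> Inc b}" for v
  define V where "V = {v. t v > 0}"
  define N2 where "N2 = {b \<in> N. card (Inc b) = 2}"
  define a where "a v = card {b \<in> N2. v \<in> Inc b}" for v
  define c where "c v = card {b \<in> N - N2. v \<in> Inc b}" for v
  have fin: "finite N2" "finite (N - N2)" "N2 \<subseteq> N" using N by (auto simp: N2_def)
  have VI: "v \<in> V \<longleftrightarrow> (\<exists>b\<in>N. v \<in> Inc b)" for v
    using N by (auto simp: V_def t_def card_gt_0_iff)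
  have tV: "t v \<ge> 2" if "v \<in> V" for v using that t2 unfolding VI t_def by blast
  have tac: "t v = a v + c v" for v
  proof -
    have "{b \<in> N. v \<in> Inc b} = {b \<in> N2. v \<in> Inc b} \<union> {b \<in> N - N2. v \<in> Inc b}" using fin(3) by auto
    then show ?thesis unfolding t_def a_def c_def using fin by (simp add: card_Un_disjoint disjoint_iff)
  qed
  have outV: "v \<notin> V \<Longrightarrow> t v = 0 \<and> a v = 0 \<and> c v = 0" for v using tac[of v] by (simp add: V_def)
  define \<iota> where "\<iota> = (\<Sum>b\<in>N. int (card (Inc b)))"
  have \<iota>t: "\<iota> = (\<Sum>v\<in>V. int (t v))"
  proof -
    have "\<iota> = int (\<Sum>b\<in>N. card (Inc b))" by (simp add: \<iota>_def)
    also have "\<dots> = (\<Sum>v\<in>UNIV. int (t v))" unfolding sum_card_incidences[OF N] t_def by simp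
    also have "\<dots> = (\<Sum>v\<in>V. int (t v))" by (rule sum.mono_neutral_right) (auto dest: outV)
    finally show ?thesis .
  qed
  define r where "r = int (card V)"
  define n where "n = int (card N)"
  define n2 where "n2 = int (card N2)"
  have "block_count D R N Inc id = int D * n - (\<Sum>v\<in>V. (int D - 1) * (int (t v) - 1))"
  proof -
    have "(\<Sum>v\<in>UNIV. (int D - of_bool (v \<in> R)) * int (t v - 1)) = (\<Sum>v\<in>V. (int D - of_bool (v \<in> R)) * int (t v - 1))"
      by (rule sum.mono_neutral_right) (auto dest: outV)
    also have "\<dots> = (\<Sum>v\<in>V. (int D - 1) * (int (t v) - 1))"
    proof (rule sum.cong)
      fix v assume "v \<in> V"
      then show "(int D - of_bool (v \<in> R)) * int (t v - 1) = (int D - 1) * (int (t v) - 1)"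
        using rods tV[of v] unfolding VI by (auto simp: of_nat_diff)
    qed simp
    finally show ?thesis unfolding block_count_def by (simp add: t_def n_def)
  qed
  also have "(\<Sum>v\<in>V. (int D - 1) * (int (t v) - 1)) = (int D - 1) * (\<iota> - r)"
    by (simp add: \<iota>t r_def sum_subtractf flip: sum_distrib_left)
  finally have cnt': "int D * n - (int D - 1) * (\<iota> - r) \<ge> 2" using cnt by linarith
  have x0: "\<iota> - 2 * n = (\<Sum>b\<in>N. int (card (Inc b)) - 2)" by (simp add: \<iota>_def n_def sum_subtractf)
  have x: "\<iota> - 2 * n = (\<Sum>b\<in>N - N2. int (card (Inc b)) - 2)"
    unfolding x0 by (rule sum.mono_neutral_right) (use N in \<open>auto simp: N2_def\<close>)
  have x3: "int (card (Inc b)) - 2 \<ge> 1" if "b \<in> N - N2" for b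
    using b2[of b] that by (auto simp: N2_def)
  have nn2: "n - n2 \<le> \<iota> - 2 * n"
  proof -
    have "n - n2 = (\<Sum>b\<in>N - N2. 1)" using fin N by (simp add: n_def n2_def card_Diff_subset of_nat_diff card_mono)
    also have "\<dots> \<le> (\<Sum>b\<in>N - N2. int (card (Inc b)) - 2)" by (rule sum_mono) (rule x3)
    finally show ?thesis using x by simp
  qed
  have csum: "(\<Sum>v\<in>V. int (c v)) \<le> 3 * (\<iota> - 2 * n)"
  proof -
    have "(\<Sum>v\<in>V. int (c v)) = (\<Sum>v\<in>UNIV. int (c v))"
      by (rule sum.mono_neutral_left) (auto dest: outV)
    also have "\<dots> = (\<Sum>b\<in>N - N2. int (card (Inc b)))"
      using sum_card_incidences[OF fin(2), of Inc] unfolding c_def by (metis (no_types, lifting) of_nat_sum sum.cong)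
    \<comment> \<open>Uses \<open>k \<le> 3 * (k - 2)\<close> for \<open>k \<ge> 3\<close>.\<close>
    also have "\<dots> \<le> (\<Sum>b\<in>N - N2. 3 * (int (card (Inc b)) - 2))"
      by (rule sum_mono) (use x3 in force)
    finally show ?thesis using x by (simp add: sum_distrib_left)
  qed
  have asum: "2 * n2 = (\<Sum>v\<in>V. int (a v))"
  proof -
    have "(\<Sum>v\<in>V. int (a v)) = (\<Sum>v\<in>UNIV. int (a v))"
      by (rule sum.mono_neutral_left) (auto dest: outV)
    also have "\<dots> = (\<Sum>b\<in>N2. int (card (Inc b)))"
      using sum_card_incidences[OF fin(1), of Inc] unfolding a_def by (metis (no_types, lifting) of_nat_sum sum.cong)
    also have "\<dots> = (\<Sum>b\<in>N2. 2)" by (rule sum.cong) (auto simp: N2_def)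
    finally show ?thesis by (simp add: n2_def)
  qed
  \<comment> \<open>The discharging inequality. At degree two, two small blocks would form the
    excluded chain, so \<open>a v \<le> 1\<close> and the other block, if any is small, is large:
    \<open>a v \<le> c v\<close>. At degree at least three,
    \<open>3 * (t v - 2) \<ge> t v \<ge> a v\<close>.\<close>
  have apt: "int (a v) \<le> 3 * (int (t v) - 2) + int (c v)" if v: "v \<in> V" for v
  proof (cases "t v = 2")
    case True
    have "a v \<noteq> 2"
    proof
      assume "a v = 2"
      then have "c v = 0" using tac[of v] True by simp
      then have "{b \<in> N - N2. v \<in> Inc b} = {}" using fin(2) unfolding c_def by (subst (asm) card_0_eq) (auto intro: finite_subset[OF _ fin(2)])
      then have sub: "{b \<in> N. v \<in> Inc b} \<subseteq> N2" by auto
      have "card {b \<in> N. v \<in> Inc b} = 2" using True by (simp add: t_def)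
      then obtain b b' where bb: "{x \<in> N. v \<in> Inc x} = {b, b'}" "b \<noteq> b'" by (auto simp: card_2_iff)
      then have in2: "b \<in> N2" "b' \<in> N2" "v \<in> Inc b" "v \<in> Inc b'" using sub by auto
      have other: "\<exists>u. Inc x = {u, v} \<and> u \<noteq> v" if "x \<in> N2" "v \<in> Inc x" for x
      proof -
        have "card (Inc x) = 2" using that by (simp add: N2_def)
        then show ?thesis using that(2) by (auto simp: card_2_iff doubleton_eq_iff)
      qed
      obtain u where u: "Inc b = {u, v}" "u \<noteq> v" using other in2 by blast
      obtain w where w: "Inc b' = {w, v}" "w \<noteq> v" using other in2 by blast
      have "Inc b' = {v, w}" using w(1) by auto
      then show False using no found[OF _ _ bb(2) u(1) _ u(2) w(2) bb(1)] in2(1,2) fin(3) by blast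
    qed
    then have "a v \<le> 1" using tac[of v] True by linarith
    then have "a v \<le> c v" using tac[of v] True by linarith
    then show ?thesis by (simp add: True)
  next
    case False
    then have "t v \<ge> 3" using tV[OF v] by simp
    then have "int (t v) \<ge> 3" by simp
    moreover have "int (t v) = int (a v) + int (c v)" using tac[of v] by simp
    ultimately show ?thesis by simp
  qed
  have "2 * n2 \<le> (\<Sum>v\<in>V. 3 * (int (t v) - 2) + int (c v))" unfolding asum by (rule sum_mono) (rule apt)
  also have "\<dots> = 3 * (\<iota> - 2 * r) + (\<Sum>v\<in>V. int (c v))"
    by (simp add: sum.distrib sum_subtractf \<iota>t r_def flip: sum_distrib_left)
  finally have n2le: "2 * n2 \<le> 3 * (\<iota> - 2 * r) + 3 * (\<iota> - 2 * n)" using csum by linarith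
  have "(\<Sum>v\<in>V. 2) \<le> (\<Sum>v\<in>V. int (t v))" by (rule sum_mono) (use tV in force)
  then have r0: "2 * r \<le> \<iota>" by (simp add: \<iota>t r_def)
  have "0 \<le> (\<Sum>b\<in>N - N2. int (card (Inc b)) - 2)" by (rule sum_nonneg) (use x3 in force)
  then have y0: "\<iota> - r - n \<ge> 0" using r0 x by linarith
  have e1: "3 * n \<le> n2 + \<iota>" using nn2 by linarith
  have e2: "2 * n2 \<le> 6 * \<iota> - 6 * r - 6 * n" using n2le by (simp add: algebra_simps)
  \<comment> \<open>With \<open>y = \<iota> - r - n\<close>, edges minus vertices of the incidence
    graph, this reads \<open>n \<le> 5 * y\<close>. The count is \<open>n - (D - 1) * y\<close>, so
    \<open>D \<ge> 6\<close> makes it at most 0, against the assumed lower bound 2. This is the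
    origin of the constant 6.\<close>
  have ub: "2 * n \<le> 10 * \<iota> - 10 * r - 10 * n" using e1 e2 r0 by linarith
  have "5 * \<iota> - 5 * r - 5 * n \<le> (int D - 1) * (\<iota> - r - n)" using D y0 mult_right_mono[of 5 "int D - 1" "\<iota> - r - n"] by simp
  moreover have "int D * n - (int D - 1) * (\<iota> - r) = n - (int D - 1) * (\<iota> - r - n)" by (simp add: algebra_simps)
  ultimately show False using cnt' ub by linarith
qed

section \<open>Dimension formulas for linear maps\<close>

lemma dim_le_injective_map:
  fixes f :: "'a::euclidean_space \<Rightarrow> 'b::euclidean_space"
  assumes "subspace S" "linear f" "\<And>x. x \<in> S \<Longrightarrow> f x \<in> T" "\<And>x. x \<in> S \<Longrightarrow> f x = 0 \<Longrightarrow> x = 0"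
  shows "dim S \<le> dim T"
proof -
  have "inj_on f (span S)"
    unfolding span_eq_iff[THEN iffD2, OF assms(1)]
    using assms(4) linear_inj_on_iff_eq_0[OF assms(2,1)] by blast
  then have "dim (f ` S) = dim S" by (rule dim_image_eq[OF assms(2)])
  moreover have "dim (f ` S) \<le> dim T" using assms(3) by (intro dim_subset) auto
  ultimately show ?thesis by simp
qed

lemma dim_image_plus_kernel:
  fixes f :: "'a::euclidean_space \<Rightarrow> 'b::euclidean_space"
  assumes S: "subspace S" and f: "linear f"
  shows "dim S = dim (f ` S) + dim {x \<in> S. f x = 0}"
proof -
  define K where "K = {x \<in> S. f x = 0}"
  have K: "subspace K" "K \<subseteq> S" unfolding K_def
    using S f by (auto simp: subspace_def linear_0 linear_add linear_cmul)
  define P where "P = {y \<in> S. \<forall>x\<in>K. orthogonal x y}"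
  have P: "subspace P" unfolding P_def
    using S by (auto simp: subspace_def orthogonal_def inner_add_right)
  have "dim P + dim K = dim S" unfolding P_def by (rule dim_subspace_orthogonal_to_vectors[OF K(1) S K(2)])
  moreover have "f ` P = f ` S"
  proof (intro equalityI subsetI)
    fix z assume "z \<in> f ` S"
    then obtain x where x: "x \<in> S" "z = f x" by blast
    obtain k y where ky: "k \<in> span K" "\<And>w. w \<in> span K \<Longrightarrow> orthogonal y w" "x = k + y"
      using orthogonal_subspace_decomp_exists[of K x] by blast
    have kK: "k \<in> K" using ky(1) span_eq_iff[THEN iffD2, OF K(1)] by blast
    then have "y \<in> S" using ky(3) x(1) K(2) subspace_diff[OF S, of x k] by auto
    then have "y \<in> P" using ky(2) by (auto simp: P_def span_base orthogonal_commute)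
    moreover have "f y = z" using kK x(2) ky(3) by (simp add: K_def linear_add[OF f])
    ultimately show "z \<in> f ` P" by blast
  qed (auto simp: P_def)
  moreover have "dim (f ` P) = dim P"
  proof (rule dim_image_eq[OF f])
    have "x = 0" if "x \<in> P" "f x = 0" for x
      using that by (auto simp: P_def K_def orthogonal_def)
    then show "inj_on f (span P)"
      unfolding span_eq_iff[THEN iffD2, OF P] using linear_inj_on_iff_eq_0[OF f P] by blast
  qed
  ultimately show ?thesis unfolding K_def by simp
qed

lemma dim_span_singleton_le: "dim (span {x :: 'a::euclidean_space}) \<le> 1"
  by (simp add: dim_span)

lemma dim_span_pair_le: "dim (span {x, y :: 'a::euclidean_space}) \<le> 2"
proof -
  have "dim (span {x, y}) \<le> card {x, y}" by (rule dim_le_card) auto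
  also have "\<dots> \<le> 2" by (simp add: card_insert_if)
  finally show ?thesis .
qed

section \<open>Motions of blocks\<close>

text \<open>\<open>c $ b\<close> is the velocity of block \<open>b\<close>. Blocks agree at a common
  vertex outside \<open>R\<close> and may slide along a common rod. Velocities outside
  \<open>N\<close> are zero, so the dimension does not depend on the index type and subfamilies
  share one ambient space.\<close>

definition motions :: "'a::euclidean_space set \<Rightarrow> 'v set \<Rightarrow> 'b::finite set \<Rightarrow> ('b \<Rightarrow> 'v set) \<Rightarrow> ('v \<Rightarrow> 'a) \<Rightarrow> ('a^'b) set" where
  "motions L R N Inc \<rho> = {c. (\<forall>b. b \<notin> N \<longrightarrow> c $ b = 0) \<and> (\<forall>b\<in>N. c $ b \<in> L) \<and>
     (\<forall>b\<in>N. \<forall>b'\<in>N. \<forall>v\<in>Inc b \<inter> Inc b'. c $ b - c $ b' \<in> (if v \<in> R then span {\<rho> v} else {0}))}"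

lemma motionsI:
  assumes "\<And>b. b \<notin> N \<Longrightarrow> c $ b = 0" "\<And>b. b \<in> N \<Longrightarrow> c $ b \<in> L"
    "\<And>b b' v. b \<in> N \<Longrightarrow> b' \<in> N \<Longrightarrow> v \<in> Inc b \<Longrightarrow> v \<in> Inc b' \<Longrightarrow> c $ b - c $ b' \<in> (if v \<in> R then span {\<rho> v} else {0})"
  shows "c \<in> motions L R N Inc \<rho>"
  using assms unfolding motions_def by blast

lemma motionsD:
  assumes "c \<in> motions L R N Inc \<rho>"
  shows "b \<notin> N \<Longrightarrow> c $ b = 0" "b \<in> N \<Longrightarrow> c $ b \<in> L"
    "b \<in> N \<Longrightarrow> b' \<in> N \<Longrightarrow> v \<in> Inc b \<Longrightarrow> v \<in> Inc b' \<Longrightarrow> c $ b - c $ b' \<in> (if v \<in> R then span {\<rho> v} else {0})"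
  using assms unfolding motions_def by blast+

lemma motions_rod:
  assumes "c \<in> motions L R N Inc \<rho>" "b \<in> N" "b' \<in> N" "v \<in> Inc b" "v \<in> Inc b'" "v \<in> R"
  shows "c $ b - c $ b' \<in> span {\<rho> v}"
  using motionsD(3)[OF assms(1-5)] assms(6) by simp

lemma subspace_motions:
  assumes L: "subspace L"
  shows "subspace (motions L R N Inc \<rho>)"
proof -
  have S: "subspace (if v \<in> R then span {\<rho> v} else {0})" for v by simp
  show ?thesis
    unfolding subspace_def
  proof (intro conjI ballI allI)
    show "0 \<in> motions L R N Inc \<rho>"
      by (rule motionsI) (auto simp: subspace_0[OF L] span_zero)
  next
    fix x y assume x: "x \<in> motions L R N Inc \<rho>" and y: "y \<in> motions L R N Inc \<rho>"
    show "x + y \<in> motions L R N Inc \<rho>"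
    proof (rule motionsI)
      fix b b' v assume b: "b \<in> N" "b' \<in> N" "v \<in> Inc b" "v \<in> Inc b'"
      have "(x $ b - x $ b') + (y $ b - y $ b') \<in> (if v \<in> R then span {\<rho> v} else {0})"
        by (rule subspace_add[OF S motionsD(3)[OF x b] motionsD(3)[OF y b]])
      then show "(x + y) $ b - (x + y) $ b' \<in> (if v \<in> R then span {\<rho> v} else {0})"
        by (simp only: vector_add_component add_diff_add)
    qed (use motionsD(1,2)[OF x] motionsD(1,2)[OF y] subspace_add[OF L] in auto)
  next
    fix k x assume x: "x \<in> motions L R N Inc \<rho>"
    show "k *\<^sub>R x \<in> motions L R N Inc \<rho>"
    proof (rule motionsI)
      fix b b' v assume b: "b \<in> N" "b' \<in> N" "v \<in> Inc b" "v \<in> Inc b'"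
      have "k *\<^sub>R (x $ b - x $ b') \<in> (if v \<in> R then span {\<rho> v} else {0})"
        by (rule subspace_scale[OF S motionsD(3)[OF x b]])
      then show "(k *\<^sub>R x) $ b - (k *\<^sub>R x) $ b' \<in> (if v \<in> R then span {\<rho> v} else {0})"
        by (simp only: vector_scaleR_component scaleR_diff_right)
    qed (use motionsD(1,2)[OF x] subspace_scale[OF L] in auto)
  qed
qed

lemma motions_mono_inc:
  assumes "\<And>b. Inc' b \<subseteq> Inc b"
  shows "motions L R N Inc \<rho> \<subseteq> motions L R N Inc' \<rho>"
  unfolding motions_def using assms by blast

lemma motions_cong_rods:
  assumes "\<And>b v. b \<in> N \<Longrightarrow> v \<in> Inc b \<Longrightarrow> \<rho> v = \<rho>' v"
  shows "motions L R N Inc \<rho> = motions L R N Inc \<rho>'"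
proof -
  have "motions L R N Inc \<rho> \<subseteq> motions L R N Inc \<rho>'" if "\<And>b v. b \<in> N \<Longrightarrow> v \<in> Inc b \<Longrightarrow> \<rho> v = \<rho>' v" for \<rho> \<rho>'
  proof
    fix c assume c: "c \<in> motions L R N Inc \<rho>"
    show "c \<in> motions L R N Inc \<rho>'"
    proof (rule motionsI)
      fix b b' v assume b: "b \<in> N" "b' \<in> N" "v \<in> Inc b" "v \<in> Inc b'"
      show "c $ b - c $ b' \<in> (if v \<in> R then span {\<rho>' v} else {0})"
        using motionsD(3)[OF c b] unfolding that[OF b(1,3)] .
    qed (use motionsD(1,2)[OF c] in auto)
  qed
  then show ?thesis using assms by (metis subset_antisym)
qed

lemma motions_drop_single_incidence:
  assumes "\<And>b'. b' \<in> N \<Longrightarrow> v \<in> Inc b' \<Longrightarrow> b' = b"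
  shows "motions L R N (Inc(b := Inc b - {v})) \<rho> = motions L R N Inc \<rho>"
proof (intro equalityI subsetI)
  fix c assume c: "c \<in> motions L R N (Inc(b := Inc b - {v})) \<rho>"
  show "c \<in> motions L R N Inc \<rho>"
  proof (rule motionsI)
    fix x y w assume b: "x \<in> N" "y \<in> N" "w \<in> Inc x" "w \<in> Inc y"
    show "c $ x - c $ y \<in> (if w \<in> R then span {\<rho> w} else {0})"
    proof (cases "x = y")
      case True
      then show ?thesis by (simp add: span_zero)
    next
      case False
      then have "w \<noteq> v" using assms b by blast
      then have w: "w \<in> (Inc(b := Inc b - {v})) x" "w \<in> (Inc(b := Inc b - {v})) y" using b by auto
      show ?thesis by (rule motionsD(3)[OF c b(1,2) w])
    qed
  qed (use motionsD(1,2)[OF c] in auto)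
next
  fix c assume "c \<in> motions L R N Inc \<rho>"
  then show "c \<in> motions L R N (Inc(b := Inc b - {v})) \<rho>"
    by (rule subsetD[OF motions_mono_inc, rotated]) auto
qed

definition restrict_blocks :: "'b::finite set \<Rightarrow> ('a::real_vector)^'b \<Rightarrow> 'a^'b" where
  "restrict_blocks X c = (\<chi> b. if b \<in> X then c $ b else 0)"

lemma restrict_blocks_nth [simp]: "restrict_blocks X c $ b = (if b \<in> X then c $ b else 0)"
  by (simp add: restrict_blocks_def)

lemma linear_restrict_blocks: "linear (restrict_blocks X)"
  by (rule linearI) (auto simp: vec_eq_iff)

lemma restrict_blocks_motions:
  assumes "c \<in> motions L R N Inc \<rho>" "X \<subseteq> N"
  shows "restrict_blocks X c \<in> motions L R X Inc \<rho>"
proof (rule motionsI)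
  fix b b' v assume b: "b \<in> X" "b' \<in> X" "v \<in> Inc b" "v \<in> Inc b'"
  then have "c $ b - c $ b' \<in> (if v \<in> R then span {\<rho> v} else {0})"
    using assms(2) by (intro motionsD(3)[OF assms(1)]) auto
  then show "restrict_blocks X c $ b - restrict_blocks X c $ b' \<in> (if v \<in> R then span {\<rho> v} else {0})"
    using b(1,2) by simp
qed (use motionsD(2)[OF assms(1)] assms(2) in auto)

text \<open>The constant motions form a copy of \<open>L\<close>; under the dimension bound there is
  no room for others.\<close>

lemma motions_rigid_constant:
  assumes L: "subspace L" and X: "X \<noteq> {}" and rigid: "dim (motions L R X Inc \<rho>) \<le> dim L"
    and c: "c \<in> motions L R X Inc \<rho>" and b: "b \<in> X" "b' \<in> X"
  shows "c $ b = c $ b'"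
proof -
  define f :: "'a \<Rightarrow> 'a^'b" where "f a = (\<chi> b. if b \<in> X then a else 0)" for a
  have lf: "linear f" by (rule linearI) (auto simp: f_def vec_eq_iff)
  have fm: "f a \<in> motions L R X Inc \<rho>" if "a \<in> L" for a
    by (rule motionsI) (use that in \<open>auto simp: f_def span_zero\<close>)
  have "a = 0" if "f a = 0" for a
  proof -
    have "f a $ b = 0" by (simp add: that)
    then show ?thesis using b(1) by (simp add: f_def)
  qed
  then have "dim L \<le> dim (f ` L)"
    by (intro dim_le_injective_map[OF L lf]) auto
  moreover have "subspace (f ` L)" by (rule linear_subspace_image[OF lf L])
  ultimately have "f ` L = motions L R X Inc \<rho>"
    using fm rigid by (intro subspace_dim_equal subspace_motions L) auto
  then obtain a where "c = f a" using c by blast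
  then show ?thesis using b by (simp add: f_def)
qed

definition merge :: "'b set \<Rightarrow> 'b \<Rightarrow> 'b \<Rightarrow> 'b" where
  "merge X x b = (if b \<in> X then x else b)"

text \<open>A rigid subfamily moves as one body, so a motion is determined by its values on
  representatives. The representative inherits the incidences of the whole subfamily, and the
  conditions at them persist since the velocities are equal.\<close>

lemma dim_motions_merge:
  assumes L: "subspace L" and X: "X \<subseteq> N" "x \<in> X" and rigid: "dim (motions L R X Inc \<rho>) \<le> dim L"
  shows "dim (motions L R N Inc \<rho>) \<le> dim (motions L R (merge X x ` N) (\<lambda>l. \<Union> (Inc ` {b \<in> N. merge X x b = l})) \<rho>)"
proof (rule dim_le_injective_map[OF subspace_motions[OF L] linear_restrict_blocks[of "merge X x ` N"]])
  fix c assume c: "c \<in> motions L R N Inc \<rho>"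
  have const: "c $ b = c $ x" if "b \<in> X" for b
    using motions_rigid_constant[OF L _ rigid restrict_blocks_motions[OF c X(1)], of b x] that X by auto
  have m: "c $ merge X x b = c $ b" for b using const[of b] by (simp add: merge_def)
  have sub: "merge X x ` N \<subseteq> N" using X by (auto simp: merge_def)
  show "restrict_blocks (merge X x ` N) c \<in> motions L R (merge X x ` N) (\<lambda>l. \<Union> (Inc ` {b \<in> N. merge X x b = l})) \<rho>"
  proof (rule motionsI)
    fix l l' v assume l: "l \<in> merge X x ` N" "l' \<in> merge X x ` N"
      "v \<in> \<Union> (Inc ` {b \<in> N. merge X x b = l})" "v \<in> \<Union> (Inc ` {b \<in> N. merge X x b = l'})"
    then obtain b b' where b: "b \<in> N" "merge X x b = l" "v \<in> Inc b" "b' \<in> N" "merge X x b' = l'" "v \<in> Inc b'" by blast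
    have "c $ b - c $ b' \<in> (if v \<in> R then span {\<rho> v} else {0})"
      by (rule motionsD(3)[OF c b(1,4,3,6)])
    moreover have "c $ l = c $ b" "c $ l' = c $ b'" using m b by auto
    ultimately show "restrict_blocks (merge X x ` N) c $ l - restrict_blocks (merge X x ` N) c $ l' \<in> (if v \<in> R then span {\<rho> v} else {0})"
      using l(1,2) by simp
  qed (use motionsD(2)[OF c] sub in auto)
  show "c = 0" if z: "restrict_blocks (merge X x ` N) c = 0"
  proof (rule vec_eq_iff[THEN iffD2], rule allI)
    fix b
    show "c $ b = 0 $ b"
    proof (cases "b \<in> N")
      case True
      have "restrict_blocks (merge X x ` N) c $ merge X x b = 0" by (simp add: z)
      then show ?thesis using True m[of b] by simp
    qed (use motionsD(1)[OF c] in auto)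
  qed
qed

text \<open>Rank and nullity of the map that forgets block \<open>b\<close>: the kernel consists of
  motions in which only \<open>b\<close> moves, and \<open>K\<close> bounds its velocities.\<close>

lemma dim_motions_remove_block:
  assumes L: "subspace L" and b: "b \<in> N" and ker: "\<And>c. c \<in> motions L R N Inc \<rho> \<Longrightarrow> (\<And>x. x \<noteq> b \<Longrightarrow> c $ x = 0) \<Longrightarrow> c $ b \<in> K"
  shows "dim (motions L R N Inc \<rho>) \<le> dim (motions L R (N - {b}) Inc \<rho>) + dim K"
proof -
  let ?M = "motions L R N Inc \<rho>" and ?f = "restrict_blocks (N - {b})"
  have "dim ?M = dim (?f ` ?M) + dim {c \<in> ?M. ?f c = 0}"
    by (rule dim_image_plus_kernel[OF subspace_motions[OF L] linear_restrict_blocks])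
  moreover have "dim (?f ` ?M) \<le> dim (motions L R (N - {b}) Inc \<rho>)"
    using restrict_blocks_motions[of _ L R N Inc \<rho> "N - {b}"] by (intro dim_subset) auto
  moreover have "dim {c \<in> ?M. ?f c = 0} \<le> dim K"
  proof (rule dim_le_injective_map)
    show "subspace {c \<in> ?M. ?f c = 0}"
      using subspace_motions[OF L, of R N Inc \<rho>] linear_restrict_blocks[of "N - {b}"]
      by (auto simp: subspace_def linear_0[OF linear_restrict_blocks] linear_add[OF linear_restrict_blocks] linear_cmul[OF linear_restrict_blocks])
    show "linear (\<lambda>c::'a^'b. c $ b)" by (rule linearI) auto
    fix c assume c: "c \<in> {c \<in> ?M. ?f c = 0}"
    have z: "c $ x = 0" if "x \<noteq> b" for x
    proof (cases "x \<in> N")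
      case True
      have "?f c $ x = 0" using c by simp
      then show ?thesis using True that by simp
    qed (use c motionsD(1)[of c L R N Inc \<rho> x] in auto)
    then show "c $ b \<in> K" using ker c by blast
    show "c = 0" if "c $ b = 0"
      using z that by (metis vec_eq_iff zero_index)
  qed
  ultimately show ?thesis by linarith
qed

text \<open>Around the cycle through \<open>b0\<close> and \<open>b1\<close>, the sliding of
  \<open>b\<close> against \<open>b'\<close> along \<open>v\<close> must be compensated by the rest
  of the structure and the rods \<open>u\<close>, \<open>w\<close>. If the rod \<open>v\<close> lies
  outside the space of possible compensations, \<open>b\<close> and \<open>b'\<close> move together
  and act as one block on the rods \<open>u\<close> and \<open>w\<close>.\<close>

lemma dim_motions_chain_contract:
  fixes \<rho> :: "'v \<Rightarrow> 'a::euclidean_space"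
  assumes L: "subspace L" and b: "b \<in> N" "b' \<in> N" "b \<noteq> b'" "Inc b = {u, v}" "Inc b' = {v, w}"
    and R: "u \<in> R" "v \<in> R" "w \<in> R"
    and b0: "b0 \<in> N - {b, b'}" "u \<in> Inc b0" and b1: "b1 \<in> N - {b, b'}" "w \<in> Inc b1"
    and \<rho>v: "\<rho> v \<notin> {x + y | x y. x \<in> (\<lambda>c. c $ b0 - c $ b1) ` motions L R (N - {b, b'}) Inc \<rho> \<and> y \<in> span {\<rho> u, \<rho> w}}"
      (is "_ \<notin> ?U")
  shows "dim (motions L R N Inc \<rho>) \<le> dim (motions L R (N - {b'}) (Inc(b := {u, w})) \<rho>)"
proof (rule dim_le_injective_map[OF subspace_motions[OF L] linear_restrict_blocks[of "N - {b'}"]])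
  fix c assume c: "c \<in> motions L R N Inc \<rho>"
  have lin: "linear (\<lambda>c::'a^'b. c $ b0 - c $ b1)" by (rule linearI) (auto simp: algebra_simps)
  have U: "subspace ?U"
    by (intro subspace_sums linear_subspace_image[OF lin] subspace_motions L subspace_span)
  have d0: "c $ b0 - c $ b \<in> span {\<rho> u}" by (rule motions_rod[OF c]) (use b b0 R in auto)
  have d1: "c $ b' - c $ b1 \<in> span {\<rho> w}" by (rule motions_rod[OF c]) (use b b1 R in auto)
  have "c $ b - c $ b' \<in> span {\<rho> v}" by (rule motions_rod[OF c]) (use b R in auto)
  then obtain t where t: "c $ b - c $ b' = t *\<^sub>R \<rho> v" by (auto simp: span_singleton)
  have "restrict_blocks (N - {b, b'}) c $ b0 - restrict_blocks (N - {b, b'}) c $ b1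
      \<in> (\<lambda>c. c $ b0 - c $ b1) ` motions L R (N - {b, b'}) Inc \<rho>"
    by (rule imageI restrict_blocks_motions[OF c])+ auto
  then have "c $ b0 - c $ b1 \<in> (\<lambda>c. c $ b0 - c $ b1) ` motions L R (N - {b, b'}) Inc \<rho>"
    using b0 b1 by simp
  moreover have "- (c $ b0 - c $ b) - (c $ b' - c $ b1) \<in> span {\<rho> u, \<rho> w}"
  proof (rule span_diff[OF span_neg])
    show "c $ b0 - c $ b \<in> span {\<rho> u, \<rho> w}"
      using d0 span_mono[of "{\<rho> u}" "{\<rho> u, \<rho> w}"] by auto
    show "c $ b' - c $ b1 \<in> span {\<rho> u, \<rho> w}"
      using d1 span_mono[of "{\<rho> w}" "{\<rho> u, \<rho> w}"] by auto
  qed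
  \<comment> \<open>The velocity difference of \<open>b\<close> and \<open>b'\<close> telescoped
    along the path from \<open>b\<close> over \<open>b0\<close> and \<open>b1\<close> to
    \<open>b'\<close>.\<close>
  moreover have "t *\<^sub>R \<rho> v = (c $ b0 - c $ b1) + (- (c $ b0 - c $ b) - (c $ b' - c $ b1))"
    by (simp flip: t)
  ultimately have tU: "t *\<^sub>R \<rho> v \<in> ?U" by blast
  have "t = 0"
  proof (rule ccontr)
    assume "t \<noteq> 0"
    then have "\<rho> v = (1 / t) *\<^sub>R (t *\<^sub>R \<rho> v)" by simp
    then show False using subspace_scale[OF U tU, of "1 / t"] \<rho>v by simp
  qed
  then have eq: "c $ b = c $ b'" using t by simp
  let ?I = "Inc(b := {u, w})"
  have one: "c $ b - c $ y \<in> span {\<rho> z}" "z \<in> R" if "y \<in> N - {b'}" "y \<noteq> b" "z \<in> {u, w}" "z \<in> Inc y" for y z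
  proof -
    show "c $ b - c $ y \<in> span {\<rho> z}"
    proof (cases "z = u")
      case True
      then show ?thesis by (intro motions_rod[OF c]) (use that b R in auto)
    next
      case False
      then have "z = w" using that(3) by simp
      then show ?thesis unfolding eq by (intro motions_rod[OF c]) (use that b R in auto)
    qed
    show "z \<in> R" using that R by auto
  qed
  show "restrict_blocks (N - {b'}) c \<in> motions L R (N - {b'}) ?I \<rho>"
  proof (rule motionsI)
    fix x y z assume xy: "x \<in> N - {b'}" "y \<in> N - {b'}" "z \<in> ?I x" "z \<in> ?I y"
    have "c $ x - c $ y \<in> (if z \<in> R then span {\<rho> z} else {0})"
    proof (cases "x = y")
      case True
      then show ?thesis by (simp add: span_zero)
    next
      case ne: False
      consider "x = b" | "y = b" | "x \<noteq> b" "y \<noteq> b" by blast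
      then show ?thesis
      proof cases
        case 1
        then show ?thesis using one[of y z] xy ne by simp
      next
        case 2
        then have "z \<in> R" "c $ b - c $ x \<in> span {\<rho> z}" using one[of x z] xy ne by simp_all
        then show ?thesis using 2 span_neg[of "c $ b - c $ x" "{\<rho> z}"] by simp
      next
        case 3
        then show ?thesis by (intro motionsD(3)[OF c]) (use xy in auto)
      qed
    qed
    then show "restrict_blocks (N - {b'}) c $ x - restrict_blocks (N - {b'}) c $ y \<in> (if z \<in> R then span {\<rho> z} else {0})"
      using xy by simp
  qed (use motionsD(2)[OF c] in auto)
  show "c = 0" if z: "restrict_blocks (N - {b'}) c = 0"
  proof (rule vec_eq_iff[THEN iffD2], rule allI)
    fix x
    have *: "c $ y = 0" if "y \<in> N - {b'}" for y
    proof -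
      have "restrict_blocks (N - {b'}) c $ y = 0" by (simp add: z)
      then show ?thesis using that by simp
    qed
    then have "c $ b = 0" using b by simp
    then show "c $ x = 0 $ x" using * eq motionsD(1)[OF c, of x] by (cases "x = b'"; cases "x \<in> N") auto
  qed
qed

text \<open>The opposite extreme to a contraction: the rest of the structure, together with the rods
  \<open>u\<close> and \<open>w\<close>, realises every relative velocity of \<open>b0\<close> and
  \<open>b1\<close>. The chain lets through only those in the span of its three rods, so it costs at
  least \<open>dim L - 3\<close> dimensions, and a motion of the rest extends over the chain in at
  most one way.\<close>

lemma dim_motions_chain_codim:
  fixes \<rho> :: "'v \<Rightarrow> 'a::euclidean_space"
  assumes L: "subspace L" and b: "b \<in> N" "b' \<in> N" "b \<noteq> b'" "Inc b = {u, v}" "Inc b' = {v, w}"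
    and R: "u \<in> R" "v \<in> R" "w \<in> R"
    and b0: "b0 \<in> N - {b, b'}" "u \<in> Inc b0" and b1: "b1 \<in> N - {b, b'}" "w \<in> Inc b1"
    and full: "L \<subseteq> {x + y | x y. x \<in> (\<lambda>c. c $ b0 - c $ b1) ` motions L R (N - {b, b'}) Inc \<rho> \<and> y \<in> span {\<rho> u, \<rho> w}}"
    and \<rho>v: "\<rho> v \<notin> span {\<rho> u, \<rho> w}" and \<rho>uw: "span {\<rho> u} \<inter> span {\<rho> w} = {0}"
  shows "dim (motions L R N Inc \<rho>) + dim L \<le> dim (motions L R (N - {b, b'}) Inc \<rho>) + 3"
proof -
  define M where "M = motions L R (N - {b, b'}) Inc \<rho>"
  define \<delta> where "\<delta> c = c $ b0 - c $ b1" for c :: "'a^'b"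
  have lin: "linear \<delta>" unfolding \<delta>_def by (rule linearI) (auto simp: algebra_simps)
  define Z where "Z = span {\<rho> u, \<rho> v, \<rho> w}"
  have M: "subspace M" unfolding M_def by (rule subspace_motions[OF L])
  have Z: "subspace Z" "dim Z \<le> 3"
  proof -
    have "dim Z \<le> card {\<rho> u, \<rho> v, \<rho> w}" unfolding Z_def by (rule dim_le_card) auto
    also have "\<dots> \<le> 3" by (simp add: card_insert_if)
    finally show "dim Z \<le> 3" .
  qed (simp add: Z_def)
  \<comment> \<open>The motions of the remaining blocks that pass the necessary condition for
    extending over the chain.\<close>
  define S where "S = {c \<in> M. \<delta> c \<in> Z}"
  have S: "subspace S" unfolding S_def
    using M Z(1) by (auto simp: subspace_def linear_0[OF lin] linear_add[OF lin] linear_cmul[OF lin])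
  have in_uw: "x \<in> span {\<rho> u} \<Longrightarrow> x \<in> span {\<rho> u, \<rho> w}" "x \<in> span {\<rho> w} \<Longrightarrow> x \<in> span {\<rho> u, \<rho> w}" for x
    using span_mono[of "{\<rho> u}" "{\<rho> u, \<rho> w}"] span_mono[of "{\<rho> w}" "{\<rho> u, \<rho> w}"] by auto
  have in_Z: "x \<in> span {\<rho> u} \<Longrightarrow> x \<in> Z" "x \<in> span {\<rho> v} \<Longrightarrow> x \<in> Z" "x \<in> span {\<rho> w} \<Longrightarrow> x \<in> Z" for x
    unfolding Z_def using span_mono[of "{\<rho> u}" "{\<rho> u, \<rho> v, \<rho> w}"] span_mono[of "{\<rho> v}" "{\<rho> u, \<rho> v, \<rho> w}"]
      span_mono[of "{\<rho> w}" "{\<rho> u, \<rho> v, \<rho> w}"] by auto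
  have "dim (motions L R N Inc \<rho>) \<le> dim S"
  proof (rule dim_le_injective_map[OF subspace_motions[OF L] linear_restrict_blocks[of "N - {b, b'}"]])
    fix c assume c: "c \<in> motions L R N Inc \<rho>"
    have d0: "c $ b0 - c $ b \<in> span {\<rho> u}" by (rule motions_rod[OF c]) (use b b0 R in auto)
    have d1: "c $ b' - c $ b1 \<in> span {\<rho> w}" by (rule motions_rod[OF c]) (use b b1 R in auto)
    have d2: "c $ b - c $ b' \<in> span {\<rho> v}" by (rule motions_rod[OF c]) (use b R in auto)
    have "c $ b0 - c $ b1 = (c $ b0 - c $ b) + (c $ b - c $ b') + (c $ b' - c $ b1)" by simp
    also have "\<dots> \<in> Z" by (intro subspace_add[OF Z(1)] in_Z(1)[OF d0] in_Z(2)[OF d2] in_Z(3)[OF d1])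
    finally have "\<delta> (restrict_blocks (N - {b, b'}) c) \<in> Z" using b0 b1 by (simp add: \<delta>_def)
    then show "restrict_blocks (N - {b, b'}) c \<in> S"
      using restrict_blocks_motions[OF c, of "N - {b, b'}"] by (auto simp: S_def M_def)
    show "c = 0" if z: "restrict_blocks (N - {b, b'}) c = 0"
    proof (rule vec_eq_iff[THEN iffD2], rule allI)
      fix x
      have *: "c $ y = 0" if "y \<in> N - {b, b'}" for y
      proof -
        have "restrict_blocks (N - {b, b'}) c $ y = 0" by (simp add: z)
        then show ?thesis using that by simp
      qed
      have cb: "c $ b \<in> span {\<rho> u}" "c $ b' \<in> span {\<rho> w}"
        using d0 d1 *[OF b0(1)] *[OF b1(1)] span_neg[of "- (c $ b)" "{\<rho> u}"] by auto
      obtain t where t: "c $ b - c $ b' = t *\<^sub>R \<rho> v" using d2 by (auto simp: span_singleton)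
      \<comment> \<open>If the rest stands still, \<open>c $ b\<close> and \<open>c $ b'\<close> are
        multiples of the outer rods. As \<open>\<rho> v\<close> is outside their span, the two
        velocities agree, and the common value lies in both lines.\<close>
      have t0: "t = 0"
      proof (rule ccontr)
        assume "t \<noteq> 0"
        then have "\<rho> v = (1 / t) *\<^sub>R (c $ b - c $ b')" using t by simp
        also have "\<dots> \<in> span {\<rho> u, \<rho> w}" by (intro span_scale span_diff in_uw(1)[OF cb(1)] in_uw(2)[OF cb(2)])
        finally show False using \<rho>v by simp
      qed
      then have "c $ b = c $ b'" using t by simp
      then have "c $ b = 0" "c $ b' = 0" using cb \<rho>uw by auto
      then show "c $ x = 0 $ x" using * motionsD(1)[OF c, of x] by (cases "x \<in> N - {b, b'}") auto
    qed
  qed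
  moreover have "dim M = dim (\<delta> ` M) + dim {c \<in> M. \<delta> c = 0}" by (rule dim_image_plus_kernel[OF M lin])
  moreover have "dim S = dim (\<delta> ` S) + dim {c \<in> S. \<delta> c = 0}" by (rule dim_image_plus_kernel[OF S lin])
  moreover have "dim {c \<in> S. \<delta> c = 0} = dim {c \<in> M. \<delta> c = 0}"
    using subspace_0[OF Z(1)] by (intro arg_cong[of _ _ dim]) (auto simp: S_def)
  moreover have "dim (\<delta> ` S) = dim (\<delta> ` M \<inter> Z)" by (rule arg_cong[of _ _ dim]) (auto simp: S_def)
  moreover have "dim {x + y |x y. x \<in> \<delta> ` M \<and> y \<in> Z} + dim (\<delta> ` M \<inter> Z) = dim (\<delta> ` M) + dim Z"
    by (rule dim_sums_Int[OF linear_subspace_image[OF lin M] Z(1)])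
  moreover have "dim L \<le> dim {x + y |x y. x \<in> \<delta> ` M \<and> y \<in> Z}"
  proof (rule dim_subset, rule subsetI)
    fix a assume "a \<in> L"
    then obtain x y where xy: "a = x + y" "x \<in> \<delta> ` M" "y \<in> span {\<rho> u, \<rho> w}"
      using full unfolding M_def \<delta>_def by blast
    then have "y \<in> Z" unfolding Z_def using span_mono[of "{\<rho> u, \<rho> w}" "{\<rho> u, \<rho> v, \<rho> w}"] by auto
    then show "a \<in> {x + y |x y. x \<in> \<delta> ` M \<and> y \<in> Z}" using xy by blast
  qed
  ultimately show ?thesis using Z(2) unfolding M_def[symmetric] by linarith
qed

section \<open>Semicontinuity of the dimension of motions\<close>

lemma polynomial_function_vec:
  fixes f :: "'p::real_normed_vector \<Rightarrow> ('c::euclidean_space)^'m"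
  assumes "\<And>i. polynomial_function (\<lambda>s. f s $ i)"
  shows "polynomial_function f"
  unfolding polynomial_function_iff_Basis_inner
proof
  fix b :: "'c^'m" assume "b \<in> Basis"
  then obtain i u where u: "u \<in> Basis" "b = axis i u" by (auto simp: Basis_vec_def)
  then show "real_polynomial_function (\<lambda>s. f s \<bullet> b)"
    using assms[of i] unfolding polynomial_function_iff_Basis_inner by (simp add: inner_axis)
qed

lemma real_polynomial_function_nth:
  assumes "polynomial_function (f :: _ \<Rightarrow> real^'m)"
  shows "real_polynomial_function (\<lambda>s. f s $ i)"
  using assms bounded_linear_vec_nth[of i] unfolding polynomial_function_def o_def by blast

text \<open>A complement of the motion space at \<open>s0\<close> is mapped injectively by the
  defining equations. Injectivity on this fixed space is a generic condition, and where it holds the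
  motion space cannot be larger than at \<open>s0\<close>.\<close>

lemma motions_dim_generic:
  fixes \<rho> :: "'p::euclidean_space \<Rightarrow> 'v::finite \<Rightarrow> real^'k"
  assumes L: "subspace L" and poly: "\<And>v. v \<in> R \<Longrightarrow> polynomial_function (\<lambda>s. \<rho> s v)"
    and nz: "\<And>v. v \<in> R \<Longrightarrow> \<rho> s0 v \<noteq> 0" and K: "dim (motions L R (N :: 'b::finite set) Inc (\<rho> s0)) \<le> K"
  shows "generically (\<lambda>s. dim (motions L R N Inc (\<rho> s)) \<le> K)"
proof -
  \<comment> \<open>Proportionality to a rod is written as the vanishing of 2 by 2 minors, which
    makes the conditions linear in \<open>c\<close> and polynomial in the parameter.\<close>
  define eqs :: "('v \<Rightarrow> real^'k) \<Rightarrow> (real^'k)^'b \<Rightarrow> real^('b \<times> 'b \<times> 'v \<times> 'k \<times> 'k)" where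
    "eqs r c = (\<chi> x. case x of (b, b', v, i, j) \<Rightarrow> if b \<in> N \<and> b' \<in> N \<and> v \<in> Inc b \<and> v \<in> Inc b' then
       (if v \<in> R then (c $ b - c $ b') $ i * r v $ j - (c $ b - c $ b') $ j * r v $ i else (c $ b - c $ b') $ i) else 0)" for r c
  have lin: "linear (eqs r)" for r
    by (rule linearI) (auto simp: eqs_def vec_eq_iff algebra_simps)
  have poly_eqs: "polynomial_function (\<lambda>s. eqs (\<rho> s) c)" for c
  proof (rule polynomial_function_vec, unfold real_polynomial_function_eq[symmetric])
    fix x :: "'b \<times> 'b \<times> 'v \<times> 'k \<times> 'k"
    obtain b b' v i j where x: "x = (b, b', v, i, j)" by (cases x) auto
    let ?g = "\<lambda>s. (c $ b - c $ b') $ i * \<rho> s v $ j - (c $ b - c $ b') $ j * \<rho> s v $ i"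
    have g: "real_polynomial_function ?g" if "v \<in> R"
      by (intro real_polynomial_function_diff real_polynomial_function.intros(4) real_polynomial_function.intros(2)
          real_polynomial_function_nth poly that)
    show "real_polynomial_function (\<lambda>s. eqs (\<rho> s) c $ x)"
    proof (cases "b \<in> N \<and> b' \<in> N \<and> v \<in> Inc b \<and> v \<in> Inc b' \<and> v \<in> R")
      case True
      then have "(\<lambda>s. eqs (\<rho> s) c $ x) = ?g" by (simp add: eqs_def x)
      then show ?thesis using g True by (simp only:)
    next
      case False
      then have "eqs (\<rho> s) c $ x = eqs (\<rho> s0) c $ x" for s by (auto simp: eqs_def x)
      then have "(\<lambda>s. eqs (\<rho> s) c $ x) = (\<lambda>s. eqs (\<rho> s0) c $ x)" by blast
      then show ?thesis by (simp only: real_polynomial_function.intros(2))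
    qed
  qed
  define T where "T = {c :: (real^'k)^'b. (\<forall>b. b \<notin> N \<longrightarrow> c $ b = 0) \<and> (\<forall>b\<in>N. c $ b \<in> L)}"
  have T: "subspace T" using L by (auto simp: T_def subspace_def)
  have MT: "motions L R N Inc r \<subseteq> T" for r unfolding motions_def T_def by blast
  have M0: "eqs r c = 0" if c: "c \<in> motions L R N Inc r" for r c
  proof (rule vec_eq_iff[THEN iffD2], rule allI)
    fix x :: "'b \<times> 'b \<times> 'v \<times> 'k \<times> 'k"
    obtain b b' v i j where x: "x = (b, b', v, i, j)" by (cases x) auto
    show "eqs r c $ x = 0 $ x"
    proof (cases "b \<in> N \<and> b' \<in> N \<and> v \<in> Inc b \<and> v \<in> Inc b'")
      case True
      then have d: "c $ b - c $ b' \<in> (if v \<in> R then span {r v} else {0})" using motionsD(3)[OF c] by blast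
      show ?thesis
      proof (cases "v \<in> R")
        case True
        then obtain k where "c $ b - c $ b' = k *\<^sub>R r v" using d by (auto simp: span_singleton)
        then show ?thesis using True by (simp add: eqs_def x)
      next
        case False
        then have "c $ b - c $ b' = 0" using d by simp
        then show ?thesis using False by (simp add: eqs_def x)
      qed
    qed (auto simp: eqs_def x)
  qed
  \<comment> \<open>Vanishing minors give proportionality only for a nonzero rod. This direction is
    applied at \<open>s0\<close> alone; at other parameters the inclusion \<open>M0\<close>, valid
    for all rods, does the work.\<close>
  have M1: "c \<in> motions L R N Inc r" if c: "c \<in> T" "eqs r c = 0" and r: "\<And>v. v \<in> R \<Longrightarrow> r v \<noteq> 0" for r c
  proof (rule motionsI)
    fix b b' v assume b: "b \<in> N" "b' \<in> N" "v \<in> Inc b" "v \<in> Inc b'"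
    have e: "eqs r c $ (b, b', v, i, j) = 0" for i j by (simp add: c(2))
    show "c $ b - c $ b' \<in> (if v \<in> R then span {r v} else {0})"
    proof (cases "v \<in> R")
      case True
      then obtain j where j: "r v $ j \<noteq> 0" using r by (metis vec_eq_iff zero_index)
      have "(c $ b - c $ b') $ i * r v $ j = (c $ b - c $ b') $ j * r v $ i" for i
        using e[of i j] True b by (simp add: eqs_def)
      then have "c $ b - c $ b' = ((c $ b - c $ b') $ j / r v $ j) *\<^sub>R r v"
        using j by (simp add: vec_eq_iff field_simps)
      then have "c $ b - c $ b' \<in> span {r v}" by (metis span_base span_scale singletonI)
      then show ?thesis using True by simp
    next
      case False
      have "(c $ b - c $ b') $ i = 0" for i using e[of i i] False b by (simp add: eqs_def)
      then show ?thesis using False by (simp add: vec_eq_iff)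
    qed
  qed (use c(1) in \<open>auto simp: T_def\<close>)
  define W where "W = motions L R N Inc (\<rho> s0)"
  have W: "subspace W" unfolding W_def by (rule subspace_motions[OF L])
  obtain B1 where B1: "B1 \<subseteq> W" "independent B1" "W \<subseteq> span B1" "card B1 = dim W" using basis_exists by blast
  then have "B1 \<subseteq> T" using MT unfolding W_def by blast
  then obtain B where B: "B1 \<subseteq> B" "B \<subseteq> T" "independent B" "T \<subseteq> span B"
    using maximal_independent_subset_extend B1(2) by blast
  have finB: "finite B" using B(3) by (rule independent_imp_finite)
  \<comment> \<open>A basis of a complement of \<open>W\<close> in the space \<open>T\<close> of all
    admissible velocities.\<close>
  define S where "S = B - B1"
  have S: "finite S" "independent S" "S \<subseteq> T" using finB B independent_mono[OF B(3), of S] by (auto simp: S_def)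
  have dimT: "dim T = dim W + card S"
  proof -
    have "dim T = card B" using basis_card_eq_dim[OF B(2,4,3)] by simp
    also have "\<dots> = card B1 + card S" using B(1) finB unfolding S_def by (simp add: card_Diff_subset finite_subset card_mono)
    finally show ?thesis using B1(4) by simp
  qed
  have WS: "W \<inter> span S = {0}"
  proof -
    have "dim {x + y |x y. x \<in> span B1 \<and> y \<in> span S} + dim (span B1 \<inter> span S) = dim (span B1) + dim (span S)"
      by (rule dim_sums_Int) auto
    moreover have "card B \<le> dim {x + y |x y. x \<in> span B1 \<and> y \<in> span S}"
    proof (rule independent_card_le_dim[OF _ B(3)], rule subsetI)
      fix x assume "x \<in> B"
      then consider "x \<in> B1" | "x \<in> S" by (auto simp: S_def)
      then show "x \<in> {x + y |x y. x \<in> span B1 \<and> y \<in> span S}"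
      proof cases
        case 1
        then have "x = x + 0 \<and> x \<in> span B1 \<and> 0 \<in> span S" by (simp add: span_base span_zero)
        then show ?thesis by blast
      next
        case 2
        then have "x = 0 + x \<and> 0 \<in> span B1 \<and> x \<in> span S" by (simp add: span_base span_zero)
        then show ?thesis by blast
      qed
    qed
    moreover have "card B = card B1 + card S" using B(1) finB unfolding S_def by (simp add: card_Diff_subset finite_subset card_mono)
    moreover have "dim (span B1) = card B1" "dim (span S) = card S"
      using B1(2) S(2) by (simp_all add: dim_eq_card_independent)
    ultimately have "dim (span B1 \<inter> span S) = 0" by linarith
    then have "span B1 \<inter> span S \<subseteq> {0}" by simp
    then show ?thesis using B1(3) span_zero subspace_0[OF W] by blast
  qed
  have eqs_sum: "(\<Sum>k\<in>S. a k *\<^sub>R eqs r k) = eqs r (\<Sum>k\<in>S. a k *\<^sub>R k)" for a r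
    by (simp add: linear_sum[OF lin] linear_cmul[OF lin] o_def)
  have in_span: "(\<Sum>k\<in>S. a k *\<^sub>R k) \<in> span S" for a by (intro span_sum span_scale span_base)
  have "generically (\<lambda>s. \<forall>a. (\<Sum>k\<in>S. a k *\<^sub>R eqs (\<rho> s) k) = 0 \<longrightarrow> (\<forall>k\<in>S. a k = 0))"
  proof (rule generically_independent_family[where ?s0.0 = s0])
    fix a assume a: "(\<Sum>k\<in>S. a k *\<^sub>R eqs (\<rho> s0) k) = 0"
    have "(\<Sum>k\<in>S. a k *\<^sub>R k) \<in> T" using S(3) T by (intro subspace_sum subspace_scale) auto
    then have "(\<Sum>k\<in>S. a k *\<^sub>R k) \<in> W" unfolding W_def using a nz by (intro M1) (auto simp: eqs_sum)
    then have "(\<Sum>k\<in>S. a k *\<^sub>R k) = 0" using WS in_span[of a] by blast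
    then show "\<forall>k\<in>S. a k = 0" using independentD[OF S(2) S(1) order.refl] by blast
  qed (use S poly_eqs in auto)
  then show ?thesis
  proof (rule generically_mono)
    fix s assume ind: "\<forall>a. (\<Sum>k\<in>S. a k *\<^sub>R eqs (\<rho> s) k) = 0 \<longrightarrow> (\<forall>k\<in>S. a k = 0)"
    let ?M = "motions L R N Inc (\<rho> s)"
    have "?M \<inter> span S \<subseteq> {0}"
    proof
      fix c assume c: "c \<in> ?M \<inter> span S"
      then obtain a where a: "c = (\<Sum>k\<in>S. a k *\<^sub>R k)" by (auto simp: span_finite[OF S(1)])
      have "eqs (\<rho> s) c = 0" using M0 c by blast
      then have "\<forall>k\<in>S. a k = 0" using ind unfolding a eqs_sum[symmetric] by blast
      then show "c \<in> {0}" unfolding a by simp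
    qed
    then have "dim (?M \<inter> span S) = 0" by simp
    moreover have "dim {x + y |x y. x \<in> ?M \<and> y \<in> span S} + dim (?M \<inter> span S) = dim ?M + dim (span S)"
      by (rule dim_sums_Int[OF subspace_motions[OF L] subspace_span])
    moreover have "dim {x + y |x y. x \<in> ?M \<and> y \<in> span S} \<le> dim T"
    proof (rule dim_subset, rule subsetI)
      fix z assume "z \<in> {x + y |x y. x \<in> ?M \<and> y \<in> span S}"
      then obtain x y where "z = x + y" "x \<in> T" "y \<in> T"
        using MT span_minimal[OF S(3) T] by blast
      then show "z \<in> T" using subspace_add[OF T] by simp
    qed
    moreover have "dim (span S) = card S" using S(2) by (simp add: dim_eq_card_independent)
    ultimately show "dim ?M \<le> K" using dimT K unfolding W_def by linarith
  qed
qed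

section \<open>Counts under insertion, deletion and contraction\<close>

lemma block_count_insert:
  assumes "finite A" "b \<notin> A"
  shows "block_count D R (insert b A) Inc id = block_count D R A Inc id + int D -
    (\<Sum>v\<in>Inc b. if \<exists>x\<in>A. v \<in> Inc x then int D - of_bool (v \<in> R) else 0)"
proof -
  define w where "w v = int D - of_bool (v \<in> R)" for v
  have t: "int (card {x \<in> insert b A. v \<in> Inc x} - 1) =
      int (card {x \<in> A. v \<in> Inc x} - 1) + (if v \<in> Inc b then of_bool (\<exists>x\<in>A. v \<in> Inc x) else 0)" for v
  proof (cases "v \<in> Inc b")
    case True
    then have e: "{x \<in> insert b A. v \<in> Inc x} = insert b {x \<in> A. v \<in> Inc x}" by auto
    have c: "card {x \<in> insert b A. v \<in> Inc x} = Suc (card {x \<in> A. v \<in> Inc x})"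
      unfolding e using assms by simp
    show ?thesis
    proof (cases "\<exists>x\<in>A. v \<in> Inc x")
      case ex: True
      then have "card {x \<in> A. v \<in> Inc x} > 0" using assms(1) by (auto simp: card_gt_0_iff)
      then show ?thesis using True ex c by simp
    next
      case False
      then have e0: "{x \<in> A. v \<in> Inc x} = {}" by blast
      have "card {x \<in> A. v \<in> Inc x} = 0" unfolding e0 by simp
      then show ?thesis using False c by simp
    qed
  next
    case False
    then have e: "{x \<in> insert b A. v \<in> Inc x} = {x \<in> A. v \<in> Inc x}" by auto
    then show ?thesis using False by simp
  qed
  have "w v * int (card {x \<in> insert b A. v \<in> Inc x} - 1) = w v * int (card {x \<in> A. v \<in> Inc x} - 1) +
      (if v \<in> Inc b then (if \<exists>x\<in>A. v \<in> Inc x then w v else 0) else 0)" for v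
    unfolding t by (cases "v \<in> Inc b"; cases "\<exists>x\<in>A. v \<in> Inc x")
      (simp_all only: distrib_left if_True if_False mult_zero_right mult_1_right of_bool_eq simp_thms)
  then have "(\<Sum>v\<in>UNIV. w v * int (card {x \<in> insert b A. v \<in> Inc x} - 1)) =
     (\<Sum>v\<in>UNIV. w v * int (card {x \<in> A. v \<in> Inc x} - 1) + (if v \<in> Inc b then (if \<exists>x\<in>A. v \<in> Inc x then w v else 0) else 0))"
    by (simp only:)
  also have "\<dots> = (\<Sum>v\<in>UNIV. w v * int (card {x \<in> A. v \<in> Inc x} - 1)) + (\<Sum>v\<in>Inc b. (if \<exists>x\<in>A. v \<in> Inc x then w v else 0))"
    by (simp add: sum.distrib sum.If_cases)
  finally have s: "(\<Sum>v\<in>UNIV. w v * int (card {x \<in> insert b A. v \<in> Inc x} - 1)) = \<dots>" .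
  have "card (insert b A) = Suc (card A)" using assms by simp
  then show ?thesis unfolding block_count_def image_id
    using s unfolding w_def by (simp add: algebra_simps)
qed

lemma block_count_cong:
  assumes "\<And>b. b \<in> A \<Longrightarrow> Inc b = Inc' b"
  shows "block_count D R A Inc p = block_count D R A Inc' p"
proof -
  have "{b \<in> A. v \<in> Inc b} = {b \<in> A. v \<in> Inc' b}" for v using assms by auto
  then show ?thesis by (simp add: block_count_def)
qed

lemma block_count_drop_single_incidence:
  assumes "\<And>b'. b' \<in> N \<Longrightarrow> v \<in> Inc b' \<Longrightarrow> b' = b"
  shows "block_count D R N (Inc(b := Inc b - {v})) p = block_count D R N Inc p"
proof -
  let ?I = "Inc(b := Inc b - {v})"
  have "card (p ` {x \<in> N. w \<in> ?I x}) - 1 = card (p ` {x \<in> N. w \<in> Inc x}) - 1" for w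
  proof (cases "w = v")
    case True
    have e: "{x \<in> N. w \<in> ?I x} = {}" using True assms by auto
    have "p ` {x \<in> N. w \<in> Inc x} \<subseteq> {p b}" using True assms by auto
    then have "card (p ` {x \<in> N. w \<in> Inc x}) \<le> card {p b}" by (rule card_mono[rotated]) simp
    then show ?thesis unfolding e by simp
  next
    case False
    then have "{x \<in> N. w \<in> ?I x} = {x \<in> N. w \<in> Inc x}" by auto
    then show ?thesis by simp
  qed
  then show ?thesis by (simp add: block_count_def)
qed

lemma block_count_antimono:
  assumes "finite N" "D \<ge> 1" "\<And>b. b \<in> N \<Longrightarrow> Inc' b \<subseteq> Inc b"
  shows "block_count D R N Inc id \<le> block_count D R N Inc' id"
proof -
  have "(\<Sum>v\<in>UNIV. (int D - of_bool (v \<in> R)) * int (card (id ` {b \<in> N. v \<in> Inc' b}) - 1)) \<le>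
    (\<Sum>v\<in>UNIV. (int D - of_bool (v \<in> R)) * int (card (id ` {b \<in> N. v \<in> Inc b}) - 1))"
  proof (intro sum_mono mult_left_mono)
    fix v
    have "card {b \<in> N. v \<in> Inc' b} \<le> card {b \<in> N. v \<in> Inc b}"
      using assms by (intro card_mono) auto
    then show "int (card (id ` {b \<in> N. v \<in> Inc' b}) - 1) \<le> int (card (id ` {b \<in> N. v \<in> Inc b}) - 1)" by simp
    show "0 \<le> int D - of_bool (v \<in> R)" using assms(2) by simp
  qed
  then show ?thesis unfolding block_count_def by simp
qed

lemma block_count_drop_incidence:
  assumes N: "finite N" and b: "b \<in> N" "v \<in> Inc b" "v \<in> R" "card {x \<in> N. v \<in> Inc x} \<ge> 2"
  shows "block_count D R N (Inc(b := Inc b - {v})) id = block_count D R N Inc id + (int D - 1)"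
proof -
  let ?I = "Inc(b := Inc b - {v})"
  have "int (card {x \<in> N. w \<in> ?I x} - 1) = int (card {x \<in> N. w \<in> Inc x} - 1) - of_bool (w = v)" for w
  proof (cases "w = v")
    case True
    have "{x \<in> N. w \<in> ?I x} = {x \<in> N. v \<in> Inc x} - {b}" using True by auto
    then have "card {x \<in> N. w \<in> ?I x} = card {x \<in> N. v \<in> Inc x} - 1" using b by simp
    then show ?thesis using True b(4) by (simp add: of_nat_diff)
  next
    case False
    then have "{x \<in> N. w \<in> ?I x} = {x \<in> N. w \<in> Inc x}" by auto
    then show ?thesis using False by simp
  qed
  then have "(int D - of_bool (w \<in> R)) * int (card {x \<in> N. w \<in> ?I x} - 1) =
      (int D - of_bool (w \<in> R)) * int (card {x \<in> N. w \<in> Inc x} - 1) - (if w = v then int D - of_bool (w \<in> R) else 0)" for w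
    by (cases "w = v") (simp_all only: right_diff_distrib of_bool_eq simp_thms if_True if_False mult_1_right mult_zero_right)
  then have "(\<Sum>w\<in>UNIV. (int D - of_bool (w \<in> R)) * int (card {x \<in> N. w \<in> ?I x} - 1)) =
    (\<Sum>w\<in>UNIV. (int D - of_bool (w \<in> R)) * int (card {x \<in> N. w \<in> Inc x} - 1) - (if w = v then int D - of_bool (w \<in> R) else 0))"
    by (simp only:)
  also have "\<dots> = (\<Sum>w\<in>UNIV. (int D - of_bool (w \<in> R)) * int (card {x \<in> N. w \<in> Inc x} - 1)) - (int D - 1)"
    using b(3) by (simp add: sum_subtractf)
  finally show ?thesis unfolding block_count_def image_id by simp
qed

text \<open>A labelling of the merged blocks pulls back to the original blocks with the same classes
  at every vertex. So a bound over all labellings is inherited by contractions.\<close>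

lemma block_count_merge:
  "block_count D R (m ` N) (\<lambda>l. \<Union> (Inc ` {b \<in> N. m b = l})) p = block_count D R N Inc (p \<circ> m)"
proof -
  have "{l \<in> m ` N. v \<in> \<Union> (Inc ` {b \<in> N. m b = l})} = m ` {b \<in> N. v \<in> Inc b}" for v
    by (auto simp: image_iff) metis
  then show ?thesis unfolding block_count_def by (simp add: image_comp)
qed

lemma dim_motions_empty: "dim (motions L R {} Inc \<rho>) = 0"
proof -
  have "motions L R {} Inc \<rho> \<subseteq> {0}" by (auto simp: motions_def vec_eq_iff)
  then show ?thesis by simp
qed

text \<open>The summand 1 for each block makes the size drop even when the merged blocks have
  disjoint sets of incidences.\<close>

lemma sum_incidences_merge_less:
  fixes Inc :: "'b \<Rightarrow> 'v::finite set"
  assumes N: "finite N" and X: "X \<subseteq> N" "x \<in> X" "card X \<ge> 2"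
  shows "(\<Sum>l\<in>merge X x ` N. card (\<Union> (Inc ` {b \<in> N. merge X x b = l})) + 1) < (\<Sum>b\<in>N. card (Inc b) + 1)"
proof -
  let ?m = "merge X x"
  have fib: "finite {b \<in> N. ?m b = l}" for l using N by simp
  have le: "card (\<Union> (Inc ` {b \<in> N. ?m b = l})) \<le> (\<Sum>b\<in>{b \<in> N. ?m b = l}. card (Inc b))" for l
    by (rule card_UN_le[OF fib])
  have fx: "X \<subseteq> {b \<in> N. ?m b = x}" using X by (auto simp: merge_def)
  have "(\<Sum>l\<in>?m ` N. card (\<Union> (Inc ` {b \<in> N. ?m b = l})) + 1) < (\<Sum>l\<in>?m ` N. \<Sum>b\<in>{b \<in> N. ?m b = l}. card (Inc b) + 1)"
  proof (rule sum_strict_mono_ex1)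
    show "\<forall>l\<in>?m ` N. card (\<Union> (Inc ` {b \<in> N. ?m b = l})) + 1 \<le> (\<Sum>b\<in>{b \<in> N. ?m b = l}. card (Inc b) + 1)"
    proof
      fix l assume "l \<in> ?m ` N"
      then have "{b \<in> N. ?m b = l} \<noteq> {}" by auto
      then have "card {b \<in> N. ?m b = l} \<ge> 1" using fib[of l] by (simp add: Suc_le_eq card_gt_0_iff)
      then show "card (\<Union> (Inc ` {b \<in> N. ?m b = l})) + 1 \<le> (\<Sum>b\<in>{b \<in> N. ?m b = l}. card (Inc b) + 1)"
        using le[of l] by (simp only: sum.distrib sum_constant) simp
    qed
    have "card {b \<in> N. ?m b = x} \<ge> 2" using card_mono[OF fib fx] X(3) by linarith
    then have "card (\<Union> (Inc ` {b \<in> N. ?m b = x})) + 1 < (\<Sum>b\<in>{b \<in> N. ?m b = x}. card (Inc b) + 1)"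
      using le[of x] by (simp only: sum.distrib sum_constant) simp
    moreover have "x \<in> ?m ` N" using X by (auto simp: merge_def intro!: image_eqI[of _ _ x])
    ultimately show "\<exists>l\<in>?m ` N. card (\<Union> (Inc ` {b \<in> N. ?m b = l})) + 1 < (\<Sum>b\<in>{b \<in> N. ?m b = l}. card (Inc b) + 1)" by blast
  qed (use N in simp)
  also have "\<dots> = (\<Sum>b\<in>N. card (Inc b) + 1)" by (rule sum.image_gen[OF N, symmetric])
  finally show ?thesis .
qed

section \<open>The generic dimension bound for motions\<close>

text \<open>Isolates what the induction uses about decomposable bivectors: they depend polynomially
  on parameters, and with all other rods fixed a single rod can leave any given proper subspace of
  \<open>L\<close>.\<close>

locale generic_rods =
  fixes L :: "(real^'k) set" and R :: "'v::finite set" and \<rho> :: "'p::euclidean_space \<Rightarrow> 'v \<Rightarrow> real^'k"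
  assumes L: "subspace L" and D6: "dim L \<ge> 6"
    and poly: "v \<in> R \<Longrightarrow> polynomial_function (\<lambda>s. \<rho> s v)"
    and rod_in: "v \<in> R \<Longrightarrow> \<rho> s v \<in> L"
    and move: "v \<in> R \<Longrightarrow> subspace U \<Longrightarrow> U \<subseteq> L \<Longrightarrow> U \<noteq> L \<Longrightarrow>
      \<exists>s'. (\<forall>w. w \<noteq> v \<longrightarrow> \<rho> s' w = \<rho> s w) \<and> \<rho> s' v \<notin> U"
begin

lemma L_not_small: "dim U < 6 \<Longrightarrow> U \<noteq> L"
  using D6 by auto

lemma span_rods_subset: "A \<subseteq> R \<Longrightarrow> span (\<rho> s ` A) \<subseteq> L"
  using rod_in by (intro span_minimal L) auto

lemma generically_nonzero: "generically (\<lambda>s. \<forall>v\<in>R. \<rho> s v \<noteq> 0)"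
proof (rule generically_ball_finite)
  fix v assume v: "v \<in> R"
  obtain s0 where s0: "\<rho> s0 v \<notin> {0}"
    \<comment> \<open>\<open>undefined\<close> is just some starting parameter; only the rod
      \<open>v\<close> obtained from it matters.\<close>
    using move[OF v, of "{0}" undefined] L_not_small[of "{0}"] subspace_0[OF L] by auto
  have "generically (\<lambda>s. \<forall>a. (\<Sum>m\<in>{v}. a m *\<^sub>R \<rho> s m) = 0 \<longrightarrow> (\<forall>m\<in>{v}. a m = (0::real)))"
    by (rule generically_independent_family[where ?s0.0 = s0 and v = "\<lambda>m s. \<rho> s m"]) (use poly v s0 in auto)
  then show "generically (\<lambda>s. \<rho> s v \<noteq> 0)"
    by (rule generically_mono) (use spec[of _ "\<lambda>_. 1::real"] in fastforce)
qed simp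

lemma generically_distinct_spans:
  assumes uw: "u \<in> R" "w \<in> R" "u \<noteq> w"
  shows "generically (\<lambda>s. span {\<rho> s u} \<inter> span {\<rho> s w} = {0})"
proof -
  obtain s1 where s1: "\<rho> s1 u \<notin> {0}"
    using move[OF uw(1), of "{0}" undefined] L_not_small[of "{0}"] subspace_0[OF L] by auto
  have "dim (span {\<rho> s1 u}) < 6" using dim_span_singleton_le[of "\<rho> s1 u"] by linarith
  then obtain s0 where s0: "\<forall>v. v \<noteq> w \<longrightarrow> \<rho> s0 v = \<rho> s1 v" "\<rho> s0 w \<notin> span {\<rho> s1 u}"
    using move[OF uw(2) subspace_span, of "{\<rho> s1 u}" s1] span_rods_subset[of "{u}" s1] uw(1) L_not_small by auto
  have "generically (\<lambda>s. \<forall>a. (\<Sum>m\<in>{u, w}. a m *\<^sub>R \<rho> s m) = 0 \<longrightarrow> (\<forall>m\<in>{u, w}. a m = (0::real)))"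
  proof (rule generically_independent_family[where ?s0.0 = s0 and v = "\<lambda>m s. \<rho> s m"])
    fix a assume "(\<Sum>m\<in>{u, w}. a m *\<^sub>R \<rho> s0 m) = 0"
    then have e: "a u *\<^sub>R \<rho> s1 u + a w *\<^sub>R \<rho> s0 w = 0" using uw s0(1) by simp
    have "a w = 0"
    proof (rule ccontr)
      assume "a w \<noteq> 0"
      moreover have "a w *\<^sub>R \<rho> s0 w = - a u *\<^sub>R \<rho> s1 u" using e by (simp add: eq_neg_iff_add_eq_0 add.commute)
      ultimately have "\<rho> s0 w = (- a u / a w) *\<^sub>R \<rho> s1 u"
        by (metis divideR_right divide_inverse_commute scaleR_scaleR divide_real_def mult.commute)
      then show False using s0(2) by (metis span_base span_scale singletonI)
    qed
    then show "\<forall>m\<in>{u, w}. a m = 0" using e s1 by auto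
  qed (use poly uw in auto)
  then show ?thesis
  proof (rule generically_mono)
    fix s assume ind: "\<forall>a. (\<Sum>m\<in>{u, w}. a m *\<^sub>R \<rho> s m) = 0 \<longrightarrow> (\<forall>m\<in>{u, w}. a m = (0::real))"
    show "span {\<rho> s u} \<inter> span {\<rho> s w} = {0}"
    proof (intro equalityI subsetI)
      fix x assume "x \<in> span {\<rho> s u} \<inter> span {\<rho> s w}"
      then have x: "x \<in> span {\<rho> s u}" "x \<in> span {\<rho> s w}" by auto
      obtain i where i: "x = i *\<^sub>R \<rho> s u" using x(1) by (auto simp: span_singleton)
      obtain j where j: "x = j *\<^sub>R \<rho> s w" using x(2) by (auto simp: span_singleton)
      note ij = i j
      have "(\<Sum>m\<in>{u, w}. (if m = u then i else - j) *\<^sub>R \<rho> s m) = 0" using uw(3) by (simp flip: ij)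
      then have "i = 0" using ind[rule_format, of "\<lambda>m. if m = u then i else - j" u] by simp
      then show "x \<in> {0}" using ij by simp
    qed (auto simp: span_zero)
  qed
qed

end

lemma generically_exists: "generically P \<Longrightarrow> \<exists>s. P s"
  by (erule generically_ex) blast

context generic_rods
begin

text \<open>Induction on the number of blocks and incidences. A rigid proper subfamily is merged into one
  block. Otherwise either an incidence can be dropped, or there is a chain of two blocks
  \<open>{u, v}\<close>, \<open>{v, w}\<close> joined by a rod \<open>v\<close> that no other block contains. The latter rod enters linearly,
  so it can be moved off the subspace of relative motions of \<open>u\<close> and \<open>w\<close>.\<close>

theorem generically_dim_motions_le:
  fixes N :: "'b::finite set"
  assumes "\<And>p. block_count (dim L) R N Inc p \<le> int K"
  shows "generically (\<lambda>s. dim (motions L R N Inc (\<rho> s)) \<le> K)"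
  using assms
proof (induction "\<Sum>b\<in>N. card (Inc b) + 1" arbitrary: N Inc K rule: less_induct)
  case (less N Inc K)
  let ?D = "dim L"
  let ?h = "\<lambda>N Inc. block_count ?D R N Inc id"
  let ?size = "\<lambda>N Inc. \<Sum>b\<in>N. card (Inc b) + (1::nat)"
  note IH = less.hyps and bound = less.prems
  have size_subset: "?size A Inc < ?size N Inc" if A: "A \<subset> N" for A
  proof -
    have "?size N Inc = ?size A Inc + ?size (N - A) Inc"
      using A sum.subset_diff[of A N "\<lambda>b. card (Inc b) + 1"] by auto
    moreover obtain b where "b \<in> N - A" using A by blast
    then have "card (Inc b) + 1 \<le> ?size (N - A) Inc" by (intro member_le_sum) auto
    ultimately show ?thesis by linarith
  qed
  have h1: "?h {b} I = int ?D" for b I by (rule block_count_const[of id _ b]) simp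
  have remove: "dim (motions L R N Inc r) \<le> dim (motions L R (N - {b}) Inc r) + ?D" if "b \<in> N" for b r
    by (rule dim_motions_remove_block[OF L that]) (use that in \<open>auto dest: motionsD(2)\<close>)
  have D_le: "?D \<le> K" if "N \<noteq> {}"
  proof -
    \<comment> \<open>A constant labelling has one class and counts \<open>dim L\<close>, so the
      hypothesis keeps \<open>K\<close> above the dimension of the rigid motions.\<close>
    have "block_count ?D R N Inc (\<lambda>_. undefined) = int ?D"
      using that by (intro block_count_const) auto
    then show ?thesis using bound[of "\<lambda>_. undefined"] by simp
  qed
  consider (small) "card N \<le> 1" | (single) b v where "b \<in> N" "v \<in> Inc b" "\<And>b'. b' \<in> N \<Longrightarrow> v \<in> Inc b' \<Longrightarrow> b' = b"
    | (tight) X where "X \<subset> N" "card X \<ge> 2" "?h X Inc \<le> int ?D"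
    | (core) "card N \<ge> 2" "\<And>b v. b \<in> N \<Longrightarrow> v \<in> Inc b \<Longrightarrow> \<exists>b'\<in>N. v \<in> Inc b' \<and> b' \<noteq> b"
       "\<And>X. X \<subset> N \<Longrightarrow> card X \<ge> 2 \<Longrightarrow> ?h X Inc > int ?D"
  proof (cases "card N \<le> 1")
    case True
    then show thesis by (rule that(1))
  next
    case False
    then have N2: "card N \<ge> 2" by simp
    show thesis
    proof (cases "\<exists>b v. b \<in> N \<and> v \<in> Inc b \<and> (\<forall>b'\<in>N. v \<in> Inc b' \<longrightarrow> b' = b)")
      case True
      then show thesis using that(2) by blast
    next
      case no_single: False
      show thesis
      proof (cases "\<exists>X. X \<subset> N \<and> card X \<ge> 2 \<and> ?h X Inc \<le> int ?D")
        case True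
        then show thesis using that(3) by blast
      next
        case False
        show thesis
        proof (rule that(4)[OF N2])
          show "\<exists>b'\<in>N. v \<in> Inc b' \<and> b' \<noteq> b" if "b \<in> N" "v \<in> Inc b" for b v
            using no_single that by blast
          show "?h X Inc > int ?D" if "X \<subset> N" "card X \<ge> 2" for X
            using False that by (meson not_le)
        qed
      qed
    qed
  qed
  then show ?case
  proof cases
    case small
    show ?thesis
    proof (rule generically_True)
      fix s
      show "dim (motions L R N Inc (\<rho> s)) \<le> K"
      proof (cases "N = {}")
        case True
        then show ?thesis by (simp add: dim_motions_empty)
      next
        case False
        then have "card N = 1" using small card_gt_0_iff[of N] by simp
        then obtain b where "N = {b}" by (auto simp: card_1_singleton_iff)
        then show ?thesis using remove[of b "\<rho> s"] D_le by (simp add: dim_motions_empty)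
      qed
    qed
  next
    case single
    let ?I = "Inc(b := Inc b - {v})"
    have "?size N ?I < ?size N Inc"
    proof (rule sum_strict_mono_ex1)
      show "\<forall>x\<in>N. card (?I x) + 1 \<le> card (Inc x) + 1" by (auto intro!: card_mono)
      show "\<exists>x\<in>N. card (?I x) + 1 < card (Inc x) + 1"
        using single(1,2) card_Diff1_less[OF finite single(2)] by (intro bexI[of _ b]) simp_all
    qed simp
    moreover have "block_count ?D R N ?I p \<le> int K" for p
      using bound[of p] block_count_drop_single_incidence[where Inc = Inc, OF single(3)] by metis
    ultimately have "generically (\<lambda>s. dim (motions L R N ?I (\<rho> s)) \<le> K)" by (rule IH)
    moreover have "motions L R N ?I r = motions L R N Inc r" for r
      by (rule motions_drop_single_incidence) (rule single(3))
    ultimately show ?thesis by (simp only:)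
  next
    case tight
    \<comment> \<open>A tight subfamily of least size has no tight proper subfamily of at least two
      blocks, so none of its labellings counts more than \<open>dim L\<close>; by induction it is
      generically rigid.\<close>
    let ?P = "\<lambda>X. X \<subset> N \<and> card X \<ge> 2 \<and> ?h X Inc \<le> int ?D"
    have "\<exists>X. ?P X \<and> (\<forall>Y. ?P Y \<longrightarrow> card X \<le> card Y)"
      using ex_has_least_nat[of ?P X card] tight by blast
    then obtain X where X: "?P X" and min: "\<And>Y. ?P Y \<Longrightarrow> card X \<le> card Y" by blast
    have "X \<noteq> {}" using X by auto
    then obtain x where x: "x \<in> X" by blast
    have "block_count ?D R X Inc p \<le> int ?D" for p
    proof -
      have "block_count ?D R X Inc p \<le> max (int ?D) (?h X Inc)"
      proof (rule block_count_le_max)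
        fix Y assume Y: "Y \<subset> X" "card Y \<ge> 2"
        have "card Y < card X" using Y(1) by (intro psubset_card_mono) auto
        then have "\<not> ?P Y" using min[of Y] by linarith
        then show "int ?D \<le> ?h Y Inc" using Y X by auto
      qed (use x in auto)
      then show ?thesis using X by simp
    qed
    then have rigid: "generically (\<lambda>s. dim (motions L R X Inc (\<rho> s)) \<le> ?D)"
      using X by (intro IH size_subset) auto
    let ?m = "merge X x"
    let ?I = "\<lambda>l. \<Union> (Inc ` {b \<in> N. ?m b = l})"
    have "generically (\<lambda>s. dim (motions L R (?m ` N) ?I (\<rho> s)) \<le> K)"
    proof (rule IH)
      show "?size (?m ` N) ?I < ?size N Inc"
        by (rule sum_incidences_merge_less) (use X x in auto)
      show "block_count ?D R (?m ` N) ?I p \<le> int K" for p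
        unfolding block_count_merge by (rule bound)
    qed
    from generically_conj[OF rigid this] show ?thesis
    proof (rule generically_mono)
      fix s assume "dim (motions L R X Inc (\<rho> s)) \<le> ?D \<and> dim (motions L R (?m ` N) ?I (\<rho> s)) \<le> K"
      then show "dim (motions L R N Inc (\<rho> s)) \<le> K"
        using dim_motions_merge[OF L, of X N x R Inc "\<rho> s"] X x by auto
    qed
  next
    case core
    \<comment> \<open>From here on every incidence is shared, and every proper subfamily of at least
      two blocks counts strictly more than \<open>dim L\<close>. This slack of one pays for the
      contraction of a chain.\<close>
    have finN: "finite N" and neN: "N \<noteq> {}" using core(1) by auto
    have hN: "?h N Inc \<le> int K" by (rule bound)
    have K_max: "max (int ?D) (?h N Inc) \<le> int K" using hN D_le[OF neN] by simp
    have t2: "card {x \<in> N. v \<in> Inc x} \<ge> 2" if bv: "b \<in> N" "v \<in> Inc b" for b v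
    proof -
      obtain b' where "b' \<in> N" "v \<in> Inc b'" "b' \<noteq> b" using core(2)[OF bv] by blast
      then show ?thesis using card_mono[of "{x \<in> N. v \<in> Inc x}" "{b, b'}"] bv by simp
    qed
    have hproper: "int ?D \<le> ?h X Inc" if "X \<subset> N" "X \<noteq> {}" for X
    proof (cases "card X \<ge> 2")
      case True
      then show ?thesis using core(3)[OF that(1) True] by simp
    next
      case False
      moreover have "card X > 0" using that by (simp add: card_gt_0_iff)
      ultimately have "card X = 1" by simp
      then obtain b where "X = {b}" by (auto simp: card_1_singleton_iff)
      then show ?thesis using h1[of b Inc] by simp
    qed
    have hcount: "block_count ?D R X Inc p \<le> ?h X Inc" if X: "X \<subset> N" "X \<noteq> {}" for X p
    proof -
      have "block_count ?D R X Inc p \<le> max (int ?D) (?h X Inc)"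
      proof (rule block_count_le_max)
        show "finite X" "X \<noteq> {}" using X by auto
        fix Y assume Y: "Y \<subset> X" "card Y \<ge> 2"
        have "Y \<subset> N" "Y \<noteq> {}" using X Y by auto
        then show "int ?D \<le> ?h Y Inc" by (rule hproper)
      qed
      then show ?thesis using hproper[OF X] by simp
    qed
    consider (body) b v where "b \<in> N" "v \<in> Inc b" "v \<notin> R" | (leaf) b where "b \<in> N" "card (Inc b) \<le> 1" "Inc b \<subseteq> R"
      | (excess) "?h N Inc \<le> 1" "\<And>b. b \<in> N \<Longrightarrow> Inc b \<subseteq> R" "\<And>b. b \<in> N \<Longrightarrow> card (Inc b) \<ge> 2"
      | (chain) "?h N Inc \<ge> 2" "\<And>b. b \<in> N \<Longrightarrow> Inc b \<subseteq> R" "\<And>b. b \<in> N \<Longrightarrow> card (Inc b) \<ge> 2"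
    proof (cases "\<forall>b\<in>N. Inc b \<subseteq> R")
      case False
      then show thesis using that(1) by blast
    next
      case rods: True
      show thesis
      proof (cases "\<forall>b\<in>N. card (Inc b) \<ge> 2")
        case False
        then obtain b where "b \<in> N" "card (Inc b) \<le> 1" by (auto simp: not_le)
        then show thesis using that(2)[of b] rods by blast
      next
        case True
        show thesis
        proof (cases "?h N Inc \<le> 1")
          case 1: True
          show thesis by (rule that(3)[OF 1]) (use rods True in blast)+
        next
          case False
          then have 2: "?h N Inc \<ge> 2" by linarith
          show thesis by (rule that(4)[OF 2]) (use rods True in blast)+
        qed
      qed
    qed
    then show ?thesis
    proof cases
      case body
      obtain b' where b': "b' \<in> N" "v \<in> Inc b'" "b' \<noteq> b" using core(2)[OF body(1,2)] by blast
      \<comment> \<open>A shared vertex outside \<open>R\<close> already costs \<open>dim L\<close>,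
        so the pair is tight and must be all of \<open>N\<close>.\<close>
      have "?h {b, b'} Inc \<le> int ?D"
      proof -
        have "?h (insert b {b'}) Inc = ?h {b'} Inc + int ?D -
          (\<Sum>z\<in>Inc b. if \<exists>x\<in>{b'}. z \<in> Inc x then int ?D - of_bool (z \<in> R) else 0)"
          by (rule block_count_insert) (use b' in auto)
        moreover have "int ?D \<le> (\<Sum>z\<in>Inc b. if \<exists>x\<in>{b'}. z \<in> Inc x then int ?D - of_bool (z \<in> R) else 0)"
        proof -
          have "(if \<exists>x\<in>{b'}. v \<in> Inc x then int ?D - of_bool (v \<in> R) else 0) \<le>
            (\<Sum>z\<in>Inc b. if \<exists>x\<in>{b'}. z \<in> Inc x then int ?D - of_bool (z \<in> R) else 0)"
            using D6 by (intro member_le_sum body(2)) auto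
          then show ?thesis using body(3) b'(2) by simp
        qed
        ultimately show ?thesis using h1[of b' Inc] by simp
      qed
      then have "\<not> {b, b'} \<subset> N" using core(3)[of "{b, b'}"] b'(3) by auto
      then have N: "N = {b, b'}" using body(1) b'(1) by blast
      show ?thesis
      proof (rule generically_True)
        fix s
        have "dim (motions L R N Inc (\<rho> s)) \<le> dim (motions L R (N - {b}) Inc (\<rho> s)) + dim {0 :: real^'k}"
        proof (rule dim_motions_remove_block[OF L body(1)])
          fix c assume c: "c \<in> motions L R N Inc (\<rho> s)" "\<And>x. x \<noteq> b \<Longrightarrow> c $ x = 0"
          have "c $ b - c $ b' \<in> (if v \<in> R then span {\<rho> s v} else {0})"
            by (rule motionsD(3)[OF c(1)]) (use body b' in auto)
          then show "c $ b \<in> {0}" using c(2)[OF b'(3)] body(3) by simp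
        qed
        moreover have "motions L R (N - {b}) Inc (\<rho> s) = motions L R {b'} Inc (\<rho> s)"
          using N b'(3) by (simp add: insert_Diff_if)
        moreover have "dim (motions L R {b'} Inc (\<rho> s)) \<le> dim (motions L R ({b'} - {b'}) Inc (\<rho> s)) + ?D"
          by (rule dim_motions_remove_block[OF L]) (auto dest: motionsD(2))
        ultimately show "dim (motions L R N Inc (\<rho> s)) \<le> K"
          using D_le[OF neN] by (simp add: dim_motions_empty)
      qed
    next
      case leaf
      \<comment> \<open>Adding \<open>b\<close> back to \<open>A\<close> raises the count by
        \<open>dim L\<close> if \<open>b\<close> is free and by 1 if it hangs on a single rod; the
        dimension of the motions rises by no more.\<close>
      define A where "A = N - {b}"
      have "\<not> N \<subseteq> {b}" using card_mono[of "{b}" N] core(1) by auto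
      then have A: "A \<subset> N" "A \<noteq> {}" "N = insert b A" "b \<notin> A" using leaf(1) by (auto simp: A_def)
      have "?h A Inc \<ge> 0" using hproper[OF A(1,2)] by simp
      then have nat: "int (nat (?h A Inc)) = ?h A Inc" by simp
      have IHA: "generically (\<lambda>s. dim (motions L R A Inc (\<rho> s)) \<le> nat (?h A Inc))"
        by (rule IH[OF size_subset[OF A(1)]], unfold nat, rule hcount[OF A(1,2)])
      have hN': "?h N Inc = ?h A Inc + int ?D -
        (\<Sum>z\<in>Inc b. if \<exists>x\<in>A. z \<in> Inc x then int ?D - of_bool (z \<in> R) else 0)"
        unfolding A(3) by (rule block_count_insert[OF finite A(4)])
      show ?thesis
      proof (cases "Inc b = {}")
        case True
        show ?thesis
        proof (rule generically_mono[OF IHA])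
          fix s assume "dim (motions L R A Inc (\<rho> s)) \<le> nat (?h A Inc)"
          then have "int (dim (motions L R N Inc (\<rho> s))) \<le> ?h A Inc + int ?D"
            using remove[OF leaf(1), of "\<rho> s"] nat unfolding A_def by linarith
          then show "dim (motions L R N Inc (\<rho> s)) \<le> K" using hN' True hN by simp
        qed
      next
        case False
        then have "card (Inc b) = 1" using leaf(2) card_gt_0_iff[of "Inc b"] by simp
        then obtain v where v: "Inc b = {v}" by (auto simp: card_1_singleton_iff)
        then obtain b' where b': "b' \<in> N" "v \<in> Inc b'" "b' \<noteq> b" using core(2)[of b v] leaf(1) by auto
        have vR: "v \<in> R" using leaf(3) v by simp
        have hN'': "?h N Inc = ?h A Inc + 1"
          using hN' vR b' unfolding v A_def by auto
        show ?thesis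
        proof (rule generically_mono[OF IHA])
          fix s assume s: "dim (motions L R A Inc (\<rho> s)) \<le> nat (?h A Inc)"
          have "dim (motions L R N Inc (\<rho> s)) \<le> dim (motions L R (N - {b}) Inc (\<rho> s)) + dim (span {\<rho> s v})"
          proof (rule dim_motions_remove_block[OF L leaf(1)])
            fix c assume c: "c \<in> motions L R N Inc (\<rho> s)" "\<And>x. x \<noteq> b \<Longrightarrow> c $ x = 0"
            have "c $ b - c $ b' \<in> span {\<rho> s v}"
              by (rule motions_rod[OF c(1)]) (use leaf v b' vR in auto)
            then show "c $ b \<in> span {\<rho> s v}" using c(2)[OF b'(3)] by simp
          qed
          then have "int (dim (motions L R N Inc (\<rho> s))) \<le> ?h A Inc + 1"
            using s nat dim_span_singleton_le[of "\<rho> s v"] unfolding A_def by linarith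
          then show "dim (motions L R N Inc (\<rho> s)) \<le> K" using hN'' hN by linarith
        qed
      qed
    next
      case excess
      obtain b where b: "b \<in> N" using neN by blast
      then have "Inc b \<noteq> {}" using excess(3)[of b] by auto
      then obtain v where v: "v \<in> Inc b" by blast
      have vR: "v \<in> R" using excess(2) b v by blast
      let ?I = "Inc(b := Inc b - {v})"
      \<comment> \<open>As the count is at most 1, it stays at most \<open>dim L\<close> after one
        incidence at a rod is dropped. By induction even this less constrained structure is
        rigid.\<close>
      have I: "?h N ?I = ?h N Inc + (int ?D - 1)"
        by (rule block_count_drop_incidence[OF finN b v vR t2[OF b v]])
      have "generically (\<lambda>s. dim (motions L R N ?I (\<rho> s)) \<le> ?D)"
      proof (rule IH)
        show "?size N ?I < ?size N Inc"
        proof (rule sum_strict_mono_ex1)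
          show "\<forall>x\<in>N. card (?I x) + 1 \<le> card (Inc x) + 1" by (auto intro!: card_mono)
          show "\<exists>x\<in>N. card (?I x) + 1 < card (Inc x) + 1"
            using b v card_Diff1_less[OF finite v] by (intro bexI[of _ b]) simp_all
        qed simp
        fix p
        have "block_count ?D R N ?I p \<le> max (int ?D) (?h N ?I)"
        proof (rule block_count_le_max[OF finN neN])
          fix X assume X: "X \<subset> N" "card X \<ge> 2"
          have "int ?D \<le> ?h X Inc" using core(3)[OF X] by simp
          also have "\<dots> \<le> ?h X ?I" using D6 by (intro block_count_antimono) auto
          finally show "int ?D \<le> ?h X ?I" .
        qed
        then show "block_count ?D R N ?I p \<le> int ?D" using I excess(1) by simp
      qed
      then show ?thesis
      proof (rule generically_mono)
        fix s assume "dim (motions L R N ?I (\<rho> s)) \<le> ?D"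
        moreover have "dim (motions L R N Inc (\<rho> s)) \<le> dim (motions L R N ?I (\<rho> s))"
          by (rule dim_subset, rule motions_mono_inc) auto
        ultimately show "dim (motions L R N Inc (\<rho> s)) \<le> K" using D_le[OF neN] by linarith
      qed
    next
      case chain
      obtain b b' u v w where bb: "b \<in> N" "b' \<in> N" "b \<noteq> b'" "Inc b = {u, v}" "Inc b' = {v, w}" "u \<noteq> v" "w \<noteq> v"
        and v_only: "{x \<in> N. v \<in> Inc x} = {b, b'}"
      proof (rule exists_chain_rod[OF finN D6 _ t2 chain(3) chain(1)])
        show "y \<in> R" if "x \<in> N" "y \<in> Inc x" for x y using chain(2) that by blast
      qed blast+
      have uvw: "u \<in> R" "v \<in> R" "w \<in> R" using chain(2) bb by auto
      \<comment> \<open>By semicontinuity a single parameter with nonzero rods and few motions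
        suffices; the remaining steps look for one.\<close>
      have reduce: ?thesis if "\<exists>s. (\<forall>z\<in>R. \<rho> s z \<noteq> 0) \<and> dim (motions L R N Inc (\<rho> s)) \<le> K"
        using that motions_dim_generic[where \<rho> = \<rho> and R = R and N = N and Inc = Inc, OF L poly] by blast
      have v_unaffected: "motions L R A I (\<rho> s') = motions L R A I (\<rho> s)"
        if "\<forall>z. z \<noteq> v \<longrightarrow> \<rho> s' z = \<rho> s z" "\<And>x. x \<in> A \<Longrightarrow> v \<notin> I x" for A I s s'
      proof (rule motions_cong_rods)
        fix x z assume "x \<in> A" "z \<in> I x"
        then have "z \<noteq> v" using that(2) by blast
        then show "\<rho> s' z = \<rho> s z" using that(1) by blast
      qed
      have nz_move: "\<forall>z\<in>R. \<rho> s' z \<noteq> 0"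
        if "\<forall>z\<in>R. \<rho> s z \<noteq> 0" "\<forall>z. z \<noteq> v \<longrightarrow> \<rho> s' z = \<rho> s z" "\<rho> s' v \<notin> U" "subspace U" for s s' U
        using that subspace_0[OF that(4)] by metis
      show ?thesis
      proof (cases "u = w")
        case True
        \<comment> \<open>Two blocks sharing two rods count
          \<open>2 * dim L - 2 * (dim L - 1) = 2\<close>, so the pair is tight and must be all of
          \<open>N\<close>.\<close>
        have "?h {b, b'} Inc \<le> int ?D"
        proof -
          have "?h (insert b {b'}) Inc = ?h {b'} Inc + int ?D -
            (\<Sum>z\<in>Inc b. if \<exists>x\<in>{b'}. z \<in> Inc x then int ?D - of_bool (z \<in> R) else 0)"
            using bb(3) by (intro block_count_insert) auto
          moreover have "(\<Sum>z\<in>Inc b. if \<exists>x\<in>{b'}. z \<in> Inc x then int ?D - of_bool (z \<in> R) else 0) = 2 * int ?D - 2"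
            using bb(7) by (simp add: bb(4,5) uvw True)
          ultimately show ?thesis using h1[of b' Inc] D6 by simp
        qed
        then have "\<not> {b, b'} \<subset> N" using core(3)[of "{b, b'}"] bb(3) by auto
        then have N: "N = {b, b'}" using bb(1,2) by blast
        obtain s where s: "\<forall>z\<in>R. \<rho> s z \<noteq> 0" "span {\<rho> s u} \<inter> span {\<rho> s v} = {0}"
          using generically_exists[OF generically_conj[OF generically_nonzero generically_distinct_spans[OF uvw(1,2) bb(6)]]]
          by blast
        have "dim (motions L R N Inc (\<rho> s)) \<le> dim (motions L R (N - {b}) Inc (\<rho> s)) + dim {0 :: real^'k}"
        proof (rule dim_motions_remove_block[OF L bb(1)])
          fix c assume c: "c \<in> motions L R N Inc (\<rho> s)" "\<And>x. x \<noteq> b \<Longrightarrow> c $ x = 0"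
          have "c $ b - c $ b' \<in> span {\<rho> s v}"
            by (rule motions_rod[OF c(1) bb(1,2)]) (simp_all add: bb(4,5) uvw)
          moreover have "c $ b - c $ b' \<in> span {\<rho> s u}"
            by (rule motions_rod[OF c(1) bb(1,2)]) (simp_all add: bb(4,5) uvw True)
          moreover have "c $ b' = 0" using c(2)[of b'] bb(3) by simp
          ultimately have "c $ b \<in> span {\<rho> s u} \<inter> span {\<rho> s v}" by simp
          then show "c $ b \<in> {0}" using s(2) by simp
        qed
        moreover have "motions L R (N - {b}) Inc (\<rho> s) = motions L R {b'} Inc (\<rho> s)"
          using N bb(3) by (simp add: insert_Diff_if)
        moreover have "dim (motions L R {b'} Inc (\<rho> s)) \<le> dim (motions L R ({b'} - {b'}) Inc (\<rho> s)) + ?D"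
          by (rule dim_motions_remove_block[OF L]) (auto dest: motionsD(2))
        ultimately have "dim (motions L R N Inc (\<rho> s)) \<le> K"
          using D_le[OF neN] by (simp add: dim_motions_empty)
        then show ?thesis using reduce s(1) by blast
      next
        case uw: False
        define A where "A = N - {b, b'}"
        obtain b0 where b0: "b0 \<in> A" "u \<in> Inc b0"
          using core(2)[of b u] bb uw by (auto simp: A_def)
        obtain b1 where b1: "b1 \<in> A" "w \<in> Inc b1"
        proof -
          obtain x where x: "x \<in> N" "w \<in> Inc x" "x \<noteq> b'" using core(2)[of b' w] bb(2,5) by auto
          then have "x \<noteq> b" using bb(4,7) uw by auto
          then show thesis using that[of x] x by (simp add: A_def)
        qed
        have A: "A \<subset> N" "A \<noteq> {}" using bb b0 by (auto simp: A_def)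
        have vA: "v \<notin> Inc x" if "x \<in> A" for x using that v_only by (auto simp: A_def)
        define I where "I = Inc(b := {u, w})"
        have IA: "I x = Inc x" if "x \<noteq> b" for x using that by (simp add: I_def)
        \<comment> \<open>Relative to \<open>X\<close>, block \<open>b\<close> shares the rod
          \<open>u\<close> and adds \<open>dim L - (dim L - 1) = 1\<close>; then \<open>b'\<close>
          shares \<open>v\<close> and \<open>w\<close> and adds \<open>2 - dim L\<close>. The
          contracted block on \<open>{u, w}\<close> adds \<open>2 - dim L\<close> at once, so
          contraction lowers the count by one.\<close>
        have add_chain: "?h (insert b' (insert b X)) Inc = ?h X Inc + 3 - int ?D"
            "?h (insert b X) I = ?h X Inc + 2 - int ?D"
          if X: "X \<subseteq> A" "\<exists>x\<in>X. u \<in> Inc x" "\<exists>x\<in>X. w \<in> Inc x" for X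
        proof -
          have fX: "finite X" "b \<notin> X" "b' \<notin> X" "b' \<notin> insert b X" using X(1) bb(3) by (auto simp: A_def)
          have vX: "\<not> (\<exists>x\<in>X. v \<in> Inc x)" using vA X(1) by blast
          have 1: "?h (insert b X) Inc = ?h X Inc + 1"
            using block_count_insert[OF fX(1,2), of ?D R Inc] bb uvw X(2) vX by simp
          have w': "\<exists>x\<in>insert b X. w \<in> Inc x" "\<exists>x\<in>insert b X. v \<in> Inc x" using X(3) bb by auto
          have "?h (insert b' (insert b X)) Inc = ?h (insert b X) Inc + 2 - int ?D"
          proof -
            have "(\<Sum>z\<in>Inc b'. if \<exists>x\<in>insert b X. z \<in> Inc x then int ?D - of_bool (z \<in> R) else 0) = (\<Sum>z\<in>{v, w}. int ?D - 1)"
              unfolding bb(5) by (rule sum.cong[OF refl]) (use uvw w' in auto)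
            also have "\<dots> = 2 * int ?D - 2" using bb(7) by simp
            finally show ?thesis using block_count_insert[OF finite fX(4), of ?D R Inc] by simp
          qed
          then show "?h (insert b' (insert b X)) Inc = ?h X Inc + 3 - int ?D" using 1 by simp
          have cg: "?h X I = ?h X Inc" by (intro block_count_cong IA) (use fX(2) in blast)
          have ex: "(\<exists>x\<in>X. z \<in> I x) = (\<exists>x\<in>X. z \<in> Inc x)" for z using IA fX(2) by metis
          have Ib: "I b = {u, w}" by (simp add: I_def)
          have "(\<Sum>z\<in>I b. if \<exists>x\<in>X. z \<in> I x then int ?D - of_bool (z \<in> R) else 0) = (\<Sum>z\<in>{u, w}. int ?D - 1)"
            unfolding Ib ex by (rule sum.cong[OF refl]) (use uvw X(2,3) in auto)
          also have "\<dots> = 2 * int ?D - 2" using uw by simp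
          finally show "?h (insert b X) I = ?h X Inc + 2 - int ?D"
            using block_count_insert[OF fX(1,2), of ?D R I] cg by linarith
        qed
        have Nins: "N = insert b' (insert b A)" "N - {b'} = insert b A" using bb by (auto simp: A_def)
        have hA: "?h N Inc = ?h A Inc + 3 - int ?D" and hI: "?h (N - {b'}) I = ?h N Inc - 1"
        proof -
          have ex: "\<exists>x\<in>A. u \<in> Inc x" "\<exists>x\<in>A. w \<in> Inc x" using b0 b1 by blast+
          note ac = add_chain[OF order.refl ex]
          show hA: "?h N Inc = ?h A Inc + 3 - int ?D" by (subst Nins(1)) (rule ac(1))
          show "?h (N - {b'}) I = ?h N Inc - 1" unfolding Nins(2) using ac(2) hA by linarith
        qed
        have hI_count: "block_count ?D R (N - {b'}) I p \<le> int K" for p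
        proof -
          have "block_count ?D R (N - {b'}) I p \<le> max (int ?D) (?h (N - {b'}) I)"
          proof (rule block_count_le_max)
            fix X assume X: "X \<subset> N - {b'}" "card X \<ge> 2"
            show "int ?D \<le> ?h X I"
            proof (cases "b \<in> X")
              case False
              then have "?h X I = ?h X Inc" by (intro block_count_cong IA) auto
              moreover have "X \<subset> N" using X(1) by blast
              ultimately show ?thesis using core(3)[of X] X(2) by simp
            next
              case True
              define Y where "Y = X - {b}"
              have Y: "X = insert b Y" "b \<notin> Y" "Y \<subseteq> A" "finite Y" using True X(1) by (auto simp: Y_def A_def)
              have neY: "Y \<noteq> {}" using X(2) Y(1) by auto
              have "Y \<subset> N" using Y(3) A(1) by blast
              then have hY: "?h Y Inc \<ge> int ?D" using hproper neY by blast
              show ?thesis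
              proof (cases "(\<exists>x\<in>Y. u \<in> Inc x) \<and> (\<exists>x\<in>Y. w \<in> Inc x)")
                case True
                \<comment> \<open>\<open>X\<close> misses a block besides \<open>b'\<close>, so
                  after \<open>b'\<close> is put back the family is still proper, and its strict
                  lower bound absorbs the one lost by contraction.\<close>
                have "insert b' X \<noteq> N" using X(1) by auto
                then have "insert b' X \<subset> N" using X(1) bb(2) by blast
                moreover have "card (insert b' X) \<ge> 2"
                  using X(2) card_mono[OF finite subset_insertI[of X b']] by linarith
                ultimately have "?h (insert b' X) Inc > int ?D" by (rule core(3))
                moreover have "?h (insert b' X) Inc = ?h Y Inc + 3 - int ?D" "?h X I = ?h Y Inc + 2 - int ?D"
                  unfolding Y(1) using True by (intro add_chain[OF Y(3)]; blast)+
                ultimately show ?thesis by linarith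
              next
                case False
                have cg: "?h Y I = ?h Y Inc" by (intro block_count_cong IA) (use Y(2) in blast)
                have ex: "(\<exists>x\<in>Y. z \<in> I x) = (\<exists>x\<in>Y. z \<in> Inc x)" for z using IA Y(2) by metis
                have "?h X I = ?h Y I + int ?D -
                    (\<Sum>z\<in>I b. if \<exists>x\<in>Y. z \<in> I x then int ?D - of_bool (z \<in> R) else 0)"
                  unfolding Y(1) by (rule block_count_insert[OF Y(4,2)])
                moreover have "I b = {u, w}" by (simp add: I_def)
                then have "(\<Sum>z\<in>I b. if \<exists>x\<in>Y. z \<in> I x then int ?D - of_bool (z \<in> R) else 0) =
                    (if \<exists>x\<in>Y. u \<in> Inc x then int ?D - 1 else 0) + (if \<exists>x\<in>Y. w \<in> Inc x then int ?D - 1 else 0)"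
                  unfolding ex using uw uvw by simp
                \<comment> \<open>The contracted block shares at most one rod with \<open>Y\<close>,
                  so adding it does not lower the count.\<close>
                moreover have "\<dots> \<le> int ?D - 1" using False D6 by auto
                ultimately show ?thesis using cg hY by linarith
              qed
            qed
            next
            show "finite (N - {b'})" by simp
            show "N - {b'} \<noteq> {}" using bb(1,3) by blast
          qed
          then show ?thesis using hI K_max by linarith
        qed
        have IH1: "generically (\<lambda>s. dim (motions L R (N - {b'}) I (\<rho> s)) \<le> K)"
        proof (rule IH[OF _ hI_count])
          have c: "card (Inc b) = 2" "card (I b) = 2" using bb(4,6) uw by (simp_all add: I_def)
          have nin: "b' \<notin> insert b A" "b \<notin> A" using bb(3) by (simp_all add: A_def)
          have "?size A I = ?size A Inc"
          proof (rule sum.cong[OF refl])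
            fix x assume "x \<in> A"
            then have "x \<noteq> b" using nin(2) by blast
            then have "I x = Inc x" by (rule IA)
            then show "card (I x) + 1 = card (Inc x) + 1" by simp
          qed
          moreover have "?size (insert b A) I = (card (I b) + 1) + ?size A I" by (rule sum.insert[OF finite nin(2)])
          moreover have "?size (insert b' (insert b A)) Inc = (card (Inc b') + 1) + ((card (Inc b) + 1) + ?size A Inc)"
            using sum.insert[OF finite nin(1), of "\<lambda>x. card (Inc x) + 1"] sum.insert[OF finite nin(2), of "\<lambda>x. card (Inc x) + 1"] by linarith
          ultimately show "?size (N - {b'}) I < ?size N Inc"
            unfolding Nins(2) Nins(1)[symmetric] using c by linarith
        qed
        have "?h A Inc \<ge> 0" using hproper[OF A] by simp
        then have natA: "int (nat (?h A Inc)) = ?h A Inc" by simp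
        have IH2: "generically (\<lambda>s. dim (motions L R A Inc (\<rho> s)) \<le> nat (?h A Inc))"
          by (rule IH[OF size_subset[OF A(1)]], unfold natA, rule hcount[OF A])
        obtain s where s: "\<forall>z\<in>R. \<rho> s z \<noteq> 0" "span {\<rho> s u} \<inter> span {\<rho> s w} = {0}"
            "dim (motions L R (N - {b'}) I (\<rho> s)) \<le> K" "dim (motions L R A Inc (\<rho> s)) \<le> nat (?h A Inc)"
          using generically_exists[OF generically_conj[OF generically_conj[OF generically_nonzero
              generically_distinct_spans[OF uvw(1,3) uw]] generically_conj[OF IH1 IH2]]] by blast
        \<comment> \<open>The relative velocities along the two ends of the chain that the other
          blocks and the outer rods permit. The rod \<open>v\<close> does not enter, so it can be
          moved while this space stays fixed.\<close>
        define U where "U s = {x + y | x y. x \<in> (\<lambda>c. c $ b0 - c $ b1) ` motions L R A Inc (\<rho> s) \<and> y \<in> span {\<rho> s u, \<rho> s w}}" for s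
        have lin: "linear (\<lambda>c::(real^'k)^'b. c $ b0 - c $ b1)" by (rule linearI) (auto simp: algebra_simps)
        have U: "subspace (U s)" unfolding U_def
          by (intro subspace_sums linear_subspace_image[OF lin] subspace_motions L subspace_span)
        have spanL: "span {\<rho> s u, \<rho> s w} \<subseteq> L" using span_rods_subset[of "{u, w}" s] uvw by simp
        have UL: "U s \<subseteq> L"
        proof
          fix z assume "z \<in> U s"
          then obtain c y where "z = (c $ b0 - c $ b1) + y" "c \<in> motions L R A Inc (\<rho> s)" "y \<in> span {\<rho> s u, \<rho> s w}"
            unfolding U_def by blast
          then show "z \<in> L" using b0 b1 spanL motionsD(2)[of c L R A Inc "\<rho> s"]
            by (auto intro!: subspace_add[OF L] subspace_diff[OF L])
        qed
        have same: "\<rho> s' u = \<rho> s u" "\<rho> s' w = \<rho> s w" "motions L R A Inc (\<rho> s') = motions L R A Inc (\<rho> s)"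
            "motions L R (N - {b'}) I (\<rho> s') = motions L R (N - {b'}) I (\<rho> s)"
          if s': "\<forall>z. z \<noteq> v \<longrightarrow> \<rho> s' z = \<rho> s z" for s'
        proof -
          show "\<rho> s' u = \<rho> s u" "\<rho> s' w = \<rho> s w" using s' bb by auto
          show "motions L R A Inc (\<rho> s') = motions L R A Inc (\<rho> s)" by (rule v_unaffected[OF s' vA])
          show "motions L R (N - {b'}) I (\<rho> s') = motions L R (N - {b'}) I (\<rho> s)"
            by (rule v_unaffected[OF s']) (use vA bb in \<open>auto simp: Nins(2) I_def\<close>)
        qed
        \<comment> \<open>If \<open>U s\<close> is proper, \<open>v\<close> is moved off it and the
          chain can be contracted. If it is all of \<open>L\<close>, the chain costs the rest
          \<open>dim L - 3\<close> dimensions, matching the count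
          \<open>?h A Inc + 3 - dim L\<close>; then \<open>v\<close> only has to leave the span of
          the outer rods.\<close>
        show ?thesis
        proof (cases "U s = L")
          case False
          obtain s' where s': "\<forall>z. z \<noteq> v \<longrightarrow> \<rho> s' z = \<rho> s z" "\<rho> s' v \<notin> U s"
            using move[OF uvw(2) U UL False] by blast
          have "U s' = U s" unfolding U_def by (simp only: same[OF s'(1)])
          then have off: "\<rho> s' v \<notin> U s'" using s'(2) by simp
          have "dim (motions L R N Inc (\<rho> s')) \<le> dim (motions L R (N - {b'}) I (\<rho> s'))"
            unfolding I_def
          proof (rule dim_motions_chain_contract[OF L bb(1-5) uvw])
            show "b0 \<in> N - {b, b'}" "u \<in> Inc b0" "b1 \<in> N - {b, b'}" "w \<in> Inc b1" using b0 b1 by (auto simp: A_def)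
          qed (rule off[unfolded U_def A_def])
          then have "dim (motions L R N Inc (\<rho> s')) \<le> K" using s(3) same(4)[OF s'(1)] by simp
          then show ?thesis using reduce nz_move[OF s(1) s'(1,2) U] by blast
        next
          case True
          have "dim (span {\<rho> s u, \<rho> s w}) < 6" using dim_span_pair_le[of "\<rho> s u" "\<rho> s w"] by linarith
          then obtain s' where s': "\<forall>z. z \<noteq> v \<longrightarrow> \<rho> s' z = \<rho> s z" "\<rho> s' v \<notin> span {\<rho> s u, \<rho> s w}"
            using move[OF uvw(2) subspace_span spanL L_not_small] by blast
          have "dim (motions L R N Inc (\<rho> s')) + ?D \<le> dim (motions L R (N - {b, b'}) Inc (\<rho> s')) + 3"
          proof (rule dim_motions_chain_codim[OF L bb(1-5) uvw])
            show "b0 \<in> N - {b, b'}" "u \<in> Inc b0" "b1 \<in> N - {b, b'}" "w \<in> Inc b1" using b0 b1 by (auto simp: A_def)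
            show "L \<subseteq> {x + y |x y. x \<in> (\<lambda>c. c $ b0 - c $ b1) ` motions L R (N - {b, b'}) Inc (\<rho> s') \<and> y \<in> span {\<rho> s' u, \<rho> s' w}}"
              using True unfolding U_def A_def[symmetric] same[OF s'(1)] by simp
            show "\<rho> s' v \<notin> span {\<rho> s' u, \<rho> s' w}" "span {\<rho> s' u} \<inter> span {\<rho> s' w} = {0}"
              using s'(2) s(2) by (simp_all add: same[OF s'(1)])
          qed
          then have "int (dim (motions L R N Inc (\<rho> s'))) + int ?D \<le> ?h A Inc + 3"
            using s(4) natA unfolding A_def[symmetric] same(3)[OF s'(1)] by linarith
          then have "dim (motions L R N Inc (\<rho> s')) \<le> K" using hA hN by linarith
          then show ?thesis using reduce nz_move[OF s(1) s'(1,2) subspace_span] by blast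
        qed
      qed
    qed
  qed
qed

end

section \<open>Independent representatives\<close>

lemma dim_Un_subset_span:
  fixes A :: "'a::euclidean_space set"
  assumes "B \<subseteq> span A"
  shows "dim (A \<union> B) = dim A"
proof -
  have "A \<union> B \<subseteq> span A" using assms span_superset by blast
  then have "dim (A \<union> B) \<le> dim (span A)" by (rule dim_subset)
  moreover have "dim A \<le> dim (A \<union> B)" by (rule dim_subset) blast
  ultimately show ?thesis by simp
qed

lemma dim_Un_submodular:
  fixes A B C :: "'a::euclidean_space set"
  assumes "C \<subseteq> A" "C \<subseteq> B"
  shows "dim (A \<union> B) + dim C \<le> dim A + dim B"
proof -
  have "dim {x + y |x y. x \<in> span A \<and> y \<in> span B} + dim (span A \<inter> span B) = dim (span A) + dim (span B)"
    by (rule dim_sums_Int) auto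
  moreover have "{x + y |x y. x \<in> span A \<and> y \<in> span B} = span (A \<union> B)" by (simp add: span_Un)
  moreover have "dim C \<le> dim (span A \<inter> span B)"
    using assms span_superset[of A] span_superset[of B] by (intro dim_subset) blast
  ultimately show ?thesis by (simp add: dim_span)
qed

text \<open>Rado's theorem for vectors: pick a representative outside the span of the largest tight subfamily.\<close>

lemma independent_representatives_relative:
  fixes S :: "'i \<Rightarrow> 'a::euclidean_space set"
  assumes "finite I" and "\<And>F. F \<subseteq> I \<Longrightarrow> card F + dim Z \<le> dim (Z \<union> \<Union> (S ` F))"
  shows "\<exists>x. (\<forall>i\<in>I. x i \<in> S i) \<and> card I + dim Z \<le> dim (Z \<union> x ` I)"
  using assms
proof (induction I arbitrary: Z rule: finite_induct)
  case empty
  show ?case by auto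
next
  case (insert e I)
  let ?d = "\<lambda>F. dim (Z \<union> \<Union> (S ` F))"
  define tight where "tight F \<longleftrightarrow> F \<subseteq> I \<and> ?d F = card F + dim Z" for F
  have cond: "card F + dim Z \<le> ?d F" if "F \<subseteq> insert e I" for F by (rule insert.prems[OF that])
  \<comment> \<open>Submodularity of the dimension closes the tight subfamilies under union, so one
    of largest size contains all others.\<close>
  have un: "tight (F \<union> G)" if FG: "tight F" "tight G" for F G
  proof -
    have fin: "finite F" "finite G" using FG insert.hyps(1) by (auto simp: tight_def intro: finite_subset)
    have "?d (F \<union> G) = dim ((Z \<union> \<Union> (S ` F)) \<union> (Z \<union> \<Union> (S ` G)))" by (rule arg_cong[of _ _ dim]) auto
    moreover have "dim ((Z \<union> \<Union> (S ` F)) \<union> (Z \<union> \<Union> (S ` G))) + ?d (F \<inter> G) \<le> ?d F + ?d G"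
      by (rule dim_Un_submodular) auto
    moreover have "card (F \<inter> G) + dim Z \<le> ?d (F \<inter> G)" using FG by (intro cond) (auto simp: tight_def)
    moreover have "card (F \<union> G) + dim Z \<le> ?d (F \<union> G)" using FG by (intro cond) (auto simp: tight_def)
    moreover have "card F + card G = card (F \<union> G) + card (F \<inter> G)" using fin by (rule card_Un_Int)
    ultimately have "?d (F \<union> G) = card (F \<union> G) + dim Z" using FG unfolding tight_def by linarith
    then show ?thesis using FG by (auto simp: tight_def)
  qed
  have tight0: "tight {}" by (simp add: tight_def)
  have bnd: "\<forall>F. tight F \<longrightarrow> card F < Suc (card I)"
    using insert.hyps(1) by (auto simp: tight_def less_Suc_eq_le intro: card_mono)
  have "\<exists>M. tight M \<and> (\<forall>F. tight F \<longrightarrow> card F \<le> card M)"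
    by (rule ex_has_greatest_nat[OF tight0 bnd])
  then obtain M where M: "tight M" "\<And>F. tight F \<Longrightarrow> card F \<le> card M" by blast
  have max: "F \<subseteq> M" if F: "tight F" for F
  proof -
    have "finite (F \<union> M)" using F M(1) insert.hyps(1) by (auto simp: tight_def intro: finite_subset)
    then have "F \<union> M = M" using M(2)[OF un[OF F M(1)]] card_seteq[of "F \<union> M" M] by auto
    then show ?thesis by blast
  qed
  have "\<not> S e \<subseteq> span (Z \<union> \<Union> (S ` M))"
  proof
    assume "S e \<subseteq> span (Z \<union> \<Union> (S ` M))"
    then have "dim ((Z \<union> \<Union> (S ` M)) \<union> S e) = ?d M" by (rule dim_Un_subset_span)
    moreover have "?d (insert e M) = dim ((Z \<union> \<Union> (S ` M)) \<union> S e)" by (rule arg_cong[of _ _ dim]) auto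
    moreover have "card (insert e M) + dim Z \<le> ?d (insert e M)" using M(1) by (intro cond) (auto simp: tight_def)
    moreover have "card (insert e M) = Suc (card M)"
      using M(1) insert.hyps by (intro card_insert_disjoint) (auto simp: tight_def intro: finite_subset)
    ultimately show False using M(1) by (simp add: tight_def)
  qed
  then obtain y where y: "y \<in> S e" "y \<notin> span (Z \<union> \<Union> (S ` M))" by blast
  \<comment> \<open>Absorbing \<open>y\<close> into \<open>Z\<close> raises the left side by at most
    one. A tight \<open>F\<close> gains a dimension, since \<open>y\<close> is outside its span; a
    family that is not tight has one to spare.\<close>
  have step: "card F + dim (insert y Z) \<le> dim (insert y Z \<union> \<Union> (S ` F))" if F: "F \<subseteq> I" for F
  proof (cases "tight F")
    case True
    then have "F \<subseteq> M" by (rule max)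
    then have "y \<notin> span (Z \<union> \<Union> (S ` F))" using y(2) span_mono[of "Z \<union> \<Union> (S ` F)" "Z \<union> \<Union> (S ` M)"] by blast
    then have "dim (insert y (Z \<union> \<Union> (S ` F))) = ?d F + 1" by (simp add: dim_insert)
    moreover have "dim (insert y Z) \<le> dim Z + 1" by (simp add: dim_insert)
    ultimately show ?thesis using True by (simp add: tight_def)
  next
    case False
    then have "?d F \<noteq> card F + dim Z" using F by (simp add: tight_def)
    moreover have "card F + dim Z \<le> ?d F" using F by (intro cond) blast
    ultimately have "card F + dim Z < ?d F" by linarith
    moreover have "?d F \<le> dim (insert y Z \<union> \<Union> (S ` F))" by (rule dim_subset) blast
    moreover have "dim (insert y Z) \<le> dim Z + 1" by (simp add: dim_insert)
    ultimately show ?thesis by linarith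
  qed
  have "\<exists>x. (\<forall>i\<in>I. x i \<in> S i) \<and> card I + dim (insert y Z) \<le> dim (insert y Z \<union> x ` I)"
    by (rule insert.IH) (rule step)
  then obtain x where x: "\<forall>i\<in>I. x i \<in> S i" "card I + dim (insert y Z) \<le> dim (insert y Z \<union> x ` I)" by blast
  have "y \<notin> span Z" using y(2) span_mono[of Z "Z \<union> \<Union> (S ` M)"] by blast
  then have "dim (insert y Z) = dim Z + 1" by (simp add: dim_insert)
  moreover have "(x(e := y)) ` insert e I = insert y (x ` I)"
  proof -
    have "(x(e := y)) ` I = x ` I" using insert.hyps(2) by (intro image_cong) auto
    moreover have "(x(e := y)) ` insert e I = insert ((x(e := y)) e) ((x(e := y)) ` I)" by (rule image_insert)
    ultimately show ?thesis by (simp only: fun_upd_same)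
  qed
  then have u: "insert y Z \<union> x ` I = Z \<union> (x(e := y)) ` insert e I" by simp
  moreover have "card (insert e I) = Suc (card I)" by (rule card_insert_disjoint[OF insert.hyps])
  ultimately have "card (insert e I) + dim Z \<le> dim (insert y Z \<union> x ` I)"
    using x(2) by linarith
  then have "card (insert e I) + dim Z \<le> dim (Z \<union> (x(e := y)) ` insert e I)" unfolding u .
  moreover have "\<forall>i\<in>insert e I. (x(e := y)) i \<in> S i"
  proof
    fix i assume "i \<in> insert e I"
    then show "(x(e := y)) i \<in> S i" using x(1) y(1) by (cases "i = e") auto
  qed
  ultimately show ?case by blast
qed

lemma independent_representatives:
  fixes S :: "'i \<Rightarrow> 'a::euclidean_space set"
  assumes I: "finite I" and "\<And>F. F \<subseteq> I \<Longrightarrow> card F \<le> dim (\<Union> (S ` F))"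
  obtains x where "\<And>i. i \<in> I \<Longrightarrow> x i \<in> S i" "inj_on x I" "independent (x ` I)"
proof -
  have "\<exists>x. (\<forall>i\<in>I. x i \<in> S i) \<and> card I + dim ({} :: 'a set) \<le> dim ({} \<union> x ` I)"
    by (rule independent_representatives_relative[OF I]) (use assms(2) in simp)
  then obtain x where x1: "\<forall>i\<in>I. x i \<in> S i" and "card I + dim ({} :: 'a set) \<le> dim ({} \<union> x ` I)" by blast
  then have x: "\<forall>i\<in>I. x i \<in> S i" "card I \<le> dim (x ` I)" by simp_all
  have "dim (x ` I) \<le> card (x ` I)" using I by (intro dim_le_card) (auto intro: span_base)
  moreover have "card (x ` I) \<le> card I" by (rule card_image_le[OF I])
  ultimately have c: "card (x ` I) = card I" "card (x ` I) = dim (x ` I)" using x(2) by linarith+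
  have "x ` I \<subseteq> span (x ` I)" by (rule span_superset)
  then have ind: "independent (x ` I)"
    using card_eq_dim[OF order.refl c(2) finite_imageI[OF I]] by simp
  show ?thesis
  proof (rule that[of x])
    show "x i \<in> S i" if "i \<in> I" for i using x(1) that by (rule bspec)
  qed (rule eq_card_imp_inj_on[OF I c(1)], rule ind)
qed

section \<open>Exterior products with vectors\<close>

lemma wedge_sign_single:
  "wedge_sign {i} J = (- 1) ^ card {j \<in> J. j < i}"
proof -
  have "{(a, b). a \<in> {i} \<and> b \<in> J \<and> b < a} = Pair i ` {j \<in> J. j < i}" by auto
  then show ?thesis unfolding wedge_sign_def by (simp add: card_image inj_on_def)
qed

lemma ext_of_vec_nth: "ext_of_vec v $ I = (\<Sum>i\<in>UNIV. if I = {i} then v $ i else 0)"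
  unfolding ext_of_vec_def by (auto simp: axis_def intro!: sum.cong)

lemma ext_of_vec_single [simp]: "ext_of_vec v $ {i} = v $ i"
  unfolding ext_of_vec_nth by simp

lemma ext_of_vec_nonsingle: "(\<And>i. I \<noteq> {i}) \<Longrightarrow> ext_of_vec v $ I = 0"
  unfolding ext_of_vec_nth by simp

lemma wedge_ext_of_vec:
  fixes z :: "'n::{finite,linorder} ext"
  shows "wedge (ext_of_vec v) z $ K = (\<Sum>i\<in>K. wedge_sign {i} (K - {i}) * v $ i * z $ (K - {i}))"
proof -
  have "wedge (ext_of_vec v) z $ K = (\<Sum>I\<in>Pow K. wedge_sign I (K - I) * ext_of_vec v $ I * z $ (K - I))"
    by (simp add: wedge_def)
  also have "\<dots> = (\<Sum>I\<in>(\<lambda>i. {i}) ` K. wedge_sign I (K - I) * ext_of_vec v $ I * z $ (K - I))"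
  proof (rule sum.mono_neutral_right)
    show "\<forall>I\<in>Pow K - (\<lambda>i. {i}) ` K. wedge_sign I (K - I) * ext_of_vec v $ I * z $ (K - I) = 0"
    proof
      fix I assume I: "I \<in> Pow K - (\<lambda>i. {i}) ` K"
      have "ext_of_vec v $ I = 0" by (rule ext_of_vec_nonsingle) (use I in auto)
      then show "wedge_sign I (K - I) * ext_of_vec v $ I * z $ (K - I) = 0" by simp
    qed
  qed auto
  also have "\<dots> = (\<Sum>i\<in>K. wedge_sign {i} (K - {i}) * ext_of_vec v $ {i} * z $ (K - {i}))"
    by (subst sum.reindex) (auto simp: inj_on_def)
  finally show ?thesis by simp
qed

text \<open>The sign rule behind anticommutativity: removing \<open>i\<close> first leaves one
  element fewer below the larger index \<open>j\<close>.\<close>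

lemma wedge_sign_pair_swap:
  fixes i j :: "'n::{finite,linorder}"
  assumes "i \<in> K" "j \<in> K" "i < j"
  shows "wedge_sign {j} (K - {j}) * wedge_sign {i} (K - {j} - {i}) = - (wedge_sign {i} (K - {i}) * wedge_sign {j} (K - {i} - {j}))"
proof -
  have i: "{k \<in> K - {i}. k < i} = {k \<in> K - {j} - {i}. k < i}" using assms by auto
  have j: "{k \<in> K - {j}. k < j} = insert i {k \<in> K - {i} - {j}. k < j}" using assms by auto
  have "card {k \<in> K - {j}. k < j} = Suc (card {k \<in> K - {i} - {j}. k < j})"
    unfolding j by (rule card_insert_disjoint) auto
  then show ?thesis unfolding wedge_sign_single i by simp
qed

lemma wedge_sign_pair:
  fixes i j :: "'n::{finite,linorder}"
  assumes "i < j"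
  shows "wedge_sign {i, j} (- {i, j}) = wedge_sign {i} (UNIV - {i}) * wedge_sign {j} (UNIV - {i} - {j})"
proof -
  have "{(a, b). a \<in> {i, j} \<and> b \<in> - {i, j} \<and> b < a} =
     Pair i ` {k \<in> UNIV - {i}. k < i} \<union> Pair j ` {k \<in> UNIV - {i} - {j}. k < j}" using assms by auto
  moreover have "card (Pair i ` {k \<in> UNIV - {i}. k < i} \<union> Pair j ` {k \<in> UNIV - {i} - {j}. k < j}) =
     card {k \<in> UNIV - {i}. k < i} + card {k \<in> UNIV - {i} - {j}. k < j}"
    using assms by (subst card_Un_disjoint) (auto simp: card_image inj_on_def)
  ultimately show ?thesis unfolding wedge_sign_single unfolding wedge_sign_def by (simp add: power_add)
qed

lemma sum_ordered_pairs:
  fixes F :: "'n::{finite,linorder} \<Rightarrow> 'n \<Rightarrow> real"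
  shows "(\<Sum>i\<in>K. \<Sum>j\<in>K - {i}. F i j) = (\<Sum>(i, j)\<in>{(i, j). i \<in> K \<and> j \<in> K \<and> i < j}. F i j + F j i)"
proof -
  let ?P = "{(i, j). i \<in> K \<and> j \<in> K \<and> i < j}" and ?Q = "{(i, j). i \<in> K \<and> j \<in> K \<and> j < i}"
  have fin: "finite ?P" "finite ?Q" by (auto intro: finite_subset[of _ UNIV])
  have "(\<Sum>i\<in>K. \<Sum>j\<in>K - {i}. F i j) = (\<Sum>(i, j)\<in>Sigma K (\<lambda>i. K - {i}). F i j)"
    by (rule sum.Sigma) auto
  also have "Sigma K (\<lambda>i. K - {i}) = ?P \<union> ?Q" by auto
  also have "(\<Sum>(i, j)\<in>?P \<union> ?Q. F i j) = (\<Sum>(i, j)\<in>?P. F i j) + (\<Sum>(i, j)\<in>?Q. F i j)"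
    by (rule sum.union_disjoint[OF fin]) auto
  also have "(\<Sum>(i, j)\<in>?Q. F i j) = (\<Sum>(i, j)\<in>?P. F j i)"
    by (rule sum.reindex_bij_witness[of _ prod.swap prod.swap]) auto
  finally show ?thesis by (simp add: sum.distrib case_prod_unfold)
qed

text \<open>The two orders in which a pair of indices can be removed combine to a 2 by 2 minor. In
  this form antisymmetry in \<open>x\<close> and \<open>y\<close> can be read off in each
  coordinate.\<close>

lemma wedge_ext_twice:
  fixes z :: "'n::{finite,linorder} ext"
  shows "wedge (ext_of_vec x) (wedge (ext_of_vec y) z) $ K =
    (\<Sum>(i, j)\<in>{(i, j). i \<in> K \<and> j \<in> K \<and> i < j}.
      wedge_sign {i} (K - {i}) * wedge_sign {j} (K - {i} - {j}) * (x $ i * y $ j - x $ j * y $ i) * z $ (K - {i, j}))"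
proof -
  let ?F = "\<lambda>i j. wedge_sign {i} (K - {i}) * wedge_sign {j} (K - {i} - {j}) * x $ i * y $ j * z $ (K - {i} - {j})"
  have "wedge (ext_of_vec x) (wedge (ext_of_vec y) z) $ K = (\<Sum>i\<in>K. \<Sum>j\<in>K - {i}. ?F i j)"
    unfolding wedge_ext_of_vec by (simp add: sum_distrib_left mult_ac)
  also have "\<dots> = (\<Sum>(i, j)\<in>{(i, j). i \<in> K \<and> j \<in> K \<and> i < j}. ?F i j + ?F j i)"
    by (rule sum_ordered_pairs)
  also have "\<dots> = (\<Sum>(i, j)\<in>{(i, j). i \<in> K \<and> j \<in> K \<and> i < j}.
      wedge_sign {i} (K - {i}) * wedge_sign {j} (K - {i} - {j}) * (x $ i * y $ j - x $ j * y $ i) * z $ (K - {i, j}))"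
  proof (rule sum.cong[OF refl], clarify)
    fix i j assume ij: "i \<in> K" "j \<in> K" "i < j"
    have sets: "K - {i} - {j} = K - {i, j}" "K - {j} - {i} = K - {i, j}" by auto
    have sw: "wedge_sign {j} (K - {j}) * wedge_sign {i} (K - {i, j}) = - (wedge_sign {i} (K - {i}) * wedge_sign {j} (K - {i, j}))"
      using wedge_sign_pair_swap[OF ij] unfolding sets .
    have "c * d * p * q * t + a * b * r * s * t = c * d * (p * q - r * s) * t" if "a * b = - (c * d)" for a b c d p q r s t :: real
      using that by algebra
    from this[OF sw] show "?F i j + ?F j i =
       wedge_sign {i} (K - {i}) * wedge_sign {j} (K - {i} - {j}) * (x $ i * y $ j - x $ j * y $ i) * z $ (K - {i, j})"
      unfolding sets by blast
  qed
  finally show ?thesis .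
qed

lemma wedge_ext_anticommute:
  fixes z :: "'n::{finite,linorder} ext"
  shows "wedge (ext_of_vec x) (wedge (ext_of_vec y) z) = - wedge (ext_of_vec y) (wedge (ext_of_vec x) z)"
  unfolding vec_eq_iff wedge_ext_twice uminus_vec_def
  by (auto simp: wedge_ext_twice sum_negf[symmetric] case_prod_unfold intro!: sum.cong) (simp add: algebra_simps)

lemma wedge_ext_self:
  fixes z :: "'n::{finite,linorder} ext"
  shows "wedge (ext_of_vec x) (wedge (ext_of_vec x) z) = 0"
  by (simp add: vec_eq_iff wedge_ext_twice case_prod_unfold)

lemma wedge_ext_linear: "linear (\<lambda>z. wedge (ext_of_vec x) z)" "linear (\<lambda>x. wedge (ext_of_vec x) z)"
  by (rule linearI; simp add: vec_eq_iff wedge_ext_of_vec algebra_simps sum.distrib sum_distrib_left)+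

lemma wedge_list_Cons: "wedge_list (v # vs) = wedge (ext_of_vec v) (wedge_list vs)"
  by (simp add: wedge_list_def)

lemma wedge_ext_mem_list: "x \<in> set vs \<Longrightarrow> wedge (ext_of_vec x) (wedge_list vs) = 0"
proof (induction vs)
  case (Cons v vs)
  show ?case
  proof (cases "x = v")
    case True
    then show ?thesis by (simp add: wedge_list_Cons wedge_ext_self)
  next
    case False
    then have "wedge (ext_of_vec x) (wedge_list vs) = 0" using Cons by simp
    then have "wedge (ext_of_vec v) (wedge (ext_of_vec x) (wedge_list vs)) = 0"
      by (simp add: linear_0[OF wedge_ext_linear(1)])
    then show ?thesis unfolding wedge_list_Cons wedge_ext_anticommute[of x v] by simp
  qed
qed simp

lemma wedge_ext_span_list: "x \<in> span (set vs) \<Longrightarrow> wedge (ext_of_vec x) (wedge_list vs) = 0"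
proof (rule span_induct[of x "set vs" "\<lambda>x. wedge (ext_of_vec x) (wedge_list vs) = 0"])
  show "subspace {x. wedge (ext_of_vec x) (wedge_list vs) = 0}"
    using wedge_ext_linear(2)[of "wedge_list vs"]
    by (auto simp: subspace_def linear_0[OF wedge_ext_linear(2)] linear_add[OF wedge_ext_linear(2)] linear_cmul[OF wedge_ext_linear(2)])
qed (auto simp: wedge_ext_mem_list)

lemma wedge_list_nth_card: "card K \<noteq> length vs \<Longrightarrow> wedge_list vs $ K = 0"
proof (induction vs arbitrary: K)
  case Nil
  then show ?case by (auto simp: wedge_list_def axis_def)
next
  case (Cons v vs)
  have "wedge_list vs $ (K - {i}) = 0" if "i \<in> K" for i
  proof (rule Cons.IH)
    have "card K > 0" using that by (auto simp: card_gt_0_iff)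
    then show "card (K - {i}) \<noteq> length vs" using that Cons.prems by simp
  qed
  then show ?case unfolding wedge_list_Cons wedge_ext_of_vec by (intro sum.neutral) auto
qed

section \<open>Bivectors, the Hodge map and the pairing\<close>

definition wedge2 :: "(real, 'n::{finite,linorder}) vec \<Rightarrow> (real, 'n) vec \<Rightarrow> 'n ext" where
  "wedge2 x y = wedge_list [x, y]"

definition bivectors :: "'n::{finite,linorder} ext set" where
  "bivectors = {p. \<forall>I. card I \<noteq> 2 \<longrightarrow> p $ I = 0}"

text \<open>Signs are chosen so that the pairing with \<open>r\<close> is the inner product with
  \<open>hodge r\<close>. For degree \<open>d - 1\<close> the image consists of bivectors, which
  puts rods and bars into one space.\<close>

definition hodge :: "'n::{finite,linorder} ext \<Rightarrow> 'n ext" where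
  "hodge r = (\<chi> I. wedge_sign I (- I) * r $ (- I))"

lemma pairing_eq_inner: "pairing p r = p \<bullet> hodge r"
proof -
  have "pairing p r = (\<Sum>I\<in>UNIV. wedge_sign I (- I) * p $ I * r $ (- I))"
    by (simp add: pairing_def wedge_def Compl_eq_Diff_UNIV)
  then show ?thesis by (simp add: inner_vec_def hodge_def mult_ac)
qed

lemma wedge_sign_square [simp]: "wedge_sign I J * wedge_sign I J = 1"
  by (simp add: wedge_sign_def flip: power_add)

text \<open>The arguments of the sign are exchanged relative to \<open>hodge\<close> because the
  coordinate at \<open>I\<close> comes back from the complement; the two equal signs then
  cancel.\<close>

definition hodge_inv :: "'n::{finite,linorder} ext \<Rightarrow> 'n ext" where
  "hodge_inv q = (\<chi> I. wedge_sign (- I) I * q $ (- I))"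

lemma hodge_inv: "hodge_inv (hodge r) = r" "hodge (hodge_inv q) = q"
  by (simp_all add: vec_eq_iff hodge_def hodge_inv_def mult.assoc[symmetric])

lemma wedge2_nth_pair:
  assumes "i < j" shows "wedge2 x y $ {i, j} = x $ i * y $ j - x $ j * y $ i"
proof -
  have P: "{(a, b). a \<in> {i, j} \<and> b \<in> {i, j} \<and> a < b} = {(i, j)}" using assms by auto
  have s: "wedge_sign {i} ({j} - {i}) = 1" "wedge_sign {j} ({j} - {i} - {j}) = 1"
  proof -
    have e: "{k \<in> {j} - {i}. k < i} = {}" "{k \<in> {j} - {i} - {j}. k < j} = {}" using assms by auto
    show "wedge_sign {i} ({j} - {i}) = 1" "wedge_sign {j} ({j} - {i} - {j}) = 1"
      unfolding wedge_sign_single e by (simp_all only: card.empty power_0)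
  qed
  have "wedge2 x y $ {i, j} = wedge (ext_of_vec x) (wedge (ext_of_vec y) (axis {} 1)) $ {i, j}"
    by (simp add: wedge2_def wedge_list_def)
  also have "\<dots> = x $ i * y $ j - x $ j * y $ i"
    unfolding wedge_ext_twice P by (simp add: s axis_def)
  finally show ?thesis .
qed

lemma wedge2_bivector: "wedge2 x y \<in> bivectors"
  by (auto simp: wedge2_def bivectors_def wedge_list_nth_card)

lemma subspace_bivectors: "subspace bivectors"
  by (auto simp: subspace_def bivectors_def)

lemma linear_wedge2: "linear (\<lambda>x. wedge2 x y)" "linear (wedge2 x)"
proof -
  have "wedge2 x = (\<lambda>y. wedge (ext_of_vec x) (wedge (ext_of_vec y) (axis {} 1)))"
    by (simp add: wedge2_def wedge_list_def fun_eq_iff)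
  then show "linear (wedge2 x)"
    using linear_compose[OF wedge_ext_linear(2)[of "axis {} 1"] wedge_ext_linear(1)[of x]] by (simp add: o_def)
  show "linear (\<lambda>x. wedge2 x y)"
    using wedge_ext_linear(2) by (simp add: wedge2_def wedge_list_def)
qed

lemma wedge2_self [simp]: "wedge2 x x = 0"
  by (simp add: wedge2_def wedge_list_def wedge_ext_self)

lemma wedge2_swap: "wedge2 y x = - wedge2 x y"
  by (simp add: wedge2_def wedge_list_def wedge_ext_anticommute[of y x])

lemmas wedge2_linear_simps =
  linear_add[OF linear_wedge2(1)] linear_add[OF linear_wedge2(2)]
  linear_diff[OF linear_wedge2(1)] linear_diff[OF linear_wedge2(2)]
  linear_cmul[OF linear_wedge2(1)] linear_cmul[OF linear_wedge2(2)]
  linear_0[OF linear_wedge2(1)] linear_0[OF linear_wedge2(2)]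

lemma bivector_eqI:
  assumes "p \<in> bivectors" "q \<in> bivectors" "\<And>i j. i < j \<Longrightarrow> p $ {i, j} = q $ {i, j}"
  shows "p = q"
proof (rule vec_eq_iff[THEN iffD2], rule allI)
  fix I
  show "p $ I = q $ I"
  proof (cases "card I = 2")
    case True
    then obtain i j where "I = {i, j}" "i \<noteq> j" by (auto simp: card_2_iff)
    then show ?thesis using assms(3)[of i j] assms(3)[of j i] by (cases "i < j") (auto simp: insert_commute)
  qed (use assms in \<open>auto simp: bivectors_def\<close>)
qed

lemma bivector_inner_eq:
  fixes p q :: "'n::{finite,linorder} ext"
  assumes "p \<in> bivectors"
  shows "p \<bullet> q = (\<Sum>(i, j)\<in>{(i, j). i < j}. p $ {i, j} * q $ {i, j})"
proof -
  have "p \<bullet> q = (\<Sum>I\<in>UNIV. p $ I * q $ I)" by (simp add: inner_vec_def)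
  also have "\<dots> = (\<Sum>I\<in>(\<lambda>(i, j). {i, j}) ` {(i, j). i < j}. p $ I * q $ I)"
  proof (rule sum.mono_neutral_right)
    show "\<forall>I\<in>UNIV - (\<lambda>(i, j). {i, j}) ` {(i, j). i < j}. p $ I * q $ I = 0"
    proof
      fix I assume I: "I \<in> UNIV - (\<lambda>(i, j). {i, j}) ` {(i::'n, j). i < j}"
      have "card I \<noteq> 2"
      proof
        assume "card I = 2"
        then obtain i j where ij: "I = {i, j}" "i \<noteq> j" by (auto simp: card_2_iff)
        then have "I \<in> (\<lambda>(i, j). {i, j}) ` {(i, j). i < j}"
        proof (cases "i < j")
          case True
          then show ?thesis using ij by (intro image_eqI[of _ _ "(i, j)"]) auto
        next
          case False
          then show ?thesis using ij by (intro image_eqI[of _ _ "(j, i)"]) auto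
        qed
        then show False using I by blast
      qed
      then show "p $ I * q $ I = 0" using assms by (simp add: bivectors_def)
    qed
  qed auto
  also have "\<dots> = (\<Sum>(i, j)\<in>{(i, j). i < j}. p $ {i, j} * q $ {i, j})"
    by (subst sum.reindex) (auto simp: inj_on_def case_prod_unfold doubleton_eq_iff)
  finally show ?thesis .
qed

lemma bivector_zeroI:
  fixes p :: "'n::{finite,linorder} ext"
  assumes p: "p \<in> bivectors" and "\<And>i j. p \<bullet> wedge2 (axis i 1) (axis j 1) = 0"
  shows "p = 0"
proof (rule bivector_eqI[OF p subspace_0[OF subspace_bivectors]])
  fix i j :: 'n assume ij: "i < j"
  have "p \<bullet> wedge2 (axis i 1) (axis j 1) = (\<Sum>(a, b)\<in>{(a, b). a < b}. p $ {a, b} * wedge2 (axis i 1) (axis j 1) $ {a, b})"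
    by (rule bivector_inner_eq[OF p])
  also have "\<dots> = (\<Sum>(a, b)\<in>{(i, j)}. p $ {a, b} * wedge2 (axis i 1) (axis j 1) $ {a, b})"
    by (rule sum.mono_neutral_right) (use ij in \<open>auto simp: wedge2_nth_pair axis_def split: if_splits intro: finite_subset[of _ UNIV]\<close>)
  also have "\<dots> = p $ {i, j}" using ij by (simp add: wedge2_nth_pair axis_def)
  finally show "p $ {i, j} = 0 $ {i, j}" using assms(2) by simp
qed

text \<open>The Binet-Cauchy identity. It translates orthogonality of decomposable bivectors into a
  2 by 2 determinant of inner products, the form in which incidences are used below.\<close>

lemma wedge2_inner:
  fixes x y a b :: "(real, 'n::{finite,linorder}) vec"
  shows "wedge2 x y \<bullet> wedge2 a b = (x \<bullet> a) * (y \<bullet> b) - (x \<bullet> b) * (y \<bullet> a)"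
proof -
  let ?F = "\<lambda>i j. x $ i * y $ j * a $ i * b $ j - x $ i * y $ j * a $ j * b $ i"
  have "(x \<bullet> a) * (y \<bullet> b) - (x \<bullet> b) * (y \<bullet> a) = (\<Sum>i\<in>UNIV. \<Sum>j\<in>UNIV. ?F i j)"
  proof -
    have "(x \<bullet> a) * (y \<bullet> b) = (\<Sum>i\<in>UNIV. \<Sum>j\<in>UNIV. x $ i * y $ j * a $ i * b $ j)"
      unfolding inner_vec_def sum_product by (intro sum.cong refl) simp
    moreover have "(x \<bullet> b) * (y \<bullet> a) = (\<Sum>i\<in>UNIV. \<Sum>j\<in>UNIV. x $ i * y $ j * a $ j * b $ i)"
      unfolding inner_vec_def sum_product by (intro sum.cong refl) simp
    ultimately show ?thesis by (simp add: sum_subtractf)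
  qed
  also have "\<dots> = (\<Sum>i\<in>UNIV. \<Sum>j\<in>UNIV - {i}. ?F i j)"
    by (rule sum.cong[OF refl], rule sum.mono_neutral_right) auto
  also have "\<dots> = (\<Sum>(i, j)\<in>{(i, j). i \<in> UNIV \<and> j \<in> UNIV \<and> i < j}. ?F i j + ?F j i)"
    by (rule sum_ordered_pairs)
  also have "\<dots> = (\<Sum>(i, j)\<in>{(i, j). i < j}. wedge2 x y $ {i, j} * wedge2 a b $ {i, j})"
    by (rule sum.cong) (auto simp: wedge2_nth_pair algebra_simps)
  also have "\<dots> = wedge2 x y \<bullet> wedge2 a b" by (rule bivector_inner_eq[OF wedge2_bivector, symmetric])
  finally show ?thesis by simp
qed

text \<open>The top-degree instance of associativity of the exterior product, with both sides
  expanded over ordered pairs of indices.\<close>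

lemma pairing_wedge2:
  fixes r :: "'n::{finite,linorder} ext"
  shows "pairing (wedge2 x y) r = wedge (ext_of_vec x) (wedge (ext_of_vec y) r) $ UNIV"
proof -
  have "pairing (wedge2 x y) r = (\<Sum>(i, j)\<in>{(i, j). i < j}. wedge2 x y $ {i, j} * hodge r $ {i, j})"
    unfolding pairing_eq_inner by (rule bivector_inner_eq[OF wedge2_bivector])
  also have "\<dots> = wedge (ext_of_vec x) (wedge (ext_of_vec y) r) $ UNIV"
    unfolding wedge_ext_twice
  proof (rule sum.cong, simp, clarify)
    fix i j :: 'n assume ij: "i < j"
    have "hodge r $ {i, j} = wedge_sign {i} (UNIV - {i}) * wedge_sign {j} (UNIV - {i} - {j}) * r $ (UNIV - {i, j})"
      by (simp only: hodge_def vec_lambda_beta wedge_sign_pair[OF ij]) (simp only: Compl_eq_Diff_UNIV)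
    then show "wedge2 x y $ {i, j} * hodge r $ {i, j} =
        wedge_sign {i} (UNIV - {i}) * wedge_sign {j} (UNIV - {i} - {j}) * (x $ i * y $ j - x $ j * y $ i) * r $ (UNIV - {i, j})"
      by (simp only: wedge2_nth_pair[OF ij] mult_ac)
  qed
  finally show ?thesis .
qed

lemma hodge_bivector:
  fixes vs :: "(real, 'n::{finite,linorder}) vec list"
  assumes "length vs + 2 = CARD('n)"
  shows "hodge (wedge_list vs) \<in> bivectors"
proof -
  have "hodge (wedge_list vs) $ I = 0" if "card I \<noteq> 2" for I
  proof -
    have "card (- I) + card I = CARD('n)" using card_mono[of UNIV I] by (simp add: Compl_eq_Diff_UNIV card_Diff_subset)
    then have "card (- I) \<noteq> length vs" using that assms by linarith
    then show ?thesis by (simp add: hodge_def wedge_list_nth_card)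
  qed
  then show ?thesis by (simp add: bivectors_def)
qed

lemma inner_wedge2_simps:
  "p \<bullet> wedge2 (x + x') y = p \<bullet> wedge2 x y + p \<bullet> wedge2 x' y"
  "p \<bullet> wedge2 x (y + y') = p \<bullet> wedge2 x y + p \<bullet> wedge2 x y'"
  "p \<bullet> wedge2 (x - x') y = p \<bullet> wedge2 x y - p \<bullet> wedge2 x' y"
  "p \<bullet> wedge2 x (y - y') = p \<bullet> wedge2 x y - p \<bullet> wedge2 x y'"
  "p \<bullet> wedge2 (c *\<^sub>R x) y = c * (p \<bullet> wedge2 x y)"
  "p \<bullet> wedge2 x (c *\<^sub>R y) = c * (p \<bullet> wedge2 x y)"
  "p \<bullet> wedge2 0 y = 0" "p \<bullet> wedge2 x 0 = 0"
  by (simp_all add: wedge2_linear_simps inner_add_right inner_diff_right)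

lemma inner_wedge2_swap: "p \<bullet> wedge2 y x = - (p \<bullet> wedge2 x y)"
  by (subst wedge2_swap) simp

lemma inner_wedge2_sum:
  "p \<bullet> wedge2 (\<Sum>i\<in>A. c i *\<^sub>R f i) y = (\<Sum>i\<in>A. c i * (p \<bullet> wedge2 (f i) y))"
  "p \<bullet> wedge2 y (\<Sum>i\<in>A. c i *\<^sub>R f i) = (\<Sum>i\<in>A. c i * (p \<bullet> wedge2 y (f i)))"
  by (simp_all add: linear_sum[OF linear_wedge2(1)] linear_sum[OF linear_wedge2(2)] wedge2_linear_simps inner_sum_right)

section \<open>Bivectors that vanish on pencils\<close>

lemma dual_vector:
  fixes x :: "'a::euclidean_space"
  assumes "x \<notin> span S"
  obtains a where "a \<bullet> x = 1" "\<And>y. y \<in> S \<Longrightarrow> a \<bullet> y = 0"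
proof -
  obtain y z where yz: "y \<in> span S" "\<And>w. w \<in> span S \<Longrightarrow> orthogonal z w" "x = y + z"
    using orthogonal_subspace_decomp_exists[of S x] by blast
  have "z \<noteq> 0" using assms yz by auto
  then have z: "z \<bullet> z \<noteq> 0" by simp
  have "z \<bullet> y = 0" using yz(1,2) by (simp add: orthogonal_def)
  then have "((1 / (z \<bullet> z)) *\<^sub>R z) \<bullet> x = 1" using z yz(3) by (simp add: inner_add_right)
  moreover have "((1 / (z \<bullet> z)) *\<^sub>R z) \<bullet> w = 0" if "w \<in> S" for w
    using yz(2)[OF span_base[OF that]] by (simp add: orthogonal_def)
  ultimately show ?thesis using that by blast
qed

lemma dual_vector_exists: "x \<notin> span S \<Longrightarrow> \<exists>a. a \<bullet> x = 1 \<and> (\<forall>y\<in>S. a \<bullet> y = 0)"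
  for x :: "'a::euclidean_space"
  by (erule dual_vector) blast

text \<open>With vectors \<open>a\<close>, \<open>b\<close> dual to \<open>\<alpha>\<close>,
  \<open>\<beta>\<close>, every vector is a combination of \<open>a\<close> and \<open>b\<close>
  modulo the common kernel, on which \<open>p\<close> vanishes as a form. So \<open>p\<close> is
  determined by its value at \<open>a\<close>, \<open>b\<close>, and the remaining determinant is
  the form of \<open>wedge2 \<alpha> \<beta>\<close>.\<close>

lemma bivector_vanishing_on_pencil:
  fixes p :: "'n::{finite,linorder} ext"
  assumes p: "p \<in> bivectors" and ind: "\<alpha> \<notin> span {\<beta>}" "\<beta> \<notin> span {\<alpha>}"
    and van: "\<And>x y. x \<bullet> \<alpha> = 0 \<Longrightarrow> x \<bullet> \<beta> = 0 \<Longrightarrow> p \<bullet> wedge2 x y = 0"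
  shows "\<exists>c. p = c *\<^sub>R wedge2 \<alpha> \<beta>"
proof -
  obtain a where a: "a \<bullet> \<alpha> = 1" "a \<bullet> \<beta> = 0"
    using dual_vector_exists[OF ind(1)] by auto
  obtain b where b: "b \<bullet> \<beta> = 1" "b \<bullet> \<alpha> = 0"
    using dual_vector_exists[OF ind(2)] by auto
  have van': "p \<bullet> wedge2 y x = 0" if "x \<bullet> \<alpha> = 0" "x \<bullet> \<beta> = 0" for x y
    using van[OF that, of y] by (subst inner_wedge2_swap) simp
  have main: "p \<bullet> wedge2 x y = (p \<bullet> wedge2 a b) * (wedge2 x y \<bullet> wedge2 \<alpha> \<beta>)" for x y
  proof -
    define x0 where "x0 = x - (x \<bullet> \<alpha>) *\<^sub>R a - (x \<bullet> \<beta>) *\<^sub>R b"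
    define y0 where "y0 = y - (y \<bullet> \<alpha>) *\<^sub>R a - (y \<bullet> \<beta>) *\<^sub>R b"
    have x0: "x0 \<bullet> \<alpha> = 0" "x0 \<bullet> \<beta> = 0" and y0: "y0 \<bullet> \<alpha> = 0" "y0 \<bullet> \<beta> = 0"
      by (simp_all add: x0_def y0_def inner_diff_left a b)
    have x: "x = x0 + ((x \<bullet> \<alpha>) *\<^sub>R a + (x \<bullet> \<beta>) *\<^sub>R b)" and y: "y = y0 + ((y \<bullet> \<alpha>) *\<^sub>R a + (y \<bullet> \<beta>) *\<^sub>R b)"
      by (simp_all add: x0_def y0_def)
    have "p \<bullet> wedge2 x y = p \<bullet> wedge2 ((x \<bullet> \<alpha>) *\<^sub>R a + (x \<bullet> \<beta>) *\<^sub>R b) ((y \<bullet> \<alpha>) *\<^sub>R a + (y \<bullet> \<beta>) *\<^sub>R b)"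
    proof -
      have "p \<bullet> wedge2 x y = p \<bullet> wedge2 (x0 + ((x \<bullet> \<alpha>) *\<^sub>R a + (x \<bullet> \<beta>) *\<^sub>R b)) (y0 + ((y \<bullet> \<alpha>) *\<^sub>R a + (y \<bullet> \<beta>) *\<^sub>R b))"
        by (rule arg_cong2[where f = "\<lambda>a b. p \<bullet> wedge2 a b", OF x y])
      then show ?thesis by (simp only: inner_wedge2_simps(1,2) van[OF x0] van'[OF y0] add_0_left add_0_right)
    qed
    also have "\<dots> = (p \<bullet> wedge2 a b) * ((x \<bullet> \<alpha>) * (y \<bullet> \<beta>) - (x \<bullet> \<beta>) * (y \<bullet> \<alpha>))"
      by (simp add: inner_wedge2_simps inner_wedge2_swap[of p b a] algebra_simps)
    finally show ?thesis by (simp add: wedge2_inner)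
  qed
  have "p - (p \<bullet> wedge2 a b) *\<^sub>R wedge2 \<alpha> \<beta> = 0"
  proof (rule bivector_zeroI)
    show "p - (p \<bullet> wedge2 a b) *\<^sub>R wedge2 \<alpha> \<beta> \<in> bivectors"
      by (intro subspace_diff subspace_scale subspace_bivectors p wedge2_bivector)
    show "(p - (p \<bullet> wedge2 a b) *\<^sub>R wedge2 \<alpha> \<beta>) \<bullet> wedge2 (axis i 1) (axis j 1) = 0" for i j
      using main[of "axis i 1" "axis j 1"] by (simp add: inner_diff_left inner_commute[of "wedge2 (axis i 1) (axis j 1)"])
  qed
  then show ?thesis by (intro exI[of _ "p \<bullet> wedge2 a b"]) simp
qed

text \<open>Four dual vectors split \<open>x\<close> into \<open>x0 x\<close>, in both kernels,
  \<open>u x\<close>, in the kernel of \<open>\<alpha>'\<close> and \<open>\<beta>'\<close>, and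
  \<open>u' x\<close>, in the kernel of \<open>\<alpha>\<close> and \<open>\<beta>\<close>. The
  hypothesis kills all mixed terms; the two that survive are multiples of the forms of the two
  rods.\<close>

lemma bivector_vanishing_on_two_pencils:
  fixes p :: "'n::{finite,linorder} ext"
  assumes p: "p \<in> bivectors"
    and ind: "\<alpha> \<notin> span {\<beta>, \<alpha>', \<beta>'}" "\<beta> \<notin> span {\<alpha>, \<alpha>', \<beta>'}" "\<alpha>' \<notin> span {\<alpha>, \<beta>, \<beta>'}" "\<beta>' \<notin> span {\<alpha>, \<beta>, \<alpha>'}"
    and van: "\<And>x y. x \<bullet> \<alpha> = 0 \<Longrightarrow> x \<bullet> \<beta> = 0 \<Longrightarrow> y \<bullet> \<alpha>' = 0 \<Longrightarrow> y \<bullet> \<beta>' = 0 \<Longrightarrow> p \<bullet> wedge2 x y = 0"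
  shows "\<exists>c c'. p = c *\<^sub>R wedge2 \<alpha> \<beta> + c' *\<^sub>R wedge2 \<alpha>' \<beta>'"
proof -
  obtain a where a: "a \<bullet> \<alpha> = 1" "a \<bullet> \<beta> = 0" "a \<bullet> \<alpha>' = 0" "a \<bullet> \<beta>' = 0"
    using dual_vector_exists[OF ind(1)] by auto
  obtain b where b: "b \<bullet> \<beta> = 1" "b \<bullet> \<alpha> = 0" "b \<bullet> \<alpha>' = 0" "b \<bullet> \<beta>' = 0"
    using dual_vector_exists[OF ind(2)] by auto
  obtain a' where a': "a' \<bullet> \<alpha>' = 1" "a' \<bullet> \<alpha> = 0" "a' \<bullet> \<beta> = 0" "a' \<bullet> \<beta>' = 0"
    using dual_vector_exists[OF ind(3)] by auto
  obtain b' where b': "b' \<bullet> \<beta>' = 1" "b' \<bullet> \<alpha> = 0" "b' \<bullet> \<beta> = 0" "b' \<bullet> \<alpha>' = 0"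
    using dual_vector_exists[OF ind(4)] by auto
  have van': "p \<bullet> wedge2 y x = 0" if "x \<bullet> \<alpha> = 0" "x \<bullet> \<beta> = 0" "y \<bullet> \<alpha>' = 0" "y \<bullet> \<beta>' = 0" for x y
    using van[OF that] by (subst inner_wedge2_swap) simp
  define u where "u x = (x \<bullet> \<alpha>) *\<^sub>R a + (x \<bullet> \<beta>) *\<^sub>R b" for x
  define u' where "u' x = (x \<bullet> \<alpha>') *\<^sub>R a' + (x \<bullet> \<beta>') *\<^sub>R b'" for x
  define x0 where "x0 x = x - u x - u' x" for x
  have u: "u x \<bullet> \<alpha>' = 0" "u x \<bullet> \<beta>' = 0" "u' x \<bullet> \<alpha> = 0" "u' x \<bullet> \<beta> = 0"
      "u x \<bullet> \<alpha> = x \<bullet> \<alpha>" "u x \<bullet> \<beta> = x \<bullet> \<beta>" "u' x \<bullet> \<alpha>' = x \<bullet> \<alpha>'" "u' x \<bullet> \<beta>' = x \<bullet> \<beta>'" for x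
    by (simp_all add: u_def u'_def inner_add_left a b a' b')
  have x0: "x0 x \<bullet> \<alpha> = 0" "x0 x \<bullet> \<beta> = 0" "x0 x \<bullet> \<alpha>' = 0" "x0 x \<bullet> \<beta>' = 0" for x
    by (simp_all add: x0_def inner_diff_left u)
  have x: "x = x0 x + (u x + u' x)" for x by (simp add: x0_def)
  have main: "p \<bullet> wedge2 x y = (p \<bullet> wedge2 a b) * (wedge2 x y \<bullet> wedge2 \<alpha> \<beta>) + (p \<bullet> wedge2 a' b') * (wedge2 x y \<bullet> wedge2 \<alpha>' \<beta>')" for x y
  proof -
    have z: "p \<bullet> wedge2 (x0 x) (x0 y) = 0" "p \<bullet> wedge2 (x0 x) (u y) = 0" "p \<bullet> wedge2 (x0 x) (u' y) = 0"
        "p \<bullet> wedge2 (u x) (x0 y) = 0" "p \<bullet> wedge2 (u' x) (x0 y) = 0" "p \<bullet> wedge2 (u' x) (u y) = 0" "p \<bullet> wedge2 (u x) (u' y) = 0" for x y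
      by (rule van van'; simp add: x0 u)+
    have "p \<bullet> wedge2 x y = p \<bullet> wedge2 (x0 x + (u x + u' x)) (x0 y + (u y + u' y))"
      by (rule arg_cong2[where f = "\<lambda>a b. p \<bullet> wedge2 a b", OF x[of x] x[of y]])
    also have "\<dots> = p \<bullet> wedge2 (u x) (u y) + p \<bullet> wedge2 (u' x) (u' y)"
      by (simp only: inner_wedge2_simps(1,2) z add_0_left add_0_right)
    also have "p \<bullet> wedge2 (u x) (u y) = (p \<bullet> wedge2 a b) * ((x \<bullet> \<alpha>) * (y \<bullet> \<beta>) - (x \<bullet> \<beta>) * (y \<bullet> \<alpha>))"
      by (simp add: u_def inner_wedge2_simps inner_wedge2_swap[of p b a] algebra_simps)
    also have "p \<bullet> wedge2 (u' x) (u' y) = (p \<bullet> wedge2 a' b') * ((x \<bullet> \<alpha>') * (y \<bullet> \<beta>') - (x \<bullet> \<beta>') * (y \<bullet> \<alpha>'))"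
      by (simp add: u'_def inner_wedge2_simps inner_wedge2_swap[of p b' a'] algebra_simps)
    finally show ?thesis by (simp add: wedge2_inner)
  qed
  let ?q = "(p \<bullet> wedge2 a b) *\<^sub>R wedge2 \<alpha> \<beta> + (p \<bullet> wedge2 a' b') *\<^sub>R wedge2 \<alpha>' \<beta>'"
  have "p - ?q = 0"
  proof (rule bivector_zeroI)
    show "p - ?q \<in> bivectors"
      by (intro subspace_diff subspace_add subspace_scale subspace_bivectors p wedge2_bivector)
    show "(p - ?q) \<bullet> wedge2 (axis i 1) (axis j 1) = 0" for i j
      using main[of "axis i 1" "axis j 1"] by (simp add: inner_diff_left inner_add_left inner_commute[of "wedge2 (axis i 1) (axis j 1)"])
  qed
  then have "p = ?q" by simp
  then show ?thesis by blast
qed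

lemma dim_orthogonal_complement:
  fixes S :: "'a::euclidean_space set"
  shows "dim {x. \<forall>a\<in>S. x \<bullet> a = 0} + dim S = DIM('a)"
proof -
  have "dim {y \<in> UNIV. \<forall>x\<in>span S. orthogonal x y} + dim (span S) = dim (UNIV :: 'a set)"
    by (rule dim_subspace_orthogonal_to_vectors) auto
  moreover have "{y \<in> UNIV. \<forall>x\<in>span S. orthogonal x y} = {x. \<forall>a\<in>S. x \<bullet> a = 0}"
  proof (intro equalityI subsetI)
    fix y assume y: "y \<in> {x. \<forall>a\<in>S. x \<bullet> a = 0}"
    have "orthogonal y x" if "x \<in> span S" for x
      using that by (rule orthogonal_to_span) (use y in \<open>auto simp: orthogonal_def\<close>)
    then show "y \<in> {y \<in> UNIV. \<forall>x\<in>span S. orthogonal x y}" by (simp add: orthogonal_commute)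
  qed (auto simp: orthogonal_def span_base inner_commute)
  ultimately show ?thesis by (simp add: dim_span)
qed

text \<open>\<open>\<alpha>\<close>, \<open>\<beta>\<close> are a basis of the orthogonal complement
  of the rod, hence its linear equations. Vectors satisfying them lie in the span of
  \<open>vs\<close> and are annihilated by the wedge product, so the bivector vanishes on this
  pencil.\<close>

lemma hodge_wedge_list:
  fixes vs :: "(real, 'n::{finite,linorder}) vec list"
  assumes len: "length vs + 2 = CARD('n)" and vs: "distinct vs" "independent (set vs)"
  shows "\<exists>\<alpha> \<beta>. hodge (wedge_list vs) = wedge2 \<alpha> \<beta>"
proof -
  let ?X = "{x. \<forall>a\<in>set vs. x \<bullet> a = 0}"
  have "dim (set vs) = length vs" using vs by (simp add: dim_eq_card_independent distinct_card)
  then have "dim ?X = 2" using dim_orthogonal_complement[of "set vs"] len by simp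
  moreover obtain B where B: "B \<subseteq> ?X" "independent B" "?X \<subseteq> span B" "card B = dim ?X" using basis_exists by blast
  ultimately obtain \<alpha> \<beta> where ab: "B = {\<alpha>, \<beta>}" "\<alpha> \<noteq> \<beta>" by (auto simp: card_2_iff)
  have ind: "\<alpha> \<notin> span {\<beta>}" "\<beta> \<notin> span {\<alpha>}"
    using B(2) ab unfolding dependent_def by (auto simp: insert_Diff_if)
  \<comment> \<open>The orthogonal complement of the complement is the span again: the component of
    \<open>x\<close> orthogonal to \<open>vs\<close> is also orthogonal to itself.\<close>
  have sp: "x \<in> span (set vs)" if x: "x \<bullet> \<alpha> = 0" "x \<bullet> \<beta> = 0" for x
  proof -
    obtain y z where yz: "y \<in> span (set vs)" "\<And>w. w \<in> span (set vs) \<Longrightarrow> orthogonal z w" "x = y + z"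
      using orthogonal_subspace_decomp_exists[of "set vs" x] by blast
    have "z \<in> ?X" using yz(2) by (auto simp: orthogonal_def span_base)
    then have zB: "z \<in> span {\<alpha>, \<beta>}" using B(3) ab by auto
    have yo: "y \<bullet> a = 0" if "a \<in> {\<alpha>, \<beta>}" for a
    proof -
      have "a \<in> ?X" using that B(1) ab by auto
      then have "orthogonal a y" by (intro orthogonal_to_span[OF yz(1)]) (auto simp: orthogonal_def)
      then show ?thesis by (simp add: orthogonal_def inner_commute)
    qed
    have "orthogonal z z"
    proof (rule orthogonal_to_span[OF zB])
      fix a assume a: "a \<in> {\<alpha>, \<beta>}"
      then have "x \<bullet> a = 0" using x by auto
      then show "orthogonal z a" using yo[OF a] yz(3) by (simp add: orthogonal_def inner_add_left)
    qed
    then show ?thesis using yz by (simp add: orthogonal_def)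
  qed
  have "\<exists>c. hodge (wedge_list vs) = c *\<^sub>R wedge2 \<alpha> \<beta>"
  proof (rule bivector_vanishing_on_pencil[OF hodge_bivector[OF len] ind])
    fix x y assume "x \<bullet> \<alpha> = 0" "x \<bullet> \<beta> = 0"
    then have w: "wedge (ext_of_vec x) (wedge_list vs) = 0" by (intro wedge_ext_span_list sp)
    have "hodge (wedge_list vs) \<bullet> wedge2 x y = pairing (wedge2 x y) (wedge_list vs)"
      by (simp add: pairing_eq_inner inner_commute)
    also have "\<dots> = wedge (ext_of_vec x) (wedge (ext_of_vec y) (wedge_list vs)) $ UNIV" by (rule pairing_wedge2)
    also have "\<dots> = 0" unfolding wedge_ext_anticommute[of x y] w by (simp add: linear_0[OF wedge_ext_linear(1)])
    finally show "hodge (wedge_list vs) \<bullet> wedge2 x y = 0" .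
  qed
  then obtain c where "hodge (wedge_list vs) = wedge2 (c *\<^sub>R \<alpha>) \<beta>" by (auto simp: wedge2_linear_simps)
  then show ?thesis by blast
qed

lemma Gr_cone_hodge:
  fixes r :: "'n::{finite,linorder} ext"
  assumes "r \<in> Gr_cone k" "k + 2 = CARD('n)"
  shows "\<exists>\<alpha> \<beta>. hodge r = wedge2 \<alpha> \<beta>"
proof -
  obtain vs where "r = wedge_list vs" "length vs = k" "distinct vs" "independent (set vs)"
    using assms(1) unfolding Gr_cone_def by blast
  then show ?thesis using hodge_wedge_list[of vs] assms(2) by blast
qed

lemma Gr_cone_2_wedge2: "q \<in> Gr_cone 2 \<Longrightarrow> \<exists>x y. q = wedge2 x y"
proof -
  assume "q \<in> Gr_cone 2"
  then obtain vs where vs: "q = wedge_list vs" "length vs = 2" unfolding Gr_cone_def by blast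
  then obtain x y where "vs = [x, y]" by (auto simp: length_Suc_conv numeral_2_eq_2)
  then show ?thesis using vs(1) by (auto simp: wedge2_def)
qed

section \<open>Charts of decomposable bivectors\<close>

text \<open>The basis is indexed by a subset of \<open>'n\<close> so that the parameters of all
  charts live in one finite type, whatever the dimension of the subspace.\<close>

lemma subspace_indexed_basis:
  fixes X :: "(real, 'n::finite) vec set"
  assumes X: "subspace X"
  obtains K :: "'n set" and f where "card K = dim X" "\<And>i. i \<in> K \<Longrightarrow> f i \<in> X"
    "\<And>x. x \<in> X \<Longrightarrow> \<exists>c. x = (\<Sum>i\<in>K. c i *\<^sub>R f i)"
proof -
  obtain B where B: "B \<subseteq> X" "independent B" "X \<subseteq> span B" "card B = dim X" using basis_exists by blast
  have finB: "finite B" using B(2) by (rule independent_imp_finite)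
  have "dim X \<le> CARD('n)" using dim_subset_UNIV[of X] by simp
  then obtain K :: "'n set" where K: "card K = dim X" using obtain_subset_with_card_n[of "dim X" "UNIV :: 'n set"] by blast
  then obtain f where f: "bij_betw f K B" using finite_same_card_bij[of K B] finB B(4) by auto
  show ?thesis
  proof (rule that[of K f])
    show "card K = dim X" by (rule K)
    show "f i \<in> X" if "i \<in> K" for i using that f B(1) by (auto simp: bij_betw_def)
    fix x assume x: "x \<in> X"
    then have "x \<in> range (\<lambda>u. \<Sum>b\<in>B. u b *\<^sub>R b)" using B(3) unfolding span_finite[OF finB] by blast
    then obtain u where "x = (\<Sum>b\<in>B. u b *\<^sub>R b)" by blast
    also have "\<dots> = (\<Sum>i\<in>K. u (f i) *\<^sub>R f i)" by (rule sum.reindex_bij_betw[OF f, symmetric])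
    finally show "\<exists>c. x = (\<Sum>i\<in>K. c i *\<^sub>R f i)" by (rule exI[of _ "\<lambda>i. u (f i)"])
  qed
qed

text \<open>A chart parametrises decomposable bivectors \<open>x \<and> y\<close> with \<open>x\<close> in an affine and \<open>y\<close> in a linear
  space. It has one real parameter for each of its indices.\<close>

type_synonym 'n chart = "(real, 'n) vec \<times> ('n \<Rightarrow> (real, 'n) vec) \<times> 'n set \<times> ('n \<Rightarrow> (real, 'n) vec) \<times> 'n set"

text \<open>Parameters flagged \<open>True\<close> belong to the affine factor, those flagged
  \<open>False\<close> to the linear one. The linear factor carries the scale, as a cone and not
  only its projective points is parametrised.\<close>

definition chart_map :: "'n::{finite,linorder} chart \<Rightarrow> (bool \<times> 'n \<Rightarrow> real) \<Rightarrow> 'n ext" where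
  "chart_map ch \<tau> = (case ch of (x0, f, A, g, B) \<Rightarrow>
     wedge2 (x0 + (\<Sum>i\<in>A. \<tau> (True, i) *\<^sub>R f i)) (\<Sum>j\<in>B. \<tau> (False, j) *\<^sub>R g j))"

definition chart_indices :: "'n chart \<Rightarrow> (bool \<times> 'n) set" where
  "chart_indices ch = (case ch of (x0, f, A, g, B) \<Rightarrow> {True} \<times> A \<union> {False} \<times> B)"

lemma card_chart_indices:
  fixes A B :: "'n::finite set"
  shows "card (chart_indices (x0, f, A, g, B)) = card A + card B"
  unfolding chart_indices_def prod.case by (subst card_Un_disjoint) (auto simp: card_cartesian_product)

lemma chart_map_cong:
  assumes "\<And>i. i \<in> chart_indices ch \<Longrightarrow> \<tau> i = \<tau>' i"
  shows "chart_map ch \<tau> = chart_map ch \<tau>'"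
proof -
  obtain x0 f A g B where ch: "ch = (x0, f, A, g, B)" by (cases ch) auto
  have "(\<Sum>i\<in>A. \<tau> (True, i) *\<^sub>R f i) = (\<Sum>i\<in>A. \<tau>' (True, i) *\<^sub>R f i)"
    "(\<Sum>j\<in>B. \<tau> (False, j) *\<^sub>R g j) = (\<Sum>j\<in>B. \<tau>' (False, j) *\<^sub>R g j)"
    using assms by (auto intro!: sum.cong simp: ch chart_indices_def)
  then show ?thesis by (simp add: chart_map_def ch)
qed

text \<open>A chart is affine in one group of parameters and linear in the other; values 0 and 1
  isolate its coefficients, where those of the base point must be handled before the mixed
  ones.\<close>

lemma chart_map_vanishing:
  fixes x0 :: "(real, 'n::{finite,linorder}) vec"
  assumes "\<And>\<tau>. p \<bullet> chart_map (x0, f, A, g, B) \<tau> = 0"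
  shows "j \<in> B \<Longrightarrow> p \<bullet> wedge2 x0 (g j) = 0" "i \<in> A \<Longrightarrow> j \<in> B \<Longrightarrow> p \<bullet> wedge2 (f i) (g j) = 0"
proof -
  have sel: "(\<Sum>i\<in>S. (if i = k then 1 else 0) *\<^sub>R h i) = h k" if "k \<in> S" for S :: "'n set" and k and h :: "'n \<Rightarrow> (real, 'n) vec"
  proof -
    have "(\<Sum>i\<in>S. (if i = k then 1 else 0) *\<^sub>R h i) = (\<Sum>i\<in>S. if i = k then h i else 0)" by (intro sum.cong) auto
    then show ?thesis using that by simp
  qed
  show 1: "p \<bullet> wedge2 x0 (g j) = 0" if "j \<in> B" for j
    using assms[of "\<lambda>(b, i). if b then 0 else if i = j then 1 else 0"] sel[OF that, of g] by (simp add: chart_map_def)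
  show "p \<bullet> wedge2 (f i) (g j) = 0" if "i \<in> A" "j \<in> B" for i j
    using assms[of "\<lambda>(b, k). if b then if k = i then 1 else 0 else if k = j then 1 else 0"] sel[OF that(2), of g] sel[OF that(1), of f] 1[OF that(2)]
    by (simp add: chart_map_def inner_wedge2_simps)
qed

text \<open>Row-reduced bases of planes: the first vector has coordinate 1 at \<open>b\<close> and 0
  at \<open>a\<close>, the second has 0 at \<open>b\<close>. With \<open>n = CARD('n)\<close> this
  leaves \<open>(n - 2) + (n - 1)\<close> parameters, the dimension of the cone over the planes in
  \<open>n\<close>-space.\<close>

definition free_chart :: "'n::{finite,linorder} \<Rightarrow> 'n \<Rightarrow> 'n chart" where
  "free_chart a b = (axis b 1, \<lambda>i. axis i 1, - {a, b}, \<lambda>i. axis i 1, - {b})"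

lemma vec_eq_sum_axis:
  assumes "\<And>i. i \<notin> S \<Longrightarrow> x $ i = 0"
  shows "x = (\<Sum>i\<in>S. (x $ i) *\<^sub>R axis i 1)"
proof -
  have "(\<Sum>i\<in>S. (x $ i) *\<^sub>R axis i 1) $ k = x $ k" for k
  proof -
    have "(\<Sum>i\<in>S. (x $ i) *\<^sub>R axis i 1) $ k = (\<Sum>i\<in>S. if i = k then x $ i else 0)"
      by (simp add: axis_def if_distrib cong: if_cong)
    then show ?thesis using assms[of k] by (cases "k \<in> S") simp_all
  qed
  then show ?thesis by (simp add: vec_eq_iff)
qed

lemma free_chart_cover:
  fixes x y :: "(real, 'n::{finite,linorder}) vec"
  assumes "CARD('n) \<ge> 2"
  shows "\<exists>a b \<tau>. a \<noteq> b \<and> wedge2 x y = chart_map (free_chart a b) \<tau>"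
proof (cases "wedge2 x y = 0")
  case True
  obtain a b :: 'n where "a \<noteq> b"
    using assms card_le_Suc0_iff_eq[of "UNIV :: 'n set"] by force
  then have "a \<noteq> b \<and> wedge2 x y = chart_map (free_chart a b) (\<lambda>_. 0)"
    by (simp add: chart_map_def free_chart_def True wedge2_linear_simps)
  then show ?thesis by blast
next
  case False
  then have "x \<noteq> 0" by (auto simp: wedge2_linear_simps)
  then obtain b where b: "x $ b \<noteq> 0" by (metis vec_eq_iff zero_index)
  \<comment> \<open>Row operations of total determinant 1 leave the bivector unchanged: the factor
    \<open>x $ b\<close> on \<open>y\<close> compensates for normalising \<open>x\<close>.\<close>
  define y1 where "y1 = (x $ b) *\<^sub>R y - y $ b *\<^sub>R x"
  define x1 where "x1 = (1 / x $ b) *\<^sub>R x"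
  have e1: "wedge2 x y = wedge2 x1 y1" using b by (simp add: x1_def y1_def wedge2_linear_simps)
  then have "y1 \<noteq> 0" using False by (auto simp: wedge2_linear_simps)
  then obtain a where a: "y1 $ a \<noteq> 0" by (metis vec_eq_iff zero_index)
  have y1b: "y1 $ b = 0" by (simp add: y1_def)
  then have ab: "a \<noteq> b" using a by auto
  define x2 where "x2 = x1 - (x1 $ a / y1 $ a) *\<^sub>R y1"
  have e2: "wedge2 x1 y1 = wedge2 x2 y1" by (simp add: x2_def wedge2_linear_simps)
  have x2: "x2 $ b = 1" "x2 $ a = 0" using a b y1b by (simp_all add: x2_def x1_def)
  let ?\<tau> = "\<lambda>(c, i). if c then x2 $ i else y1 $ i"
  have "x2 - axis b 1 = (\<Sum>i\<in>- {a, b}. ((x2 - axis b 1) $ i) *\<^sub>R axis i 1)"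
    by (rule vec_eq_sum_axis) (use x2 ab in \<open>auto simp: axis_def\<close>)
  also have "\<dots> = (\<Sum>i\<in>- {a, b}. (x2 $ i) *\<^sub>R axis i 1)"
    by (rule sum.cong) (auto simp: axis_def)
  finally have "x2 = axis b 1 + (\<Sum>i\<in>- {a, b}. (x2 $ i) *\<^sub>R axis i 1)" by (simp add: algebra_simps)
  moreover have "y1 = (\<Sum>i\<in>- {b}. (y1 $ i) *\<^sub>R axis i 1)"
    by (rule vec_eq_sum_axis) (use y1b in auto)
  ultimately have "wedge2 x2 y1 = chart_map (free_chart a b) ?\<tau>"
    by (simp add: chart_map_def free_chart_def)
  then show ?thesis using ab e1 e2 by metis
qed

text \<open>Stated dually: even the image of one chart spans all bivectors. This lets a rod leave
  any proper subspace without leaving its chart.\<close>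

lemma free_chart_spanning:
  fixes p :: "'n::{finite,linorder} ext"
  assumes p: "p \<in> bivectors" and ab: "a \<noteq> b" and van: "\<And>\<tau>. p \<bullet> chart_map (free_chart a b) \<tau> = 0"
  shows "p = 0"
proof (rule bivector_zeroI[OF p])
  let ?P = "\<lambda>i j. p \<bullet> wedge2 (axis i 1) (axis j 1)"
  have P1: "?P b j = 0" if "j \<noteq> b" for j
    using chart_map_vanishing(1)[OF van[unfolded free_chart_def], of j] that by simp
  have P2: "?P i j = 0" if "i \<noteq> a" "i \<noteq> b" "j \<noteq> b" for i j
    using chart_map_vanishing(2)[OF van[unfolded free_chart_def], of i j] that by simp
  have sw: "?P i j = - ?P j i" for i j by (rule inner_wedge2_swap)
  fix i j
  show "?P i j = 0"
  proof (cases "i = j")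
    case False
    have "?P i j = 0 \<or> ?P j i = 0"
    proof (cases "i = b \<or> j = b")
      case True
      then show ?thesis using False P1[of j] P1[of i] by blast
    next
      case neq: False
      then show ?thesis using False P2[of i j] P2[of j i] by blast
    qed
    then show ?thesis using sw[of i j] by linarith
  qed simp
qed

lemma card_free_chart: "a \<noteq> b \<Longrightarrow> card (chart_indices (free_chart a (b::'n::{finite,linorder}))) = 2 * CARD('n) - 3"
  unfolding free_chart_def card_chart_indices by (simp add: Compl_eq_Diff_UNIV card_Diff_subset)

text \<open>For a rod with Hodge dual \<open>wedge2 \<alpha> \<beta>\<close>, the set
  \<open>pencil {\<alpha>, \<beta>}\<close> is the rod itself as a subspace of
  \<open>W\<close>.\<close>

definition pencil :: "(real, 'n) vec set \<Rightarrow> (real, 'n::finite) vec set" where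
  "pencil S = {x. \<forall>a\<in>S. x \<bullet> a = 0}"

lemma subspace_pencil: "subspace (pencil S)"
  by (auto simp: subspace_def pencil_def inner_add_left)

text \<open>A plane that meets \<open>ker \<alpha> \<inter> ker \<beta>\<close> can be spanned by a given vector outside of this space
  and a vector inside of it.\<close>

lemma wedge2_move_into_pencil:
  fixes x y \<alpha> \<beta> :: "(real, 'n::{finite,linorder}) vec"
  assumes "wedge2 x y \<bullet> wedge2 \<alpha> \<beta> = 0" "x \<notin> pencil {\<alpha>, \<beta>}"
  shows "\<exists>y'. y' \<in> pencil {\<alpha>, \<beta>} \<and> wedge2 x y = wedge2 x y'"
proof -
  have e: "(x \<bullet> \<alpha>) * (y \<bullet> \<beta>) = (x \<bullet> \<beta>) * (y \<bullet> \<alpha>)" using assms(1) by (simp add: wedge2_inner)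
  have "\<exists>c. (y - c *\<^sub>R x) \<bullet> \<alpha> = 0 \<and> (y - c *\<^sub>R x) \<bullet> \<beta> = 0"
  proof (cases "x \<bullet> \<alpha> = 0")
    case False
    then show ?thesis using e by (intro exI[of _ "(y \<bullet> \<alpha>) / (x \<bullet> \<alpha>)"]) (simp add: inner_diff_left field_simps)
  next
    case True
    then have "x \<bullet> \<beta> \<noteq> 0" using assms(2) by (simp add: pencil_def)
    then show ?thesis using e True by (intro exI[of _ "(y \<bullet> \<beta>) / (x \<bullet> \<beta>)"]) (simp add: inner_diff_left field_simps)
  qed
  then obtain c where "y - c *\<^sub>R x \<in> pencil {\<alpha>, \<beta>}" by (auto simp: pencil_def)
  moreover have "wedge2 x y = wedge2 x (y - c *\<^sub>R x)" by (simp add: wedge2_linear_simps)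
  ultimately show ?thesis by blast
qed

lemma sum_normalized:
  fixes f :: "'n::finite \<Rightarrow> 'a::real_vector"
  assumes "x = (\<Sum>i\<in>K. c i *\<^sub>R f i)" "i0 \<in> K" "c i0 \<noteq> 0"
  shows "(1 / c i0) *\<^sub>R x = f i0 + (\<Sum>i\<in>K - {i0}. (c i / c i0) *\<^sub>R f i)"
proof -
  have "(1 / c i0) *\<^sub>R x = (\<Sum>i\<in>K. (c i / c i0) *\<^sub>R f i)" by (simp add: assms(1) scaleR_sum_right)
  also have "\<dots> = f i0 + (\<Sum>i\<in>K - {i0}. (c i / c i0) *\<^sub>R f i)"
    using assms(2,3) by (subst sum.remove[of K i0]) auto
  finally show ?thesis .
qed

text \<open>One coefficient of \<open>x\<close> is normalised to 1 and the scale moves into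
  \<open>y\<close>, from which a multiple of \<open>x\<close> is subtracted to clear the coordinate
  \<open>k\<close>. The choice of \<open>k\<close> with \<open>x $ k \<noteq> 0\<close> is recorded,
  since only such charts are used for one rod.\<close>

lemma subspace_chart_cover:
  fixes f :: "'n::{finite,linorder} \<Rightarrow> (real, 'n) vec"
  assumes "x = (\<Sum>i\<in>K. c i *\<^sub>R f i)" "x \<noteq> 0"
  shows "\<exists>i0\<in>K. \<exists>k \<tau>. x $ k \<noteq> 0 \<and> wedge2 x y = chart_map (f i0, f, K - {i0}, \<lambda>j. axis j 1, - {k}) \<tau>"
proof -
  have "\<exists>i0\<in>K. c i0 \<noteq> 0"
  proof (rule ccontr)
    assume "\<not> (\<exists>i0\<in>K. c i0 \<noteq> 0)"
    then have "x = 0" unfolding assms(1) by (intro sum.neutral) auto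
    then show False using assms(2) by blast
  qed
  then obtain i0 where i0: "i0 \<in> K" "c i0 \<noteq> 0" by blast
  obtain k where k: "x $ k \<noteq> 0" using assms(2) by (metis vec_eq_iff zero_index)
  define x' where "x' = (1 / c i0) *\<^sub>R x"
  define y' where "y' = c i0 *\<^sub>R (y - (y $ k / x $ k) *\<^sub>R x)"
  let ?\<tau> = "\<lambda>(b, i). if b then c i / c i0 else y' $ i"
  have x': "x' = f i0 + (\<Sum>i\<in>K - {i0}. (c i / c i0) *\<^sub>R f i)"
    unfolding x'_def by (rule sum_normalized[OF assms(1) i0])
  have y': "y' = (\<Sum>j\<in>- {k}. (y' $ j) *\<^sub>R axis j 1)"
    by (rule vec_eq_sum_axis) (use k in \<open>auto simp: y'_def\<close>)
  have "chart_map (f i0, f, K - {i0}, \<lambda>j. axis j 1, - {k}) ?\<tau> =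
      wedge2 (f i0 + (\<Sum>i\<in>K - {i0}. (c i / c i0) *\<^sub>R f i)) (\<Sum>j\<in>- {k}. (y' $ j) *\<^sub>R axis j 1)"
    by (simp add: chart_map_def)
  also have "\<dots> = wedge2 x' y'" unfolding x'[symmetric] y'[symmetric] ..
  also have "\<dots> = wedge2 x y" using i0 by (simp add: x'_def y'_def wedge2_linear_simps)
  finally have "wedge2 x y = chart_map (f i0, f, K - {i0}, \<lambda>j. axis j 1, - {k}) ?\<tau>" by (rule sym)
  then show ?thesis using i0(1) k by blast
qed

lemma subspace_chart_vanishing:
  fixes p :: "'n::{finite,linorder} ext" and f :: "'n \<Rightarrow> (real, 'n) vec"
  assumes i0: "i0 \<in> K" and van: "\<And>\<tau>. p \<bullet> chart_map (f i0, f, K - {i0}, g, B) \<tau> = 0"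
  shows "p \<bullet> wedge2 (\<Sum>i\<in>K. c i *\<^sub>R f i) (\<Sum>j\<in>B. e j *\<^sub>R g j) = 0"
proof -
  have "p \<bullet> wedge2 (f i) (g j) = 0" if "i \<in> K" "j \<in> B" for i j
    using chart_map_vanishing(1)[OF van that(2)] chart_map_vanishing(2)[OF van, of i j] that by (cases "i = i0") auto
  then show ?thesis unfolding inner_wedge2_sum by (auto intro!: sum.neutral)
qed

text \<open>The chart reaches only those \<open>y\<close> with \<open>y $ k = 0\<close>. Subtracting
  a multiple of \<open>x1\<close> brings any \<open>y\<close> into this form, and the correction
  term with \<open>x\<close> and \<open>x1\<close> vanishes by applying the same reduction to the
  swapped pair.\<close>

lemma pencil_chart_vanishing:
  fixes p :: "'n::{finite,linorder} ext" and f :: "'n \<Rightarrow> (real, 'n) vec"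
  assumes i0: "i0 \<in> K" and van: "\<And>\<tau>. p \<bullet> chart_map (f i0, f, K - {i0}, \<lambda>j. axis j 1, - {k}) \<tau> = 0"
    and X: "\<And>x. x \<in> X \<Longrightarrow> \<exists>c. x = (\<Sum>i\<in>K. c i *\<^sub>R f i)" and x1: "x1 \<in> X" "x1 $ k \<noteq> 0" and x: "x \<in> X"
  shows "p \<bullet> wedge2 x y = 0"
proof -
  have base: "p \<bullet> wedge2 x y = 0" if xX: "x \<in> X" and yk: "y $ k = 0" for x y
  proof -
    obtain c where c: "x = (\<Sum>i\<in>K. c i *\<^sub>R f i)" using X[OF xX] by blast
    have y: "y = (\<Sum>j\<in>- {k}. (y $ j) *\<^sub>R axis j 1)" by (rule vec_eq_sum_axis) (use yk in auto)
    have "p \<bullet> wedge2 (\<Sum>i\<in>K. c i *\<^sub>R f i) (\<Sum>j\<in>- {k}. (y $ j) *\<^sub>R axis j 1) = 0"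
      by (rule subspace_chart_vanishing[OF i0 van])
    then show ?thesis unfolding c[symmetric] y[symmetric] .
  qed
  have "(x - (x $ k / x1 $ k) *\<^sub>R x1) $ k = 0" using x1(2) by simp
  then have "p \<bullet> wedge2 x1 (x - (x $ k / x1 $ k) *\<^sub>R x1) = 0" by (rule base[OF x1(1)])
  then have "p \<bullet> wedge2 x1 x = 0" by (simp add: inner_wedge2_simps)
  then have xx1: "p \<bullet> wedge2 x x1 = 0" by (subst inner_wedge2_swap) simp
  have "(y - (y $ k / x1 $ k) *\<^sub>R x1) $ k = 0" using x1(2) by simp
  then have "p \<bullet> wedge2 x (y - (y $ k / x1 $ k) *\<^sub>R x1) = 0" by (rule base[OF x])
  then show ?thesis by (simp add: inner_wedge2_simps xx1)
qed

lemma notin_span_mono: "x \<notin> span T \<Longrightarrow> S \<subseteq> T \<Longrightarrow> x \<notin> span S"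
  using span_mono by blast

lemma dim_pair_independent:
  fixes \<alpha> \<beta> :: "'a::euclidean_space"
  assumes "\<alpha> \<notin> span {\<beta>}" "\<beta> \<notin> span {\<alpha>}"
  shows "dim {\<alpha>, \<beta>} = 2"
proof -
  have "\<beta> \<noteq> 0" using assms(2) span_zero by blast
  then show ?thesis using assms(1) by (simp add: dim_insert)
qed

lemma dim_pencil:
  fixes S :: "(real, 'n::finite) vec set"
  shows "dim (pencil S) + dim S = CARD('n)"
  using dim_orthogonal_complement[of S] by (simp add: pencil_def)

lemma wedge2_rep_in_pencil:
  fixes x y \<alpha> \<beta> :: "(real, 'n::{finite,linorder}) vec"
  assumes "wedge2 x y \<bullet> wedge2 \<alpha> \<beta> = 0"
  shows "\<exists>x' y'. x' \<in> pencil {\<alpha>, \<beta>} \<and> wedge2 x y = wedge2 x' y'"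
proof (cases "x \<in> pencil {\<alpha>, \<beta>}")
  case False
  then obtain y' where y': "y' \<in> pencil {\<alpha>, \<beta>}" "wedge2 x y = wedge2 x y'"
    using wedge2_move_into_pencil[OF assms] by blast
  have "wedge2 x y = wedge2 y' ((- 1) *\<^sub>R x)"
    unfolding y'(2) wedge2_linear_simps(6) wedge2_swap[of y' x] by simp
  then show ?thesis using y'(1) by blast
qed blast

lemma card_subspace_chart:
  fixes K :: "'n::finite set"
  assumes "i0 \<in> K"
  shows "card (chart_indices (x0, f, K - {i0}, g, - {k::'n})) = card K - 1 + (CARD('n) - 1)"
  unfolding card_chart_indices using assms by (simp add: Compl_eq_Diff_UNIV card_Diff_subset)

text \<open>Besides the number of parameters, this demands in dual form that the bivectors
  orthogonal to \<open>S\<close> lie in the span of the image: no linear condition on the bar is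
  lost in the chart.\<close>

definition full_chart :: "nat \<Rightarrow> 'n::{finite,linorder} ext set \<Rightarrow> 'n chart \<Rightarrow> bool" where
  "full_chart m S ch \<longleftrightarrow> card (chart_indices ch) = m \<and>
     (\<forall>p\<in>bivectors. (\<forall>\<tau>. p \<bullet> chart_map ch \<tau> = 0) \<longrightarrow> p \<in> span S)"

lemma subspace_indexed_basis_exists:
  fixes X :: "(real, 'n::finite) vec set"
  assumes X: "subspace X"
  shows "\<exists>(K :: 'n set) f. card K = dim X \<and> (\<forall>x\<in>X. \<exists>c. x = (\<Sum>i\<in>K. c i *\<^sub>R f i))"
proof (rule subspace_indexed_basis[OF X])
  fix K :: "'n set" and f
  assume "card K = dim X" "\<And>x. x \<in> X \<Longrightarrow> \<exists>c. x = (\<Sum>i\<in>K. c i *\<^sub>R f i)"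
  then show ?thesis by (intro exI[of _ K] exI[of _ f] conjI ballI)
qed

text \<open>A bar meeting the rod is spanned by a vector \<open>x\<close> of the rod, a space of
  dimension \<open>d - 1\<close>, and a second vector \<open>y\<close>. Normalising one coefficient
  of \<open>x\<close> and clearing one coordinate of \<open>y\<close> leaves
  \<open>(d - 2) + d\<close> parameters.\<close>

lemma charts_one_rod:
  fixes \<alpha> \<beta> :: "(real, 'n::{finite,linorder}) vec"
  assumes n: "CARD('n) = d + 1" and ind: "\<alpha> \<notin> span {\<beta>}" "\<beta> \<notin> span {\<alpha>}"
  shows "\<exists>Ch. finite Ch \<and> (\<forall>ch\<in>Ch. full_chart (2 * d - 2) {wedge2 \<alpha> \<beta>} ch) \<and>
    (\<forall>x y. wedge2 x y \<noteq> 0 \<longrightarrow> wedge2 x y \<bullet> wedge2 \<alpha> \<beta> = 0 \<longrightarrow> (\<exists>ch\<in>Ch. \<exists>\<tau>. wedge2 x y = chart_map ch \<tau>))"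
proof -
  let ?X = "pencil {\<alpha>, \<beta>}"
  have dimX: "dim ?X + 2 = d + 1" using dim_pencil[of "{\<alpha>, \<beta>}"] dim_pair_independent[OF ind] n by simp
  obtain K :: "'n set" and f where K0: "card K = dim ?X \<and> (\<forall>x\<in>?X. \<exists>c. x = (\<Sum>i\<in>K. c i *\<^sub>R f i))"
    using subspace_indexed_basis_exists[OF subspace_pencil[of "{\<alpha>, \<beta>}"]] by (elim exE)
  have K: "card K = dim ?X" "\<And>x. x \<in> ?X \<Longrightarrow> \<exists>c. x = (\<Sum>i\<in>K. c i *\<^sub>R f i)"
    using K0 by (blast, blast)
  define mk :: "'n \<times> 'n \<Rightarrow> 'n chart" where "mk = (\<lambda>(i0, k). (f i0, f, K - {i0}, \<lambda>j. axis j 1, - {k}))"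
  define Ch where "Ch = mk ` {(i0, k). i0 \<in> K \<and> (\<exists>x\<in>?X. x $ k \<noteq> 0)}"
  have "finite Ch" unfolding Ch_def by (rule finite_imageI) simp
  moreover have "full_chart (2 * d - 2) {wedge2 \<alpha> \<beta>} ch" if chCh: "ch \<in> Ch" for ch
  proof -
    obtain i0 k x1 where ik: "ch = mk (i0, k)" "i0 \<in> K" "x1 \<in> ?X" "x1 $ k \<noteq> 0" using chCh unfolding Ch_def by auto
    have ch: "ch = (f i0, f, K - {i0}, \<lambda>j. axis j 1, - {k})" using ik(1) by (simp add: mk_def)
    have "card (chart_indices ch) = card K - 1 + (CARD('n) - 1)" unfolding ch by (rule card_subspace_chart[OF ik(2)])
    moreover have "card K \<ge> 1" using ik(2) by (auto simp: Suc_le_eq card_gt_0_iff)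
    ultimately have "card (chart_indices ch) = 2 * d - 2" using dimX K(1) n by simp
    moreover have "p \<in> span {wedge2 \<alpha> \<beta>}" if p: "p \<in> bivectors" "\<forall>\<tau>. p \<bullet> chart_map ch \<tau> = 0" for p
    proof -
      have "\<exists>c. p = c *\<^sub>R wedge2 \<alpha> \<beta>"
      proof (rule bivector_vanishing_on_pencil[OF p(1) ind])
        fix x y assume "x \<bullet> \<alpha> = 0" "x \<bullet> \<beta> = 0"
        then have "x \<in> ?X" by (simp add: pencil_def)
        show "p \<bullet> wedge2 x y = 0"
          by (rule pencil_chart_vanishing[OF ik(2) _ K(2) ik(3,4) \<open>x \<in> ?X\<close>]) (use p(2) ch in auto)
      qed
      then show ?thesis by (auto intro: span_scale span_base)
    qed
    ultimately show ?thesis by (simp add: full_chart_def)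
  qed
  moreover have "\<exists>ch\<in>Ch. \<exists>\<tau>. wedge2 x y = chart_map ch \<tau>"
    if nz: "wedge2 x y \<noteq> 0" and 0: "wedge2 x y \<bullet> wedge2 \<alpha> \<beta> = 0" for x y
  proof -
    obtain x' y' where x': "x' \<in> ?X" "wedge2 x y = wedge2 x' y'" using wedge2_rep_in_pencil[OF 0] by blast
    obtain c where c: "x' = (\<Sum>i\<in>K. c i *\<^sub>R f i)" using K(2)[OF x'(1)] by blast
    have "x' \<noteq> 0" using nz x'(2) by (auto simp: wedge2_linear_simps)
    from subspace_chart_cover[OF c this, of y'] obtain i0 k \<tau> where
      ik: "i0 \<in> K" "x' $ k \<noteq> 0" "wedge2 x' y' = chart_map (f i0, f, K - {i0}, \<lambda>j. axis j 1, - {k}) \<tau>" by blast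
    have "mk (i0, k) \<in> Ch" unfolding Ch_def using ik(1,2) x'(1) by (intro imageI) auto
    moreover have "wedge2 x y = chart_map (mk (i0, k)) \<tau>" using ik(3) x'(2) by (simp add: mk_def)
    ultimately show ?thesis by blast
  qed
  ultimately show ?thesis by (intro exI[of _ Ch]) blast
qed

text \<open>A typical bar is spanned by one vector from each rod, which gives
  \<open>(d - 2) + (d - 1)\<close> parameters. Bars through a common point of the rods need other
  charts: that point varies in dimension \<open>d - 3\<close>, giving \<open>(d - 4) + d\<close>
  parameters, one too few to matter for the measure.\<close>

lemma charts_two_rods:
  fixes \<alpha> \<beta> \<alpha>' \<beta>' :: "(real, 'n::{finite,linorder}) vec"
  assumes n: "CARD('n) = d + 1"
    and ind: "\<alpha> \<notin> span {\<beta>, \<alpha>', \<beta>'}" "\<beta> \<notin> span {\<alpha>, \<alpha>', \<beta>'}" "\<alpha>' \<notin> span {\<alpha>, \<beta>, \<beta>'}" "\<beta>' \<notin> span {\<alpha>, \<beta>, \<alpha>'}"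
  shows "\<exists>Ch. finite Ch \<and>
    (\<forall>ch\<in>Ch. full_chart (2 * d - 3) {wedge2 \<alpha> \<beta>, wedge2 \<alpha>' \<beta>'} ch \<or> card (chart_indices ch) < 2 * d - 3) \<and>
    (\<forall>x y. wedge2 x y \<noteq> 0 \<longrightarrow> wedge2 x y \<bullet> wedge2 \<alpha> \<beta> = 0 \<longrightarrow> wedge2 x y \<bullet> wedge2 \<alpha>' \<beta>' = 0 \<longrightarrow>
      (\<exists>ch\<in>Ch. \<exists>\<tau>. wedge2 x y = chart_map ch \<tau>))"
proof -
  let ?X = "pencil {\<alpha>, \<beta>}" and ?Y = "pencil {\<alpha>', \<beta>'}" and ?Z = "pencil {\<alpha>, \<beta>, \<alpha>', \<beta>'}"
  have ind2: "\<alpha> \<notin> span {\<beta>}" "\<beta> \<notin> span {\<alpha>}" "\<alpha>' \<notin> span {\<beta>'}" "\<beta>' \<notin> span {\<alpha>'}" "\<beta> \<notin> span {\<alpha>', \<beta>'}"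
    by (rule notin_span_mono[OF ind(1)] notin_span_mono[OF ind(2)] notin_span_mono[OF ind(3)] notin_span_mono[OF ind(4)]; blast)+
  have dimX: "dim ?X + 2 = d + 1" using dim_pencil[of "{\<alpha>, \<beta>}"] dim_pair_independent[OF ind2(1,2)] n by simp
  have dimY: "dim ?Y + 2 = d + 1" using dim_pencil[of "{\<alpha>', \<beta>'}"] dim_pair_independent[OF ind2(3,4)] n by simp
  have "dim {\<alpha>, \<beta>, \<alpha>', \<beta>'} = 4"
    using ind(1) ind2(5) dim_pair_independent[OF ind2(3,4)] by (simp add: dim_insert[of \<alpha>] dim_insert[of \<beta>])
  then have dimZ: "dim ?Z + 4 = d + 1" using dim_pencil[of "{\<alpha>, \<beta>, \<alpha>', \<beta>'}"] n by simp
  obtain K :: "'n set" and f where K0: "card K = dim ?X \<and> (\<forall>x\<in>?X. \<exists>c. x = (\<Sum>i\<in>K. c i *\<^sub>R f i))"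
    using subspace_indexed_basis_exists[OF subspace_pencil[of "{\<alpha>, \<beta>}"]] by (elim exE)
  have K: "card K = dim ?X" "\<And>x. x \<in> ?X \<Longrightarrow> \<exists>c. x = (\<Sum>i\<in>K. c i *\<^sub>R f i)"
    using K0 by (blast, blast)
  obtain K' :: "'n set" and g where K'0: "card K' = dim ?Y \<and> (\<forall>x\<in>?Y. \<exists>c. x = (\<Sum>i\<in>K'. c i *\<^sub>R g i))"
    using subspace_indexed_basis_exists[OF subspace_pencil[of "{\<alpha>', \<beta>'}"]] by (elim exE)
  have K': "card K' = dim ?Y" "\<And>x. x \<in> ?Y \<Longrightarrow> \<exists>c. x = (\<Sum>i\<in>K'. c i *\<^sub>R g i)"
    using K'0 by (blast, blast)
  obtain M :: "'n set" and h where M0: "card M = dim ?Z \<and> (\<forall>x\<in>?Z. \<exists>c. x = (\<Sum>i\<in>M. c i *\<^sub>R h i))"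
    using subspace_indexed_basis_exists[OF subspace_pencil[of "{\<alpha>, \<beta>, \<alpha>', \<beta>'}"]] by (elim exE)
  have M: "card M = dim ?Z" "\<And>x. x \<in> ?Z \<Longrightarrow> \<exists>c. x = (\<Sum>i\<in>M. c i *\<^sub>R h i)"
    using M0 by (blast, blast)
  define mk :: "'n \<Rightarrow> 'n chart" where "mk i0 = (f i0, f, K - {i0}, g, K')" for i0
  define low :: "'n \<times> 'n \<Rightarrow> 'n chart" where "low = (\<lambda>(i0, k). (h i0, h, M - {i0}, \<lambda>j. axis j 1, - {k}))"
  define Ch where "Ch = mk ` K \<union> low ` (M \<times> UNIV)"
  have "finite Ch" unfolding Ch_def by simp
  moreover have "full_chart (2 * d - 3) {wedge2 \<alpha> \<beta>, wedge2 \<alpha>' \<beta>'} ch \<or> card (chart_indices ch) < 2 * d - 3" if chCh: "ch \<in> Ch" for ch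
  proof -
    consider i0 where "i0 \<in> K" "ch = mk i0" | i0 k where "i0 \<in> M" "ch = low (i0, k)" using chCh unfolding Ch_def by blast
    then show ?thesis
    proof cases
      case (1 i0)
      have ch: "ch = (f i0, f, K - {i0}, g, K')" using 1(2) by (simp add: mk_def)
      have "card K \<ge> 1" using 1(1) by (auto simp: Suc_le_eq card_gt_0_iff)
      then have "card (chart_indices ch) = 2 * d - 3"
        unfolding ch card_chart_indices using dimX dimY K(1) K'(1) 1(1) by simp
      moreover have "p \<in> span {wedge2 \<alpha> \<beta>, wedge2 \<alpha>' \<beta>'}" if p: "p \<in> bivectors" "\<forall>\<tau>. p \<bullet> chart_map ch \<tau> = 0" for p
      proof -
        have "\<exists>c c'. p = c *\<^sub>R wedge2 \<alpha> \<beta> + c' *\<^sub>R wedge2 \<alpha>' \<beta>'"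
        proof (rule bivector_vanishing_on_two_pencils[OF p(1) ind])
          fix x y assume "x \<bullet> \<alpha> = 0" "x \<bullet> \<beta> = 0" "y \<bullet> \<alpha>' = 0" "y \<bullet> \<beta>' = 0"
          then have "x \<in> ?X" "y \<in> ?Y" by (simp_all add: pencil_def)
          then obtain c e where xy: "x = (\<Sum>i\<in>K. c i *\<^sub>R f i)" "y = (\<Sum>j\<in>K'. e j *\<^sub>R g j)" using K(2) K'(2) by meson
          show "p \<bullet> wedge2 x y = 0" unfolding xy
            by (rule subspace_chart_vanishing[OF 1(1)]) (use p(2) ch in auto)
        qed
        then obtain c c' where "p = c *\<^sub>R wedge2 \<alpha> \<beta> + c' *\<^sub>R wedge2 \<alpha>' \<beta>'" by blast
        then show ?thesis by (auto intro!: span_add span_scale intro: span_base)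
      qed
      ultimately show ?thesis by (simp add: full_chart_def)
    next
      case (2 i0 k)
      have ch: "ch = (h i0, h, M - {i0}, \<lambda>j. axis j 1, - {k})" using 2(2) by (simp add: low_def)
      have "card (chart_indices ch) = card M - 1 + (CARD('n) - 1)" unfolding ch by (rule card_subspace_chart[OF 2(1)])
      moreover have "card M \<ge> 1" using 2(1) by (auto simp: Suc_le_eq card_gt_0_iff)
      ultimately have "card (chart_indices ch) < 2 * d - 3" using dimZ M(1) n by simp
      then show ?thesis by blast
    qed
  qed
  moreover have "\<exists>ch\<in>Ch. \<exists>\<tau>. wedge2 x y = chart_map ch \<tau>"
    if nz: "wedge2 x y \<noteq> 0" and 0: "wedge2 x y \<bullet> wedge2 \<alpha> \<beta> = 0" "wedge2 x y \<bullet> wedge2 \<alpha>' \<beta>' = 0" for x y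
  proof -
    obtain x' y' where x': "x' \<in> ?X" "wedge2 x y = wedge2 x' y'" using wedge2_rep_in_pencil[OF 0(1)] by blast
    have x'0: "x' \<noteq> 0" using nz x'(2) by (auto simp: wedge2_linear_simps)
    show ?thesis
    proof (cases "x' \<in> ?Y")
      case True
      then have "x' \<in> ?Z" using x'(1) by (simp add: pencil_def)
      then obtain c where c: "x' = (\<Sum>i\<in>M. c i *\<^sub>R h i)" using M(2) by blast
      from subspace_chart_cover[OF c x'0, of y'] obtain i0 k \<tau> where
        ik: "i0 \<in> M" "wedge2 x' y' = chart_map (h i0, h, M - {i0}, \<lambda>j. axis j 1, - {k}) \<tau>" by blast
      have "low (i0, k) \<in> Ch" unfolding Ch_def using ik(1) by blast
      moreover have "wedge2 x y = chart_map (low (i0, k)) \<tau>" using ik(2) x'(2) by (simp add: low_def)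
      ultimately show ?thesis by blast
    next
      case False
      have "wedge2 x' y' \<bullet> wedge2 \<alpha>' \<beta>' = 0" using 0(2) x'(2) by simp
      then obtain y2 where y2: "y2 \<in> ?Y" "wedge2 x' y' = wedge2 x' y2" using wedge2_move_into_pencil[OF _ False] by blast
      obtain c where c: "x' = (\<Sum>i\<in>K. c i *\<^sub>R f i)" using K(2)[OF x'(1)] by blast
      obtain e where e: "y2 = (\<Sum>j\<in>K'. e j *\<^sub>R g j)" using K'(2)[OF y2(1)] by blast
      have "\<exists>i0\<in>K. c i0 \<noteq> 0"
      proof (rule ccontr)
        assume "\<not> (\<exists>i0\<in>K. c i0 \<noteq> 0)"
        then have "x' = 0" unfolding c by (intro sum.neutral) auto
        then show False using x'0 by blast
      qed
      then obtain i0 where i0: "i0 \<in> K" "c i0 \<noteq> 0" by blast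
      \<comment> \<open>The coefficient \<open>c i0\<close> divided out of the first factor
        reappears in the second.\<close>
      let ?\<tau> = "\<lambda>(b, i). if b then c i / c i0 else c i0 * e i"
      have "chart_map (mk i0) ?\<tau> = wedge2 (f i0 + (\<Sum>i\<in>K - {i0}. (c i / c i0) *\<^sub>R f i)) (\<Sum>j\<in>K'. (c i0 * e j) *\<^sub>R g j)"
        by (simp add: chart_map_def mk_def)
      also have "\<dots> = wedge2 ((1 / c i0) *\<^sub>R x') (c i0 *\<^sub>R y2)"
        unfolding sum_normalized[OF c i0] by (simp add: e scaleR_sum_right)
      also have "\<dots> = wedge2 x y" using i0(2) by (simp add: wedge2_linear_simps x'(2) y2(2))
      finally have "wedge2 x y = chart_map (mk i0) ?\<tau>" by (rule sym)
      moreover have "mk i0 \<in> Ch" unfolding Ch_def using i0(1) by blast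
      ultimately show ?thesis by blast
    qed
  qed
  ultimately show ?thesis by (intro exI[of _ Ch]) blast
qed

lemma charts_no_rod:
  assumes n: "CARD('n::{finite,linorder}) = d + 1" "d \<ge> 1"
  shows "\<exists>Ch :: 'n chart set. finite Ch \<and> (\<forall>ch\<in>Ch. full_chart (2 * d - 1) {} ch) \<and>
    (\<forall>x y. \<exists>ch\<in>Ch. \<exists>\<tau>. wedge2 x y = chart_map ch \<tau>)"
proof -
  define Ch :: "'n chart set" where "Ch = (\<lambda>(a, b). free_chart a b) ` {(a, b). a \<noteq> b}"
  have "finite Ch" unfolding Ch_def by (rule finite_imageI) simp
  moreover have "full_chart (2 * d - 1) {} ch" if chCh: "ch \<in> Ch" for ch
  proof -
    obtain a b where ab: "ch = free_chart a b" "a \<noteq> b" using chCh unfolding Ch_def by auto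
    have "card (chart_indices ch) = 2 * d - 1" using card_free_chart[OF ab(2)] n by (simp add: ab(1))
    moreover have "p = 0" if "p \<in> bivectors" "\<forall>\<tau>. p \<bullet> chart_map ch \<tau> = 0" for p
      using free_chart_spanning[OF that(1) ab(2)] that(2) unfolding ab(1) by blast
    ultimately show ?thesis by (simp add: full_chart_def)
  qed
  moreover have "\<exists>ch\<in>Ch. \<exists>\<tau>. wedge2 x y = chart_map ch \<tau>" for x y :: "(real, 'n) vec"
  proof -
    have "CARD('n) \<ge> 2" using n by simp
    then obtain a b \<tau> where "a \<noteq> b" "wedge2 x y = chart_map (free_chart a b) \<tau>" using free_chart_cover by blast
    moreover have "free_chart a b \<in> Ch" unfolding Ch_def using \<open>a \<noteq> b\<close> by force
    ultimately show ?thesis by blast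
  qed
  ultimately show ?thesis by (intro exI[of _ Ch]) blast
qed

lemma polynomial_chart_map:
  fixes \<tau> :: "'p::euclidean_space \<Rightarrow> bool \<times> 'n::{finite,linorder} \<Rightarrow> real"
  assumes "\<And>i. real_polynomial_function (\<lambda>s. \<tau> s i)"
  shows "polynomial_function (\<lambda>s. chart_map ch (\<tau> s))"
proof -
  obtain x0 f A g B where ch: "ch = (x0, f, A, g, B)" by (cases ch) auto
  have p: "polynomial_function (\<lambda>s. \<tau> s i)" for i
    using assms[of i] by (simp add: real_polynomial_function_eq)
  have r: "wedge2 x (\<Sum>j\<in>B. t j *\<^sub>R g j) = (\<Sum>j\<in>B. t j *\<^sub>R wedge2 x (g j))" for x t
    by (simp add: linear_sum[OF linear_wedge2(2)] wedge2_linear_simps)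
  have l: "wedge2 (x0 + (\<Sum>i\<in>A. t i *\<^sub>R f i)) y = wedge2 x0 y + (\<Sum>i\<in>A. t i *\<^sub>R wedge2 (f i) y)" for t y
    by (simp add: linear_sum[OF linear_wedge2(1)] wedge2_linear_simps)
  have "(\<lambda>s. chart_map ch (\<tau> s)) = (\<lambda>s. (\<Sum>j\<in>B. \<tau> s (False, j) *\<^sub>R wedge2 x0 (g j)) +
      (\<Sum>i\<in>A. \<tau> s (True, i) *\<^sub>R (\<Sum>j\<in>B. \<tau> s (False, j) *\<^sub>R wedge2 (f i) (g j))))"
    unfolding chart_map_def ch prod.case l r ..
  moreover have "polynomial_function \<dots>"
    by (intro polynomial_function_add polynomial_function_sum polynomial_function_mult polynomial_function_const p) simp_all
  ultimately show ?thesis by simp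
qed

section \<open>Ambient dimension and count condition\<close>

lemma dim_bivectors: "dim (bivectors :: 'n::{finite,linorder} ext set) = CARD('n) choose 2"
proof -
  let ?S = "{I :: 'n set. card I = 2}" and ?ax = "\<lambda>I :: 'n set. axis I (1 :: real)"
  have ax: "?ax I \<in> Basis" for I by (simp add: axis_in_Basis_iff)
  have inj: "inj_on ?ax ?S" by (auto simp: inj_on_def axis_eq_axis)
  have "independent (?ax ` ?S)" by (rule independent_mono[OF independent_Basis]) (use ax in auto)
  moreover have "?ax ` ?S \<subseteq> bivectors" by (auto simp: bivectors_def axis_def)
  moreover have "bivectors \<subseteq> span (?ax ` ?S)"
  proof
    fix p :: "'n ext" assume "p \<in> bivectors"
    then have "p = (\<Sum>I\<in>?S. (p $ I) *\<^sub>R ?ax I)" by (intro vec_eq_sum_axis) (auto simp: bivectors_def)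
    also have "\<dots> \<in> span (?ax ` ?S)" by (intro span_sum span_mul span_base imageI)
    finally show "p \<in> span (?ax ` ?S)" .
  qed
  ultimately have "dim (bivectors :: 'n ext set) = card (?ax ` ?S)"
    using basis_card_eq_dim[of "?ax ` ?S" "bivectors :: 'n ext set"] by simp
  also have "\<dots> = card ?S" by (rule card_image[OF inj])
  also have "\<dots> = CARD('n) choose 2" using n_subsets[of "UNIV :: 'n set" 2] by simp
  finally show ?thesis .
qed

text \<open>The count condition is summed over the classes of \<open>p\<close>. A vertex is then
  weighted once for every class that meets it, which is the quantity in \<open>block_count\<close>
  up to the first class at each vertex.\<close>

lemma block_count_le_count_matroid:
  fixes ends :: "'e::finite \<Rightarrow> 'v::finite set"
  assumes "F \<in> count_matroid D E ends R"
  shows "block_count D R F ends p \<le> int D * int (card (vertices_of ends F))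
    - int (card (R \<inter> vertices_of ends F)) - int (card F)"
proof -
  let ?V = "vertices_of ends" and ?w = "\<lambda>v. int D - of_bool (v \<in> R)"
  let ?Fl = "\<lambda>l. {e \<in> F. p e = l}" and ?c = "\<lambda>v. card (p ` {e \<in> F. v \<in> ends e})"
  have w: "(\<Sum>v\<in>X. ?w v) = int D * int (card X) - int (card (R \<inter> X))" for X :: "'v set"
  proof -
    have "(\<Sum>v\<in>X. of_bool (v \<in> R) :: int) = (\<Sum>v\<in>{v \<in> X. v \<in> R}. 1)"
      unfolding of_bool_def by (rule sum.inter_filter[symmetric]) (rule finite)
    moreover have "{v \<in> X. v \<in> R} = R \<inter> X" by auto
    ultimately show ?thesis by (simp add: sum_subtractf mult.commute)
  qed
  have wif: "(\<Sum>v\<in>X. ?w v) = (\<Sum>v\<in>UNIV. if v \<in> X then ?w v else 0)" for X :: "'v set"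
    using sum.inter_filter[of UNIV ?w "\<lambda>v. v \<in> X"] by simp
  have each: "int (card (?Fl l)) \<le> (\<Sum>v\<in>?V (?Fl l). ?w v) - int D" if "l \<in> p ` F" for l
  proof -
    have "?Fl l \<subseteq> F" "?Fl l \<noteq> {}" using that by auto
    then have "int (card (?Fl l)) \<le> int D * (int (card (?V (?Fl l))) - 1) - int (card (R \<inter> ?V (?Fl l)))"
      using assms unfolding count_matroid_def by blast
    then show ?thesis unfolding w by (simp only: right_diff_distrib mult_1_right)
  qed
  have m: "(\<Sum>l\<in>p ` F. if v \<in> ?V (?Fl l) then ?w v else 0) = ?w v * int (?c v)" for v
  proof -
    have "{l \<in> p ` F. v \<in> ?V (?Fl l)} = p ` {e \<in> F. v \<in> ends e}"
    proof (intro equalityI subsetI)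
      fix l assume "l \<in> {l \<in> p ` F. v \<in> ?V (?Fl l)}"
      then obtain e where "e \<in> F" "p e = l" "v \<in> ends e" by (auto simp: vertices_of_def)
      then show "l \<in> p ` {e \<in> F. v \<in> ends e}" by blast
    next
      fix l assume "l \<in> p ` {e \<in> F. v \<in> ends e}"
      then obtain e where "e \<in> F" "v \<in> ends e" "l = p e" by blast
      then show "l \<in> {l \<in> p ` F. v \<in> ?V (?Fl l)}" by (auto simp: vertices_of_def)
    qed
    moreover have "(\<Sum>l\<in>p ` F. if v \<in> ?V (?Fl l) then ?w v else 0) = (\<Sum>l\<in>{l \<in> p ` F. v \<in> ?V (?Fl l)}. ?w v)"
      by (rule sum.inter_filter[symmetric]) simp
    ultimately show ?thesis by (simp only: sum_constant mult.commute[of "?w v"])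
  qed
  have shift: "(\<Sum>l\<in>p ` F. g l - int D) = (\<Sum>l\<in>p ` F. g l) - int D * int (card (p ` F))" for g
    by (simp add: sum_subtractf)
  have "int (card F) = (\<Sum>l\<in>p ` F. int (card (?Fl l)))"
    using sum.image_gen[of F "\<lambda>_. 1 :: int" p] by simp
  also have "\<dots> \<le> (\<Sum>l\<in>p ` F. (\<Sum>v\<in>?V (?Fl l). ?w v) - int D)" by (rule sum_mono) (rule each)
  also have "\<dots> = (\<Sum>l\<in>p ` F. \<Sum>v\<in>UNIV. if v \<in> ?V (?Fl l) then ?w v else 0) - int D * int (card (p ` F))"
    unfolding wif by (rule shift)
  also have "(\<Sum>l\<in>p ` F. \<Sum>v\<in>UNIV. if v \<in> ?V (?Fl l) then ?w v else 0) = (\<Sum>v\<in>UNIV. ?w v * int (?c v))"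
    by (subst sum.swap) (simp only: m)
  finally have card: "int (card F) \<le> (\<Sum>v\<in>UNIV. ?w v * int (?c v)) - int D * int (card (p ` F))" .
  \<comment> \<open>Dropping the first class at each covered vertex subtracts exactly the total
    weight of the vertices of \<open>F\<close>, which is the bound in the conclusion.\<close>
  have "?w v * int (?c v - 1) = ?w v * int (?c v) - (if v \<in> ?V F then ?w v else 0)" for v
  proof (cases "v \<in> ?V F")
    case True
    then have "{e \<in> F. v \<in> ends e} \<noteq> {}" by (auto simp: vertices_of_def)
    then have "?c v \<ge> 1" by (simp add: Suc_le_eq card_gt_0_iff)
    then have "int (?c v - 1) = int (?c v) - 1" by simp
    then show ?thesis using True by (simp only: right_diff_distrib mult_1_right if_True)
  next
    case False
    then have "{e \<in> F. v \<in> ends e} = {}" by (auto simp: vertices_of_def)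
    then show ?thesis using False by (simp only: image_empty card.empty if_False)
  qed
  then have "(\<Sum>v\<in>UNIV. ?w v * int (?c v - 1)) = (\<Sum>v\<in>UNIV. ?w v * int (?c v)) - (\<Sum>v\<in>?V F. ?w v)"
    unfolding wif by (simp only: sum_subtractf)
  then show ?thesis using card unfolding block_count_def w by linarith
qed

section \<open>Rows of the rigidity matrix and motions\<close>

definition block_space :: "'a::euclidean_space set \<Rightarrow> 'v set \<Rightarrow> ('a^'v::finite) set" where
  "block_space L X = {x. (\<forall>v. v \<notin> X \<longrightarrow> x $ v = 0) \<and> (\<forall>v\<in>X. x $ v \<in> L)}"

lemma subspace_block_space: "subspace L \<Longrightarrow> subspace (block_space L X)"
  unfolding block_space_def subspace_def by auto

lemma dim_block_space:
  assumes L: "subspace L"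
  shows "dim (block_space L X :: ('a::euclidean_space^'v::finite) set) = dim L * card X"
proof -
  have "finite X" by simp
  then show ?thesis
  proof (induction X rule: finite_induct)
    case empty
    have "block_space L {} = ({0} :: ('a^'v) set)" by (auto simp: block_space_def vec_eq_iff)
    then show ?case by simp
  next
    case (insert v X)
    let ?S = "block_space L (insert v X) :: ('a^'v) set"
    have lin: "linear (\<lambda>x :: 'a^'v. x $ v)" by (simp add: bounded_linear.linear bounded_linear_vec_nth)
    have "(\<lambda>x. x $ v) ` ?S = L"
    proof (intro equalityI subsetI)
      fix y assume "y \<in> L"
      then have "axis v y \<in> ?S" using subspace_0[OF L] by (auto simp: block_space_def axis_def)
      then show "y \<in> (\<lambda>x. x $ v) ` ?S" by (intro image_eqI[of _ _ "axis v y"]) simp_all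
    qed (auto simp: block_space_def)
    moreover have "{x \<in> ?S. x $ v = 0} = block_space L X"
      using insert.hyps subspace_0[OF L] by (auto simp: block_space_def)
    ultimately show ?case
      using dim_image_plus_kernel[OF subspace_block_space[OF L] lin, of "insert v X"] insert by simp
  qed
qed

definition edge_row :: "'v \<Rightarrow> 'v \<Rightarrow> 'a::real_vector \<Rightarrow> 'a^'v::finite" where
  "edge_row t h x = (\<chi> w. if w = t then x else if w = h then - x else 0)"

lemma edge_row_inner:
  fixes x :: "'a::euclidean_space"
  assumes "t \<noteq> h"
  shows "edge_row t h x \<bullet> y = x \<bullet> (y $ t) - x \<bullet> (y $ h)"
proof -
  have "edge_row t h x \<bullet> y = (\<Sum>w\<in>UNIV. (if w = t then x \<bullet> (y $ w) else 0) - (if w = h then x \<bullet> (y $ w) else 0))"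
    unfolding inner_vec_def by (rule sum.cong) (use assms in \<open>auto simp: edge_row_def\<close>)
  then show ?thesis by (simp add: sum_subtractf)
qed

lemma edge_row_block_space:
  assumes L: "subspace L" "x \<in> L" and "t \<in> X" "h \<in> X"
  shows "edge_row t h x \<in> block_space L X"
  using assms subspace_neg[OF L] subspace_0[OF L(1)] by (auto simp: block_space_def edge_row_def)

text \<open>Each row is orthogonal to every assignment consisting of one constant plus, at each rod,
  a multiple of that rod. These assignments have dimension
  \<open>dim L + card (R \<inter> vertices_of ends F)\<close> inside a space of dimension
  \<open>dim L * card (vertices_of ends F)\<close>.\<close>

lemma card_independent_rows_le:
  fixes L :: "'a::euclidean_space set" and q :: "'e \<Rightarrow> 'a" and ends :: "'e \<Rightarrow> 'v::finite set"
  assumes L: "subspace L" and F: "F \<noteq> {}"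
    and ends: "\<And>e. e \<in> F \<Longrightarrow> ends e = {tail e, head e}" "\<And>e. e \<in> F \<Longrightarrow> tail e \<noteq> head e"
    and q: "\<And>e. e \<in> F \<Longrightarrow> q e \<in> L" "\<And>e v. e \<in> F \<Longrightarrow> v \<in> ends e \<Longrightarrow> v \<in> R \<Longrightarrow> q e \<bullet> \<rho> v = 0"
    and \<rho>: "\<And>v. v \<in> R \<Longrightarrow> \<rho> v \<in> L" "\<And>v. v \<in> R \<Longrightarrow> \<rho> v \<noteq> 0"
      "\<And>u v. u \<in> R \<Longrightarrow> v \<in> R \<Longrightarrow> u \<noteq> v \<Longrightarrow> \<rho> u \<notin> span {\<rho> v}"
    and ind: "inj_on (\<lambda>e. edge_row (tail e) (head e) (q e)) F" "independent ((\<lambda>e. edge_row (tail e) (head e) (q e)) ` F)"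
  shows "card F + dim L + card (R \<inter> vertices_of ends F) \<le> dim L * card (vertices_of ends F)"
proof -
  define X where "X = vertices_of ends F"
  define \<Lambda> where "\<Lambda> = (block_space UNIV (R \<inter> X) :: (real^'v) set)"
  define \<rho>' where "\<rho>' v = (if v \<in> R then \<rho> v else 0)" for v
  define f where "f z = (\<chi> v. if v \<in> X then fst z + (snd z $ v) *\<^sub>R \<rho>' v else 0)" for z :: "'a \<times> (real^'v)"
  let ?r = "\<lambda>e. edge_row (tail e) (head e) (q e)"
  let ?T = "block_space L X :: ('a^'v) set"
  let ?P = "{y \<in> ?T. \<forall>x\<in>span (?r ` F). orthogonal x y}"
  have X: "tail e \<in> X" "head e \<in> X" if "e \<in> F" for e
    using that ends(1) by (auto simp: X_def vertices_of_def)
  have fv: "f z $ v = fst z + (snd z $ v) *\<^sub>R \<rho>' v" if "v \<in> X" for z v using that by (simp add: f_def)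
  have f: "linear f"
    by (rule linearI) (auto simp: f_def vec_eq_iff algebra_simps)
  have \<Lambda>: "subspace \<Lambda>" "dim \<Lambda> = card (R \<inter> X)"
    unfolding \<Lambda>_def by (simp_all add: subspace_block_space dim_block_space)
  have "?r e \<in> ?T" if "e \<in> F" for e by (rule edge_row_block_space[OF L q(1)[OF that] X[OF that]])
  then have rT: "?r ` F \<subseteq> ?T" by blast
  have sT: "span (?r ` F) \<subseteq> ?T" by (rule span_minimal[OF rT subspace_block_space[OF L]])
  have mem: "f z \<in> ?P" if z: "z \<in> L \<times> \<Lambda>" for z
  proof -
    have "\<rho>' v \<in> L" for v using \<rho>(1) subspace_0[OF L] by (simp add: \<rho>'_def)
    then have "f z \<in> ?T" using z
      by (auto simp: block_space_def f_def intro!: subspace_add[OF L] subspace_scale[OF L])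
    moreover have "orthogonal x (f z)" if "x \<in> span (?r ` F)" for x
    proof -
      have "span (?r ` F) \<subseteq> {x. x \<bullet> f z = 0}"
      proof (rule span_minimal)
        show "subspace {x. x \<bullet> f z = 0}" by (auto simp: subspace_def inner_add_left)
        show "?r ` F \<subseteq> {x. x \<bullet> f z = 0}"
        proof
        fix x assume "x \<in> ?r ` F"
        then obtain e where e: "e \<in> F" "x = ?r e" by blast
        have "q e \<bullet> \<rho>' v = 0" if "v \<in> ends e" for v using q(2)[OF e(1) that] by (simp add: \<rho>'_def)
        then have "q e \<bullet> \<rho>' (tail e) = 0" "q e \<bullet> \<rho>' (head e) = 0" using ends(1)[OF e(1)] by simp_all
        have "x \<bullet> f z = 0"
          unfolding e(2) edge_row_inner[OF ends(2)[OF e(1)]] fv[OF X(1)[OF e(1)]] fv[OF X(2)[OF e(1)]]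
          using \<open>q e \<bullet> \<rho>' (tail e) = 0\<close> \<open>q e \<bullet> \<rho>' (head e) = 0\<close> by (simp add: inner_add_right)
        then show "x \<in> {x. x \<bullet> f z = 0}" by blast
        qed
      qed
      then show ?thesis using that by (auto simp: orthogonal_def)
    qed
    ultimately show ?thesis by blast
  qed
  have inj: "z = 0" if z: "z \<in> L \<times> \<Lambda>" "f z = 0" for z
  proof -
    have e0: "fst z + (snd z $ v) *\<^sub>R \<rho>' v = 0" if "v \<in> X" for v using fv[OF that, of z] z(2) by simp
    obtain e where e: "e \<in> F" using F by blast
    let ?t = "tail e" and ?h = "head e"
    have t: "fst z + (snd z $ ?t) *\<^sub>R \<rho>' ?t = 0" and h: "fst z + (snd z $ ?h) *\<^sub>R \<rho>' ?h = 0"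
      using e0 X[OF e] by blast+
    \<comment> \<open>A nonzero constant that cancels at both ends of an edge would make both ends
      rods, and these two rods proportional.\<close>
    have c: "fst z = 0"
    proof (rule ccontr)
      assume c: "fst z \<noteq> 0"
      have tR: "?t \<in> R" "snd z $ ?t \<noteq> 0" using t c by (auto simp: \<rho>'_def split: if_splits)
      have hR: "?h \<in> R" using h c by (auto simp: \<rho>'_def split: if_splits)
      have eq: "(snd z $ ?t) *\<^sub>R \<rho> ?t = (snd z $ ?h) *\<^sub>R \<rho> ?h"
      proof -
        have "(snd z $ ?t) *\<^sub>R \<rho> ?t = - fst z" "(snd z $ ?h) *\<^sub>R \<rho> ?h = - fst z"
          using t h tR(1) hR by (simp_all add: \<rho>'_def eq_neg_iff_add_eq_0 add.commute)
        then show ?thesis by simp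
      qed
      have "(snd z $ ?t) *\<^sub>R \<rho> ?t \<in> span {\<rho> ?h}" unfolding eq by (intro span_mul span_base) simp
      then have "(1 / snd z $ ?t) *\<^sub>R ((snd z $ ?t) *\<^sub>R \<rho> ?t) \<in> span {\<rho> ?h}" by (rule span_mul)
      then have "\<rho> ?t \<in> span {\<rho> ?h}" using tR(2) by simp
      then show False using \<rho>(3)[OF tR(1) hR ends(2)[OF e]] by blast
    qed
    have "snd z $ v = 0" for v
    proof (cases "v \<in> R \<inter> X")
      case True
      then show ?thesis using e0[of v] c \<rho>(2)[of v] by (simp add: \<rho>'_def)
    next
      case False
      then show ?thesis using z(1) by (auto simp: \<Lambda>_def block_space_def)
    qed
    then show ?thesis using c by (simp add: prod_eq_iff vec_eq_iff)
  qed
  have "dim L + card (R \<inter> X) = dim (L \<times> \<Lambda>)" using dim_Times[OF L \<Lambda>(1)] \<Lambda>(2) by simp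
  also have "\<dots> \<le> dim ?P"
  proof (rule dim_le_injective_map[OF subspace_Times[OF L \<Lambda>(1)] f])
    show "f z \<in> ?P" if "z \<in> L \<times> \<Lambda>" for z by (rule mem[OF that])
    show "z = 0" if "z \<in> L \<times> \<Lambda>" "f z = 0" for z by (rule inj[OF that])
  qed
  finally have P: "dim L + card (R \<inter> X) \<le> dim ?P" .
  have "dim ?P + dim (span (?r ` F)) = dim ?T"
    by (rule dim_subspace_orthogonal_to_vectors[OF subspace_span subspace_block_space[OF L] sT])
  moreover have "dim (span (?r ` F)) = card F"
    using dim_eq_card_independent[OF ind(2)] card_image[OF ind(1)] by simp
  ultimately show ?thesis using P dim_block_space[OF L, of X] by (simp add: X_def)
qed

text \<open>Distributes a velocity difference over the two ends of an edge; an end outside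
  \<open>R\<close> receives zero.\<close>

lemma span_pair_split:
  fixes \<rho> :: "'v \<Rightarrow> 'a::euclidean_space"
  assumes "x \<in> span (\<rho> ` ({t, h} \<inter> R))"
  shows "\<exists>a b. a \<in> (if t \<in> R then span {\<rho> t} else {0}) \<and> b \<in> (if h \<in> R then span {\<rho> h} else {0}) \<and> x = b - a"
proof (cases "t \<in> R")
  case t: True
  show ?thesis
  proof (cases "h \<in> R")
    case True
    then have eq: "\<rho> ` ({t, h} \<inter> R) = insert (\<rho> t) {\<rho> h}" using t by auto
    have "\<exists>k. x - k *\<^sub>R \<rho> t \<in> span {\<rho> h}" using assms unfolding eq span_breakdown_eq .
    then obtain k where k: "x - k *\<^sub>R \<rho> t \<in> span {\<rho> h}" by blast
    have "- (k *\<^sub>R \<rho> t) \<in> span {\<rho> t}" by (intro span_neg span_mul span_base) simp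
    then show ?thesis using k t True
      by (intro exI[of _ "- (k *\<^sub>R \<rho> t)"] exI[of _ "x - k *\<^sub>R \<rho> t"]) simp
  next
    case False
    then have "\<rho> ` ({t, h} \<inter> R) = {\<rho> t}" using t by auto
    then have "- x \<in> span {\<rho> t}" using assms by (simp add: span_neg)
    then show ?thesis using t False by (intro exI[of _ "- x"] exI[of _ 0]) simp
  qed
next
  case t: False
  show ?thesis
  proof (cases "h \<in> R")
    case True
    then have "\<rho> ` ({t, h} \<inter> R) = {\<rho> h}" using t by auto
    then show ?thesis using assms t True by (intro exI[of _ 0] exI[of _ x]) simp
  next
    case False
    then have "{t, h} \<inter> R = {}" using t by auto
    then show ?thesis using assms t False by simp
  qed
qed

lemma span_singleton_multiple: "y \<in> span {x} \<Longrightarrow> \<exists>k. y = k *\<^sub>R x"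
  by (auto simp: span_singleton)

text \<open>An assignment \<open>m\<close> orthogonal to all admissible rows differs across an edge
  by a combination of the rods at its ends. So each edge carries a velocity that agrees with
  \<open>m\<close> at both ends up to the rods. These velocities form a motion of the edges, and
  \<open>m\<close> is recovered from it with one scalar per rod, which bounds the orthogonal
  complement of the rows.\<close>

lemma card_le_dim_rows:
  fixes L :: "'a::euclidean_space set" and ends :: "'e::finite \<Rightarrow> 'v::finite set"
  assumes L: "subspace L"
    and ends: "\<And>e. e \<in> F \<Longrightarrow> ends e = {tail e, head e}" "\<And>e. e \<in> F \<Longrightarrow> tail e \<noteq> head e"
    and Q: "\<And>e. e \<in> F \<Longrightarrow> Q e \<subseteq> L"
      "\<And>e p. e \<in> F \<Longrightarrow> p \<in> L \<Longrightarrow> (\<And>x. x \<in> Q e \<Longrightarrow> x \<bullet> p = 0) \<Longrightarrow> p \<in> span (\<rho> ` (ends e \<inter> R))"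
    and \<rho>: "\<And>v. v \<in> R \<Longrightarrow> \<rho> v \<in> L"
    and dim: "dim (motions L R F ends \<rho>) + card F + card (R \<inter> vertices_of ends F) \<le> dim L * card (vertices_of ends F)"
  shows "card F \<le> dim (\<Union>e\<in>F. edge_row (tail e) (head e) ` Q e)"
proof -
  define X where "X = vertices_of ends F"
  define \<Lambda> where "\<Lambda> = (block_space UNIV (R \<inter> X) :: (real^'v) set)"
  define \<rho>' where "\<rho>' v = (if v \<in> R then \<rho> v else 0)" for v
  define rs where "rs v = (if v \<in> R then span {\<rho> v} else {0})" for v
  \<comment> \<open>An arbitrary edge at \<open>v\<close>: the value of \<open>m\<close> at
    \<open>v\<close> is read off from the velocity of this edge.\<close>
  define ee where "ee v = (SOME e. e \<in> F \<and> v \<in> ends e)" for v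
  define f where "f z = (\<chi> v. if v \<in> X then fst z $ ee v + (snd z $ v) *\<^sub>R \<rho>' v else 0)" for z :: "('a^'e) \<times> (real^'v)"
  let ?S = "\<Union>e\<in>F. edge_row (tail e) (head e) ` Q e"
  let ?T = "block_space L X :: ('a^'v) set"
  let ?P = "{y \<in> ?T. \<forall>x\<in>span ?S. orthogonal x y}"
  let ?M = "motions L R F ends \<rho>"
  have X: "tail e \<in> X" "head e \<in> X" if "e \<in> F" for e
    using that ends(1) by (auto simp: X_def vertices_of_def)
  have ee: "ee v \<in> F \<and> v \<in> ends (ee v)" if "v \<in> X" for v
  proof -
    have "\<exists>e. e \<in> F \<and> v \<in> ends e" using that by (auto simp: X_def vertices_of_def)
    then show ?thesis unfolding ee_def by (rule someI_ex)
  qed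
  have f: "linear f" by (rule linearI) (auto simp: f_def vec_eq_iff algebra_simps)
  have \<Lambda>: "subspace \<Lambda>" "dim \<Lambda> = card (R \<inter> X)"
    unfolding \<Lambda>_def by (simp_all add: subspace_block_space dim_block_space)
  have rT: "?S \<subseteq> ?T"
  proof (intro UN_least image_subsetI)
    fix e x assume e: "e \<in> F" "x \<in> Q e"
    then have "x \<in> L" using Q(1)[OF e(1)] by blast
    then show "edge_row (tail e) (head e) x \<in> ?T" by (rule edge_row_block_space[OF L _ X[OF e(1)]])
  qed
  have sT: "span ?S \<subseteq> ?T" by (rule span_minimal[OF rT subspace_block_space[OF L]])
  have rsL: "rs v \<subseteq> L" for v
    using \<rho> subspace_0[OF L] span_minimal[OF _ L, of "{\<rho> v}"] by (auto simp: rs_def)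
  have rs: "subspace (rs v)" for v by (simp add: rs_def)
  have "?P \<subseteq> f ` (?M \<times> \<Lambda>)"
  proof
    fix m assume m: "m \<in> ?P"
    have mL: "m $ v \<in> L" if "v \<in> X" for v using m that by (auto simp: block_space_def)
    \<comment> \<open>The witness is \<open>m\<close> at the tail plus the share \<open>a\<close> of
      the tail; by the splitting it equals \<open>m\<close> at the head plus the share of the
      head.\<close>
    have "\<exists>c. c \<in> L \<and> (\<forall>v\<in>ends e. m $ v - c \<in> rs v)" if e: "e \<in> F" for e
    proof -
      let ?t = "tail e" and ?h = "head e"
      have "x \<bullet> (m $ ?t - m $ ?h) = 0" if "x \<in> Q e" for x
      proof -
        have "edge_row ?t ?h x \<in> span ?S" using e that by (intro span_base) blast
        then have "edge_row ?t ?h x \<bullet> m = 0" using m by (auto simp: orthogonal_def)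
        then show ?thesis unfolding edge_row_inner[OF ends(2)[OF e]] by (simp add: inner_diff_right)
      qed
      then have "m $ ?t - m $ ?h \<in> span (\<rho> ` (ends e \<inter> R))"
        by (intro Q(2)[OF e] subspace_diff[OF L] mL X[OF e])
      then obtain a b where ab: "a \<in> rs ?t" "b \<in> rs ?h" "m $ ?t - m $ ?h = b - a"
        using span_pair_split[of _ \<rho> ?t ?h R] unfolding ends(1)[OF e] rs_def by blast
      have h: "m $ ?h - (m $ ?t + a) = - b" using ab(3) by (simp add: algebra_simps)
      have "m $ ?t + a \<in> L" using rsL[of ?t] ab(1) by (intro subspace_add[OF L] mL X[OF e]) blast
      moreover have "m $ ?t - (m $ ?t + a) \<in> rs ?t" using subspace_neg[OF rs ab(1)] by simp
      moreover have "m $ ?h - (m $ ?t + a) \<in> rs ?h" unfolding h by (rule subspace_neg[OF rs ab(2)])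
      ultimately show ?thesis using ends(1)[OF e] by (intro exI[of _ "m $ ?t + a"]) simp
    qed
    then have "\<forall>e\<in>F. \<exists>c. c \<in> L \<and> (\<forall>v\<in>ends e. m $ v - c \<in> rs v)" by (rule ballI)
    from bchoice[OF this] obtain c0 where c0: "\<forall>e\<in>F. c0 e \<in> L \<and> (\<forall>v\<in>ends e. m $ v - c0 e \<in> rs v)" by (elim exE)
    define c where "c = c0"
    have c: "\<And>e. e \<in> F \<Longrightarrow> c e \<in> L" "\<And>e v. e \<in> F \<Longrightarrow> v \<in> ends e \<Longrightarrow> m $ v - c e \<in> rs v"
      using c0 by (simp_all add: c_def)
    define cv where "cv = (\<chi> e. if e \<in> F then c e else 0)"
    have "cv \<in> ?M"
    proof (rule motionsI)
      fix e e' v assume e: "e \<in> F" "e' \<in> F" "v \<in> ends e" "v \<in> ends e'"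
      have "(m $ v - c e') - (m $ v - c e) \<in> rs v" by (rule subspace_diff[OF rs c(2)[OF e(2,4)] c(2)[OF e(1,3)]])
      then show "cv $ e - cv $ e' \<in> (if v \<in> R then span {\<rho> v} else {0})" using e by (simp add: cv_def rs_def[symmetric])
    qed (simp_all add: cv_def c(1))
    have "\<exists>k. m $ v = c (ee v) + k *\<^sub>R \<rho>' v" if "v \<in> X" for v
    proof -
      have "m $ v - c (ee v) \<in> rs v" using c(2) ee[OF that] by blast
      then have "\<exists>k. m $ v - c (ee v) = k *\<^sub>R \<rho>' v"
        using span_singleton_multiple[of "m $ v - c (ee v)" "\<rho> v"] by (cases "v \<in> R") (simp_all add: rs_def \<rho>'_def)
      then obtain k where "m $ v - c (ee v) = k *\<^sub>R \<rho>' v" by blast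
      then have "m $ v = c (ee v) + k *\<^sub>R \<rho>' v" by (simp add: diff_eq_eq add.commute)
      then show ?thesis by blast
    qed
    then have "\<forall>v\<in>X. \<exists>k. m $ v = c (ee v) + k *\<^sub>R \<rho>' v" by (rule ballI)
    from bchoice[OF this] obtain k where k0: "\<forall>v\<in>X. m $ v = c (ee v) + k v *\<^sub>R \<rho>' v" by (elim exE)
    have k: "\<And>v. v \<in> X \<Longrightarrow> m $ v = c (ee v) + k v *\<^sub>R \<rho>' v" using k0 by blast
    define kv where "kv = (\<chi> v. if v \<in> R \<inter> X then k v else 0)"
    have "kv \<in> \<Lambda>" by (auto simp: \<Lambda>_def block_space_def kv_def)
    moreover have "m = f (cv, kv)"
    proof (rule vec_eq_iff[THEN iffD2], rule allI)
      fix v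
      show "m $ v = f (cv, kv) $ v"
      proof (cases "v \<in> X")
        case True
        have "kv $ v *\<^sub>R \<rho>' v = k v *\<^sub>R \<rho>' v" using True by (simp add: kv_def \<rho>'_def)
        then show ?thesis using True ee[OF True] k[OF True] by (auto simp: f_def cv_def)
      next
        case False
        then show ?thesis using m by (auto simp: f_def block_space_def)
      qed
    qed
    ultimately show "m \<in> f ` (?M \<times> \<Lambda>)" using \<open>cv \<in> ?M\<close> by blast
  qed
  then have "dim ?P \<le> dim (f ` (?M \<times> \<Lambda>))" by (rule dim_subset)
  also have "\<dots> \<le> dim (?M \<times> \<Lambda>)" by (rule dim_image_le[OF f])
  also have "\<dots> = dim ?M + card (R \<inter> X)" using dim_Times[OF subspace_motions[OF L] \<Lambda>(1)] \<Lambda>(2) by simp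
  finally have P: "dim ?P \<le> dim ?M + card (R \<inter> X)" .
  have "dim ?P + dim (span ?S) = dim ?T"
    by (rule dim_subspace_orthogonal_to_vectors[OF subspace_span subspace_block_space[OF L] sT])
  then show ?thesis using P dim dim_block_space[OF L, of X] by (simp add: X_def)
qed

section \<open>Independent families and pairs of rods in general position\<close>

text \<open>Connects independence of a set, as in \<open>linear_matroid\<close>, with the
  coefficient form for families, which is the one that varies well with parameters.\<close>

lemma independent_family_iff:
  fixes x :: "'i \<Rightarrow> 'a::real_vector"
  assumes I: "finite I"
  shows "inj_on x I \<and> independent (x ` I) \<longleftrightarrow> (\<forall>a. (\<Sum>i\<in>I. a i *\<^sub>R x i) = 0 \<longrightarrow> (\<forall>i\<in>I. a i = 0))"
proof (intro iffI allI impI ballI)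
  fix a i assume x: "inj_on x I \<and> independent (x ` I)" and a: "(\<Sum>i\<in>I. a i *\<^sub>R x i) = 0" and i: "i \<in> I"
  have inj: "inj_on x I" using x by blast
  have "(\<Sum>y\<in>x ` I. a (the_inv_into I x y) *\<^sub>R y) = (\<Sum>i\<in>I. a i *\<^sub>R x i)"
    unfolding sum.reindex[OF inj] by (rule sum.cong) (simp_all add: the_inv_into_f_f[OF inj])
  then have "(\<Sum>y\<in>x ` I. a (the_inv_into I x y) *\<^sub>R y) = 0" using a by simp
  then have "a (the_inv_into I x (x i)) = 0"
    using independentD[of "x ` I" "x ` I" "\<lambda>y. a (the_inv_into I x y)" "x i"] x I i by blast
  then show "a i = 0" by (simp add: the_inv_into_f_f[OF inj i])
next
  assume x: "\<forall>a. (\<Sum>i\<in>I. a i *\<^sub>R x i) = 0 \<longrightarrow> (\<forall>i\<in>I. a i = 0)"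
  have inj: "inj_on x I"
  proof (rule inj_onI, rule ccontr)
    fix i j assume ij: "i \<in> I" "j \<in> I" "x i = x j" "i \<noteq> j"
    let ?a = "\<lambda>k. (if k = i then 1 else 0) - (if k = j then 1 else 0 :: real)"
    have "(\<Sum>k\<in>I. ?a k *\<^sub>R x k) = (\<Sum>k\<in>I. (if k = i then x k else 0) - (if k = j then x k else 0))"
      by (rule sum.cong) auto
    also have "\<dots> = 0" using I ij by (simp add: sum_subtractf)
    finally have "?a i = 0" using x[rule_format, of ?a i] ij(1) by blast
    then show False using ij(4) by simp
  qed
  moreover have "independent (x ` I)"
  proof (rule independent_if_scalars_zero)
    fix b y assume b: "(\<Sum>y\<in>x ` I. b y *\<^sub>R y) = 0" and y: "y \<in> x ` I"
    have "(\<Sum>i\<in>I. b (x i) *\<^sub>R x i) = 0" using b unfolding sum.reindex[OF inj] by (simp add: o_def)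
    then show "b y = 0" using x[rule_format, of "\<lambda>i. b (x i)"] y by blast
  qed (simp add: I)
  ultimately show "inj_on x I \<and> independent (x ` I)" by blast
qed

lemma wedge2_nonzero_notin_span: "wedge2 x y \<noteq> 0 \<Longrightarrow> x \<notin> span {y} \<and> y \<notin> span {x}"
proof -
  assume nz: "wedge2 x y \<noteq> 0"
  have "wedge2 x y = 0" if xy: "x \<in> span {y}"
  proof -
    obtain k where k: "x = k *\<^sub>R y" using xy span_singleton[of y] by blast
    show ?thesis unfolding k linear_cmul[OF linear_wedge2(1)] wedge2_self by (rule scaleR_zero_right)
  qed
  moreover have "wedge2 x y = 0" if yx: "y \<in> span {x}"
  proof -
    obtain k where k: "y = k *\<^sub>R x" using yx span_singleton[of x] by blast
    show ?thesis unfolding k linear_cmul[OF linear_wedge2(2)] wedge2_self by (rule scaleR_zero_right)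
  qed
  ultimately show ?thesis using nz by blast
qed

lemma wedge2_nonzero:
  assumes "x \<noteq> 0" "y \<notin> span {x}"
  shows "wedge2 x y \<noteq> 0"
proof
  assume 0: "wedge2 x y = 0"
  obtain a where a: "a \<bullet> y = 1" "\<forall>y\<in>{x}. a \<bullet> y = 0" using dual_vector_exists[OF assms(2)] by (elim exE conjE)
  have "y \<bullet> a = 1" "x \<bullet> a = 0" using a by (simp_all add: inner_commute[of _ a])
  then have "wedge2 x y \<bullet> wedge2 x a = x \<bullet> x" unfolding wedge2_inner by simp
  then show False using 0 assms(1) by simp
qed

text \<open>Linear independence as four span conditions, one for each of the dual vectors on which
  the charts for two rods rely. For the equations of two rods it says that the rods meet in
  codimension four.\<close>

definition quadruple_independent :: "'a::real_vector \<Rightarrow> 'a \<Rightarrow> 'a \<Rightarrow> 'a \<Rightarrow> bool" where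
  "quadruple_independent x y z w \<longleftrightarrow>
     x \<notin> span {y, z, w} \<and> y \<notin> span {x, z, w} \<and> z \<notin> span {x, y, w} \<and> w \<notin> span {x, y, z}"

lemma span_triple: "x \<in> span {y, z, w} \<Longrightarrow> \<exists>a b c. x = a *\<^sub>R y + b *\<^sub>R z + c *\<^sub>R w"
proof -
  assume "x \<in> span {y, z, w}"
  then obtain a where "x - a *\<^sub>R y \<in> span {z, w}" unfolding span_breakdown_eq[of x y "{z, w}"] by blast
  then obtain b where "x - a *\<^sub>R y - b *\<^sub>R z \<in> span {w}" unfolding span_breakdown_eq[of _ z "{w}"] by blast
  then obtain c where "x - a *\<^sub>R y - b *\<^sub>R z = c *\<^sub>R w" using span_singleton[of w] by blast
  then have "x = a *\<^sub>R y + b *\<^sub>R z + c *\<^sub>R w" by (simp only: diff_eq_eq add.commute add.left_commute)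
  then show ?thesis by blast
qed

lemma quadruple_independentI:
  assumes rel: "\<And>a b c d. a *\<^sub>R x + b *\<^sub>R y + c *\<^sub>R z + d *\<^sub>R w = 0 \<Longrightarrow> a = 0 \<and> b = 0 \<and> c = 0 \<and> d = 0"
  shows "quadruple_independent x y z w"
  unfolding quadruple_independent_def
proof (intro conjI notI)
  assume "x \<in> span {y, z, w}"
  then obtain a b c where e: "x = a *\<^sub>R y + b *\<^sub>R z + c *\<^sub>R w" using span_triple by blast
  have "(- 1) *\<^sub>R x + a *\<^sub>R y + b *\<^sub>R z + c *\<^sub>R w = (a *\<^sub>R y + b *\<^sub>R z + c *\<^sub>R w) - x" by simp
  then show False using rel[of "- 1" a b c] e by simp
next
  assume "y \<in> span {x, z, w}"
  then obtain a b c where e: "y = a *\<^sub>R x + b *\<^sub>R z + c *\<^sub>R w" using span_triple by blast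
  have "a *\<^sub>R x + (- 1) *\<^sub>R y + b *\<^sub>R z + c *\<^sub>R w = (a *\<^sub>R x + b *\<^sub>R z + c *\<^sub>R w) - y" by simp
  then show False using rel[of a "- 1" b c] e by simp
next
  assume "z \<in> span {x, y, w}"
  then obtain a b c where e: "z = a *\<^sub>R x + b *\<^sub>R y + c *\<^sub>R w" using span_triple by blast
  have "a *\<^sub>R x + b *\<^sub>R y + (- 1) *\<^sub>R z + c *\<^sub>R w = (a *\<^sub>R x + b *\<^sub>R y + c *\<^sub>R w) - z" by simp
  then show False using rel[of a b "- 1" c] e by simp
next
  assume "w \<in> span {x, y, z}"
  then obtain a b c where e: "w = a *\<^sub>R x + b *\<^sub>R y + c *\<^sub>R z" using span_triple by blast
  have "a *\<^sub>R x + b *\<^sub>R y + c *\<^sub>R z + (- 1) *\<^sub>R w = (a *\<^sub>R x + b *\<^sub>R y + c *\<^sub>R z) - w" by simp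
  then show False using rel[of a b c "- 1"] e by simp
qed

lemma wedge2_pair_relation:
  assumes "wedge2 x y \<noteq> 0" "a *\<^sub>R x + b *\<^sub>R y = 0"
  shows "a = 0 \<and> b = 0"
proof -
  have "a *\<^sub>R wedge2 x y = wedge2 (a *\<^sub>R x + b *\<^sub>R y) y" by (simp add: wedge2_linear_simps)
  then have "a *\<^sub>R wedge2 x y = 0" unfolding assms(2) by (simp add: wedge2_linear_simps)
  moreover have "b *\<^sub>R wedge2 x y = wedge2 x (a *\<^sub>R x + b *\<^sub>R y)" by (simp add: wedge2_linear_simps)
  then have "b *\<^sub>R wedge2 x y = 0" unfolding assms(2) by (simp add: wedge2_linear_simps)
  ultimately show ?thesis using assms(1) by simp
qed

text \<open>Pairing a relation with \<open>\<xi>\<close> and \<open>\<eta>\<close> removes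
  \<open>x\<close> and \<open>y\<close>. What remains is a 2 by 2 system in \<open>c\<close> and
  \<open>d\<close> whose determinant is
  \<open>wedge2 \<xi> \<eta> \<bullet> wedge2 z w\<close>.\<close>

lemma quadruple_independent_pencil:
  fixes x y z w :: "(real, 'n::{finite,linorder}) vec"
  assumes "wedge2 x y \<noteq> 0" and \<xi>: "\<xi> \<in> pencil {x, y}" "\<eta> \<in> pencil {x, y}" and nz: "wedge2 \<xi> \<eta> \<bullet> wedge2 z w \<noteq> 0"
    and rel: "a *\<^sub>R x + b *\<^sub>R y + c *\<^sub>R z + d *\<^sub>R w = 0"
  shows "a = 0 \<and> b = 0 \<and> c = 0 \<and> d = 0"
proof -
  have e: "c * (\<zeta> \<bullet> z) + d * (\<zeta> \<bullet> w) = 0" if "\<zeta> \<in> pencil {x, y}" for \<zeta>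
  proof -
    have "\<zeta> \<bullet> (a *\<^sub>R x + b *\<^sub>R y + c *\<^sub>R z + d *\<^sub>R w) = 0" unfolding rel by simp
    then show ?thesis using that by (simp add: pencil_def inner_add_right)
  qed
  define p q p' q' where pq: "p = \<xi> \<bullet> z" "q = \<xi> \<bullet> w" "p' = \<eta> \<bullet> z" "q' = \<eta> \<bullet> w"
  have e1: "c * p + d * q = 0" and e2: "c * p' + d * q' = 0" using e[OF \<xi>(1)] e[OF \<xi>(2)] by (simp_all add: pq)
  have det: "p * q' - q * p' \<noteq> 0" using nz by (simp add: wedge2_inner pq)
  have "c * (p * q' - q * p') = (c * p + d * q) * q' - (c * p' + d * q') * q" by (simp add: algebra_simps)
  then have c: "c = 0" using e1 e2 det by simp
  have "d * (p * q' - q * p') = (c * p' + d * q') * p - (c * p + d * q) * p'" by (simp add: algebra_simps)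
  then have d: "d = 0" using e1 e2 det by simp
  show ?thesis using wedge2_pair_relation[OF assms(1), of a b] rel c d by simp
qed

lemma exists_wedge2_in_subspace:
  fixes P :: "(real, 'n::{finite,linorder}) vec set"
  assumes P: "subspace P" "dim P \<ge> 2"
  shows "\<exists>\<xi>\<in>P. \<exists>\<eta>\<in>P. wedge2 \<xi> \<eta> \<noteq> 0"
proof -
  have "\<not> P \<subseteq> {0}"
  proof
    assume "P \<subseteq> {0}"
    then have "dim P = 0" by simp
    then show False using P(2) by linarith
  qed
  then obtain \<xi> where \<xi>: "\<xi> \<in> P" "\<xi> \<noteq> 0" by blast
  have "\<not> P \<subseteq> span {\<xi>}"
  proof
    assume "P \<subseteq> span {\<xi>}"
    then have "dim P \<le> dim (span {\<xi>})" by (rule dim_subset)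
    then show False using dim_span_singleton_le[of \<xi>] P(2) by simp
  qed
  then obtain \<eta> where "\<eta> \<in> P" "\<eta> \<notin> span {\<xi>}" by blast
  then show ?thesis using wedge2_nonzero[OF \<xi>(2)] \<xi>(1) by blast
qed

text \<open>Dual vectors of \<open>x\<close> and \<open>y\<close> distinguish the two bivectors.
  General position of two rods thus excludes that they are proportional.\<close>

lemma quadruple_independent_wedge2:
  fixes x y z w :: "(real, 'n::{finite,linorder}) vec"
  assumes "quadruple_independent x y z w"
  shows "wedge2 x y \<notin> span {wedge2 z w}"
proof
  assume "wedge2 x y \<in> span {wedge2 z w}"
  then obtain k where k: "wedge2 x y = k *\<^sub>R wedge2 z w" using span_singleton[of "wedge2 z w"] by blast
  note q = assms[unfolded quadruple_independent_def]
  from dual_vector_exists[OF conjunct1[OF q]] dual_vector_exists[OF conjunct1[OF conjunct2[OF q]]] obtain a b where a: "a \<bullet> x = 1" "\<forall>v\<in>{y, z, w}. a \<bullet> v = 0"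
    and b: "b \<bullet> y = 1" "\<forall>v\<in>{x, z, w}. b \<bullet> v = 0"
    by (elim exE conjE)
  have "x \<bullet> a = 1" "y \<bullet> a = 0" "z \<bullet> a = 0" "w \<bullet> a = 0" "y \<bullet> b = 1" "x \<bullet> b = 0"
    using a b by (simp_all add: inner_commute[of _ a] inner_commute[of _ b])
  then have "wedge2 x y \<bullet> wedge2 a b = 1" "wedge2 z w \<bullet> wedge2 a b = 0" unfolding wedge2_inner by simp_all
  then show False unfolding k by simp
qed

section \<open>Generic rods\<close>

definition chart_left :: "'n::{finite,linorder} chart \<Rightarrow> (bool \<times> 'n \<Rightarrow> real) \<Rightarrow> (real, 'n) vec" where
  "chart_left ch \<tau> = (case ch of (x0, f, A, g, B) \<Rightarrow> x0 + (\<Sum>i\<in>A. \<tau> (True, i) *\<^sub>R f i))"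

definition chart_right :: "'n::{finite,linorder} chart \<Rightarrow> (bool \<times> 'n \<Rightarrow> real) \<Rightarrow> (real, 'n) vec" where
  "chart_right ch \<tau> = (case ch of (x0, f, A, g, B) \<Rightarrow> \<Sum>j\<in>B. \<tau> (False, j) *\<^sub>R g j)"

lemma chart_map_eq_wedge2: "chart_map ch \<tau> = wedge2 (chart_left ch \<tau>) (chart_right ch \<tau>)"
  by (cases ch) (simp only: chart_map_def chart_left_def chart_right_def prod.case)

lemma chart_sides_cong:
  assumes "\<And>i. i \<in> chart_indices ch \<Longrightarrow> \<tau> i = \<tau>' i"
  shows "chart_left ch \<tau> = chart_left ch \<tau>'" "chart_right ch \<tau> = chart_right ch \<tau>'"
proof -
  obtain x0 f A g B where ch: "ch = (x0, f, A, g, B)" by (cases ch)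
  have "\<tau> (True, i) = \<tau>' (True, i)" if "i \<in> A" for i
    by (rule assms) (use that in \<open>simp add: ch chart_indices_def\<close>)
  then have "(\<Sum>i\<in>A. \<tau> (True, i) *\<^sub>R f i) = (\<Sum>i\<in>A. \<tau>' (True, i) *\<^sub>R f i)" by (intro sum.cong refl) (simp only:)
  then show "chart_left ch \<tau> = chart_left ch \<tau>'" by (simp only: ch chart_left_def prod.case)
  have "\<tau> (False, j) = \<tau>' (False, j)" if "j \<in> B" for j
    by (rule assms) (use that in \<open>simp add: ch chart_indices_def\<close>)
  then have "(\<Sum>j\<in>B. \<tau> (False, j) *\<^sub>R g j) = (\<Sum>j\<in>B. \<tau>' (False, j) *\<^sub>R g j)" by (intro sum.cong refl) (simp only:)
  then show "chart_right ch \<tau> = chart_right ch \<tau>'" by (simp only: ch chart_right_def prod.case)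
qed

lemma polynomial_chart_sides:
  fixes \<tau> :: "'p::euclidean_space \<Rightarrow> bool \<times> 'n::{finite,linorder} \<Rightarrow> real"
  assumes "\<And>i. real_polynomial_function (\<lambda>s. \<tau> s i)"
  shows "polynomial_function (\<lambda>s. chart_left ch (\<tau> s))" "polynomial_function (\<lambda>s. chart_right ch (\<tau> s))"
proof -
  obtain x0 f A g B where ch: "ch = (x0, f, A, g, B)" by (cases ch)
  have p: "polynomial_function (\<lambda>s. \<tau> s i)" for i
    using assms[of i] by (simp add: real_polynomial_function_eq)
  have S: "polynomial_function (\<lambda>s. \<Sum>i\<in>X. \<tau> s (k, i) *\<^sub>R h i)" for X k and h :: "'n \<Rightarrow> (real, 'n) vec"
    by (intro polynomial_function_sum polynomial_function_mult polynomial_function_const p) simp_all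
  show "polynomial_function (\<lambda>s. chart_left ch (\<tau> s))"
    unfolding chart_left_def ch prod.case by (rule polynomial_function_add[OF polynomial_function_const S])
  show "polynomial_function (\<lambda>s. chart_right ch (\<tau> s))"
    unfolding chart_right_def ch prod.case by (rule S)
qed

lemma exists_orthogonal_in_subspace:
  fixes L :: "'a::euclidean_space set"
  assumes "subspace U" "subspace L" "U \<subseteq> L" "U \<noteq> L"
  shows "\<exists>p\<in>L. p \<noteq> 0 \<and> (\<forall>x\<in>U. p \<bullet> x = 0)"
proof (rule ccontr)
  assume no: "\<not> ?thesis"
  have "{y \<in> L. \<forall>x\<in>U. orthogonal x y} \<subseteq> {0}"
    using no by (auto simp: orthogonal_def inner_commute)
  then have "dim {y \<in> L. \<forall>x\<in>U. orthogonal x y} = 0" by simp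
  then have "dim U = dim L"
    using dim_subspace_orthogonal_to_vectors[OF assms(1-3)] by linarith
  then show False using subspace_dim_equal[OF assms(1-3)] assms(4) by simp
qed

text \<open>The rods enter through their equations \<open>\<alpha>\<close>, \<open>\<beta>\<close>
  and not through bivectors, as the charts of the bars need the single vectors. The natural
  subtractions do not truncate, by \<open>count_matroid_bound\<close>.\<close>

definition good_rods :: "nat \<Rightarrow> 'e::finite set \<Rightarrow> ('e \<Rightarrow> 'v::finite set) \<Rightarrow> 'v set \<Rightarrow>
    ('v \<Rightarrow> (real, 'n::{finite,linorder}) vec) \<Rightarrow> ('v \<Rightarrow> (real, 'n) vec) \<Rightarrow> bool" where
  "good_rods D E ends R \<alpha> \<beta> \<longleftrightarrow> (\<forall>v\<in>R. wedge2 (\<alpha> v) (\<beta> v) \<noteq> 0) \<and>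
     (\<forall>(u, v)\<in>{(u, v). u \<in> R \<and> v \<in> R \<and> u \<noteq> v}. quadruple_independent (\<alpha> u) (\<beta> u) (\<alpha> v) (\<beta> v)) \<and>
     (\<forall>F\<in>count_matroid D E ends R - {{}}. dim (motions bivectors R F ends (\<lambda>v. wedge2 (\<alpha> v) (\<beta> v)))
        \<le> D * card (vertices_of ends F) - card (R \<inter> vertices_of ends F) - card F)"

lemma count_matroid_bound:
  assumes "F \<in> count_matroid D E ends R" "F \<noteq> {}"
  shows "card F + D + card (R \<inter> vertices_of ends F) \<le> D * card (vertices_of ends F)"
proof -
  have "int (card F) \<le> int D * (int (card (vertices_of ends F)) - 1) - int (card (R \<inter> vertices_of ends F))"
    using assms unfolding count_matroid_def by blast
  then have "int (card F) + int D + int (card (R \<inter> vertices_of ends F)) \<le> int D * int (card (vertices_of ends F))"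
    by (simp add: right_diff_distrib)
  then show ?thesis by (simp flip: of_nat_mult of_nat_add)
qed

text \<open>Finitely many generic conditions for fixed charts. The motion bound is the dimension
  theorem for \<open>generic_rods\<close>, where the charts supply \<open>move\<close> because each
  of them spans the bivectors.\<close>

lemma generically_good_rods:
  fixes ch :: "'v::finite \<Rightarrow> 'n::{finite,linorder} chart" and E :: "'e::finite set"
  assumes n: "CARD('n) = d + 1" "d \<ge> 3" and D: "D = (d + 1) choose 2"
    and ch: "\<And>v. v \<in> R \<Longrightarrow> \<exists>a b. a \<noteq> b \<and> ch v = free_chart a b"
  shows "generically (\<lambda>s :: real^('v \<times> bool \<times> 'n). good_rods D E ends R
    (\<lambda>v. if v \<in> R then chart_left (ch v) (\<lambda>i. s $ (v, i)) else 0)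
    (\<lambda>v. if v \<in> R then chart_right (ch v) (\<lambda>i. s $ (v, i)) else 0))"
proof -
  define \<alpha> where "\<alpha> s v = (if v \<in> R then chart_left (ch v) (\<lambda>i. s $ (v, i)) else 0)" for s :: "real^('v \<times> bool \<times> 'n)" and v
  define \<beta> where "\<beta> s v = (if v \<in> R then chart_right (ch v) (\<lambda>i. s $ (v, i)) else 0)" for s :: "real^('v \<times> bool \<times> 'n)" and v
  define \<rho> where "\<rho> s v = wedge2 (\<alpha> s v) (\<beta> s v)" for s v
  \<comment> \<open>Overwrites the parameters of the single rod \<open>v\<close>, so the other rods
    stay where they are.\<close>
  define upd where "upd s v \<tau> = (\<chi> j. if fst j = v then \<tau> (snd j) else s $ j)" for s :: "real^('v \<times> bool \<times> 'n)" and v \<tau>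
  have coord: "real_polynomial_function (\<lambda>s :: real^('v \<times> bool \<times> 'n). s $ j)" for j
    by (rule real_polynomial_function.intros(1)[OF bounded_linear_vec_nth])
  have \<alpha>\<beta>p: "polynomial_function (\<lambda>s. \<alpha> s v)" "polynomial_function (\<lambda>s. \<beta> s v)" if "v \<in> R" for v
  proof -
    have "(\<lambda>s. \<alpha> s v) = (\<lambda>s. chart_left (ch v) (\<lambda>i. s $ (v, i)))" "(\<lambda>s. \<beta> s v) = (\<lambda>s. chart_right (ch v) (\<lambda>i. s $ (v, i)))"
      using that by (simp_all only: \<alpha>_def \<beta>_def if_True)
    moreover have "polynomial_function (\<lambda>s :: real^('v \<times> bool \<times> 'n). chart_left (ch v) (\<lambda>i. s $ (v, i)))"
      "polynomial_function (\<lambda>s :: real^('v \<times> bool \<times> 'n). chart_right (ch v) (\<lambda>i. s $ (v, i)))"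
      by (rule polynomial_chart_sides, rule coord)+
    ultimately show "polynomial_function (\<lambda>s. \<alpha> s v)" "polynomial_function (\<lambda>s. \<beta> s v)" by (simp_all only:)
  qed
  have \<rho>: "\<rho> s v = chart_map (ch v) (\<lambda>i. s $ (v, i))" if "v \<in> R" for s v
    by (simp only: \<rho>_def \<alpha>_def \<beta>_def that if_True chart_map_eq_wedge2)
  have upd_other: "\<alpha> (upd s v \<tau>) w = \<alpha> s w" "\<beta> (upd s v \<tau>) w = \<beta> s w" if "w \<noteq> v" for s v \<tau> w
    using that by (simp_all add: \<alpha>_def \<beta>_def upd_def)
  have upd_same: "\<rho> (upd s v \<tau>) v = chart_map (ch v) \<tau>" if "v \<in> R" for s v \<tau>
    unfolding \<rho>[OF that] by (simp add: upd_def)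
  have hit: "\<exists>\<tau>. p \<bullet> chart_map (ch v) \<tau> \<noteq> 0" if v: "v \<in> R" and p: "p \<in> bivectors" "p \<noteq> 0" for v p
  proof -
    obtain a b where "a \<noteq> b" "ch v = free_chart a b" using ch[OF v] by blast
    show ?thesis
    proof (rule ccontr)
      assume "\<not> ?thesis"
      then have "p = 0" using \<open>ch v = free_chart a b\<close> by (intro free_chart_spanning[OF p(1) \<open>a \<noteq> b\<close>]) simp
      then show False using p(2) by simp
    qed
  qed
  \<comment> \<open>For \<open>d = 3\<close> this is \<open>4 choose 2 = 6\<close>, exactly the
    value that the discharging needs.\<close>
  have D6: "D \<ge> 6"
  proof -
    have "4 * 3 \<le> (d + 1) * (d + 1 - 1)" using n(2) by (intro mult_le_mono) simp_all
    then have "4 * 3 div 2 \<le> (d + 1) * (d + 1 - 1) div 2" by (rule div_le_mono)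
    moreover have "4 * 3 div 2 = (6 :: nat)" by simp
    ultimately show ?thesis unfolding D choose_two by (simp only:)
  qed
  have dimL: "dim (bivectors :: 'n ext set) = D" by (simp only: dim_bivectors n(1) D)
  interpret generic_rods "bivectors :: 'n ext set" R \<rho>
  proof
    show "subspace (bivectors :: 'n ext set)" by (rule subspace_bivectors)
    show "dim (bivectors :: 'n ext set) \<ge> 6" using D6 dimL by simp
    show "polynomial_function (\<lambda>s. \<rho> s v)" if "v \<in> R" for v
      unfolding \<rho>[OF that] by (rule polynomial_chart_map) (rule coord)
    show "\<rho> s v \<in> bivectors" for s v unfolding \<rho>_def by (rule wedge2_bivector)
    fix v s and U :: "'n ext set" assume v: "v \<in> R" and U: "subspace U" "U \<subseteq> bivectors" "U \<noteq> bivectors"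
    obtain p where p: "p \<in> bivectors" "p \<noteq> 0" "\<forall>x\<in>U. p \<bullet> x = 0"
      using exists_orthogonal_in_subspace[OF U(1) subspace_bivectors U(2,3)] by blast
    obtain \<tau> where \<tau>: "p \<bullet> chart_map (ch v) \<tau> \<noteq> 0" using hit[OF v p(1,2)] by blast
    have "\<rho> (upd s v \<tau>) v \<notin> U" using \<tau> p(3) unfolding upd_same[OF v] by blast
    moreover have "\<rho> (upd s v \<tau>) w = \<rho> s w" if "w \<noteq> v" for w using upd_other[OF that] by (simp add: \<rho>_def)
    ultimately show "\<exists>s'. (\<forall>w. w \<noteq> v \<longrightarrow> \<rho> s' w = \<rho> s w) \<and> \<rho> s' v \<notin> U" by blast
  qed
  have quad: "generically (\<lambda>s. quadruple_independent (\<alpha> s u) (\<beta> s u) (\<alpha> s v) (\<beta> s v))"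
    if uv: "u \<in> R" "v \<in> R" "u \<noteq> v" for u v
  proof -
    define w where "w m s = [\<alpha> s u, \<beta> s u, \<alpha> s v, \<beta> s v] ! m" for m :: nat and s
    let ?S = "{0, 1, 2, 3 :: nat}"
    have w: "w 0 = (\<lambda>s. \<alpha> s u)" "w 1 = (\<lambda>s. \<beta> s u)" "w 2 = (\<lambda>s. \<alpha> s v)" "w 3 = (\<lambda>s. \<beta> s v)"
      by (simp_all add: w_def[abs_def])
    have sum: "(\<Sum>m\<in>?S. a m *\<^sub>R w m s) = a 0 *\<^sub>R \<alpha> s u + a 1 *\<^sub>R \<beta> s u + a 2 *\<^sub>R \<alpha> s v + a 3 *\<^sub>R \<beta> s v" for a s
    proof -
      have "(\<Sum>m\<in>?S. a m *\<^sub>R w m s) = a 0 *\<^sub>R w 0 s + (a 1 *\<^sub>R w 1 s + (a 2 *\<^sub>R w 2 s + a 3 *\<^sub>R w 3 s))" by simp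
      then show ?thesis unfolding w by (simp only: add.assoc)
    qed
    \<comment> \<open>A witness for general position: with the rod \<open>u\<close> nonzero,
      \<open>\<xi>\<close> and \<open>\<eta>\<close> span a plane on which its equations vanish, and
      the rod \<open>v\<close> is moved until it is not orthogonal to this plane.\<close>
    obtain s1 where s1: "\<rho> s1 u \<noteq> 0" using generically_exists[OF generically_nonzero] uv(1) by blast
    let ?P = "pencil {\<alpha> s1 u, \<beta> s1 u}"
    have "dim {\<alpha> s1 u, \<beta> s1 u} = 2"
      using wedge2_nonzero_notin_span[of "\<alpha> s1 u" "\<beta> s1 u"] s1 by (intro dim_pair_independent) (auto simp: \<rho>_def)
    then have "dim ?P \<ge> 2" using dim_pencil[of "{\<alpha> s1 u, \<beta> s1 u}"] n by simp
    then obtain \<xi> \<eta> where \<xi>: "\<xi> \<in> ?P" "\<eta> \<in> ?P" "wedge2 \<xi> \<eta> \<noteq> 0"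
      using exists_wedge2_in_subspace[OF subspace_pencil] by blast
    obtain \<tau> where \<tau>: "wedge2 \<xi> \<eta> \<bullet> chart_map (ch v) \<tau> \<noteq> 0" using hit[OF uv(2) wedge2_bivector \<xi>(3)] by blast
    define s0 where "s0 = upd s1 v \<tau>"
    have s0: "\<alpha> s0 u = \<alpha> s1 u" "\<beta> s0 u = \<beta> s1 u" "wedge2 \<xi> \<eta> \<bullet> wedge2 (\<alpha> s0 v) (\<beta> s0 v) \<noteq> 0"
      using upd_other[OF uv(3)] \<tau> upd_same[OF uv(2), of s1 \<tau>] by (simp_all add: s0_def \<rho>_def)
    have "generically (\<lambda>s. \<forall>a. (\<Sum>m\<in>?S. a m *\<^sub>R w m s) = 0 \<longrightarrow> (\<forall>m\<in>?S. a m = 0))"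
    proof (rule generically_independent_family[where ?s0.0 = s0 and v = w])
      show "finite ?S" by simp
      show "polynomial_function (w m)" if "m \<in> ?S" for m
      proof -
        have "m = 0 \<or> m = 1 \<or> m = 2 \<or> m = 3" using that by blast
        then show ?thesis using \<alpha>\<beta>p[OF uv(1)] \<alpha>\<beta>p[OF uv(2)] by (elim disjE) (simp_all only: w)
      qed
      show "\<forall>m\<in>?S. a m = 0" if a: "(\<Sum>m\<in>?S. a m *\<^sub>R w m s0) = 0" for a
      proof -
        have "wedge2 (\<alpha> s0 u) (\<beta> s0 u) \<noteq> 0" using s1 by (simp add: s0 \<rho>_def)
        moreover have "\<xi> \<in> pencil {\<alpha> s0 u, \<beta> s0 u}" "\<eta> \<in> pencil {\<alpha> s0 u, \<beta> s0 u}"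
          using \<xi>(1,2) by (simp_all only: s0)
        ultimately have "a 0 = 0 \<and> a 1 = 0 \<and> a 2 = 0 \<and> a 3 = 0"
          by (rule quadruple_independent_pencil[OF _ _ _ s0(3) a[unfolded sum]])
        then show ?thesis by blast
      qed
    qed
    then show ?thesis
    proof (rule generically_mono)
      fix s assume *: "\<forall>a. (\<Sum>m\<in>?S. a m *\<^sub>R w m s) = 0 \<longrightarrow> (\<forall>m\<in>?S. a m = 0)"
      show "quadruple_independent (\<alpha> s u) (\<beta> s u) (\<alpha> s v) (\<beta> s v)"
      proof (rule quadruple_independentI)
        fix a b c d assume r: "a *\<^sub>R \<alpha> s u + b *\<^sub>R \<beta> s u + c *\<^sub>R \<alpha> s v + d *\<^sub>R \<beta> s v = 0"
        define A where "A = (\<lambda>m. [a, b, c, d] ! m)"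
        have A: "A 0 = a" "A 1 = b" "A 2 = c" "A 3 = d" by (simp_all add: A_def)
        have "(\<Sum>m\<in>?S. A m *\<^sub>R w m s) = 0" unfolding sum A by (rule r)
        then have "\<forall>m\<in>?S. A m = 0" using * by blast
        then have "A 0 = 0" "A 1 = 0" "A 2 = 0" "A 3 = 0" by blast+
        then show "a = 0 \<and> b = 0 \<and> c = 0 \<and> d = 0" unfolding A by blast
      qed
    qed
  qed
  have mot: "generically (\<lambda>s. dim (motions bivectors R F ends (\<rho> s))
      \<le> D * card (vertices_of ends F) - card (R \<inter> vertices_of ends F) - card F)"
    if F: "F \<in> count_matroid D E ends R" "F \<noteq> {}" for F
  proof (rule generically_dim_motions_le)
    fix p
    have "card F + card (R \<inter> vertices_of ends F) \<le> D * card (vertices_of ends F)"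
      using count_matroid_bound[OF F] by simp
    then have "int (D * card (vertices_of ends F) - card (R \<inter> vertices_of ends F) - card F) =
      int D * int (card (vertices_of ends F)) - int (card (R \<inter> vertices_of ends F)) - int (card F)"
      by simp
    then show "block_count (dim (bivectors :: 'n ext set)) R F ends p
        \<le> int (D * card (vertices_of ends F) - card (R \<inter> vertices_of ends F) - card F)"
      unfolding dimL using block_count_le_count_matroid[OF F(1), of p] by simp
  qed
  have "generically (\<lambda>s. good_rods D E ends R (\<alpha> s) (\<beta> s))"
    unfolding good_rods_def
  proof (intro generically_conj)
    show "generically (\<lambda>s. \<forall>v\<in>R. wedge2 (\<alpha> s v) (\<beta> s v) \<noteq> 0)"
      using generically_nonzero by (simp only: \<rho>_def)
    show "generically (\<lambda>s. \<forall>(u, v)\<in>{(u, v). u \<in> R \<and> v \<in> R \<and> u \<noteq> v}. quadruple_independent (\<alpha> s u) (\<beta> s u) (\<alpha> s v) (\<beta> s v))"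
    proof (rule generically_ball_finite)
      show "generically (\<lambda>s. case x of (u, v) \<Rightarrow> quadruple_independent (\<alpha> s u) (\<beta> s u) (\<alpha> s v) (\<beta> s v))"
        if "x \<in> {(u, v). u \<in> R \<and> v \<in> R \<and> u \<noteq> v}" for x
        using quad[of "fst x" "snd x"] that by (simp add: case_prod_unfold)
    qed simp
    show "generically (\<lambda>s. \<forall>F\<in>count_matroid D E ends R - {{}}. dim (motions bivectors R F ends (\<lambda>v. wedge2 (\<alpha> s v) (\<beta> s v)))
        \<le> D * card (vertices_of ends F) - card (R \<inter> vertices_of ends F) - card F)"
    proof (rule generically_ball_finite)
      show "generically (\<lambda>s. dim (motions bivectors R F ends (\<lambda>v. wedge2 (\<alpha> s v) (\<beta> s v)))
          \<le> D * card (vertices_of ends F) - card (R \<inter> vertices_of ends F) - card F)"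
        if "F \<in> count_matroid D E ends R - {{}}" for F
      proof -
        have "\<rho> s = (\<lambda>v. wedge2 (\<alpha> s v) (\<beta> s v))" for s by (simp add: \<rho>_def fun_eq_iff)
        then show ?thesis using mot[of F] that by simp
      qed
    qed simp
  qed
  then show ?thesis by (simp add: \<alpha>_def[abs_def] \<beta>_def[abs_def])
qed

section \<open>Charts and generic bars over good rods\<close>

lemma edge_charts_exist:
  fixes \<alpha> \<beta> :: "'v \<Rightarrow> (real, 'n::{finite,linorder}) vec"
  assumes n: "CARD('n) = d + 1" "d \<ge> 3" and th: "t \<noteq> h"
    and nz: "\<And>v. v \<in> R \<Longrightarrow> wedge2 (\<alpha> v) (\<beta> v) \<noteq> 0"
    and quad: "\<And>u v. u \<in> R \<Longrightarrow> v \<in> R \<Longrightarrow> u \<noteq> v \<Longrightarrow> quadruple_independent (\<alpha> u) (\<beta> u) (\<alpha> v) (\<beta> v)"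
  shows "\<exists>Ch. finite Ch \<and>
    (\<forall>ch\<in>Ch. full_chart (2 * d - 1 - card ({t, h} \<inter> R)) ((\<lambda>v. wedge2 (\<alpha> v) (\<beta> v)) ` ({t, h} \<inter> R)) ch
      \<or> card (chart_indices ch) < 2 * d - 1 - card ({t, h} \<inter> R)) \<and>
    (\<forall>x y. wedge2 x y \<noteq> 0 \<longrightarrow> (\<forall>v\<in>{t, h} \<inter> R. wedge2 x y \<bullet> wedge2 (\<alpha> v) (\<beta> v) = 0) \<longrightarrow>
      (\<exists>ch\<in>Ch. \<exists>\<tau>. wedge2 x y = chart_map ch \<tau>))"
proof -
  have one: ?thesis if T: "{t, h} \<inter> R = {v}" for v
  proof -
    have "v \<in> R" using T by blast
    then have "\<alpha> v \<notin> span {\<beta> v}" "\<beta> v \<notin> span {\<alpha> v}" using wedge2_nonzero_notin_span[OF nz] by blast+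
    from charts_one_rod[OF n(1) this] show ?thesis
    proof (elim exE conjE, intro exI conjI)
      fix Ch :: "'n chart set"
      assume Ch: "finite Ch" "\<forall>ch\<in>Ch. full_chart (2 * d - 2) {wedge2 (\<alpha> v) (\<beta> v)} ch"
        "\<forall>x y. wedge2 x y \<noteq> 0 \<longrightarrow> wedge2 x y \<bullet> wedge2 (\<alpha> v) (\<beta> v) = 0 \<longrightarrow> (\<exists>ch\<in>Ch. \<exists>\<tau>. wedge2 x y = chart_map ch \<tau>)"
      show "finite Ch" by (rule Ch(1))
      have c: "2 * d - 1 - card {v} = 2 * d - 2" by simp
      show "\<forall>ch\<in>Ch. full_chart (2 * d - 1 - card ({t, h} \<inter> R)) ((\<lambda>v. wedge2 (\<alpha> v) (\<beta> v)) ` ({t, h} \<inter> R)) ch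
        \<or> card (chart_indices ch) < 2 * d - 1 - card ({t, h} \<inter> R)"
        unfolding T c image_insert image_empty using Ch(2) by (intro ballI disjI1) (erule bspec)
      show "\<forall>x y. wedge2 x y \<noteq> 0 \<longrightarrow> (\<forall>v\<in>{t, h} \<inter> R. wedge2 x y \<bullet> wedge2 (\<alpha> v) (\<beta> v) = 0) \<longrightarrow>
        (\<exists>ch\<in>Ch. \<exists>\<tau>. wedge2 x y = chart_map ch \<tau>)"
      proof (intro allI impI)
        fix x y :: "(real, 'n) vec"
        assume nz: "wedge2 x y \<noteq> 0" and o: "\<forall>v\<in>{t, h} \<inter> R. wedge2 x y \<bullet> wedge2 (\<alpha> v) (\<beta> v) = 0"
        have "wedge2 x y \<bullet> wedge2 (\<alpha> v) (\<beta> v) = 0" by (rule bspec[OF o]) (simp only: T singleton_iff)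
        from Ch(3)[rule_format, OF nz this] show "\<exists>ch\<in>Ch. \<exists>\<tau>. wedge2 x y = chart_map ch \<tau>" .
      qed
    qed
  qed
  have two: ?thesis if tR: "t \<in> R" and hR: "h \<in> R"
  proof -
    have T: "{t, h} \<inter> R = {t, h}" using tR hR by blast
    have c: "2 * d - 1 - card {t, h} = 2 * d - 3" using th by simp
    note q = quad[OF tR hR th, unfolded quadruple_independent_def]
    note q3 = conjunct2[OF conjunct2[OF q]]
    from charts_two_rods[OF n(1) conjunct1[OF q] conjunct1[OF conjunct2[OF q]] conjunct1[OF q3] conjunct2[OF q3]] show ?thesis
    proof (elim exE conjE, intro exI conjI)
      fix Ch :: "'n chart set"
      assume Ch: "finite Ch"
        "\<forall>ch\<in>Ch. full_chart (2 * d - 3) {wedge2 (\<alpha> t) (\<beta> t), wedge2 (\<alpha> h) (\<beta> h)} ch \<or> card (chart_indices ch) < 2 * d - 3"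
        "\<forall>x y. wedge2 x y \<noteq> 0 \<longrightarrow> wedge2 x y \<bullet> wedge2 (\<alpha> t) (\<beta> t) = 0 \<longrightarrow> wedge2 x y \<bullet> wedge2 (\<alpha> h) (\<beta> h) = 0 \<longrightarrow>
          (\<exists>ch\<in>Ch. \<exists>\<tau>. wedge2 x y = chart_map ch \<tau>)"
      show "finite Ch" by (rule Ch(1))
      show "\<forall>ch\<in>Ch. full_chart (2 * d - 1 - card ({t, h} \<inter> R)) ((\<lambda>v. wedge2 (\<alpha> v) (\<beta> v)) ` ({t, h} \<inter> R)) ch
        \<or> card (chart_indices ch) < 2 * d - 1 - card ({t, h} \<inter> R)"
        unfolding T c image_insert image_empty by (rule Ch(2))
      show "\<forall>x y. wedge2 x y \<noteq> 0 \<longrightarrow> (\<forall>v\<in>{t, h} \<inter> R. wedge2 x y \<bullet> wedge2 (\<alpha> v) (\<beta> v) = 0) \<longrightarrow>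
        (\<exists>ch\<in>Ch. \<exists>\<tau>. wedge2 x y = chart_map ch \<tau>)"
      proof (intro allI impI)
        fix x y :: "(real, 'n) vec"
        assume nz: "wedge2 x y \<noteq> 0" and o: "\<forall>v\<in>{t, h} \<inter> R. wedge2 x y \<bullet> wedge2 (\<alpha> v) (\<beta> v) = 0"
        have ot: "wedge2 x y \<bullet> wedge2 (\<alpha> t) (\<beta> t) = 0" by (rule bspec[OF o]) (simp add: T)
        have oh: "wedge2 x y \<bullet> wedge2 (\<alpha> h) (\<beta> h) = 0" by (rule bspec[OF o]) (simp add: T)
        from Ch(3)[rule_format, OF nz ot oh] show "\<exists>ch\<in>Ch. \<exists>\<tau>. wedge2 x y = chart_map ch \<tau>" .
      qed
    qed
  qed
  show ?thesis
  proof (cases "t \<in> R")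
    case t: True
    show ?thesis
    proof (cases "h \<in> R")
      case True
      with t show ?thesis by (rule two)
    next
      case False
      show ?thesis by (rule one[of t]) (use t False in auto)
    qed
  next
    case t: False
    show ?thesis
    proof (cases "h \<in> R")
      case True
      show ?thesis by (rule one[of h]) (use t True in auto)
    next
      case False
      have T: "{t, h} \<inter> R = {}" using t False by auto
      have "d \<ge> 1" using n(2) by simp
      from charts_no_rod[OF n(1) this] show ?thesis
      proof (elim exE conjE, intro exI conjI)
        fix Ch :: "'n chart set"
        assume Ch: "finite Ch" "\<forall>ch\<in>Ch. full_chart (2 * d - 1) {} ch"
          "\<forall>x y. \<exists>ch\<in>Ch. \<exists>\<tau>. wedge2 x y = chart_map ch \<tau>"
        show "finite Ch" by (rule Ch(1))
        show "\<forall>ch\<in>Ch. full_chart (2 * d - 1 - card ({t, h} \<inter> R)) ((\<lambda>v. wedge2 (\<alpha> v) (\<beta> v)) ` ({t, h} \<inter> R)) ch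
          \<or> card (chart_indices ch) < 2 * d - 1 - card ({t, h} \<inter> R)"
          unfolding T card.empty diff_zero image_empty using Ch(2) by (intro ballI disjI1) (erule bspec)
        show "\<forall>x y. wedge2 x y \<noteq> 0 \<longrightarrow> (\<forall>v\<in>{t, h} \<inter> R. wedge2 x y \<bullet> wedge2 (\<alpha> v) (\<beta> v) = 0) \<longrightarrow>
          (\<exists>ch\<in>Ch. \<exists>\<tau>. wedge2 x y = chart_map ch \<tau>)"
          by (intro allI impI) (rule Ch(3)[rule_format])
      qed
    qed
  qed
qed

lemma independent_representatives_ex:
  fixes S :: "'i \<Rightarrow> 'a::euclidean_space set"
  assumes "finite I" "\<And>F. F \<subseteq> I \<Longrightarrow> card F \<le> dim (\<Union> (S ` F))"
  shows "\<exists>x. (\<forall>i\<in>I. x i \<in> S i) \<and> inj_on x I \<and> independent (x ` I)"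
proof (rule independent_representatives[of I S])
  show "finite I" by (rule assms(1))
  show "card F \<le> dim (\<Union> (S ` F))" if "F \<subseteq> I" for F by (rule assms(2)[OF that])
  fix x assume "\<And>i. i \<in> I \<Longrightarrow> x i \<in> S i" "inj_on x I" "independent (x ` I)"
  then show ?thesis by (intro exI[of _ x] conjI ballI)
qed

lemma brb_row_eq: "brb_row tail head q e = edge_row (tail e) (head e) (q $ e)"
  by (simp add: brb_row_def edge_row_def)

lemma Gr_cone_2_nonzero:
  assumes "q \<in> Gr_cone 2"
  shows "q \<noteq> 0"
proof -
  obtain vs where vs: "q = wedge_list vs" "length vs = 2" "distinct vs" "independent (set vs)"
    using assms unfolding Gr_cone_def by blast
  then obtain x y where xy: "vs = [x, y]" by (auto simp: length_Suc_conv numeral_2_eq_2)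
  have S: "set vs = {x, y}" "x \<noteq> y" using vs(3) by (simp_all add: xy)
  have x: "x \<noteq> 0"
  proof
    assume "x = 0"
    then have "dependent (set vs)" by (intro dependent_zero) (simp add: S(1))
    then show False using vs(4) by blast
  qed
  have y: "y \<notin> span {x}"
  proof
    assume ys: "y \<in> span {x}"
    have e: "set vs - {y} = {x}" using S by auto
    have "dependent (set vs)" unfolding dependent_def by (rule bexI[of _ y]) (simp_all only: e ys, simp add: S(1))
    then show False using vs(4) by blast
  qed
  show ?thesis using wedge2_nonzero[OF x y] unfolding vs(1) xy wedge2_def .
qed

lemma coordinate_polynomial: "real_polynomial_function (\<lambda>s :: real^'i. s $ j)"
  by (rule real_polynomial_function.intros(1)[OF bounded_linear_vec_nth])

text \<open>Over good rods this inclusion holds for every admissible choice of bars; genericity of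
  the bars matters only for the converse.\<close>

lemma good_rods_count_of_independent:
  fixes \<alpha> \<beta> :: "'v::finite \<Rightarrow> (real, 'n::{finite,linorder}) vec" and E :: "'e::finite set"
  assumes n: "CARD('n) = d + 1" and D: "D = (d + 1) choose 2"
    and ends: "\<And>e. e \<in> E \<Longrightarrow> ends e = {tail e, head e}" "\<And>e. e \<in> E \<Longrightarrow> tail e \<noteq> head e"
    and good: "good_rods D E ends R \<alpha> \<beta>"
    and q: "\<And>e. e \<in> E \<Longrightarrow> q $ e \<in> bivectors" "\<And>e v. e \<in> E \<Longrightarrow> v \<in> ends e \<Longrightarrow> v \<in> R \<Longrightarrow> q $ e \<bullet> wedge2 (\<alpha> v) (\<beta> v) = 0"
    and I: "I \<in> brb_matroid E tail head q"
  shows "I \<in> count_matroid D E ends R"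
proof -
  have I': "I \<subseteq> E" "inj_on (brb_row tail head q) I" "independent (brb_row tail head q ` I)"
    using I by (auto simp: brb_matroid_def linear_matroid_def)
  have row: "brb_row tail head q = (\<lambda>e. edge_row (tail e) (head e) (q $ e))" by (simp add: fun_eq_iff brb_row_eq)
  let ?V = "vertices_of ends"
  have "int (card F) \<le> int D * (int (card (?V F)) - 1) - int (card (R \<inter> ?V F))" if F: "F \<subseteq> I" "F \<noteq> {}" for F
  proof -
    have FE: "F \<subseteq> E" using F(1) I'(1) by blast
    have "card F + dim (bivectors :: 'n ext set) + card (R \<inter> ?V F) \<le> dim (bivectors :: 'n ext set) * card (?V F)"
    proof (rule card_independent_rows_le[where \<rho> = "\<lambda>v. wedge2 (\<alpha> v) (\<beta> v)" and q = "\<lambda>e. q $ e" and tail = tail and head = head])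
      show "inj_on (\<lambda>e. edge_row (tail e) (head e) (q $ e)) F"
        using inj_on_subset[OF I'(2) F(1)] unfolding row .
      show "independent ((\<lambda>e. edge_row (tail e) (head e) (q $ e)) ` F)"
        using independent_mono[OF I'(3) image_mono[OF F(1)]] unfolding row .
      show "wedge2 (\<alpha> u) (\<beta> u) \<notin> span {wedge2 (\<alpha> v) (\<beta> v)}" if "u \<in> R" "v \<in> R" "u \<noteq> v" for u v
        using good that unfolding good_rods_def by (intro quadruple_independent_wedge2) blast
      show "wedge2 (\<alpha> v) (\<beta> v) \<noteq> 0" if "v \<in> R" for v using good that unfolding good_rods_def by blast
      show "subspace (bivectors :: 'n ext set)" by (rule subspace_bivectors)
      show "F \<noteq> {}" by (rule F(2))
      show "wedge2 (\<alpha> v) (\<beta> v) \<in> bivectors" for v by (rule wedge2_bivector)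
      fix e assume "e \<in> F"
      then have e: "e \<in> E" using FE by blast
      show "ends e = {tail e, head e}" "tail e \<noteq> head e" "q $ e \<in> bivectors" using ends q(1) e by blast+
      show "q $ e \<bullet> wedge2 (\<alpha> v) (\<beta> v) = 0" if "v \<in> ends e" "v \<in> R" for v by (rule q(2)[OF e that])
    qed
    then have "card F + D + card (R \<inter> ?V F) \<le> D * card (?V F)" by (simp only: dim_bivectors n D)
    then have "int (card F) + int D + int (card (R \<inter> ?V F)) \<le> int D * int (card (?V F))"
      by (simp flip: of_nat_mult of_nat_add)
    then show ?thesis by (simp add: right_diff_distrib)
  qed
  then show ?thesis using I'(1) unfolding count_matroid_def by blast
qed

text \<open>One chart is fixed for each edge. Every coordinate triple has a parameter, whether or
  not its chart uses it, so that all choices of charts share one domain.\<close>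

definition bar_map :: "'e::finite set \<Rightarrow> ('e \<Rightarrow> 'n::{finite,linorder} chart) \<Rightarrow> real^('e \<times> bool \<times> 'n) \<Rightarrow> ('n ext, 'e) vec" where
  "bar_map E c t = (\<chi> e. if e \<in> E then chart_map (c e) (\<lambda>i. t $ (e, i)) else 0)"

lemma polynomial_bar_map:
  fixes c :: "'e::finite \<Rightarrow> 'n::{finite,linorder} chart"
  shows "polynomial_function (bar_map E c)"
proof (rule polynomial_function_vec)
  fix e
  have "polynomial_function (\<lambda>t :: real^('e \<times> bool \<times> 'n). chart_map (c e) (\<lambda>i. t $ (e, i)))"
    by (rule polynomial_chart_map) (rule coordinate_polynomial)
  then show "polynomial_function (\<lambda>t. bar_map E c t $ e)"
    by (cases "e \<in> E") (simp_all add: bar_map_def)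
qed

lemma bar_map_cong:
  assumes "\<And>j. j \<in> Sigma E (\<lambda>e. chart_indices (c e)) \<Longrightarrow> t' $ j = t $ j"
  shows "bar_map E c t' = bar_map E c t"
proof -
  have "chart_map (c e) (\<lambda>i. t' $ (e, i)) = chart_map (c e) (\<lambda>i. t $ (e, i))" if "e \<in> E" for e
    by (rule chart_map_cong, rule assms) (use that in simp)
  then show ?thesis by (simp add: bar_map_def vec_eq_iff)
qed

text \<open>Rado's theorem picks admissible rows that are independent, its rank condition coming
  from the motion bound of good rods. As rows of different edges have separate parameters, the
  picked rows come from one parameter, and independence at one parameter is generic.\<close>

lemma generically_count_independent:
  fixes \<alpha> \<beta> :: "'v::finite \<Rightarrow> (real, 'n::{finite,linorder}) vec" and E :: "'e::finite set"
  assumes n: "CARD('n) = d + 1" and D: "D = (d + 1) choose 2"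
    and ends: "\<And>e. e \<in> E \<Longrightarrow> ends e = {tail e, head e}" "\<And>e. e \<in> E \<Longrightarrow> tail e \<noteq> head e"
    and good: "good_rods D E ends R \<alpha> \<beta>"
    and c: "\<And>e. e \<in> E \<Longrightarrow> full_chart (m e) ((\<lambda>v. wedge2 (\<alpha> v) (\<beta> v)) ` (ends e \<inter> R)) (c e)"
  shows "generically (\<lambda>t. \<forall>I\<in>count_matroid D E ends R. \<forall>a.
    (\<Sum>e\<in>I. a e *\<^sub>R brb_row tail head (bar_map E c t) e) = 0 \<longrightarrow> (\<forall>e\<in>I. a e = 0))"
proof (rule generically_ball_finite)
  fix I assume I: "I \<in> count_matroid D E ends R"
  then have IE: "I \<subseteq> E" by (simp add: count_matroid_def)
  let ?\<rho> = "\<lambda>v. wedge2 (\<alpha> v) (\<beta> v)"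
  define Q where "Q e = range (chart_map (c e))" for e
  define S where "S e = edge_row (tail e) (head e) ` Q e" for e
  have "\<exists>x. (\<forall>e\<in>I. x e \<in> S e) \<and> inj_on x I \<and> independent (x ` I)"
  proof (rule independent_representatives_ex)
    fix F assume F: "F \<subseteq> I"
    show "card F \<le> dim (\<Union> (S ` F))"
    proof (cases "F = {}")
      case False
      have FE: "F \<subseteq> E" using F IE by blast
      have FC: "F \<in> count_matroid D E ends R" using I F unfolding count_matroid_def by blast
      have "dim (motions bivectors R F ends ?\<rho>) \<le> D * card (vertices_of ends F) - card (R \<inter> vertices_of ends F) - card F"
        using good FC False unfolding good_rods_def by blast
      then have dim: "dim (motions bivectors R F ends ?\<rho>) + card F + card (R \<inter> vertices_of ends F) \<le> D * card (vertices_of ends F)"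
        using count_matroid_bound[OF FC False] by simp
      show ?thesis unfolding S_def
      proof (rule card_le_dim_rows[where \<rho> = ?\<rho> and L = bivectors and R = R and ends = ends])
        show "dim (motions bivectors R F ends ?\<rho>) + card F + card (R \<inter> vertices_of ends F)
            \<le> dim (bivectors :: 'n ext set) * card (vertices_of ends F)"
          using dim by (simp only: dim_bivectors n D)
        show "Q e \<subseteq> bivectors" for e unfolding Q_def chart_map_eq_wedge2 using wedge2_bivector by blast
        show "p \<in> span (?\<rho> ` (ends e \<inter> R))"
          if e: "e \<in> F" and p: "p \<in> bivectors" and orth: "\<And>x. x \<in> Q e \<Longrightarrow> x \<bullet> p = 0" for e p
        proof -
          have "p \<bullet> chart_map (c e) \<tau> = 0" for \<tau>
            using orth[of "chart_map (c e) \<tau>"] unfolding Q_def by (simp add: inner_commute)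
          moreover have "e \<in> E" using e FE by blast
          note conjunct2[OF c[OF this, unfolded full_chart_def], rule_format, OF p]
          ultimately show ?thesis by blast
        qed
        show "ends e = {tail e, head e}" "tail e \<noteq> head e" if "e \<in> F" for e using ends FE that by blast+
      qed (simp_all add: subspace_bivectors wedge2_bivector)
    qed simp
  qed simp
  then obtain x where x: "\<forall>e\<in>I. x e \<in> S e" "inj_on x I" "independent (x ` I)" by (elim exE conjE)
  have "\<forall>e\<in>I. \<exists>\<tau>. x e = edge_row (tail e) (head e) (chart_map (c e) \<tau>)"
    using x(1) unfolding S_def Q_def by blast
  from bchoice[OF this] obtain \<tau> where \<tau>: "\<forall>e\<in>I. x e = edge_row (tail e) (head e) (chart_map (c e) (\<tau> e))" by (elim exE)
  \<comment> \<open>Collects the separately chosen chart parameters of the edges into one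
    point.\<close>
  define t0 where "t0 = (\<chi> j. \<tau> (fst j) (snd j))"
  have row: "brb_row tail head (bar_map E c t0) e = x e" if "e \<in> I" for e
  proof -
    have "e \<in> E" using that IE by blast
    then show ?thesis unfolding \<tau>[rule_format, OF that] by (simp add: brb_row_eq bar_map_def t0_def)
  qed
  have "polynomial_function (\<lambda>t. brb_row tail head (bar_map E c t) e)" for e
  proof (rule polynomial_function_vec)
    fix w
    have "polynomial_function (\<lambda>t. bar_map E c t $ e)"
    proof -
      have "polynomial_function (\<lambda>t :: real^('e \<times> bool \<times> 'n). chart_map (c e) (\<lambda>i. t $ (e, i)))"
        by (rule polynomial_chart_map) (rule coordinate_polynomial)
      then show ?thesis by (cases "e \<in> E") (simp_all add: bar_map_def)
    qed
    then show "polynomial_function (\<lambda>t. brb_row tail head (bar_map E c t) e $ w)"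
    proof -
      have "(\<lambda>t. brb_row tail head (bar_map E c t) e $ w) = (\<lambda>t. (if w = tail e then 1 else if w = head e then - 1 else 0) *\<^sub>R bar_map E c t $ e)"
        by (simp add: brb_row_def fun_eq_iff)
      moreover have "polynomial_function (\<lambda>t. k *\<^sub>R bar_map E c t $ e)" for k :: real
        by (rule polynomial_function_mult[OF polynomial_function_const \<open>polynomial_function (\<lambda>t. bar_map E c t $ e)\<close>])
      ultimately show ?thesis by (simp only:)
    qed
  qed
  moreover have "\<forall>e\<in>I. a e = 0" if a: "(\<Sum>e\<in>I. a e *\<^sub>R brb_row tail head (bar_map E c t0) e) = 0" for a
  proof -
    have "(\<Sum>e\<in>I. a e *\<^sub>R x e) = (\<Sum>e\<in>I. a e *\<^sub>R brb_row tail head (bar_map E c t0) e)"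
      by (rule sum.cong[OF refl]) (simp only: row)
    then have "(\<Sum>e\<in>I. a e *\<^sub>R x e) = 0" using a by (rule trans)
    with independent_family_iff[THEN iffD1, OF finite conjI[OF x(2,3)], rule_format, of a]
    show ?thesis by blast
  qed
  ultimately show "generically (\<lambda>t. \<forall>a. (\<Sum>e\<in>I. a e *\<^sub>R brb_row tail head (bar_map E c t) e) = 0 \<longrightarrow> (\<forall>e\<in>I. a e = 0))"
    by (rule generically_independent_family[where ?s0.0 = t0 and v = "\<lambda>e t. brb_row tail head (bar_map E c t) e", OF finite])
qed simp

text \<open>Finitely many combinations of charts cover all bars. A combination of full charts has
  exactly \<open>bar_dim\<close> parameters and a negligible bad set; any other combination has
  fewer, so its whole image is null.\<close>

lemma good_rods_almost_all_bars:
  fixes \<alpha> \<beta> :: "'v::finite \<Rightarrow> (real, 'n::{finite,linorder}) vec" and E :: "'e::finite set"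
  assumes n: "CARD('n) = d + 1" "d \<ge> 3" and D: "D = (d + 1) choose 2"
    and ends: "\<And>e. e \<in> E \<Longrightarrow> ends e = {tail e, head e}" "\<And>e. e \<in> E \<Longrightarrow> tail e \<noteq> head e"
    and good: "good_rods D E ends R \<alpha> \<beta>"
    and r: "\<And>v. v \<in> R \<Longrightarrow> hodge (r $ v) = wedge2 (\<alpha> v) (\<beta> v)"
  shows "almost_all (bar_dim d E ends R) (bar_configs E ends R r :: ('n ext, 'e) vec set)
    (\<lambda>q. brb_matroid E tail head q = count_matroid D E ends R)"
proof -
  let ?\<rho> = "\<lambda>v. wedge2 (\<alpha> v) (\<beta> v)"
  define m where "m e = 2 * d - 1 - card (ends e \<inter> R)" for e
  define full where "full e ch \<longleftrightarrow> full_chart (m e) (?\<rho> ` (ends e \<inter> R)) ch" for e and ch :: "'n chart"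
  define ind where "ind q \<longleftrightarrow> (\<forall>I\<in>count_matroid D E ends R. \<forall>a.
    (\<Sum>e\<in>I. a e *\<^sub>R brb_row tail head q e) = 0 \<longrightarrow> (\<forall>e\<in>I. a e = 0))" for q :: "('n ext, 'e) vec"
  have "\<forall>e\<in>E. \<exists>Ch. finite Ch \<and> (\<forall>ch\<in>Ch. full e ch \<or> card (chart_indices ch) < m e) \<and>
    (\<forall>x y. wedge2 x y \<noteq> 0 \<longrightarrow> (\<forall>v\<in>ends e \<inter> R. wedge2 x y \<bullet> ?\<rho> v = 0) \<longrightarrow> (\<exists>ch\<in>Ch. \<exists>\<tau>. wedge2 x y = chart_map ch \<tau>))"
  proof
    fix e assume e: "e \<in> E"
    show "\<exists>Ch. finite Ch \<and> (\<forall>ch\<in>Ch. full e ch \<or> card (chart_indices ch) < m e) \<and>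
      (\<forall>x y. wedge2 x y \<noteq> 0 \<longrightarrow> (\<forall>v\<in>ends e \<inter> R. wedge2 x y \<bullet> ?\<rho> v = 0) \<longrightarrow> (\<exists>ch\<in>Ch. \<exists>\<tau>. wedge2 x y = chart_map ch \<tau>))"
      unfolding full_def m_def ends(1)[OF e]
    proof (rule edge_charts_exist[OF n ends(2)[OF e]])
      show "wedge2 (\<alpha> v) (\<beta> v) \<noteq> 0" if "v \<in> R" for v using good that unfolding good_rods_def by blast
      show "quadruple_independent (\<alpha> u) (\<beta> u) (\<alpha> v) (\<beta> v)" if "u \<in> R" "v \<in> R" "u \<noteq> v" for u v
        using good that unfolding good_rods_def by blast
    qed
  qed
  from bchoice[OF this] obtain Ch where Ch0: "\<forall>e\<in>E. finite (Ch e) \<and> (\<forall>ch\<in>Ch e. full e ch \<or> card (chart_indices ch) < m e) \<and>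
    (\<forall>x y. wedge2 x y \<noteq> 0 \<longrightarrow> (\<forall>v\<in>ends e \<inter> R. wedge2 x y \<bullet> ?\<rho> v = 0) \<longrightarrow> (\<exists>ch\<in>Ch e. \<exists>\<tau>. wedge2 x y = chart_map ch \<tau>))"
    by (elim exE)
  \<comment> \<open>If some chart is not full, all parameters count as bad.\<close>
  define bad where "bad c = bar_map E c ` {t. (\<forall>e\<in>E. full e (c e)) \<longrightarrow> \<not> ind (bar_map E c t)}" for c
  let ?J = "\<lambda>c. Sigma E (\<lambda>e. chart_indices (c e))"
  have cardJ: "card (?J c) = (\<Sum>e\<in>E. card (chart_indices (c e)))" for c :: "'e \<Rightarrow> 'n chart" by simp
  have bar: "bar_dim d E ends R = (\<Sum>e\<in>E. m e)" by (simp add: bar_dim_def m_def)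
  have fullD: "card (chart_indices ch) = m e" if "full e ch" for e ch
    using that unfolding full_def full_chart_def by (rule conjunct1)
  have null: "hausdorff_null (bar_dim d E ends R) (bad c)" if c: "c \<in> PiE E Ch" for c
  proof (cases "\<forall>e\<in>E. full e (c e)")
    case True
    have "card (?J c) = bar_dim d E ends R"
      unfolding bar cardJ by (rule sum.cong[OF refl]) (rule fullD, use True in blast)
    moreover have "hausdorff_null (card (?J c)) (bar_map E c ` {t. \<not> ind (bar_map E c t)})"
    proof (rule hausdorff_null_image)
      have "generically (\<lambda>t. ind (bar_map E c t))"
        unfolding ind_def
      proof (rule generically_count_independent[OF n(1) D _ _ good])
        show "ends e = {tail e, head e}" if "e \<in> E" for e by (rule ends(1)[OF that])
        show "tail e \<noteq> head e" if "e \<in> E" for e by (rule ends(2)[OF that])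
        show "full_chart (m e) (?\<rho> ` (ends e \<inter> R)) (c e)" if "e \<in> E" for e
          using True[rule_format, OF that] unfolding full_def .
      qed
      then show "negligible {t. \<not> ind (bar_map E c t)}" by (simp add: generically_def)
      show "bar_map E c t' = bar_map E c t" if "\<And>j. j \<in> ?J c \<Longrightarrow> t' $ j = t $ j" for t t'
        by (rule bar_map_cong) (rule that)
      show "t' \<in> {t. \<not> ind (bar_map E c t)}"
        if t: "t \<in> {t. \<not> ind (bar_map E c t)}" and hj: "\<And>j. j \<in> ?J c \<Longrightarrow> t' $ j = t $ j" for t t'
      proof -
        have e: "bar_map E c t' = bar_map E c t" by (rule bar_map_cong) (rule hj)
        show ?thesis using t unfolding mem_Collect_eq e .
      qed
      show "polynomial_function (bar_map E c)" by (rule polynomial_bar_map)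
    qed
    moreover have "bad c = bar_map E c ` {t. \<not> ind (bar_map E c t)}"
      unfolding bad_def eqTrueI[OF True] by (simp only: simp_thms)
    ultimately show ?thesis by (simp only:)
  next
    case False
    then obtain e0 where e0: "e0 \<in> E" "\<not> full e0 (c e0)" by blast
    have alt: "full e (c e) \<or> card (chart_indices (c e)) < m e" if "e \<in> E" for e
    proof -
      have "c e \<in> Ch e" using c that by (rule PiE_mem)
      then show ?thesis by (rule conjunct1[OF conjunct2[OF bspec[OF Ch0 that]], rule_format])
    qed
    have le: "card (chart_indices (c e)) \<le> m e" if "e \<in> E" for e
      using alt[OF that] fullD[of e "c e"] by linarith
    have "card (?J c) < bar_dim d E ends R"
      unfolding bar cardJ
    proof (rule sum_strict_mono_ex1)
      show "\<forall>e\<in>E. card (chart_indices (c e)) \<le> m e" using le by blast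
      show "\<exists>e\<in>E. card (chart_indices (c e)) < m e" using alt[OF e0(1)] e0 by blast
    qed simp
    \<comment> \<open>The ambient parameter space must have at least \<open>bar_dim\<close>
      coordinates, so that the too small set of used coordinates can be enlarged to that
      size.\<close>
    moreover have "bar_dim d E ends R \<le> CARD('e \<times> bool \<times> 'n)"
    proof -
      have "(\<Sum>e\<in>E. m e) \<le> (\<Sum>e\<in>E. 2 * (d + 1))" by (rule sum_mono) (simp add: m_def)
      also have "\<dots> = card E * (2 * (d + 1))" by simp
      also have "\<dots> \<le> CARD('e) * (2 * (d + 1))" by (intro mult_right_mono card_mono) simp_all
      also have "\<dots> = CARD('e \<times> bool \<times> 'n)" by (simp only: card_cartesian_product UNIV_Times_UNIV[symmetric] card_UNIV_bool n(1))
      finally show ?thesis unfolding bar .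
    qed
    ultimately have "hausdorff_null (bar_dim d E ends R) (range (bar_map E c))"
    proof (rule hausdorff_null_image_few_coordinates)
      show "bar_map E c t' = bar_map E c t" if "\<And>j. j \<in> ?J c \<Longrightarrow> t' $ j = t $ j" for t t'
        by (rule bar_map_cong) (rule that)
      show "polynomial_function (bar_map E c)" by (rule polynomial_bar_map)
    qed
    then show ?thesis by (rule hausdorff_null_subset) (unfold bad_def, rule image_mono, rule subset_UNIV)
  qed
  have "finite (PiE E Ch)" by (rule finite_PiE) (simp, rule conjunct1[OF bspec[OF Ch0]])
  then have "hausdorff_null (bar_dim d E ends R) (\<Union>c\<in>PiE E Ch. bad c)"
    by (rule hausdorff_null_UN_finite) (rule null)
  moreover have "{q \<in> bar_configs E ends R r. \<not> (brb_matroid E tail head q = count_matroid D E ends R)} \<subseteq> (\<Union>c\<in>PiE E Ch. bad c)"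
  proof
    fix q assume "q \<in> {q \<in> bar_configs E ends R r. \<not> (brb_matroid E tail head q = count_matroid D E ends R)}"
    then have q: "\<And>e. e \<in> E \<Longrightarrow> q $ e \<in> Gr_cone 2" "\<And>e v. e \<in> E \<Longrightarrow> v \<in> ends e \<inter> R \<Longrightarrow> pairing (q $ e) (r $ v) = 0"
      "\<And>e. e \<notin> E \<Longrightarrow> q $ e = 0" and ne: "brb_matroid E tail head q \<noteq> count_matroid D E ends R"
      by (simp_all add: bar_configs_def)
    have orth: "q $ e \<bullet> ?\<rho> v = 0" if "e \<in> E" "v \<in> ends e" "v \<in> R" for e v
      using q(2)[OF that(1), of v] that unfolding pairing_eq_inner by (simp add: r)
    have biv: "q $ e \<in> bivectors" if "e \<in> E" for e
      using Gr_cone_2_wedge2[OF q(1)[OF that]] wedge2_bivector by (elim exE) simp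
    have "brb_matroid E tail head q \<subseteq> count_matroid D E ends R"
    proof
      fix I assume I: "I \<in> brb_matroid E tail head q"
      show "I \<in> count_matroid D E ends R"
      proof (rule good_rods_count_of_independent[OF n(1) D _ _ good _ _ I])
        show "ends e = {tail e, head e}" if "e \<in> E" for e by (rule ends(1)[OF that])
        show "tail e \<noteq> head e" if "e \<in> E" for e by (rule ends(2)[OF that])
        show "q $ e \<in> bivectors" if "e \<in> E" for e by (rule biv[OF that])
        show "q $ e \<bullet> ?\<rho> v = 0" if "e \<in> E" "v \<in> ends e" "v \<in> R" for e v by (rule orth[OF that])
      qed
    qed
    moreover have "count_matroid D E ends R \<subseteq> brb_matroid E tail head q" if ind: "ind q"
    proof
      fix I assume I: "I \<in> count_matroid D E ends R"
      then have IE: "I \<subseteq> E" by (simp add: count_matroid_def)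
      have "\<forall>a. (\<Sum>e\<in>I. a e *\<^sub>R brb_row tail head q e) = 0 \<longrightarrow> (\<forall>e\<in>I. a e = 0)" using ind I unfolding ind_def by blast
      then have "inj_on (brb_row tail head q) I \<and> independent (brb_row tail head q ` I)"
        by (rule independent_family_iff[THEN iffD2, OF finite])
      then show "I \<in> brb_matroid E tail head q" using IE by (simp add: brb_matroid_def linear_matroid_def)
    qed
    ultimately have nind: "\<not> ind q" using ne by blast
    have "\<forall>e\<in>E. \<exists>ch. ch \<in> Ch e \<and> (\<exists>\<tau>. q $ e = chart_map ch \<tau>)"
    proof
      fix e assume e: "e \<in> E"
      obtain x y where xy: "q $ e = wedge2 x y" using Gr_cone_2_wedge2[OF q(1)[OF e]] by blast
      have "wedge2 x y \<noteq> 0" "\<forall>v\<in>ends e \<inter> R. wedge2 x y \<bullet> ?\<rho> v = 0"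
        using Gr_cone_2_nonzero[OF q(1)[OF e]] orth[OF e] unfolding xy by simp_all
      then have "\<exists>ch\<in>Ch e. \<exists>\<tau>. wedge2 x y = chart_map ch \<tau>"
        by (rule conjunct2[OF conjunct2[OF bspec[OF Ch0 e]], THEN spec, THEN spec, THEN mp, THEN mp])
      then show "\<exists>ch. ch \<in> Ch e \<and> (\<exists>\<tau>. q $ e = chart_map ch \<tau>)" unfolding xy Bex_def .
    qed
    from bchoice[OF this] obtain c where c: "\<forall>e\<in>E. c e \<in> Ch e \<and> (\<exists>\<tau>. q $ e = chart_map (c e) \<tau>)" by (elim exE)
    then have "\<forall>e\<in>E. \<exists>\<tau>. q $ e = chart_map (c e) \<tau>" by blast
    from bchoice[OF this] obtain \<tau> where \<tau>: "\<forall>e\<in>E. q $ e = chart_map (c e) (\<tau> e)" by (elim exE)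
    \<comment> \<open>The selection is made \<open>undefined\<close> outside \<open>E\<close>, as
      membership in the finite product \<open>PiE E Ch\<close> requires.\<close>
    define c' where "c' = restrict c E"
    define t where "t = (\<chi> j. \<tau> (fst j) (snd j))"
    have "c' \<in> PiE E Ch" unfolding c'_def
      by (rule restrict_PiE_iff[THEN iffD2]) (use c in blast)
    moreover have "q = bar_map E c' t" 
    proof (rule vec_eq_iff[THEN iffD2], rule allI)
      fix e
      show "q $ e = bar_map E c' t $ e"
      proof (cases "e \<in> E")
        case True
        have "bar_map E c' t $ e = chart_map (c e) (\<tau> e)" using True by (simp add: bar_map_def c'_def t_def)
        then show ?thesis using \<tau> True by simp
      next
        case False
        then show ?thesis using q(3) by (simp add: bar_map_def)
      qed
    qed
    have "q \<in> bad c'" unfolding bad_def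
      by (rule image_eqI[of _ _ t]) (use \<open>q = bar_map E c' t\<close> nind in simp_all)
    ultimately show "q \<in> (\<Union>c\<in>PiE E Ch. bad c)" by blast
  qed
  ultimately show ?thesis unfolding almost_all_def by (rule hausdorff_null_subset)
qed

section \<open>Almost all rod configurations\<close>

lemma polynomial_hodge_inv:
  assumes "polynomial_function f"
  shows "polynomial_function (\<lambda>s. hodge_inv (f s))"
proof (rule polynomial_function_vec)
  fix I
  have "real_polynomial_function (\<lambda>s. wedge_sign (- I) I * f s $ (- I))"
    by (intro real_polynomial_function.intros(2,4) real_polynomial_function_nth assms)
  then show "polynomial_function (\<lambda>s. hodge_inv (f s) $ I)" by (simp add: hodge_inv_def real_polynomial_function_eq)
qed

theorem theorem4p8:
  fixes d D :: nat
    and V B R :: "'v::finite set"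
    and E :: "'e::finite set"
    and ends :: "'e \<Rightarrow> 'v set"
    and tail head :: "'e \<Rightarrow> 'v"
  assumes "d \<ge> 3"
    and "CARD('n::{finite,linorder}) = d + 1"
    and "D = (d + 1) choose 2"
    and "\<And>e. e \<in> E \<Longrightarrow> ends e \<subseteq> V \<and> card (ends e) = 2"
    and "B \<union> R = V" and "B \<inter> R = {}"
    and "\<And>e. e \<in> E \<Longrightarrow> ends e = {tail e, head e}"
  shows "almost_all (rod_dim d R) (rod_configs d R :: ('n ext, 'v) vec set)
    (\<lambda>r. almost_all (bar_dim d E ends R) (bar_configs E ends R r)
      (\<lambda>q. brb_matroid E tail head q = count_matroid D E ends R))"
proof -
  note n = assms(2,1) and D = assms(3)
  have th: "tail e \<noteq> head e" if "e \<in> E" for e using assms(4)[OF that] assms(7)[OF that] by auto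
  define ch where "ch ab v = free_chart (fst (ab v)) (snd (ab v))" for ab :: "'v \<Rightarrow> 'n \<times> 'n" and v
  define \<alpha> where "\<alpha> ab s v = (if v \<in> R then chart_left (ch ab v) (\<lambda>i. s $ (v, i)) else 0)"
    for ab v and s :: "real^('v \<times> bool \<times> 'n)"
  define \<beta> where "\<beta> ab s v = (if v \<in> R then chart_right (ch ab v) (\<lambda>i. s $ (v, i)) else 0)"
    for ab v and s :: "real^('v \<times> bool \<times> 'n)"
  \<comment> \<open>Charts parametrise the Hodge duals of the rods; the inverse Hodge map, which is
    linear, returns to the rods themselves.\<close>
  define \<Phi> where "\<Phi> ab s = (\<chi> v. if v \<in> R then hodge_inv (chart_map (ch ab v) (\<lambda>i. s $ (v, i))) else 0)"
    for ab and s :: "real^('v \<times> bool \<times> 'n)"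
  \<comment> \<open>Each rod has its own pair of distinct indices. There are finitely many choices,
    as \<open>'v\<close> and \<open>'n\<close> are finite types; values outside \<open>R\<close> are
    arbitrary.\<close>
  define AB where "AB = {ab :: 'v \<Rightarrow> 'n \<times> 'n. \<forall>v\<in>R. fst (ab v) \<noteq> snd (ab v)}"
  define Z where "Z ab = {s. \<not> good_rods D E ends R (\<alpha> ab s) (\<beta> ab s)}" for ab
  have null: "hausdorff_null (rod_dim d R) (\<Phi> ab ` Z ab)" if ab: "ab \<in> AB" for ab
  proof -
    let ?J = "Sigma R (\<lambda>v. chart_indices (ch ab v))"
    have "card (chart_indices (ch ab v)) = 2 * d - 1" if "v \<in> R" for v
      using card_free_chart[of "fst (ab v)" "snd (ab v)"] ab that n by (auto simp: ch_def AB_def)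
    then have J: "card ?J = rod_dim d R" by (simp add: rod_dim_def)
    have cong: "\<alpha> ab s' = \<alpha> ab s" "\<beta> ab s' = \<beta> ab s" if hj: "\<And>j. j \<in> ?J \<Longrightarrow> s' $ j = s $ j" for s s'
    proof -
      have "chart_left (ch ab v) (\<lambda>i. s' $ (v, i)) = chart_left (ch ab v) (\<lambda>i. s $ (v, i))"
        "chart_right (ch ab v) (\<lambda>i. s' $ (v, i)) = chart_right (ch ab v) (\<lambda>i. s $ (v, i))" if "v \<in> R" for v
        by (rule chart_sides_cong, rule hj, use that in simp)+
      then show "\<alpha> ab s' = \<alpha> ab s" "\<beta> ab s' = \<beta> ab s" by (auto simp: \<alpha>_def \<beta>_def fun_eq_iff)
    qed
    have \<Phi>: "\<Phi> ab s = (\<chi> v. if v \<in> R then hodge_inv (wedge2 (\<alpha> ab s v) (\<beta> ab s v)) else 0)" for s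
      by (simp add: \<Phi>_def \<alpha>_def \<beta>_def chart_map_eq_wedge2 vec_eq_iff)
    have "hausdorff_null (card ?J) (\<Phi> ab ` Z ab)"
    proof (rule hausdorff_null_image)
      have "generically (\<lambda>s. good_rods D E ends R (\<alpha> ab s) (\<beta> ab s))"
        unfolding \<alpha>_def \<beta>_def
        by (rule generically_good_rods[OF n D]) (use ab in \<open>auto simp: ch_def AB_def\<close>)
      then show "negligible (Z ab)" by (simp add: generically_def Z_def)
      show "s' \<in> Z ab" if "s \<in> Z ab" "\<And>j. j \<in> ?J \<Longrightarrow> s' $ j = s $ j" for s s'
      proof -
        have "\<alpha> ab s' = \<alpha> ab s" "\<beta> ab s' = \<beta> ab s" by (rule cong; rule that(2); assumption)+
        then show ?thesis using that(1) by (simp add: Z_def)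
      qed
      show "\<Phi> ab s' = \<Phi> ab s" if "\<And>j. j \<in> ?J \<Longrightarrow> s' $ j = s $ j" for s s'
      proof -
        have "\<alpha> ab s' = \<alpha> ab s" "\<beta> ab s' = \<beta> ab s" by (rule cong; rule that; assumption)+
        then show ?thesis by (simp only: \<Phi>)
      qed
      show "polynomial_function (\<Phi> ab)"
      proof (rule polynomial_function_vec)
        fix v
        have "polynomial_function (\<lambda>s :: real^('v \<times> bool \<times> 'n). hodge_inv (chart_map (ch ab v) (\<lambda>i. s $ (v, i))))"
          by (intro polynomial_hodge_inv polynomial_chart_map coordinate_polynomial)
        then show "polynomial_function (\<lambda>s. \<Phi> ab s $ v)" by (cases "v \<in> R") (simp_all add: \<Phi>_def)
      qed
    qed
    then show ?thesis by (simp only: J)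
  qed
  have "hausdorff_null (rod_dim d R) (\<Union>ab\<in>AB. \<Phi> ab ` Z ab)"
    by (rule hausdorff_null_UN_finite) (simp, rule null)
  moreover have "{r \<in> rod_configs d R. \<not> almost_all (bar_dim d E ends R) (bar_configs E ends R r :: ('n ext, 'e) vec set)
      (\<lambda>q. brb_matroid E tail head q = count_matroid D E ends R)} \<subseteq> (\<Union>ab\<in>AB. \<Phi> ab ` Z ab)"
  proof
    fix r :: "('n ext, 'v) vec"
    assume "r \<in> {r \<in> rod_configs d R. \<not> almost_all (bar_dim d E ends R) (bar_configs E ends R r :: ('n ext, 'e) vec set)
      (\<lambda>q. brb_matroid E tail head q = count_matroid D E ends R)}"
    then have r: "\<And>v. v \<in> R \<Longrightarrow> r $ v \<in> Gr_cone (d - 1)" "\<And>v. v \<notin> R \<Longrightarrow> r $ v = 0"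
      and bad: "\<not> almost_all (bar_dim d E ends R) (bar_configs E ends R r :: ('n ext, 'e) vec set)
        (\<lambda>q. brb_matroid E tail head q = count_matroid D E ends R)"
      by (simp_all add: rod_configs_def)
    have n2: "d - 1 + 2 = CARD('n)" "CARD('n) \<ge> 2" using n by simp_all
    \<comment> \<open>\<open>z\<close> packs the pair of indices of the chart with its parameters,
      so that one choice function serves all rods.\<close>
    have "\<forall>v\<in>R. \<exists>z. fst (fst z) \<noteq> snd (fst z) \<and> hodge (r $ v) = chart_map (free_chart (fst (fst z)) (snd (fst z))) (snd z)"
    proof
      fix v assume "v \<in> R"
      then obtain x y where xy: "hodge (r $ v) = wedge2 x y" using Gr_cone_hodge[OF r(1) n2(1)] by blast
      obtain a b \<tau> where "a \<noteq> b" "wedge2 x y = chart_map (free_chart a b) \<tau>" using free_chart_cover[OF n2(2)] by blast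
      then show "\<exists>z. fst (fst z) \<noteq> snd (fst z) \<and> hodge (r $ v) = chart_map (free_chart (fst (fst z)) (snd (fst z))) (snd z)"
        unfolding xy by (intro exI[of _ "((a, b), \<tau>)"]) simp
    qed
    from bchoice[OF this] obtain z where z: "\<forall>v\<in>R. fst (fst (z v)) \<noteq> snd (fst (z v)) \<and>
      hodge (r $ v) = chart_map (free_chart (fst (fst (z v))) (snd (fst (z v)))) (snd (z v))" by (elim exE)
    define ab where "ab v = fst (z v)" for v
    define s where "s = (\<chi> j. snd (z (fst j)) (snd j))"
    have AB: "ab \<in> AB" using z by (simp add: AB_def ab_def)
    have hod: "hodge (r $ v) = chart_map (ch ab v) (\<lambda>i. s $ (v, i))" if "v \<in> R" for v
      using z that by (simp add: ch_def ab_def s_def)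
    have "r = \<Phi> ab s" unfolding \<Phi>_def vec_eq_iff using hod[symmetric] r(2) by (simp add: hodge_inv)
    moreover have "s \<in> Z ab"
    \<comment> \<open>Good parameters would give the claim for almost all bars over
      \<open>r\<close>, so an exceptional \<open>r\<close> can only come from a bad
      parameter.\<close>
    proof (rule ccontr)
      assume "s \<notin> Z ab"
      then have "good_rods D E ends R (\<alpha> ab s) (\<beta> ab s)" by (simp add: Z_def)
      then have "almost_all (bar_dim d E ends R) (bar_configs E ends R r :: ('n ext, 'e) vec set)
        (\<lambda>q. brb_matroid E tail head q = count_matroid D E ends R)"
      proof (rule good_rods_almost_all_bars[OF n D, rotated 2])
        show "ends e = {tail e, head e}" if "e \<in> E" for e by (rule assms(7)[OF that])
        show "tail e \<noteq> head e" if "e \<in> E" for e by (rule th[OF that])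
        show "hodge (r $ v) = wedge2 (\<alpha> ab s v) (\<beta> ab s v)" if "v \<in> R" for v
          unfolding hod[OF that] by (simp only: \<alpha>_def \<beta>_def that if_True chart_map_eq_wedge2)
      qed
      then show False using bad by blast
    qed
    ultimately show "r \<in> (\<Union>ab\<in>AB. \<Phi> ab ` Z ab)" using AB by blast
  qed
  ultimately show ?thesis unfolding almost_all_def[of "rod_dim d R"] by (rule hausdorff_null_subset)
qed

end
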